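(* Let $X$ be a locally compact second countable space. A random measure $\zeta$ on $X$ is strictly $\alpha$-stable if and only if $$\zeta\overset{\mathcal D}{=}\sum_{\mu_i\in\Psi}\mu_i,$$ where $\Psi$ is the Poisson process on $\mathbb{M}\setminus\{0\}$ driven by an intensity measure $\Lambda$ satisfying $\int_{\mathbb{M}\setminus\{0\}}(1-e^{-\langle h,\mu\rangle})\Lambda(d\mu)<\infty$ for all $h\in\mathrm{BM}(X)$ and such that $\Lambda(tA)=t^{-\alpha}\Lambda(A)$ for all $t>0$ and any measurable $A$. In this case $\Lambda$ is exactly the Lévy measure of $\zeta$. Convergence of the series is in the sense of the vague convergence of measures. If the spectral measure $\sigma$ corresponding to $\Lambda$ satisfies $c=\sigma(\mathbb{S})<\infty$, then $$\zeta\overset{\mathcal D}{=}b\sum_{k=1}^\infty\gamma_k^{-1/\alpha}\varepsilon_k,\qquad b=\Bigl(\frac{c}{\Gamma(1-\alpha)}\Bigr)^{1/\alpha},$$ where $\varepsilon_1,\varepsilon_2,\dots$ are i.i.d. random measures with distribution $c^{-1}\sigma$ and $\gamma_k=\xi_1+\cdots+\xi_k$, $k\ge1$, for a sequence of independent exponentially distributed random variables $\xi_k$ with mean one.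
   Context: $X$ is a locally compact second countable space with Borel $\sigma$-algebra $\mathcal{B}$. $\mathbb{M}$ is the family of (non-negative) Radon measures on $\mathcal{B}$, i.e. measures finite on relatively compact Borel sets, with the $\sigma$-algebra generated by the maps $\mu\mapsto\mu(B)$, $B\in\mathcal{B}$; $0$ is the zero measure. A random measure is a random element of $\mathbb{M}$. $\mathrm{BM}(X)$ is the set of non-negative bounded measurable functions on $X$ with compact support; $\langle h,\mu\rangle=\int_X h\,d\mu$; the Laplace functional of $\zeta$ is $L_\zeta[h]=\mathbf{E}e^{-\langle h,\zeta\rangle}$, $h\in\mathrm{BM}(X)$. $\Gamma$ is the gamma function. Strict $\alpha$-stability: $t^{1/\alpha}\zeta'+(1-t)^{1/\alpha}\zeta''\overset{\mathcal D}{=}\zeta$ for all $0\le t\le1$, with $\zeta',\zeta''$ independent copies of $\zeta$; this forces $\alpha\in(0,1]$. Lévy measure: a locally finite random measure $\zeta$ is strictly $\alpha$-stable if and only if it is deterministic in the case $\alpha=1$, and in the case $\alpha\in(0,1)$ if and only if $L_\zeta[h]=\exp\{-\int_{\mathbb{M}\setminus\{0\}}(1-e^{-\langle h,\mu\rangle})\Lambda(d\mu)\}$, $h\in\mathrm{BM}(X)$, where $\Lambda$ (the Lévy measure of $\zeta$) is a Radon measure on $\mathbb{M}\setminus\{0\}$ with $\int_{\mathbb{M}\setminus\{0\}}(1-e^{-\langle h,\mu\rangle})\Lambda(d\mu)<\infty$ for all $h\in\mathrm{BM}(X)$ and $\Lambda(tA)=t^{-\alpha}\Lambda(A)$ for all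 measurable $A\subset\mathbb{M}\setminus\{0\}$ and $t>0$. Sphere $\mathbb{S}$: fix a countable base $B_1,B_2,\dots$ of the topology of $X$ consisting of relatively compact sets and put $B_0=X$. For $\mu\in\mathbb{M}\setminus\{0\}$ let $i(\mu)$ be the smallest $i\ge0$ with $0<\mu(B_i)<\infty$, and let $\mathbb{S}=\{\mu\in\mathbb{M}:\mu(B_{i(\mu)})=1\}$. Every $\mu\in\mathbb{M}\setminus\{0\}$ is uniquely $t\hat\mu$ with $t>0$, $\hat\mu\in\mathbb{S}$. Spectral measure corresponding to $\Lambda$: $\sigma=\Gamma(1-\alpha)\widehat\sigma$, where $\widehat\sigma(A)=\Lambda(\{t\mu:\mu\in A,\ t\ge1\})$ for measurable $A\subset\mathbb{S}$.
   Formalization: Stated for 0 < α < 1 only: at α = 1 a nonzero deterministic measure is strictly stable, yet the integrability and homogeneity conditions force Λ = 0, so the equivalence fails there; X is read as Hausdorff. *)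

theory Defs
  imports "HOL-Probability.Probability"
begin

section \<open>Radon measures and random measures\<close>

definition radon_measures :: "'x::topological_space measure set" where
  "radon_measures = {\<mu>. sets \<mu> = sets borel \<and>
     (\<forall>B\<in>sets borel. compact (closure B) \<longrightarrow> emeasure \<mu> B < \<infinity>)}"

text \<open>The measurable space of Radon measures, with the sigma-algebra generated by the evaluations.
  As for \<open>subprob_algebra\<close>, only the space and the sets of this object matter.\<close>

definition radon_space :: "'x::topological_space measure measure" where
  "radon_space = (SUP B\<in>sets borel. vimage_algebra radon_measures (\<lambda>\<mu>. emeasure \<mu> B) borel)"

definition nonzero_radon_space :: "'x::topological_space measure measure" where
  "nonzero_radon_space = restrict_space radon_space (- {null_measure borel})"

definition random_measure :: "'w measure \<Rightarrow> ('w \<Rightarrow> 'x::topological_space measure) \<Rightarrow> bool" where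
  "random_measure P \<zeta> \<longleftrightarrow> prob_space P \<and> \<zeta> \<in> measurable P radon_space"

definition eq_in_distribution ::
  "'v measure \<Rightarrow> ('v \<Rightarrow> 'x::topological_space measure) \<Rightarrow> 'w measure \<Rightarrow> ('w \<Rightarrow> 'x measure) \<Rightarrow> bool" where
  "eq_in_distribution Q \<eta> P \<zeta> \<longleftrightarrow> distr Q radon_space \<eta> = distr P radon_space \<zeta>"

definition add_measure :: "'x::topological_space measure \<Rightarrow> 'x measure \<Rightarrow> 'x measure" where
  "add_measure \<mu> \<nu> = measure_of UNIV (sets borel) (\<lambda>B. emeasure \<mu> B + emeasure \<nu> B)"

text \<open>Meant for finite index sets \<open>J\<close> only.\<close>

definition sum_measure :: "'i set \<Rightarrow> ('i \<Rightarrow> 'x::topological_space measure) \<Rightarrow> 'x measure" where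
  "sum_measure J \<mu> = measure_of UNIV (sets borel) (\<lambda>B. \<Sum>i\<in>J. emeasure (\<mu> i) B)"

definition vague_topology :: "'x::topological_space measure topology" where
  "vague_topology = topology_generated_by
     {{\<mu> \<in> radon_measures. integral\<^sup>L \<mu> f \<in> U} | f U.
        continuous_on UNIV f \<and> compact (closure {x. f x \<noteq> 0}) \<and> open (U :: real set)}"

definition vague_sums :: "nat set \<Rightarrow> (nat \<Rightarrow> 'x::topological_space measure) \<Rightarrow> 'x measure \<Rightarrow> bool" where
  "vague_sums I \<mu> \<nu> \<longleftrightarrow>
     limitin vague_topology (\<lambda>n. sum_measure (I \<inter> {..<n}) \<mu>) \<nu> sequentially"


section \<open>Strict stability, Laplace functional and Levy measure\<close>

text \<open>Independent copies of \<open>\<zeta>\<close> are realised on the product of \<open>P\<close> with itself.\<close>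

definition strictly_stable ::
  "real \<Rightarrow> 'w measure \<Rightarrow> ('w \<Rightarrow> 'x::topological_space measure) \<Rightarrow> bool" where
  "strictly_stable \<alpha> P \<zeta> \<longleftrightarrow>
     (\<forall>t\<in>{0..1}. eq_in_distribution
        (P \<Otimes>\<^sub>M P)
        (\<lambda>(\<omega>', \<omega>''). add_measure (scale_measure (ennreal (t powr (1 / \<alpha>))) (\<zeta> \<omega>'))
                                (scale_measure (ennreal ((1 - t) powr (1 / \<alpha>))) (\<zeta> \<omega>'')))
        P \<zeta>)"

definition BM :: "('x::topological_space \<Rightarrow> real) set" where
  "BM = {h. h \<in> borel_measurable borel \<and> (\<forall>x. 0 \<le> h x) \<and> bounded (range h) \<and>
            compact (closure {x. h x \<noteq> 0})}"

definition laplace_functional ::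
  "'w measure \<Rightarrow> ('w \<Rightarrow> 'x::topological_space measure) \<Rightarrow> ('x \<Rightarrow> real) \<Rightarrow> real" where
  "laplace_functional P \<zeta> h = (\<integral>\<omega>. exp (- integral\<^sup>L (\<zeta> \<omega>) h) \<partial>P)"

definition laplace_exponent :: "'x::topological_space measure measure \<Rightarrow> ('x \<Rightarrow> real) \<Rightarrow> ennreal" where
  "laplace_exponent \<Lambda> h = (\<integral>\<^sup>+\<mu>. ennreal (1 - exp (- integral\<^sup>L \<mu> h)) \<partial>\<Lambda>)"

definition stable_intensity :: "real \<Rightarrow> 'x::topological_space measure measure \<Rightarrow> bool" where
  "stable_intensity \<alpha> \<Lambda> \<longleftrightarrow>
     sets \<Lambda> = sets nonzero_radon_space \<and>
     (\<forall>h\<in>BM. laplace_exponent \<Lambda> h < \<infinity>) \<and>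
     (\<forall>t>0. \<forall>A\<in>sets \<Lambda>.
        emeasure \<Lambda> (scale_measure (ennreal t) ` A) = ennreal (t powr (- \<alpha>)) * emeasure \<Lambda> A)"

text \<open>Finiteness on the sets that are relatively compact in the space of non-zero measures,
  endowed with the vague topology.\<close>

definition radon_on_nonzero :: "'x::topological_space measure measure \<Rightarrow> bool" where
  "radon_on_nonzero \<Lambda> \<longleftrightarrow>
     (let T = subtopology vague_topology (- {null_measure borel})
      in \<forall>A\<in>sets \<Lambda>. compactin T (T closure_of A) \<longrightarrow> emeasure \<Lambda> A < \<infinity>)"

definition levy_measure ::
  "real \<Rightarrow> 'w measure \<Rightarrow> ('w \<Rightarrow> 'x::topological_space measure) \<Rightarrow> 'x measure measure \<Rightarrow> bool" where
  "levy_measure \<alpha> P \<zeta> \<Lambda> \<longleftrightarrow>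
     stable_intensity \<alpha> \<Lambda> \<and> radon_on_nonzero \<Lambda> \<and>
     (\<forall>h\<in>BM. laplace_functional P \<zeta> h = exp (- enn2real (laplace_exponent \<Lambda> h)))"


section \<open>Poisson processes\<close>

definition poisson_process :: "'w measure \<Rightarrow> 'a measure \<Rightarrow> ('w \<Rightarrow> 'a measure) \<Rightarrow> bool" where
  "poisson_process Q \<Lambda> \<Psi> \<longleftrightarrow>
     prob_space Q \<and>
     (\<forall>\<omega>\<in>space Q. sets (\<Psi> \<omega>) = sets \<Lambda>) \<and>
     (\<forall>A\<in>sets \<Lambda>. (\<lambda>\<omega>. emeasure (\<Psi> \<omega>) A) \<in> borel_measurable Q) \<and>
     (\<forall>A\<in>sets \<Lambda>. emeasure \<Lambda> A < \<infinity> \<longrightarrow>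
        (\<forall>k. measure Q {\<omega>\<in>space Q. emeasure (\<Psi> \<omega>) A = of_nat k} =
             exp (- measure \<Lambda> A) * measure \<Lambda> A ^ k / fact k)) \<and>
     (\<forall>A\<in>sets \<Lambda>. emeasure \<Lambda> A = \<infinity> \<longrightarrow> (AE \<omega> in Q. emeasure (\<Psi> \<omega>) A = \<infinity>)) \<and>
     (\<forall>(n::nat) A. (\<forall>i<n. A i \<in> sets \<Lambda>) \<and> disjoint_family_on A {..<n} \<longrightarrow>
        prob_space.indep_vars Q (\<lambda>_. borel) (\<lambda>i \<omega>. emeasure (\<Psi> \<omega>) (A i)) {..<n})"

text \<open>The points of a Poisson process, listed with multiplicities as the family \<open>x \<omega> i\<close> for \<open>i\<close>
  in \<open>I \<omega>\<close>. The push-forward of the counting measure on \<open>I \<omega>\<close> is the sum of the Dirac measures at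
  these points. No measurability of the enumeration is required.\<close>

definition poisson_points ::
  "'w measure \<Rightarrow> 'a measure \<Rightarrow> ('w \<Rightarrow> nat set) \<Rightarrow> ('w \<Rightarrow> nat \<Rightarrow> 'a) \<Rightarrow> bool" where
  "poisson_points Q \<Lambda> I x \<longleftrightarrow>
     (\<forall>\<omega>\<in>space Q. \<forall>i\<in>I \<omega>. x \<omega> i \<in> space \<Lambda>) \<and>
     poisson_process Q \<Lambda> (\<lambda>\<omega>. distr (count_space (I \<omega>)) \<Lambda> (x \<omega>))"

definition equals_vague_series ::
  "'w measure \<Rightarrow> ('w \<Rightarrow> 'x::topological_space measure) \<Rightarrow>
   'q measure \<Rightarrow> real \<Rightarrow> ('q \<Rightarrow> nat set) \<Rightarrow> ('q \<Rightarrow> nat \<Rightarrow> 'x measure) \<Rightarrow> bool" where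
  "equals_vague_series P \<zeta> Q b I x \<longleftrightarrow>
     (\<exists>S. random_measure Q S \<and>
          (AE \<omega> in Q. vague_sums (I \<omega>) (x \<omega>) (S \<omega>)) \<and>
          eq_in_distribution P \<zeta> Q (\<lambda>\<omega>. scale_measure (ennreal b) (S \<omega>)))"

text \<open>The sample space of the standard construction: the intensity measure is split into finite
  pieces, and for each piece there are a Poisson number and a sequence of independent points. It
  carries a Poisson process for every sigma-finite intensity measure on a space of elements of type
  \<open>'a\<close>, which makes it large enough for existential statements about Poisson processes.\<close>

type_synonym 'a poisson_sample = "nat \<Rightarrow> nat \<times> (nat \<Rightarrow> 'a)"


section \<open>Polar decomposition and spectral measure\<close>

definition relatively_compact_base :: "(nat \<Rightarrow> 'x::topological_space set) \<Rightarrow> bool" where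
  "relatively_compact_base B \<longleftrightarrow>
     B 0 = UNIV \<and> topological_basis (B ` {1..}) \<and> (\<forall>i\<ge>1. compact (closure (B i)))"

definition first_index :: "(nat \<Rightarrow> 'x set) \<Rightarrow> 'x measure \<Rightarrow> nat" where
  "first_index B \<mu> = (LEAST i. 0 < emeasure \<mu> (B i) \<and> emeasure \<mu> (B i) < \<infinity>)"

definition sphere_of :: "(nat \<Rightarrow> 'x::topological_space set) \<Rightarrow> 'x measure set" where
  "sphere_of B = {\<mu> \<in> radon_measures. \<mu> \<noteq> null_measure borel \<and> emeasure \<mu> (B (first_index B \<mu>)) = 1}"

definition spectral_measure ::
  "real \<Rightarrow> (nat \<Rightarrow> 'x::topological_space set) \<Rightarrow> 'x measure measure \<Rightarrow> 'x measure measure" where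
  "spectral_measure \<alpha> B \<Lambda> =
     scale_measure (ennreal (Gamma (1 - \<alpha>)))
       (measure_of (sphere_of B) (sets (restrict_space radon_space (sphere_of B)))
          (\<lambda>A. emeasure \<Lambda> {scale_measure (ennreal t) \<mu> | t \<mu>. \<mu> \<in> A \<and> 1 \<le> t}))"

text \<open>The variables \<open>\<epsilon> k\<close> take values in all Radon measures; their distribution is the image of
  \<open>\<sigma> / c\<close> under the inclusion of the sphere. For \<open>c = 0\<close> no such variables exist. The sequences
  are indexed from 0. The last condition is the independence of the two sequences from each other
  (\<open>indep_var\<close> would force both to take values in the same type).\<close>

definition lepage_variables ::
  "'q measure \<Rightarrow> 'x::topological_space measure measure \<Rightarrow> real \<Rightarrow>
   (nat \<Rightarrow> 'q \<Rightarrow> 'x measure) \<Rightarrow> (nat \<Rightarrow> 'q \<Rightarrow> real) \<Rightarrow> bool" where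
  "lepage_variables Q \<sigma> c \<epsilon> \<xi> \<longleftrightarrow>
     prob_space Q \<and>
     prob_space.indep_vars Q (\<lambda>_. radon_space) \<epsilon> UNIV \<and>
     (\<forall>k. distr Q radon_space (\<epsilon> k) = distr (scale_measure (ennreal (1 / c)) \<sigma>) radon_space (\<lambda>\<mu>. \<mu>)) \<and>
     prob_space.indep_vars Q (\<lambda>_. borel) \<xi> UNIV \<and>
     (\<forall>k. distributed Q lborel (\<xi> k) (exponential_density 1)) \<and>
     prob_space.indep_set Q
       {(\<lambda>\<omega> k. \<epsilon> k \<omega>) -` A \<inter> space Q | A. A \<in> sets (PiM UNIV (\<lambda>_. radon_space))}
       {(\<lambda>\<omega> k. \<xi> k \<omega>) -` A \<inter> space Q | A. A \<in> sets (PiM UNIV (\<lambda>_. borel))}"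

end

theory Submission
  imports Defs
begin

text \<open>The law of a random measure is determined by its Laplace functional, and a Levy measure by its
  Laplace exponent. The Laplace functional of a Poisson process at \<open>g\<close> is the exponential of minus the
  integral of \<open>1 - exp (- g)\<close> with respect to the intensity measure, and this identity characterises
  Poisson processes; it turns the statements on Poisson series into statements on Laplace exponents.

  For the LePage series, the Levy measure is the image of the product of the Lebesgue measure on the
  half-line and of the spectral measure (up to a factor) under \<open>(s, \<mu>) \<mapsto> s powr (- 1 / \<alpha>) \<mu>\<close>. If
  \<open>H s\<close> is the exponential of minus the integral of \<open>1 - \<phi>\<close> over the half-line from \<open>s\<close>, then \<open>H s\<close> is
  the expectation of \<open>\<phi> (s + \<xi>) * H (s + \<xi>)\<close> for a standard exponential variable \<open>\<xi>\<close>; iterating this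
  along the arrival times gives the expectation of the product of the \<open>\<phi> (\<gamma> k)\<close>.

  The hard part is the existence of the Levy measure. Strict stability gives
  \<open>E exp (- s \<langle>h, \<zeta>\<rangle>) = exp (- s powr \<alpha> * \<psi> h)\<close>, hence the moment of \<open>\<langle>h, \<zeta>\<rangle>\<close> of order \<open>\<alpha> * \<gamma>\<close> is a
  constant times \<open>\<psi> h powr \<gamma>\<close> for \<open>\<gamma> < 1\<close>. Choose a positive function \<open>f\<close> for which \<open>T = \<langle>f, \<zeta>\<rangle>\<close> is
  finite. If \<open>P\<close> is reweighted by a multiple of \<open>T powr (\<alpha> * \<gamma>)\<close>, then the expectation of
  \<open>(\<langle>f * k, \<zeta>\<rangle> / T) powr (\<alpha> * \<gamma>)\<close> is \<open>(\<psi> (f * k) / \<psi> f) powr \<gamma>\<close>. Embed the space into the unit interval and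
  encode the values of the distribution function of the random probability measure \<open>f \<zeta> / T\<close> at the
  rationals by one real number. By Helly's theorem the laws of this number converge weakly along a
  sequence \<open>\<gamma> \<longlonglongrightarrow> 1\<close>; the limit is the law of the angular part of the Levy measure.\<close>

text \<open>The Levy measure lives on a space of measures and its test functions are merely bounded
  and measurable, so a direct limit of rescaled laws of \<zeta> would need compactness there and a
  proof that \<sigma>-additivity survives. Both are obtained on the real line. Compactness is that
  of laws on a bounded interval. The weak limit of the encoded distribution functions has no a
  priori regularity: it need not be monotone or left continuous. Suprema over the rationals below x
  and the quantile transform still yield a random probability measure, and the identity for it is
  reached in stages: finitely many rationals, all rationals, step functions, pointwise limits.
  Continuity of the exponent under dominated convergence permits each passage. The constant in the
  fractional moment is \<Gamma>(1 - \<gamma>) / \<Gamma>(1 - \<alpha>\<gamma>), which blows up as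
  \<gamma> tends to 1; the reweighting divides by it, so that only ratios of exponents remain. The
  exponential \<open>lap\<close> vanishes at infinity, so that Laplace identities can be proved for
  series before their convergence is known, and then yield that convergence.\<close>

abbreviation (input) np :: "('a => ennreal) => 'a measure => ennreal" where "np h \<mu> \<equiv> (\<integral>\<^sup>+x. h x \<partial>\<mu>)"

abbreviation (input) en :: "('a => real) => 'a => ennreal" where "en h \<equiv> (%x. ennreal (h x))"

text \<open>The pairing of a test function and a measure, for which the paper uses angle brackets.\<close>

abbreviation (input) ip :: "('a => real) => 'a measure => ennreal" where "ip h \<mu> \<equiv> np (en h) \<mu>"

abbreviation (input) supp :: "('a::topological_space => real) => 'a set" where "supp f \<equiv> closure {x. f x \<noteq> 0}"

abbreviation (input) seq_lim :: "(nat => 'a::topological_space) => 'a => bool" ("((_)/ ----> (_))" [60, 60] 60) where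
  "X ----> l \<equiv> X \<longlonglongrightarrow> l"

lemmas bint_cong = Bochner_Integration.integral_cong

section \<open>The exponential on extended non-negative reals\<close>

text \<open>The function exp (- x) on the extended half-line, with value 0 at infinity. In this form
  it is injective, continuous and turns sums into products without any finiteness condition.\<close>

definition lap :: "ennreal => real" where
  "lap x = (if x = top then 0 else exp (- enn2real x))"

lemma lap_ennreal: "0 <= x ==> lap (ennreal x) = exp (- x)"
  by (simp add: lap_def)

lemma lap_0 [simp]: "lap 0 = 1"
  by (simp add: lap_def)

lemma lap_top [simp]: "lap top = 0"
  by (simp add: lap_def)

lemma lap_nonneg [simp]: "0 <= lap x"
  by (simp add: lap_def)

lemma lap_le_1 [simp]: "lap x <= 1"
  by (simp add: lap_def)

lemma lap_eq_0_iff: "lap x = 0 \<longleftrightarrow> x = top"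
  by (simp add: lap_def)

lemma lap_eq_1_iff: "lap x = 1 \<longleftrightarrow> x = 0"
  by (cases x) (auto simp: lap_def)

lemma lap_add: "lap (x + y) = lap x * lap y"
  by (cases x; cases y) (auto simp: lap_def exp_add[symmetric] simp flip: ennreal_plus)

lemma lap_sum: "finite A ==> lap (\<Sum>i\<in>A. f i) = (\<Prod>i\<in>A. lap (f i))"
  by (induction A rule: finite_induct) (auto simp: lap_add)

lemma lap_of_nat_mult: "lap (of_nat n * x) = lap x ^ n"
  by (induction n) (auto simp: lap_add distrib_right)

lemma lap_antimono: "x <= y ==> lap y <= lap x"
  by (cases x; cases y) (auto simp: lap_def top_unique)

lemma lap_inj: "lap x = lap y \<longleftrightarrow> x = y"
  by (cases x; cases y) (auto simp: lap_def)

lemma lap_less_1_iff: "lap x < 1 \<longleftrightarrow> 0 < x"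
  using lap_le_1[of x] lap_eq_1_iff[of x] by (auto simp: less_le)

lemma measurable_lap [measurable]: "lap \<in> borel_measurable borel"
  unfolding lap_def[abs_def] by measurable

lemma tendsto_lap:
  assumes "(f \<longlongrightarrow> l) F"
  shows "((%x. lap (f x)) \<longlongrightarrow> lap l) F"
proof (cases "l = top")
  case False
  then obtain r where r: "l = ennreal r" "0 <= r" by (cases l) auto
  have ev: "eventually (%x. f x < top) F"
    using order_tendstoD(2)[OF assms, of top] False by (simp add: less_top)
  have "((%x. exp (- enn2real (f x))) \<longlongrightarrow> exp (- r)) F"
    using assms r by (intro tendsto_intros tendsto_enn2real) auto
  then show ?thesis
    by (rule Lim_transform_eventually[THEN tendsto_eq_rhs])
      (use ev r in \<open>auto simp: lap_def elim!: eventually_mono\<close>)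
next
  case True
  have "eventually (%x. lap (f x) < e) F" if "e > 0" for e
  proof -
    have "eventually (%x. ennreal (max 0 (- ln e + 1)) < f x) F"
      using order_tendstoD(1)[OF assms, of "ennreal (max 0 (- ln e + 1))"] True by simp
    then show ?thesis
    proof eventually_elim
      case (elim x)
      then have "lap (f x) <= lap (ennreal (max 0 (- ln e + 1)))"
        by (intro lap_antimono less_imp_le)
      also have "\<dots> = exp (- max 0 (- ln e + 1))"
        by (rule lap_ennreal) simp
      also have "\<dots> <= exp (ln e - 1)" by simp
      also have "\<dots> < exp (ln e)" by simp
      finally show ?case using that by simp
    qed
  qed
  then show ?thesis using True
    by (auto simp: tendsto_iff dist_real_def)
qed

lemma ennreal_eq_ln_lap: "x = (if lap x = 0 then top else ennreal (- ln (lap x)))"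
  by (cases x) (auto simp: lap_def)

text \<open>\<open>lap\<close> has a measurable inverse built from the logarithm, so a
  \<sigma>-algebra that makes exponentials measurable makes the exponents measurable. This supplies
  the generation hypothesis of the uniqueness lemma below.\<close>

lemma borel_measurable_lap_iff:
  "(%x. lap (f x)) \<in> borel_measurable M \<longleftrightarrow> f \<in> borel_measurable M"
proof
  assume [measurable]: "(%x. lap (f x)) \<in> borel_measurable M"
  have "(%x. if lap (f x) = 0 then top else ennreal (- ln (lap (f x)))) \<in> borel_measurable M"
    by measurable
  then show "f \<in> borel_measurable M" using ennreal_eq_ln_lap by simp
qed simp

lemma one_minus_lap_le: "ennreal (1 - lap x) <= min 1 x"
proof (cases x)
  case (real r)
  have "1 - exp (- r) <= r" using exp_ge_add_one_self[of "- r"] by simp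
  moreover have "ennreal (1 - exp (- r)) <= ennreal 1" by (intro ennreal_leI) simp
  ultimately show ?thesis using real by (auto simp: lap_def intro!: ennreal_leI)
qed (auto simp: lap_def)

section \<open>Measures determined by a multiplicative class of functions\<close>

text \<open>A functional monotone class theorem. Integrals agree for products of polynomials in
  members of \<open>F\<close>, hence by Weierstrass for products of continuous functions of them,
  hence for finite intersections of sublevel sets, which form a generating \<pi>-system.\<close>

lemma finite_measure_eqI_multiplicative_class:
  fixes M N :: "'a measure" and F :: "('a => real) set"
  assumes fM: "finite_measure M" and fN: "finite_measure N" and sets_eq: "sets M = sets N"
    and meas: "!!f. f \<in> F ==> f \<in> borel_measurable M"
    and range: "!!f x. f \<in> F ==> x \<in> space M ==> f x \<in> {0..1}"
    and one: "(%_. 1) \<in> F" and mult: "!!f g. f \<in> F ==> g \<in> F ==> (%x. f x * g x) \<in> F"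
    and gen: "!!K. space K = space M ==> (!!f. f \<in> F ==> f \<in> borel_measurable K) ==> sets M \<subseteq> sets K"
    and eq: "!!f. f \<in> F ==> (\<integral>x. f x \<partial>M) = (\<integral>x. f x \<partial>N)"
  shows "M = N"
proof -
  interpret M: finite_measure M by fact
  interpret N: finite_measure N by fact
  have sp: "space M = space N" using sets_eq by (rule sets_eq_imp_space_eq)
  have measN: "f \<in> borel_measurable N" if "f \<in> F" for f
    using meas[OF that] by (simp add: measurable_cong_sets[OF sets_eq refl])
  have pw: "(%x. f x ^ i) \<in> F" if "f \<in> F" for f i
    by (induction i) (use one mult that in auto)
  have bdM: "integrable M h" if "h \<in> borel_measurable M" "!!x. x \<in> space M ==> \<bar>h x\<bar> <= B" for h :: "'a => real" and B
    using that by (intro M.integrable_const_bound[where B=B]) auto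
  have bdN: "integrable N h" if "h \<in> borel_measurable M" "!!x. x \<in> space M ==> \<bar>h x\<bar> <= B" for h :: "'a => real" and B
    using that by (intro N.integrable_const_bound[where B=B])
      (auto simp: sp measurable_cong_sets[OF sets_eq refl])
  \<comment> \<open>The factor \<open>g\<close> ranges over all of \<open>F\<close> in the
    induction: when a new \<open>f\<close> is treated, its powers are absorbed into
    \<open>g\<close>, where the induction hypothesis applies.\<close>
  have approx: "(\<integral>x. (\<Prod>f\<in>J. c f (f x)) * g x \<partial>M) = (\<integral>x. (\<Prod>f\<in>J. c f (f x)) * g x \<partial>N)"
    if "finite J" "J \<subseteq> F" "!!f. f \<in> J ==> continuous_on UNIV (c f)" "!!f y. f \<in> J ==> \<bar>c f y\<bar> <= 1"
      "g \<in> F" for J g and c :: "('a => real) => real => real"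
    using that
  proof (induction J arbitrary: g rule: finite_induct)
    case empty
    then show ?case using eq by simp
  next
    case (insert f J)
    define R where "R x = (\<Prod>f\<in>J. c f (f x)) * g x" for x
    have f: "f \<in> F" using insert by auto
    have cm: "c h \<in> borel_measurable borel" if "h \<in> insert f J" for h
      using insert.prems(2)[OF that] by (rule borel_measurable_continuous_onI)
    have Rm [measurable]: "R \<in> borel_measurable M"
      unfolding R_def using insert meas
      by (auto intro!: borel_measurable_times borel_measurable_prod measurable_compose[OF _ cm])
    have fm [measurable]: "f \<in> borel_measurable M" using meas f by auto
    have cfm [measurable]: "c f \<in> borel_measurable borel" using cm by auto
    have R1: "\<bar>R x\<bar> <= 1" if "x \<in> space M" for x
    proof -
      have "\<bar>\<Prod>f\<in>J. c f (f x)\<bar> <= 1"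
        unfolding abs_prod using insert.prems by (intro prod_le_1) auto
      moreover have "\<bar>g x\<bar> <= 1" using range[OF insert.prems(4) that] by auto
      ultimately show ?thesis unfolding R_def abs_mult
        by (metis abs_ge_zero mult_le_one)
    qed
    have step: "\<bar>(\<integral>x. c f (f x) * R x \<partial>M) - (\<integral>x. c f (f x) * R x \<partial>N)\<bar>
       <= e * (measure M (space M) + measure N (space N))" if e: "e > 0" for e
    proof -
      have "\<exists>q. real_polynomial_function q \<and> (\<forall>x \<in> {0..1}. \<bar>c f x - q x\<bar> < e)"
        using Stone_Weierstrass_real_polynomial_function[of "{0..1}" "c f" e] insert.prems(2)[of f] e
        by (metis compact_Icc continuous_on_subset insertI1 subset_UNIV)
      then obtain q where q: "real_polynomial_function q" "!!x. x \<in> {0..1} ==> \<bar>c f x - q x\<bar> < e" by blast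
      then obtain a n where qa: "q = (%x. \<Sum>i\<le>n. a i * x ^ i)"
        unfolding real_polynomial_function_iff_sum by blast
      have eqR: "(\<integral>x. f x ^ i * R x \<partial>M) = (\<integral>x. f x ^ i * R x \<partial>N)" for i
      proof -
        have "(%x. f x ^ i * g x) \<in> F" using pw[OF f] mult insert.prems by auto
        from insert.IH[OF _ _ _ this] insert.prems
        have "(\<integral>x. (\<Prod>f\<in>J. c f (f x)) * (f x ^ i * g x) \<partial>M) = (\<integral>x. (\<Prod>f\<in>J. c f (f x)) * (f x ^ i * g x) \<partial>N)"
          by auto
        then show ?thesis by (simp add: R_def mult_ac)
      qed
      have b1: "\<bar>f x ^ i * R x\<bar> <= 1" if "x \<in> space M" for x i
        using R1[OF that] range[OF f that] unfolding abs_mult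
        by (intro mult_le_one) (auto simp: power_le_one)
      have qR: "(\<integral>x. q (f x) * R x \<partial>M) = (\<integral>x. q (f x) * R x \<partial>N)"
      proof -
        have "(\<integral>x. q (f x) * R x \<partial>M) = (\<Sum>i\<le>n. a i * (\<integral>x. f x ^ i * R x \<partial>M))"
          unfolding qa sum_distrib_right using b1
          by (subst Bochner_Integration.integral_sum)
            (auto simp: mult.assoc intro!: integrable_mult_right bdM[where B=1])
        also have "\<dots> = (\<Sum>i\<le>n. a i * (\<integral>x. f x ^ i * R x \<partial>N))" by (simp add: eqR)
        also have "\<dots> = (\<integral>x. q (f x) * R x \<partial>N)"
          unfolding qa sum_distrib_right using b1
          by (subst Bochner_Integration.integral_sum)
            (auto simp: mult.assoc intro!: integrable_mult_right bdN[where B=1])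
        finally show ?thesis .
      qed
      have qm [measurable]: "q \<in> borel_measurable borel" unfolding qa by measurable
      have bc: "\<bar>c f (f x) * R x\<bar> <= 1" if "x \<in> space M" for x
        using R1[OF that] insert.prems(3)[of f] unfolding abs_mult by (intro mult_le_one) auto
      have d: "\<bar>c f (f x) * R x - q (f x) * R x\<bar> <= e" if "x \<in> space M" for x
      proof -
        have "\<bar>c f (f x) * R x - q (f x) * R x\<bar> = \<bar>c f (f x) - q (f x)\<bar> * \<bar>R x\<bar>"
          by (simp add: abs_mult[symmetric] left_diff_distrib)
        also have "\<dots> <= e * 1"
          using q(2)[OF range[OF f that]] R1[OF that] e by (intro mult_mono) auto
        finally show ?thesis by simp
      qed
      have bq: "\<bar>q (f x) * R x\<bar> <= 1 + e" if "x \<in> space M" for x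
        using bc[OF that] d[OF that] by linarith
      have 1: "\<bar>(\<integral>x. c f (f x) * R x \<partial>M) - (\<integral>x. q (f x) * R x \<partial>M)\<bar> <= e * measure M (space M)"
      proof -
        have "\<bar>(\<integral>x. c f (f x) * R x \<partial>M) - (\<integral>x. q (f x) * R x \<partial>M)\<bar> = \<bar>\<integral>x. c f (f x) * R x - q (f x) * R x \<partial>M\<bar>"
          by (subst Bochner_Integration.integral_diff) (use bc bq in \<open>auto intro!: bdM\<close>)
        also have "\<dots> <= (\<integral>x. \<bar>c f (f x) * R x - q (f x) * R x\<bar> \<partial>M)"
          by (rule integral_abs_bound)
        also have "\<dots> <= (\<integral>x. e \<partial>M)"
          using d by (intro integral_mono) (auto intro!: bdM[where B=e])
        finally show ?thesis by (simp add: mult.commute)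
      qed
      have 2: "\<bar>(\<integral>x. c f (f x) * R x \<partial>N) - (\<integral>x. q (f x) * R x \<partial>N)\<bar> <= e * measure N (space N)"
      proof -
        have "\<bar>(\<integral>x. c f (f x) * R x \<partial>N) - (\<integral>x. q (f x) * R x \<partial>N)\<bar> = \<bar>\<integral>x. c f (f x) * R x - q (f x) * R x \<partial>N\<bar>"
          by (subst Bochner_Integration.integral_diff) (use bc bq in \<open>auto intro!: bdN\<close>)
        also have "\<dots> <= (\<integral>x. \<bar>c f (f x) * R x - q (f x) * R x\<bar> \<partial>N)"
          by (rule integral_abs_bound)
        also have "\<dots> <= (\<integral>x. e \<partial>N)"
          using d by (intro integral_mono) (auto simp: sp[symmetric] intro!: bdN[where B=e])
        finally show ?thesis by (simp add: mult.commute)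
      qed
      show ?thesis using 1 2 qR by (simp add: distrib_left)
    qed
    have "(\<integral>x. c f (f x) * R x \<partial>M) = (\<integral>x. c f (f x) * R x \<partial>N)"
    proof (rule ccontr)
      let ?m = "measure M (space M) + measure N (space N)"
      assume "\<not> ?thesis"
      then have pos: "0 < \<bar>(\<integral>x. c f (f x) * R x \<partial>M) - (\<integral>x. c f (f x) * R x \<partial>N)\<bar>" (is "0 < ?d") by simp
      have m: "0 <= ?m" by simp
      have "?m \<noteq> 0" using step[of 1] pos by (intro notI) simp
      then have mp: "0 < ?m" using m by linarith
      have half: "d / (2 * m) * m = d / 2" if "m \<noteq> 0" for d m :: real
        using that by simp
      have "?d <= ?d / (2 * ?m) * ?m"
        using pos mp by (intro step divide_pos_pos mult_pos_pos) simp_all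
      also have "\<dots> = ?d / 2" using mp by (intro half) linarith
      finally show False using pos by simp
    qed
    then show ?case using insert.hyps by (simp add: R_def mult.assoc)
  qed
  define G where "G = {{x \<in> space M. \<forall>f\<in>J. f x <= a f} | J a. finite J \<and> J \<subseteq> F}"
  have GI: "{x \<in> space M. \<forall>f\<in>J. f x <= a f} \<in> G" if "finite J" "J \<subseteq> F" for J a
    unfolding G_def using that by (intro CollectI exI[of _ J] exI[of _ a]) simp
  have GM: "G \<subseteq> sets M"
    unfolding G_def using meas by (auto intro!: sets.sets_Collect_finite_All) 
  have eqG: "emeasure M A = emeasure N A" if "A \<in> G" for A
  proof -
    from that obtain J a where J: "finite J" "J \<subseteq> F" and A: "A = {x \<in> space M. \<forall>f\<in>J. f x <= a f}"
      unfolding G_def by blast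
    \<comment> \<open>Piecewise linear functions that decrease to the indicator of the half-line up
      to \<open>a f\<close>.\<close>
    define c where "c n f y = max 0 (min 1 (1 - real n * (y - a f)))" for n f and y :: real
    have lim: "(%n. c n f y) ----> (if y <= a f then 1 else 0)" for f :: "'a => real" and y
    proof (cases "y <= a f")
      case True
      then have "c n f y = 1" for n by (auto simp: c_def mult_nonneg_nonpos)
      then show ?thesis using True by simp
    next
      case False
      obtain n0 :: nat where n0: "real n0 > 1 / (y - a f)" using reals_Archimedean2 by blast
      have "c n f y = 0" if "n \<ge> n0" for n
      proof -
        have "1 < real n0 * (y - a f)" using n0 False by (simp add: field_simps)
        also have "\<dots> <= real n * (y - a f)" using that False by (intro mult_right_mono) auto
        finally show ?thesis by (simp add: c_def)
      qed
      then have "eventually (%n. c n f y = 0) sequentially" by (auto simp: eventually_sequentially)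
      then show ?thesis using False by (simp add: tendsto_eventually)
    qed
    have lim2: "(%n. (\<Prod>f\<in>J. c n f (f x)) * 1) ----> indicator A x" if "x \<in> space M" for x
    proof -
      have "(%n. (\<Prod>f\<in>J. c n f (f x))) ----> (\<Prod>f\<in>J. if f x <= a f then 1 else (0::real))"
        by (intro tendsto_prod lim)
      also have "(\<Prod>f\<in>J. if f x <= a f then 1 else (0::real)) = indicator A x"
        using that J by (auto simp: A indicator_def prod_zero_iff intro!: prod.neutral)
      finally show ?thesis by simp
    qed
    have c1: "\<bar>c n f y\<bar> <= 1" for n f y by (auto simp: c_def)
    have cc: "continuous_on UNIV (c n f)" for n f
      unfolding c_def by (intro continuous_intros)
    have cm [measurable]: "c n f \<in> borel_measurable borel" for n f
      using cc by (rule borel_measurable_continuous_onI)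
    have Am: "A \<in> sets M" using that GM by auto
    have mm: "(%x. (\<Prod>f\<in>J. c n f (f x)) * 1) \<in> borel_measurable M" for n
      using J meas by (auto intro!: borel_measurable_prod measurable_compose[OF _ cm])
    have bb: "\<bar>(\<Prod>f\<in>J. c n f (f x)) * 1\<bar> <= 1" for n x
      unfolding mult_1_right abs_prod using c1 by (intro prod_le_1) auto
    have "(%n. \<integral>x. (\<Prod>f\<in>J. c n f (f x)) * 1 \<partial>M) ----> (\<integral>x. indicator A x \<partial>M)"
      using lim2 mm bb Am by (intro integral_dominated_convergence[where w="%_. 1"]) auto
    moreover have "(%n. \<integral>x. (\<Prod>f\<in>J. c n f (f x)) * 1 \<partial>N) ----> (\<integral>x. indicator A x \<partial>N)"
      using lim2 mm bb Am unfolding sp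
      by (intro integral_dominated_convergence[where w="%_. 1"])
        (auto simp: measurable_cong_sets[OF sets_eq refl] sets_eq)
    ultimately have "(\<integral>x. indicator A x \<partial>M) = (\<integral>x. indicator A x \<partial>N :: real)"
      using approx[OF J cc c1 one] by (auto intro: LIMSEQ_unique)
    then have "measure M A = measure N A" using Am sets_eq by (simp add: sets.Int_space_eq2)
    then show ?thesis by (simp add: M.emeasure_eq_measure N.emeasure_eq_measure)
  qed
  show ?thesis
  proof (rule measure_eqI_generator_eq[where E=G and \<Omega>="space M" and A="%_. space M"])
    show "Int_stable G"
    proof (rule Int_stableI)
      fix A B assume "A \<in> G" "B \<in> G"
      then obtain J a J' a' where J: "finite J" "J \<subseteq> F" "finite J'" "J' \<subseteq> F" and
        A: "A = {x \<in> space M. \<forall>f\<in>J. f x <= a f}" and B: "B = {x \<in> space M. \<forall>f\<in>J'. f x <= a' f}"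
        unfolding G_def by blast
      \<comment> \<open>A function that occurs in both families gets the smaller of its two
        thresholds.\<close>
      let ?b = "%f. if f \<in> J \<and> f \<in> J' then min (a f) (a' f) else if f \<in> J then a f else a' f"
      have "A \<inter> B = {x \<in> space M. \<forall>f\<in>J \<union> J'. f x <= ?b f}"
      proof -
        have "(\<forall>f\<in>J \<union> J'. f x <= ?b f) \<longleftrightarrow> (\<forall>f\<in>J. f x <= a f) \<and> (\<forall>f\<in>J'. f x <= a' f)" for x
        proof (intro iffI conjI ballI)
          fix f assume *: "\<forall>f\<in>J \<union> J'. f x <= ?b f" and "f \<in> J"
          then have "f x <= ?b f" by blast
          with \<open>f \<in> J\<close> show "f x <= a f" by (simp split: if_splits)
        next
          fix f assume *: "\<forall>f\<in>J \<union> J'. f x <= ?b f" and "f \<in> J'"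
          then have "f x <= ?b f" by blast
          with \<open>f \<in> J'\<close> show "f x <= a' f" by (simp split: if_splits)
        next
          fix f assume "(\<forall>f\<in>J. f x <= a f) \<and> (\<forall>f\<in>J'. f x <= a' f)" "f \<in> J \<union> J'"
          then show "f x <= ?b f" by (cases "f \<in> J"; cases "f \<in> J'") simp_all
        qed
        then show ?thesis unfolding A B by blast
      qed
      then show "A \<inter> B \<in> G" unfolding G_def using J
        by (intro CollectI exI[of _ "J \<union> J'"] exI[of _ ?b]) auto
    qed
    show "G \<subseteq> Pow (space M)" by (auto simp: G_def)
    let ?K = "sigma (space M) G"
    have spK: "space ?K = space M" and setsK: "sets ?K = sigma_sets (space M) G"
      using \<open>G \<subseteq> Pow (space M)\<close> by (auto simp: space_measure_of sets_measure_of)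
    have "f \<in> borel_measurable ?K" if "f \<in> F" for f
    proof (subst borel_measurable_iff_le, intro allI)
      fix b
      have "{w \<in> space M. f w <= b} \<in> G" using GI[of "{f}" "%_. b"] that by simp
      then show "{w \<in> space ?K. f w <= b} \<in> sets ?K" unfolding spK setsK by auto
    qed
    from gen[OF spK this] have "sets M \<subseteq> sigma_sets (space M) G" by (simp add: setsK)
    moreover have "sigma_sets (space M) G \<subseteq> sets M" using GM by (rule sets.sigma_sets_subset)
    ultimately show "sets M = sigma_sets (space M) G" by auto
    then show "sets N = sigma_sets (space M) G" by (simp add: sets_eq)
    have "space M \<in> G" using GI[of "{}"] by simp
    then show "range (%_::nat. space M) \<subseteq> G" by auto
    show "emeasure M (space M) \<noteq> \<infinity>" by simp
  qed (use eqG in auto)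
qed

section \<open>Spaces of Radon measures\<close>

lemma space_radon_space [simp]: "space radon_space = radon_measures"
  by (auto simp add: radon_space_def space_Sup_eq_UN)

lemma sets_radon_measure: "\<mu> \<in> radon_measures ==> sets \<mu> = sets borel"
  by (simp add: radon_measures_def)

lemma borel_measurable_sets_borel:
  "sets \<mu> = sets borel ==> f \<in> borel_measurable borel ==> f \<in> borel_measurable \<mu>"
  using measurable_cong_sets[OF _ refl] by blast

lemma borel_measurable_radon:
  "\<mu> \<in> radon_measures ==> f \<in> borel_measurable borel ==> f \<in> borel_measurable \<mu>"
  using measurable_cong_sets[OF sets_radon_measure refl] by blast

lemma measurable_emeasure_radon_space [measurable]:
  "B \<in> sets borel ==> (%\<mu>. emeasure \<mu> B) \<in> borel_measurable radon_space"
  by (auto intro!: measurable_Sup1 measurable_vimage_algebra1 simp: radon_space_def)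

lemma measurable_radon_spaceI:
  fixes f :: "'a => 'x::topological_space measure"
  assumes "!!w. w \<in> space M ==> f w \<in> radon_measures"
    and "!!B. B \<in> sets borel ==> (%w. emeasure (f w) B) \<in> borel_measurable M"
  shows "f \<in> measurable M radon_space"
  using assms
  by (auto intro!: measurable_SUP2 measurable_vimage_algebra2 simp: radon_space_def)

lemma measurable_np [measurable]:
  fixes h :: "'x::topological_space => ennreal"
  assumes "h \<in> borel_measurable borel"
  shows "(%\<mu>. \<integral>\<^sup>+x. h x \<partial>\<mu>) \<in> borel_measurable radon_space"
  using assms
proof (induction h rule: borel_measurable_induct)
  case (cong f g)
  moreover have "(np f \<mu>) = (np g \<mu>)" for \<mu> :: "'x measure"
    using cong by (intro nn_integral_cong) auto
  ultimately show ?case by simp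
next
  case (set B)
  then show ?case
    by (subst measurable_cong[of _ _ "%\<mu>. emeasure \<mu> B"])
      (auto simp: sets_radon_measure)
next
  case (mult f c)
  have "(\<integral>\<^sup>+x. c * f x \<partial>\<mu>) = c * (np f \<mu>)" if "\<mu> \<in> radon_measures" for \<mu>
    using mult(2) by (intro nn_integral_cmult borel_measurable_radon[OF that])
  with mult show ?case
    by (subst measurable_cong[of _ _ "%\<mu>. c * (np f \<mu>)"]) auto
next
  case (add f g)
  have "(\<integral>\<^sup>+x. g x + f x \<partial>\<mu>) = (np g \<mu>) + (np f \<mu>)"
    if "\<mu> \<in> radon_measures" for \<mu>
    using add(1,3) by (intro nn_integral_add borel_measurable_radon[OF that])
  with add show ?case
    by (subst measurable_cong[of _ _ "%\<mu>. (np g \<mu>) + (np f \<mu>)"]) auto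
next
  case (seq F)
  have eq: "(SUP i. F i) = (%x. SUP i. F i x)" by (rule ext) (simp add: image_comp)
  have "integral\<^sup>N \<mu> (SUP i. F i) = (SUP i. integral\<^sup>N \<mu> (F i))" if "\<mu> \<in> radon_measures" for \<mu>
    using seq(1,3) unfolding eq
    by (intro nn_integral_monotone_convergence_SUP borel_measurable_radon[OF that])
  with seq show ?case
    by (subst measurable_cong[of _ _ "%\<mu>. SUP i. \<integral>\<^sup>+x. F i x \<partial>\<mu>"]) auto
qed

lemma scale_measure_radon:
  "\<mu> \<in> radon_measures ==> r < top ==> scale_measure r \<mu> \<in> radon_measures"
  by (auto simp: radon_measures_def ennreal_mult_less_top)

lemma measurable_scale_measure_radon:
  assumes "r \<in> borel_measurable M" "f \<in> measurable M radon_space" "!!x. x \<in> space M ==> r x < top"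
  shows "(%x. scale_measure (r x) (f x)) \<in> measurable M radon_space"
proof (rule measurable_radon_spaceI)
  fix x assume "x \<in> space M"
  with assms measurable_space[OF assms(2)] show "scale_measure (r x) (f x) \<in> radon_measures"
    by (intro scale_measure_radon) simp_all
next
  fix B :: "'b set" assume "B \<in> sets borel"
  then have "(%x. emeasure (f x) B) \<in> borel_measurable M"
    by (intro measurable_compose[OF assms(2)] measurable_emeasure_radon_space)
  with assms(1) show "(%x. emeasure (scale_measure (r x) (f x)) B) \<in> borel_measurable M"
    by simp
qed

lemma nn_integral_scale_measure':
  assumes "sets \<mu> = sets borel" "h \<in> borel_measurable borel"
  shows "(np h (scale_measure r \<mu>)) = r * (np h \<mu>)"
  using assms measurable_cong_sets[OF assms(1) refl] by (intro nn_integral_scale_measure) blast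

text \<open>A sum of measures as an integral over the counting measure of the index set. One
  construction covers finite sums, two-term sums and series, and it has a value even when the sum is
  not locally finite, so that convergence can be examined afterwards.\<close>

definition series_measure :: "'i set => ('i => 'x::topological_space measure) => 'x measure" where
  "series_measure J \<mu> = measure_of UNIV (sets borel) (%B. \<integral>\<^sup>+i. emeasure (\<mu> i) B \<partial>count_space J)"

lemma sets_series_measure [simp]: "sets (series_measure J \<mu>) = sets borel"
proof -
  have "sigma_sets UNIV (sets (borel :: 'a measure)) = sets borel"
    using sets.sigma_sets_eq[of "borel :: 'a measure"] by simp
  then show ?thesis by (simp add: series_measure_def)
qed

lemma space_series_measure [simp]: "space (series_measure J \<mu>) = UNIV"
  by (simp add: series_measure_def)

lemma emeasure_series_measure:
  assumes "!!i. i \<in> J ==> sets (\<mu> i) = sets borel" "B \<in> sets borel"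
  shows "emeasure (series_measure J \<mu>) B = (\<integral>\<^sup>+i. emeasure (\<mu> i) B \<partial>count_space J)"
  unfolding series_measure_def
proof (rule emeasure_measure_of_sigma)
  show "sigma_algebra UNIV (sets (borel :: 'b measure))"
    using sets.sigma_algebra_axioms[of "borel :: 'b measure"] by simp
  show "positive (sets borel) (%B. \<integral>\<^sup>+i. emeasure (\<mu> i) B \<partial>count_space J)"
    by (simp add: positive_def)
  show "countably_additive (sets borel) (%B. \<integral>\<^sup>+i. emeasure (\<mu> i) B \<partial>count_space J)"
  proof (rule countably_additiveI)
    fix A :: "nat => 'b set" assume A: "range A \<subseteq> sets borel" "disjoint_family A"
    have "(\<Sum>n. \<integral>\<^sup>+i. emeasure (\<mu> i) (A n) \<partial>count_space J) = (\<integral>\<^sup>+i. (\<Sum>n. emeasure (\<mu> i) (A n)) \<partial>count_space J)"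
      by (rule nn_integral_suminf[symmetric]) simp
    also have "\<dots> = (\<integral>\<^sup>+i. emeasure (\<mu> i) (\<Union>n. A n) \<partial>count_space J)"
      using A assms(1) by (intro nn_integral_cong) (auto intro!: suminf_emeasure)
    finally show "(\<Sum>n. \<integral>\<^sup>+i. emeasure (\<mu> i) (A n) \<partial>count_space J) = (\<integral>\<^sup>+i. emeasure (\<mu> i) (\<Union>n. A n) \<partial>count_space J)" .
  qed
qed fact

lemma nn_integral_series_measure:
  assumes J: "!!i. i \<in> J ==> sets (\<mu> i) = sets borel" and h: "h \<in> borel_measurable borel"
  shows "(np h (series_measure J \<mu>)) = (\<integral>\<^sup>+i. (np h (\<mu> i)) \<partial>count_space J)"
  using h
proof (induction h rule: borel_measurable_induct)
  case (cong f g)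
  moreover have "(np f \<mu>) = (np g \<mu>)" for \<mu> :: "'b measure"
    using cong by (intro nn_integral_cong) auto
  ultimately show ?case by simp
next
  case (set B)
  then show ?case using J by (simp add: emeasure_series_measure cong: nn_integral_cong_simp)
next
  case (mult f c)
  have "(\<integral>\<^sup>+i. (\<integral>\<^sup>+x. c * f x \<partial>\<mu> i) \<partial>count_space J) = (\<integral>\<^sup>+i. c * (np f (\<mu> i)) \<partial>count_space J)"
    using borel_measurable_sets_borel[OF J mult(2)] by (intro nn_integral_cong nn_integral_cmult) auto
  also have "\<dots> = c * (\<integral>\<^sup>+i. (np f (\<mu> i)) \<partial>count_space J)"
    by (intro nn_integral_cmult) simp
  also have "\<dots> = (\<integral>\<^sup>+x. c * f x \<partial>series_measure J \<mu>)"
    unfolding mult.IH[symmetric] by (intro nn_integral_cmult[symmetric] borel_measurable_sets_borel[OF sets_series_measure] mult)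
  finally show ?case ..
next
  case (add f g)
  have "(\<integral>\<^sup>+i. (\<integral>\<^sup>+x. g x + f x \<partial>\<mu> i) \<partial>count_space J) = (\<integral>\<^sup>+i. (np g (\<mu> i)) + (np f (\<mu> i)) \<partial>count_space J)"
    using borel_measurable_sets_borel[OF J add(1)] borel_measurable_sets_borel[OF J add(3)] by (intro nn_integral_cong nn_integral_add) auto
  also have "\<dots> = (\<integral>\<^sup>+i. (np g (\<mu> i)) \<partial>count_space J) + (\<integral>\<^sup>+i. (np f (\<mu> i)) \<partial>count_space J)"
    by (intro nn_integral_add) simp_all
  also have "\<dots> = (\<integral>\<^sup>+x. g x + f x \<partial>series_measure J \<mu>)"
    unfolding add.IH[symmetric] by (intro nn_integral_add[symmetric] borel_measurable_sets_borel[OF sets_series_measure] add)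
  finally show ?case ..
next
  case (seq F)
  have eq: "(SUP k. F k) = (%x. SUP k. F k x)" by (rule ext) (simp add: image_comp)
  have inc: "incseq (%k. \<integral>\<^sup>+x. F k x \<partial>\<mu> i)" for i
    using seq(3) by (intro incseq_SucI nn_integral_mono) (auto simp: incseq_Suc_iff le_fun_def)
  have "(\<integral>\<^sup>+i. (\<integral>\<^sup>+x. (SUP k. F k) x \<partial>\<mu> i) \<partial>count_space J) = (\<integral>\<^sup>+i. (SUP k. \<integral>\<^sup>+x. F k x \<partial>\<mu> i) \<partial>count_space J)"
    unfolding eq using seq(3) borel_measurable_sets_borel[OF J seq(1)]
    by (intro nn_integral_cong nn_integral_monotone_convergence_SUP) auto
  also have "\<dots> = (SUP k. \<integral>\<^sup>+i. (np (F k) (\<mu> i)) \<partial>count_space J)"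
    using inc by (intro nn_integral_monotone_convergence_SUP) (auto simp: incseq_Suc_iff le_fun_def)
  also have "\<dots> = (SUP k. \<integral>\<^sup>+x. F k x \<partial>series_measure J \<mu>)"
    using seq.IH by simp
  also have "\<dots> = (\<integral>\<^sup>+x. (SUP k. F k) x \<partial>series_measure J \<mu>)"
    unfolding eq using seq(3)
    by (intro nn_integral_monotone_convergence_SUP[symmetric] borel_measurable_sets_borel[OF sets_series_measure] seq(1))
  finally show ?case ..
qed

lemma sum_measure_eq_series_measure: "finite J ==> sum_measure J \<mu> = series_measure J \<mu>"
  by (simp add: sum_measure_def series_measure_def nn_integral_count_space_finite)

lemma add_measure_eq_series_measure:
  "add_measure \<mu> \<nu> = series_measure UNIV (%b. if b then \<mu> else \<nu>)"
  by (simp add: add_measure_def series_measure_def nn_integral_count_space_finite UNIV_bool add.commute)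

lemma
  assumes "sets \<mu> = sets borel" "sets \<nu> = sets borel"
  shows emeasure_add_measure: "B \<in> sets borel ==> emeasure (add_measure \<mu> \<nu>) B = emeasure \<mu> B + emeasure \<nu> B"
    and nn_integral_add_measure: "h \<in> borel_measurable borel ==>
      (np h (add_measure \<mu> \<nu>)) = (np h \<mu>) + (np h \<nu>)"
  using assms unfolding add_measure_eq_series_measure
  by (simp_all add: emeasure_series_measure nn_integral_series_measure nn_integral_count_space_finite UNIV_bool add.commute)

lemma sets_add_measure [simp]: "sets (add_measure \<mu> \<nu>) = sets borel"
  by (simp add: add_measure_eq_series_measure)

lemma add_measure_radon:
  "\<mu> \<in> radon_measures ==> \<nu> \<in> radon_measures ==> add_measure \<mu> \<nu> \<in> radon_measures"
  by (auto simp: radon_measures_def emeasure_add_measure)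

lemma measurable_add_measure_radon:
  assumes "f \<in> measurable M radon_space" "g \<in> measurable M radon_space"
  shows "(%x. add_measure (f x) (g x)) \<in> measurable M radon_space"
proof (rule measurable_radon_spaceI)
  fix B :: "'b set" assume B: "B \<in> sets borel"
  have "(%x. emeasure (f x) B + emeasure (g x) B) \<in> borel_measurable M"
    using assms B measurable_compose[OF _ measurable_emeasure_radon_space] by auto
  then show "(%x. emeasure (add_measure (f x) (g x)) B) \<in> borel_measurable M"
    using assms[THEN measurable_space] B
    by (subst measurable_cong[of _ _ "%x. emeasure (f x) B + emeasure (g x) B"])
      (auto simp: emeasure_add_measure sets_radon_measure)
qed (use assms[THEN measurable_space] in \<open>auto intro!: add_measure_radon\<close>)

lemma sum_measure_radon:
  assumes "finite J" "!!i. i \<in> J ==> \<mu> i \<in> radon_measures"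
  shows "sum_measure J \<mu> \<in> radon_measures"
  using assms by (auto simp: sum_measure_eq_series_measure radon_measures_def emeasure_series_measure
    nn_integral_count_space_finite)

lemma nn_integral_sum_measure:
  assumes "finite J" "!!i. i \<in> J ==> sets (\<mu> i) = sets borel" "h \<in> borel_measurable borel"
  shows "(np h (sum_measure J \<mu>)) = (\<Sum>i\<in>J. \<integral>\<^sup>+x. h x \<partial>\<mu> i)"
  using assms by (simp add: sum_measure_eq_series_measure nn_integral_series_measure nn_integral_count_space_finite)

section \<open>Test functions\<close>

lemma BM_measurable: "h \<in> BM ==> h \<in> borel_measurable borel"
  and BM_nonneg: "h \<in> BM ==> 0 <= h x"
  by (auto simp: BM_def)

text \<open>The constant is taken at least 1, hence positive: it later sets the scale in the
  comparison with a normalising function.\<close>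

lemma BM_bound:
  assumes "h \<in> BM"
  shows "\<exists>c K. 0 < c \<and> compact K \<and> closed K \<and> (\<forall>x. h x <= c * indicator K x)"
proof -
  from assms have "bounded (range h)" and c: "compact (supp h)"
    by (auto simp: BM_def)
  then obtain b where b: "!!x. \<bar>h x\<bar> <= b" unfolding bounded_iff real_norm_def by blast
  have "h x <= max 1 b * indicator (supp h) x" for x
    using b[of x] closure_subset[of "{x. h x \<noteq> 0}"] by (cases "h x = 0") (auto simp: indicator_def)
  with c show ?thesis by (intro exI[of _ "max 1 b"] exI[of _ "supp h"]) auto
qed

lemma zero_BM [simp]: "(%_. 0) \<in> BM"
  by (simp add: BM_def)

lemma BM_add: "f \<in> BM ==> g \<in> BM ==> (%x. f x + g x) \<in> BM"
proof -
  assume f: "f \<in> BM" and g: "g \<in> BM"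
  have "closure {x. f x + g x \<noteq> 0} \<subseteq> closure ({x. f x \<noteq> 0} \<union> {x. g x \<noteq> 0})"
    by (intro closure_mono) auto
  moreover have "compact (closure ({x. f x \<noteq> 0} \<union> {x. g x \<noteq> 0}))"
    using f g by (auto simp: BM_def closure_Un)
  ultimately have "compact (closure {x. f x + g x \<noteq> 0})"
    using compact_Int_closed[of "closure ({x. f x \<noteq> 0} \<union> {x. g x \<noteq> 0})" "closure {x. f x + g x \<noteq> 0}"]
    by (simp add: Int_absorb1)
  moreover have "bounded (range (%x. f x + g x))"
    using f g by (auto simp: BM_def intro!: bounded_plus_comp)
  ultimately show ?thesis using f g by (auto simp: BM_def)
qed

lemma BM_scale: "f \<in> BM ==> 0 <= s ==> (%x. s * f x) \<in> BM"
proof -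
  assume f: "f \<in> BM" and s: "0 <= s"
  show ?thesis
  proof (cases "s = 0")
    case False
    with f s show ?thesis
      by (auto simp: BM_def bounded_iff abs_mult) (meson abs_ge_zero mult_left_mono)
  qed simp
qed

lemma indicator_BM: "B \<in> sets borel ==> compact (closure B) ==> indicator B \<in> BM"
  by (auto simp: BM_def bounded_iff indicator_def intro!: exI[of _ 1])

lemma compact_closure_subset:
  fixes K :: "'x::t2_space set"
  assumes "compact K" "A \<subseteq> K"
  shows "compact (closure A)"
proof -
  have "closure A \<subseteq> K" using assms compact_imp_closed closure_minimal by blast
  then show ?thesis using compact_Int_closed[OF assms(1), of "closure A"] by (simp add: Int_absorb1)
qed

lemma nn_integral_BM_finite:
  assumes "h \<in> BM" "\<mu> \<in> radon_measures"
  shows "(ip h \<mu>) < top"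
proof -
  obtain c K where c: "0 < c" "compact K" "closed K" "\<forall>x. h x <= c * indicator K x"
    using BM_bound[OF assms(1)] by (elim exE conjE) 
  have K: "K \<in> sets \<mu>" using c(3) by (simp add: sets_radon_measure[OF assms(2)])
  have "(ip h \<mu>) <= (\<integral>\<^sup>+x. ennreal c * indicator K x \<partial>\<mu>)"
  proof (rule nn_integral_mono)
    fix x show "ennreal (h x) <= ennreal c * indicator K x"
      using c(4)[rule_format, of x] by (cases "x \<in> K") (simp_all add: ennreal_leI ennreal_neg)
  qed
  also have "\<dots> = ennreal c * emeasure \<mu> K" using K by (rule nn_integral_cmult_indicator)
  also have "\<dots> < top"
    using assms(2) c by (auto simp: radon_measures_def ennreal_mult_less_top)
  finally show ?thesis .
qed

lemma integral_BM:
  assumes "h \<in> BM" "\<mu> \<in> radon_measures"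
  shows "integral\<^sup>L \<mu> h = enn2real (ip h \<mu>)"
  by (intro integral_eq_nn_integral borel_measurable_radon[OF assms(2)] BM_measurable[OF assms(1)])
    (simp add: BM_nonneg[OF assms(1)])

lemma exp_integral_BM:
  assumes "h \<in> BM" "\<mu> \<in> radon_measures"
  shows "exp (- integral\<^sup>L \<mu> h) = lap (ip h \<mu>)"
proof -
  have "(ip h \<mu>) \<noteq> top" using nn_integral_BM_finite[OF assms] by simp
  then show ?thesis unfolding integral_BM[OF assms] lap_def by simp
qed

text \<open>The exponent for extended-valued functions, which lets it be evaluated at arbitrary
  measurable functions without conditions on bounds or supports.\<close>

definition laplace_exp :: "'x::topological_space measure measure => ('x => ennreal) => ennreal" where
  "laplace_exp \<Lambda> h = (\<integral>\<^sup>+\<mu>. ennreal (1 - lap (np h \<mu>)) \<partial>\<Lambda>)"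

lemma space_nonzero: "space nonzero_radon_space = radon_measures - {null_measure borel}"
  by (auto simp: nonzero_radon_space_def space_restrict_space)

lemma laplace_exponent_eq:
  assumes "h \<in> BM" "sets \<Lambda> = sets nonzero_radon_space"
  shows "laplace_exponent \<Lambda> h = laplace_exp \<Lambda> (en h)"
  unfolding laplace_exponent_def laplace_exp_def
  using sets_eq_imp_space_eq[OF assms(2)]
  by (intro nn_integral_cong) (auto simp: exp_integral_BM[OF assms(1)] space_nonzero)

lemma measurable_lap_nn_integral:
  assumes "h \<in> borel_measurable borel" "sets M = sets (restrict_space radon_space S)"
  shows "(%\<mu>. lap (np h \<mu>)) \<in> borel_measurable M"
proof -
  have "(%\<mu>. lap (np h \<mu>)) \<in> borel_measurable (restrict_space radon_space S)"
    using assms(1) by (intro measurable_restrict_space1) measurable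
  then show ?thesis using measurable_cong_sets[OF assms(2) refl] by blast
qed

section \<open>Locally compact second countable spaces\<close>

locale lcsc =
  fixes X :: "'x::{second_countable_topology, t2_space} itself"
  assumes lc: "locally compact (UNIV :: 'x set)"
begin

lemma open_compact_nbhd:
  assumes "open W" "(x::'x) \<in> W"
  shows "\<exists>V. open V \<and> x \<in> V \<and> compact (closure V) \<and> closure V \<subseteq> W"
proof -
  obtain u v where uv: "open u" "compact v" "x \<in> u" "u \<subseteq> v" "v \<subseteq> W"
    using lc assms unfolding locally_def subtopology_UNIV openin_subtopology
    by (metis (no_types, lifting) open_openin inf_top.right_neutral)
  have "closure u \<subseteq> v" using uv compact_imp_closed closure_minimal by blast
  with uv compact_closure_subset[OF uv(2,4)] show ?thesis by blast
qed

text \<open>A countable base of relatively compact open sets, fixed once. It is unrelated to the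
  base \<open>B\<close> of the polar decomposition, which belongs to the statement.\<close>

definition nb :: "nat => 'x set" where
  "nb = (SOME U. topological_basis (range U) \<and> (\<forall>i. open (U i) \<and> compact (closure (U i))))"

lemma nb: "topological_basis (range nb)" "open (nb i)" "compact (closure (nb i))"
proof -
  obtain \<B> :: "'x set set" where B: "countable \<B>" "topological_basis \<B>" using ex_countable_basis by blast
  define \<C> where "\<C> = {b \<in> \<B>. compact (closure b)}"
  have tb: "topological_basis \<C>"
  proof (rule topological_basisI)
    fix W and x :: 'x assume "open W" "x \<in> W"
    then obtain V where V: "open V" "x \<in> V" "compact (closure V)" "closure V \<subseteq> W"
      using open_compact_nbhd by blast
    then obtain b where "b \<in> \<B>" "x \<in> b" "b \<subseteq> V" using topological_basisE[OF B(2)] by metis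
    with V closure_subset[of V] compact_closure_subset[of "closure V" b] show "\<exists>B'\<in>\<C>. x \<in> B' \<and> B' \<subseteq> W"
      by (auto simp: \<C>_def intro!: bexI[of _ b])
  qed (use B topological_basis_open in \<open>auto simp: \<C>_def\<close>)
  obtain b where "b \<in> \<C>" using topological_basisE[OF tb open_UNIV UNIV_I] by metis
  then have "range (from_nat_into \<C>) = \<C>"
    using B(1) by (intro range_from_nat_into) (auto simp: \<C>_def)
  then have "\<exists>U :: nat => 'x set. topological_basis (range U) \<and> (\<forall>i. open (U i) \<and> compact (closure (U i)))"
    using tb topological_basis_open[OF tb]
    by (intro exI[of _ "from_nat_into \<C>"]) (auto simp: \<C>_def)
  from someI_ex[OF this, folded nb_def]
  show "topological_basis (range nb)" "open (nb i)" "compact (closure (nb i))" by auto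
qed

lemma nb_cover: "(\<Union>i. nb i) = UNIV"
proof -
  have "\<exists>i. x \<in> nb i" for x using topological_basisE[OF nb(1) open_UNIV UNIV_I, of x] by (metis rangeE)
  then show ?thesis by blast
qed

text \<open>An exhaustion by relatively compact open sets that eventually contains every compact
  set. Local finiteness and non-vanishing of a measure are tested on it.\<close>

definition exh :: "nat => 'x set" where "exh n = (\<Union>i<n. nb i)"

lemma exh: "open (exh n)" "compact (closure (exh n))" "incseq exh" "(\<Union>n. exh n) = UNIV"
proof -
  show "open (exh n)" using nb by (auto simp: exh_def)
  have "compact (\<Union>i<n. closure (nb i))" using nb(3) by (intro compact_UN) auto
  then show "compact (closure (exh n))" unfolding exh_def
    by (rule compact_closure_subset) (use closure_subset in fast)
  show "incseq exh" by (force simp: exh_def incseq_def)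
  show "(\<Union>n. exh n) = UNIV" using nb_cover by (fastforce simp: exh_def)
qed

lemma exh_borel [measurable]: "exh n \<in> sets borel" using exh(1) by simp

lemma compact_subset_exh:
  assumes "compact K" shows "\<exists>n. K \<subseteq> exh n"
proof -
  have "K \<subseteq> (\<Union>i\<in>UNIV. nb i)" using nb_cover by simp
  then obtain I where I: "finite I" "K \<subseteq> (\<Union>i\<in>I. nb i)"
    using compactE_image[OF assms, of UNIV nb] nb(2) by metis
  then obtain n where "I \<subseteq> {..<n}" using finite_nat_iff_bounded by blast
  with I(2) show ?thesis by (fastforce simp: exh_def)
qed

lemma radon_measuresI:
  assumes "sets \<mu> = sets borel" "!!n. emeasure \<mu> (exh n) < top"
  shows "\<mu> \<in> radon_measures"
proof -
  have "emeasure \<mu> B < top" if B: "B \<in> sets borel" "compact (closure B)" for B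
  proof -
    obtain n where "closure B \<subseteq> exh n" using compact_subset_exh B by blast
    then have "B \<subseteq> exh n" using closure_subset by blast
    then have "emeasure \<mu> B <= emeasure \<mu> (exh n)" using assms(1) by (intro emeasure_mono) auto
    then show ?thesis using assms(2) order_le_less_trans by blast
  qed
  then show ?thesis using assms(1) by (auto simp: radon_measures_def)
qed

lemma radon_exh: "\<mu> \<in> radon_measures ==> emeasure \<mu> (exh n) < top"
  using exh(2)[of n] by (auto simp: radon_measures_def)

lemma indicator_exh_BM: "indicator (exh n) \<in> BM"
  by (intro indicator_BM exh) simp

lemma emeasure_eq_SUP_exh:
  fixes B :: "'x set"
  assumes "sets \<mu> = sets borel" "B \<in> sets borel"
  shows "emeasure \<mu> B = (SUP n. emeasure \<mu> (B \<inter> exh n))"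
proof -
  have "(SUP n. emeasure \<mu> (B \<inter> exh n)) = emeasure \<mu> (\<Union>n. B \<inter> exh n)"
    using assms exh(3) by (intro SUP_emeasure_incseq) (auto simp: incseq_def)
  also have "(\<Union>n. B \<inter> exh n) = B" using exh(4) by blast
  finally show ?thesis ..
qed

lemma Int_exh_BM: "B \<in> sets borel ==> indicator (B \<inter> exh n) \<in> BM"
  by (intro indicator_BM compact_closure_subset[OF exh(2)[of n]])
    (use closure_subset in auto)

section \<open>Laws of random measures and their Laplace functionals\<close>

lemma measure_eqI_laplace:
  fixes M N :: "'x measure measure"
  assumes fM: "finite_measure M" and fN: "finite_measure N"
    and sM: "sets M = sets (restrict_space radon_space S)" and sN: "sets N = sets (restrict_space radon_space S)"
    and eq: "!!h. h \<in> BM ==> (\<integral>\<mu>. lap (ip h \<mu>) \<partial>M) = (\<integral>\<mu>. lap (ip h \<mu>) \<partial>N)"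
  shows "M = N"
proof (rule finite_measure_eqI_multiplicative_class[OF fM fN])
  let ?F = "{%\<mu>. lap (ip h \<mu>) | h. h \<in> BM}"
  \<comment> \<open>The exponentials are set to 1 off the Radon measures. There the additivity of
    the integral could fail, and the class has to be closed under products as functions on the whole
    type.\<close>
  define F where "F = {%\<mu>. if \<mu> \<in> radon_measures then lap (ip h \<mu>) else 1 | h :: 'x => real. h \<in> BM}"
  have spM: "space M = S \<inter> radon_measures"
    using sets_eq_imp_space_eq[OF sM] by (simp add: space_restrict_space)
  show "sets M = sets N" using sM sN by simp
  have spN: "space N = S \<inter> radon_measures"
    using sets_eq_imp_space_eq[OF sN] by (simp add: space_restrict_space)
  show "f \<in> borel_measurable M" if "f \<in> F" for f
  proof -
    from that obtain h where h: "h \<in> BM" and f: "f = (%\<mu>. if \<mu> \<in> radon_measures then lap (ip h \<mu>) else 1)"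
      by (auto simp: F_def)
    have "(%\<mu>. lap (ip h \<mu>)) \<in> borel_measurable M"
      using BM_measurable[OF h] by (intro measurable_lap_nn_integral[OF _ sM]) simp
    then show ?thesis unfolding f by (subst measurable_cong) (auto simp: spM)
  qed
  show "f x \<in> {0..1}" if "f \<in> F" for f x
    using that by (auto simp: F_def)
  show "(%_. 1) \<in> F" unfolding F_def by (rule CollectI, rule exI[of _ "%_. 0"]) auto
  show "(%x. f x * g x) \<in> F" if "f \<in> F" "g \<in> F" for f g
  proof -
    from that obtain h k where h: "h \<in> BM" and f: "f = (%\<mu>. if \<mu> \<in> radon_measures then lap (ip h \<mu>) else 1)"
      and k: "k \<in> BM" and g: "g = (%\<mu>. if \<mu> \<in> radon_measures then lap (ip k \<mu>) else 1)"
      unfolding F_def by blast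
    have "(\<integral>\<^sup>+x. ennreal (h x + k x) \<partial>\<mu>) = (ip h \<mu>) + (ip k \<mu>)" if "\<mu> \<in> radon_measures" for \<mu>
    proof -
      have "(\<integral>\<^sup>+x. ennreal (h x + k x) \<partial>\<mu>) = (\<integral>\<^sup>+x. ennreal (h x) + ennreal (k x) \<partial>\<mu>)"
        using h k by (intro nn_integral_cong) (simp add: BM_nonneg)
      also have "\<dots> = (ip h \<mu>) + (ip k \<mu>)"
        using h k by (intro nn_integral_add borel_measurable_radon[OF that] measurable_compose[OF _ measurable_ennreal] BM_measurable)
      finally show ?thesis .
    qed
    then have "(%x. f x * g x) = (%\<mu>. if \<mu> \<in> radon_measures then lap (\<integral>\<^sup>+x. ennreal (h x + k x) \<partial>\<mu>) else 1)"
      by (auto simp: f g lap_add)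
    with BM_add[OF h k] show ?thesis unfolding F_def by (intro CollectI exI[of _ "%x. h x + k x"]) simp
  qed
  show "(\<integral>x. f x \<partial>M) = (\<integral>x. f x \<partial>N)" if "f \<in> F" for f
  proof -
    from that obtain h where h: "h \<in> BM" and f: "f = (%\<mu>. if \<mu> \<in> radon_measures then lap (ip h \<mu>) else 1)"
      by (auto simp: F_def)
    have "(\<integral>x. f x \<partial>M) = (\<integral>\<mu>. lap (ip h \<mu>) \<partial>M)"
      by (intro bint_cong) (auto simp: f spM)
    moreover have "(\<integral>x. f x \<partial>N) = (\<integral>\<mu>. lap (ip h \<mu>) \<partial>N)"
      by (intro bint_cong) (auto simp: f spN)
    ultimately show ?thesis using eq[OF h] by simp
  qed
  show "sets M \<subseteq> sets K" if K: "space K = space M" and meas: "!!f. f \<in> F ==> f \<in> borel_measurable K" for K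
  proof -
    have "(%\<mu>. emeasure \<mu> B) \<in> borel_measurable K" if B: "B \<in> sets (borel :: 'x measure)" for B
    proof -
      \<comment> \<open>The indicator of \<open>B\<close> need not have compact support. Its
        intersections with the exhaustion are relatively compact, and their masses increase to that
        of \<open>B\<close>.\<close>
      have 1: "(%\<mu>. emeasure \<mu> (B \<inter> exh n)) \<in> borel_measurable K" for n
      proof -
        let ?h = "indicator (B \<inter> exh n) :: 'x => real"
        have "(%\<mu>. if \<mu> \<in> radon_measures then lap (\<integral>\<^sup>+x. ennreal (?h x) \<partial>\<mu>) else 1) \<in> F"
          unfolding F_def using Int_exh_BM[OF B, of n] by blast
        from meas[OF this] have "(%\<mu>. lap (emeasure \<mu> (B \<inter> exh n))) \<in> borel_measurable K"
          by (subst (asm) measurable_cong[where g="%\<mu>. lap (emeasure \<mu> (B \<inter> exh n))"])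
            (use B in \<open>auto simp: K spM ennreal_indicator sets_radon_measure\<close>)
        then show ?thesis by (simp only: borel_measurable_lap_iff)
      qed
      have "(%\<mu>. SUP n. emeasure \<mu> (B \<inter> exh n)) \<in> borel_measurable K"
        by (intro borel_measurable_SUP 1) simp
      then show ?thesis
        by (subst measurable_cong[where g="%\<mu>. SUP n. emeasure \<mu> (B \<inter> exh n)"])
          (use B in \<open>auto simp: K spM sets_radon_measure intro!: emeasure_eq_SUP_exh\<close>)
    qed
    then have id: "(%\<mu>. \<mu>) \<in> measurable K radon_space"
      by (intro measurable_radon_spaceI) (auto simp: K spM)
    have id2: "(%\<mu>. \<mu>) \<in> measurable K (restrict_space radon_space S)"
      by (intro measurable_restrict_space2 id) (auto simp: K spM)
    show ?thesis
    proof
      fix A assume A: "A \<in> sets M"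
      have "(%\<mu>. \<mu>) -` A \<inter> space K \<in> sets K"
        using A by (intro measurable_sets[OF id2]) (simp add: sM)
      then show "A \<in> sets K" using sets.sets_into_space[OF A] by (simp add: K Int_absorb2)
    qed
  qed
qed

lemma eq_in_distributionI:
  assumes z: "random_measure P \<zeta>" and e: "random_measure Q \<eta>"
    and eq: "!!h. h \<in> BM ==> (\<integral>w. lap (ip h (\<zeta> w)) \<partial>P) = (\<integral>w. lap (\<integral>\<^sup>+x. ennreal ((h :: 'x => real) x) \<partial>\<eta> w) \<partial>Q)"
  shows "eq_in_distribution P \<zeta> Q \<eta>"
proof -
  have zm: "\<zeta> \<in> measurable P radon_space" and em: "\<eta> \<in> measurable Q radon_space"
    and "prob_space P" "prob_space Q" using z e by (auto simp: random_measure_def)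
  have "finite_measure (distr P radon_space \<zeta>)" "finite_measure (distr Q radon_space \<eta>)"
    using prob_space.prob_space_distr[OF \<open>prob_space P\<close> zm] prob_space.prob_space_distr[OF \<open>prob_space Q\<close> em]
    by (auto simp: prob_space_def)
  moreover have "(\<integral>\<mu>. lap (ip h \<mu>) \<partial>distr P radon_space \<zeta>)
    = (\<integral>\<mu>. lap (ip h \<mu>) \<partial>distr Q radon_space \<eta>)" if h: "h \<in> BM" for h
  proof -
    have [measurable]: "(%\<mu>. lap (ip h \<mu>)) \<in> borel_measurable radon_space"
      using BM_measurable[OF h] by measurable
    show ?thesis using eq[OF h] zm em by (simp add: integral_distr)
  qed
  ultimately show ?thesis unfolding eq_in_distribution_def
    by (intro measure_eqI_laplace[where S=UNIV]) auto
qed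

lemma random_measure_laplace:
  assumes "random_measure P \<zeta>" "h \<in> BM"
  shows "laplace_functional P \<zeta> h = (\<integral>w. lap (\<integral>\<^sup>+x. ennreal ((h :: 'x => real) x) \<partial>\<zeta> w) \<partial>P)"
  unfolding laplace_functional_def
  using assms by (intro bint_cong)
    (auto simp: random_measure_def exp_integral_BM dest!: measurable_space)

lemma null_measure_radon: "null_measure borel \<in> (radon_measures :: 'x measure set)"
  by (simp add: radon_measures_def)

lemma nonzero_iff_exh:
  assumes "\<mu> \<in> radon_measures"
  shows "\<mu> \<noteq> null_measure borel \<longleftrightarrow> (\<exists>n. 0 < emeasure \<mu> (exh n))"
proof
  assume "\<exists>n. 0 < emeasure \<mu> (exh n)"
  then show "\<mu> \<noteq> null_measure borel" by auto
next
  assume n: "\<mu> \<noteq> null_measure borel"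
  show "\<exists>n. 0 < emeasure \<mu> (exh n)"
  proof (rule ccontr)
    assume "\<nexists>n. 0 < emeasure \<mu> (exh n)"
    then have z: "emeasure \<mu> (exh n) = 0" for n using zero_less_iff_neq_zero by blast
    have "emeasure \<mu> B = 0" if B: "B \<in> sets borel" for B
    proof -
      have "emeasure \<mu> (B \<inter> exh n) = 0" for n
        using emeasure_mono[of "B \<inter> exh n" "exh n" \<mu>] z[of n] sets_radon_measure[OF assms] by simp
      then show ?thesis using emeasure_eq_SUP_exh[OF sets_radon_measure[OF assms] B] by simp
    qed
    then have "\<mu> = null_measure borel"
      by (intro measure_eqI) (auto simp: sets_radon_measure[OF assms])
    with n show False by simp
  qed
qed

end

section \<open>Vague convergence and series of measures\<close>

lemma nn_integral_count_space_LIMSEQ: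
  fixes a :: "nat => ennreal"
  shows "(%n. \<Sum>i\<in>I \<inter> {..<n}. a i) ----> (np a (count_space I))"
proof -
  have "(np a (count_space I)) = (\<integral>\<^sup>+i. a i * indicator I i \<partial>count_space UNIV)"
    by (rule nn_integral_count_space_indicator) simp
  also have "\<dots> = (\<Sum>i. a i * indicator I i)" by (rule nn_integral_count_space_nat)
  finally have eq: "(np a (count_space I)) = (\<Sum>i. a i * indicator I i)" .
  have "(%n. \<Sum>i<n. a i * indicator I i) ----> (\<Sum>i. a i * indicator I i)"
    by (intro summable_LIMSEQ) simp
  moreover have "(\<Sum>i<n. a i * indicator I i) = (\<Sum>i\<in>I \<inter> {..<n}. a i)" for n
    by (subst Int_commute) (simp add: sum.inter_restrict indicator_def if_distrib cong: if_cong)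
  ultimately show ?thesis by (simp add: eq)
qed

lemma continuous_compact_support_BM:
  fixes f :: "'x::topological_space => real"
  assumes "continuous_on UNIV f" "compact (supp f)" "!!x. 0 <= f x"
  shows "f \<in> BM"
proof -
  have "compact (f ` supp f)"
    using assms by (intro compact_continuous_image) (auto intro: continuous_on_subset)
  then have "bounded (insert 0 (f ` supp f))" by (simp add: compact_imp_bounded)
  moreover have "range f \<subseteq> insert 0 (f ` supp f)"
    using closure_subset[of "{x. f x \<noteq> 0}"] by auto
  ultimately have "bounded (range f)" by (rule bounded_subset)
  then show ?thesis using assms by (auto simp: BM_def intro: borel_measurable_continuous_onI)
qed

definition vague_subbase :: "'x::topological_space measure set set" where
  "vague_subbase = {{\<mu> \<in> radon_measures. integral\<^sup>L \<mu> f \<in> U} | f U.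
     continuous_on UNIV f \<and> compact (supp f) \<and> open (U :: real set)}"

lemma vague_topology_eq: "vague_topology = topology_generated_by vague_subbase"
  unfolding vague_topology_def vague_subbase_def by (rule refl)

lemma vague_subbaseI:
  fixes f :: "'x::topological_space => real"
  assumes "continuous_on UNIV f" "compact (supp f)" "open U"
  shows "{\<mu> \<in> radon_measures. integral\<^sup>L \<mu> f \<in> U} \<in> vague_subbase"
  unfolding vague_subbase_def
  by (rule CollectI, rule exI, rule exI, rule conjI[OF refl], intro conjI assms)

lemma vague_subbaseE:
  fixes s :: "'x::topological_space measure set"
  assumes "s \<in> vague_subbase"
  shows "\<exists>f U. s = {\<mu> \<in> radon_measures. integral\<^sup>L \<mu> f \<in> U} \<and>
    continuous_on UNIV f \<and> compact (supp f) \<and> open (U :: real set)"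
  using assms unfolding vague_subbase_def by (rule CollectD)

lemma openin_vague_topologyI:
  fixes f :: "'x::topological_space => real"
  assumes "continuous_on UNIV f" "compact (supp f)" "open U"
  shows "openin vague_topology {\<mu> \<in> radon_measures. integral\<^sup>L \<mu> f \<in> U}"
  unfolding vague_topology_eq by (intro topology_generated_by_Basis vague_subbaseI assms)

lemma vague_limitD:
  fixes f :: "'x::topological_space => real"
  assumes "limitin vague_topology \<mu> \<nu> F"
  shows "\<nu> \<in> radon_measures"
    and "continuous_on UNIV f ==> compact (supp f) ==>
      ((%n. integral\<^sup>L (\<mu> n) f) \<longlongrightarrow> integral\<^sup>L \<nu> f) F"
proof -
  have "\<nu> \<in> topspace vague_topology" using assms by (simp add: limitin_def)
  then show nu: "\<nu> \<in> radon_measures"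
    unfolding vague_topology_eq topology_generated_by_topspace using vague_subbaseE by blast
  assume f: "continuous_on UNIV f" "compact (supp f)"
  show "((%n. integral\<^sup>L (\<mu> n) f) \<longlongrightarrow> integral\<^sup>L \<nu> f) F"
  proof (rule topological_tendstoI)
    fix U :: "real set" assume U: "open U" "integral\<^sup>L \<nu> f \<in> U"
    have "openin vague_topology {\<mu> \<in> radon_measures. integral\<^sup>L \<mu> f \<in> U}"
      using f U(1) by (intro openin_vague_topologyI)
    with assms have "\<forall>\<^sub>F n in F. \<mu> n \<in> {\<mu> \<in> radon_measures. integral\<^sup>L \<mu> f \<in> U}"
      using nu U(2) unfolding limitin_def by blast
    then show "\<forall>\<^sub>F n in F. integral\<^sup>L (\<mu> n) f \<in> U" by eventually_elim simp
  qed
qed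

lemma topspace_vague: "topspace vague_topology = (radon_measures :: 'x::topological_space measure set)"
proof -
  have "radon_measures \<subseteq> topspace (vague_topology :: 'x measure topology)"
    using openin_subset[OF openin_vague_topologyI[of "%_. 0 :: real" UNIV]] by simp
  moreover have "topspace (vague_topology :: 'x measure topology) \<subseteq> radon_measures"
    unfolding vague_topology_eq topology_generated_by_topspace using vague_subbaseE by blast
  ultimately show ?thesis by (rule antisym[rotated])
qed

text \<open>An induction over the generation of open sets reduces the claim to subbasic sets, that
  is, to the convergence of single integrals.\<close>

lemma vague_limitI:
  fixes \<nu> :: "'x::topological_space measure"
  assumes nu: "\<nu> \<in> radon_measures" and mu: "\<forall>\<^sub>F n in F. \<mu> n \<in> radon_measures"
    and lim: "!!f :: 'x => real. continuous_on UNIV f ==> compact (supp f) ==>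
      ((%n. integral\<^sup>L (\<mu> n) f) \<longlongrightarrow> integral\<^sup>L \<nu> f) F"
  shows "limitin vague_topology \<mu> \<nu> F"
  unfolding limitin_def
proof (intro conjI allI impI)
  show "\<nu> \<in> topspace vague_topology" using nu by (simp add: topspace_vague)
  fix U assume U: "openin vague_topology U \<and> \<nu> \<in> U"
  then have "openin vague_topology U" ..
  then have "generate_topology_on vague_subbase U"
    unfolding vague_topology_eq by (rule openin_topology_generated_by)
  moreover have "\<nu> \<in> U" using U ..
  ultimately show "\<forall>\<^sub>F n in F. \<mu> n \<in> U"
  proof (induction U)
    case (Int a b)
    then show ?case by (auto elim: eventually_elim2)
  next
    case (UN K)
    then obtain k where k: "k \<in> K" "\<nu> \<in> k" by blast
    have "\<forall>\<^sub>F n in F. \<mu> n \<in> k" by (rule UN.IH[OF k])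
    then show ?case using k(1) by (auto elim!: eventually_mono)
  next
    case (Basis s)
    from vague_subbaseE[OF Basis(1)] obtain f :: "'x => real" where
      "\<exists>U. s = {\<mu> \<in> radon_measures. integral\<^sup>L \<mu> f \<in> U} \<and>
        continuous_on UNIV f \<and> compact (supp f) \<and> open (U :: real set)" ..
    then obtain V where sV: "s = {\<mu> \<in> radon_measures. integral\<^sup>L \<mu> f \<in> V} \<and>
        continuous_on UNIV f \<and> compact (supp f) \<and> open V" ..
    note s = sV[THEN conjunct1] and f = sV[THEN conjunct2]
    have V: "integral\<^sup>L \<nu> f \<in> V" using Basis(2) unfolding s by (simp only: mem_Collect_eq)
    have "((%n. integral\<^sup>L (\<mu> n) f) \<longlongrightarrow> integral\<^sup>L \<nu> f) F" using f by (intro lim) simp_all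
    then have "\<forall>\<^sub>F n in F. integral\<^sup>L (\<mu> n) f \<in> V"
      by (rule topological_tendstoD) (use f V in simp_all)
    with mu show ?case by eventually_elim (simp add: s)
  qed simp
qed

section \<open>Urysohn functions and uniqueness of vague limits\<close>

context lcsc
begin

lemma Urysohn_compact_support:
  assumes K: "compact K" and W: "open W" "K \<subseteq> (W :: 'x set)"
  shows "\<exists>f :: 'x => real. continuous_on UNIV f \<and> (\<forall>x. f x \<in> {0..1}) \<and> (\<forall>x\<in>K. f x = 1) \<and>
    (\<forall>x. x \<notin> W --> f x = 0) \<and> compact (supp f)"
proof -
  have hd: "Hausdorff_space (euclidean :: 'x topology)"
    unfolding Hausdorff_space_def disjnt_def
  proof (intro allI impI)
    fix x y :: 'x assume "x \<in> topspace euclidean \<and> y \<in> topspace euclidean \<and> x \<noteq> y"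
    then obtain U V where "open U" "open V" "x \<in> U" "y \<in> V" "U \<inter> V = {}" using hausdorff[of x y] by blast
    then show "\<exists>U V. openin euclidean U \<and> openin euclidean V \<and> x \<in> U \<and> y \<in> V \<and> U \<inter> V = {}"
      by (metis open_openin)
  qed
  have "locally_compact_space (euclidean :: 'x topology)"
    unfolding locally_compact_space_def
  proof (intro ballI)
    fix x :: 'x
    obtain V where V: "open V" "x \<in> V" "compact (closure V)" using open_compact_nbhd[OF open_UNIV UNIV_I] by metis
    then show "\<exists>U K. openin euclidean U \<and> compactin euclidean K \<and> x \<in> U \<and> U \<subseteq> K"
      using closure_subset by (intro exI[of _ V] exI[of _ "closure V"]) (simp add: flip: open_openin)
  qed
  then have cr: "completely_regular_space (euclidean :: 'x topology)"
    using hd by (intro locally_compact_regular_imp_completely_regular_space) blast+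
  obtain n where n: "K \<subseteq> exh n" using compact_subset_exh[OF K] by blast
  \<comment> \<open>Intersecting with the relatively compact \<open>exh n\<close> makes the
    separating function vanish off a relatively compact set, which gives compact support.\<close>
  define T where "T = - (W \<inter> exh n)"
  have "closed T" unfolding T_def by (intro closed_Compl open_Int W(1) exh(1))
  moreover have "disjnt K T" using n W(2) by (auto simp: T_def disjnt_def)
  ultimately obtain f :: "'x => real" where f: "continuous_map euclidean (top_of_set {0..1}) f" "f ` T \<subseteq> {0}" "f ` K \<subseteq> {1}"
    using Urysohn_completely_regular_compact_closed[OF zero_le_one cr, of K T] K
    by (auto simp: compactin_euclidean_iff)
  have cont: "continuous_on UNIV f" and range: "!!x. f x \<in> {0..1}"
    using f(1) by (auto simp: continuous_map_in_subtopology)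
  have "{x. f x \<noteq> 0} \<subseteq> closure (exh n)" using f(2) closure_subset[of "exh n"] by (auto simp: T_def)
  then have "compact (supp f)" by (rule compact_closure_subset[OF exh(2)])
  with cont range f show ?thesis by (intro exI[of _ f]) (auto simp: T_def)
qed

lemma exh_bump:
  "\<exists>f :: 'x => real. continuous_on UNIV f \<and> (\<forall>x. f x \<in> {0..1}) \<and>
    (\<forall>x\<in>closure (exh n). f x = 1) \<and> compact (supp f)"
proof -
  from Urysohn_compact_support[OF exh(2)[of n] open_UNIV subset_UNIV]
  obtain f :: "'x => real" where "continuous_on UNIV f \<and> (\<forall>x. f x \<in> {0..1}) \<and> (\<forall>x\<in>closure (exh n). f x = 1) \<and>
    (\<forall>x. x \<notin> UNIV --> f x = 0) \<and> compact (supp f)" ..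
  then show ?thesis by (intro exI[of _ f]) (elim conjE, intro conjI; assumption)
qed

text \<open>A continuous stand-in for the indicator of \<open>exh n\<close>: the vague topology sees
  continuous functions only, while local finiteness speaks of sets.\<close>

definition bump :: "nat => 'x => real" where
  "bump n = (SOME f. continuous_on UNIV f \<and> (\<forall>x. f x \<in> {0..1}) \<and>
    (\<forall>x\<in>closure (exh n). f x = 1) \<and> compact (supp f))"

lemma bump: "continuous_on UNIV (bump n)" "bump n x \<in> {0..1}"
  "x \<in> closure (exh n) ==> bump n x = 1" "compact (closure {x. bump n x \<noteq> 0})"
  using someI_ex[OF exh_bump[of n], folded bump_def] by blast+

lemma bump_BM: "bump n \<in> BM"
  using bump by (intro continuous_compact_support_BM) auto

lemma open_compact_exhaustion:
  assumes "open (W :: 'x set)"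
  shows "\<exists>K. (\<forall>n. compact (K n)) \<and> incseq K \<and> (\<Union>n. K n) = W"
proof -
  define K where "K n = (\<Union>i\<in>{i. i < n \<and> closure (nb i) \<subseteq> W}. closure (nb i))" for n
  have "compact (K n)" for n unfolding K_def using nb(3) by (intro compact_UN) auto
  moreover have "incseq K" by (force simp: K_def incseq_def)
  moreover have "(\<Union>n. K n) = W"
  proof
    show "(\<Union>n. K n) \<subseteq> W" by (auto simp: K_def)
    show "W \<subseteq> (\<Union>n. K n)"
    proof
      fix x assume "x \<in> W"
      then obtain V where V: "open V" "x \<in> V" "compact (closure V)" "closure V \<subseteq> W"
        using open_compact_nbhd[OF assms] by blast
      then obtain b where "b \<in> range nb" "x \<in> b" "b \<subseteq> V" using topological_basisE[OF nb(1)] by metis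
      then obtain i where i: "x \<in> nb i" "nb i \<subseteq> V" by blast
      then have "closure (nb i) \<subseteq> W" using V(4) closure_mono by blast
      then have "i \<in> {j. j < Suc i \<and> closure (nb j) \<subseteq> W}" by simp
      moreover have "x \<in> closure (nb i)" using i(1) closure_subset by blast
      ultimately have "x \<in> K (Suc i)" unfolding K_def by (rule UN_I)
      then show "x \<in> (\<Union>n. K n)" by blast
    qed
  qed
  ultimately show ?thesis by blast
qed

text \<open>Compact subsets of an open set are separated from its complement by Urysohn functions,
  which yields the inequality on open sets in both directions; open sets form a generating
  \<pi>-system.\<close>

lemma radon_measure_eqI:
  assumes mu: "\<mu> \<in> radon_measures" and nu: "\<nu> \<in> radon_measures"
    and eq: "!!f :: 'x => real. continuous_on UNIV f ==> (!!x. f x \<in> {0..1}) ==> compact (supp f) ==>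
      (ip f \<mu>) = (ip f \<nu>)"
  shows "\<mu> = \<nu>"
proof -
  have le: "emeasure \<mu> W <= emeasure \<nu> W" if "open W" and mu: "\<mu> \<in> radon_measures" and nu: "\<nu> \<in> radon_measures"
    and eq: "!!f :: 'x => real. continuous_on UNIV f ==> (!!x. f x \<in> {0..1}) ==> compact (supp f) ==>
      (ip f \<mu>) = (ip f \<nu>)" for W and \<mu> \<nu> :: "'x measure"
  proof -
    obtain K where K: "!!n. compact (K n)" "incseq K" "(\<Union>n. K n) = W"
      using open_compact_exhaustion[OF \<open>open W\<close>] by metis
    have Kb: "K n \<in> sets borel" for n using K(1) by (simp add: compact_imp_closed)
    have "emeasure \<mu> (K n) <= emeasure \<nu> W" for n
    proof -
      have "K n \<subseteq> W" using K(3) by blast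
      then obtain f where f: "continuous_on UNIV f" "\<forall>x. f x \<in> {0..1::real}" "\<forall>x\<in>K n. f x = 1"
          "\<forall>x. x \<notin> W --> f x = 0" "compact (supp f)"
        using Urysohn_compact_support[OF K(1) \<open>open W\<close>] by blast
      have "emeasure \<mu> (K n) = (\<integral>\<^sup>+x. indicator (K n) x \<partial>\<mu>)"
        using Kb by (simp add: sets_radon_measure[OF mu])
      also have "\<dots> <= (ip f \<mu>)"
        using f(3) by (intro nn_integral_mono) (auto simp: indicator_def)
      also have "\<dots> = (ip f \<nu>)" using f by (intro eq) auto
      also have "\<dots> <= (np (indicator W) \<nu>)"
        using f(2,4) by (intro nn_integral_mono) (auto simp: indicator_def)
      also have "\<dots> = emeasure \<nu> W"
        using \<open>open W\<close> by (simp add: sets_radon_measure[OF nu])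
      finally show ?thesis .
    qed
    moreover have "emeasure \<mu> W = (SUP n. emeasure \<mu> (K n))"
      using K Kb by (subst SUP_emeasure_incseq) (auto simp: sets_radon_measure[OF mu])
    ultimately show ?thesis by (simp add: SUP_least)
  qed
  have sb: "sets borel = sigma_sets UNIV {W :: 'x set. open W}"
    unfolding borel_def by (rule sets_measure_of) simp
  show ?thesis
  proof (rule measure_eqI_generator_eq[where E="{W. open W}" and \<Omega>=UNIV and A=exh])
    show "emeasure \<mu> W = emeasure \<nu> W" if "W \<in> {W. open W}" for W
      using le[of W \<mu> \<nu>] le[of W \<nu> \<mu>] that mu nu eq by (simp add: antisym)
    show "sets \<mu> = sigma_sets UNIV {W. open W}" using sb sets_radon_measure[OF mu] by simp
    show "sets \<nu> = sigma_sets UNIV {W. open W}" using sb sets_radon_measure[OF nu] by simp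
    show "emeasure \<mu> (exh i) \<noteq> \<infinity>" for i using radon_exh[OF mu, of i] by simp
  qed (use exh in \<open>auto simp: Int_stable_def\<close>)
qed

text \<open>Partial sums increase, so non-negative test functions are handled by monotone
  convergence, with a finite limit because the full sum is locally finite. Other test functions are
  split into positive and negative parts.\<close>

lemma vague_sums_series_measure:
  assumes x: "!!i. i \<in> I ==> x i \<in> radon_measures" and S: "series_measure I x \<in> (radon_measures :: 'x measure set)"
  shows "vague_sums I x (series_measure I x)"
  unfolding vague_sums_def
proof (rule vague_limitI[OF S])
  have fin: "sum_measure (I \<inter> {..<n}) x \<in> radon_measures" for n
    using x by (intro sum_measure_radon) auto
  then show "\<forall>\<^sub>F n in sequentially. sum_measure (I \<inter> {..<n}) x \<in> radon_measures" by simp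
  fix f :: "'x => real" assume f: "continuous_on UNIV f" "compact (supp f)"
  have lim: "(%n. integral\<^sup>L (sum_measure (I \<inter> {..<n}) x) h) ----> integral\<^sup>L (series_measure I x) h" if h: "h \<in> BM" for h
  proof -
    have hm: "(en h) \<in> borel_measurable borel" using BM_measurable[OF h] by simp
    have sx: "sets (x i) = sets borel" if "i \<in> I" for i using x[OF that] by (rule sets_radon_measure)
    have eq: "(ip h (sum_measure (I \<inter> {..<n}) x)) = (\<Sum>i\<in>I \<inter> {..<n}. \<integral>\<^sup>+y. ennreal (h y) \<partial>x i)" for n
      using sx hm by (intro nn_integral_sum_measure) auto
    have eqS: "(ip h (series_measure I x)) = (\<integral>\<^sup>+i. (ip h (x i)) \<partial>count_space I)"
      using sx hm by (rule nn_integral_series_measure)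
    have "(%n. enn2real (ip h (sum_measure (I \<inter> {..<n}) x))) ----> enn2real (ip h (series_measure I x))"
    proof (rule tendsto_enn2real)
      show "(%n. \<integral>\<^sup>+y. ennreal (h y) \<partial>sum_measure (I \<inter> {..<n}) x) ----> ennreal (enn2real (ip h (series_measure I x)))"
        using nn_integral_BM_finite[OF h S] unfolding eq eqS
        by (simp add: nn_integral_count_space_LIMSEQ)
    qed simp
    then show ?thesis by (simp add: integral_BM[OF h S] integral_BM[OF h fin])
  qed
  have c: "compact (closure {x. max 0 (f x) \<noteq> 0})" "compact (closure {x. max 0 (- f x) \<noteq> 0})"
    by (rule compact_closure_subset[OF f(2)], use closure_subset[of "{x. f x \<noteq> 0}"] in \<open>auto simp: max_def\<close>)+
  have p: "(%x. max 0 (f x)) \<in> BM" and m: "(%x. max 0 (- f x)) \<in> BM"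
    using f c by (auto intro!: continuous_compact_support_BM continuous_intros)
  have split: "integral\<^sup>L \<mu> f = integral\<^sup>L \<mu> (%x. max 0 (f x)) - integral\<^sup>L \<mu> (%x. max 0 (- f x))"
    if mu: "\<mu> \<in> radon_measures" for \<mu>
  proof -
    have int: "integrable \<mu> h" if h: "h \<in> BM" for h
      using nn_integral_BM_finite[OF h mu] borel_measurable_radon[OF mu BM_measurable[OF h]] BM_nonneg[OF h]
      by (intro integrableI_nonneg) auto
    have "integral\<^sup>L \<mu> f = integral\<^sup>L \<mu> (%x. max 0 (f x) - max 0 (- f x))"
      by (intro bint_cong) auto
    then show ?thesis using int[OF p] int[OF m] by simp
  qed
  show "(%n. integral\<^sup>L (sum_measure (I \<inter> {..<n}) x) f) ----> integral\<^sup>L (series_measure I x) f"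
    unfolding split[OF fin] split[OF S] by (intro tendsto_diff lim p m)
qed

text \<open>Local finiteness of the full sum is extracted from that of the limit, by comparing the
  indicator of \<open>exh n\<close> with \<open>bump n\<close>. Then the two Radon measures agree on
  continuous test functions.\<close>

lemma vague_sums_unique:
  assumes x: "!!i. i \<in> I ==> x i \<in> radon_measures" and v: "vague_sums I x (S :: 'x measure)"
  shows "S = series_measure I x"
proof -
  have S: "S \<in> radon_measures" using vague_limitD(1)[OF v[unfolded vague_sums_def]] .
  have sx: "sets (x i) = sets borel" if "i \<in> I" for i using x[OF that] by (rule sets_radon_measure)
  have fin: "sum_measure (I \<inter> {..<n}) x \<in> radon_measures" for n
    using x by (intro sum_measure_radon) auto
  have eq: "(ip f (series_measure I x)) = (ip f S)"
    if f: "continuous_on UNIV f" "!!x. f x \<in> {0..1}" "compact (supp f)" for f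
  proof -
    have h: "f \<in> BM" using f by (intro continuous_compact_support_BM) auto
    have hm: "(en f) \<in> borel_measurable borel" using BM_measurable[OF h] by simp
    have "(%n. integral\<^sup>L (sum_measure (I \<inter> {..<n}) x) f) ----> integral\<^sup>L S f"
      using vague_limitD(2)[OF v[unfolded vague_sums_def] f(1,3)] .
    then have "(%n. ennreal (integral\<^sup>L (sum_measure (I \<inter> {..<n}) x) f)) ----> ennreal (integral\<^sup>L S f)"
      by (rule tendsto_ennrealI)
    then have l1: "(%n. \<integral>\<^sup>+y. ennreal (f y) \<partial>sum_measure (I \<inter> {..<n}) x) ----> (ip f S)"
      using nn_integral_BM_finite[OF h S] nn_integral_BM_finite[OF h fin]
      by (simp add: integral_BM[OF h S] integral_BM[OF h fin] less_top)
    have l2: "(ip f (sum_measure (I \<inter> {..<n}) x)) = (\<Sum>i\<in>I \<inter> {..<n}. \<integral>\<^sup>+y. ennreal (f y) \<partial>x i)" for n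
      using sx hm by (intro nn_integral_sum_measure) auto
    have l3: "(ip f (series_measure I x)) = (\<integral>\<^sup>+i. (ip f (x i)) \<partial>count_space I)"
      using sx hm by (rule nn_integral_series_measure)
    show ?thesis unfolding l3 by (rule LIMSEQ_unique[OF nn_integral_count_space_LIMSEQ l1[unfolded l2]])
  qed
  have fin: "emeasure (series_measure I x) (exh n) < top" for n
  proof -
    have "emeasure (series_measure I x) (exh n) = (\<integral>\<^sup>+y. indicator (exh n) y \<partial>series_measure I x)"
      by (rule nn_integral_indicator[symmetric]) (simp only: sets_series_measure exh_borel)
    also have "\<dots> <= (ip (bump n) (series_measure I x))"
    proof (rule nn_integral_mono)
      fix y show "indicator (exh n) y <= ennreal (bump n y)"
        using bump(3)[of y n] closure_subset[of "exh n"] by (cases "y \<in> exh n") auto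
    qed
    also have "\<dots> = (ip (bump n) S)" by (intro eq bump)
    also have "\<dots> < top" by (rule nn_integral_BM_finite[OF bump_BM S])
    finally show ?thesis .
  qed
  have "series_measure I x \<in> radon_measures"
    by (intro radon_measuresI sets_series_measure fin)
  with eq show ?thesis by (intro radon_measure_eqI[OF S]) auto
qed

text \<open>The measures may be infinite, so they are first weighted by the integrable functions 1 -
  exp (- \<mu> (exh n)). The weighted measures are finite and have equal Laplace transforms. The
  sets where these weights are positive exhaust the space, so the measures themselves agree.\<close>

lemma levy_measure_unique:
  fixes \<Lambda> \<Lambda>' :: "'x measure measure"
  assumes s: "sets \<Lambda> = sets nonzero_radon_space" "sets \<Lambda>' = sets nonzero_radon_space"
    and fin: "!!h. h \<in> BM ==> laplace_exp \<Lambda> (en h) < top"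
    and eq: "!!h. h \<in> BM ==> laplace_exp \<Lambda> (en h) = laplace_exp \<Lambda>' (en h)"
  shows "\<Lambda> = \<Lambda>'"
proof -
  have sr: "sets M = sets (restrict_space radon_space (- {null_measure borel}))"
    if "sets M = sets nonzero_radon_space" for M using that by (simp add: nonzero_radon_space_def)
  have sp: "space M = radon_measures - {null_measure borel}" if "sets M = sets nonzero_radon_space" for M :: "'x measure measure"
    using sets_eq_imp_space_eq[OF that] by (simp add: space_nonzero)
  define g where "g n \<mu> = 1 - lap (\<integral>\<^sup>+x. ennreal (indicator (exh n) x) \<partial>\<mu>)" for n and \<mu> :: "'x measure"
  have lm: "(%\<mu>. lap (ip h \<mu>)) \<in> borel_measurable M"
    if "h \<in> BM" "sets M = sets nonzero_radon_space" for h M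
    using BM_measurable[OF that(1)] by (intro measurable_lap_nn_integral[OF _ sr[OF that(2)]]) simp
  have gm: "g n \<in> borel_measurable M" if "sets M = sets nonzero_radon_space" for n M
    unfolding g_def using lm[OF indicator_exh_BM that] by simp
  have g01: "0 <= g n \<mu>" "g n \<mu> <= 1" for n \<mu> by (simp_all add: g_def)
  \<comment> \<open>This is (1 - u) v + (1 - v) = 1 - u v, where u and v are the exponentials of
    minus the pairings with the indicator of \<open>exh n\<close> and with \<open>h\<close>.\<close>
  have key: "(\<integral>\<^sup>+\<mu>. ennreal (g n \<mu> * lap (ip h \<mu>)) \<partial>M)
      + laplace_exp M (en h) = laplace_exp M (%x. ennreal (h x + indicator (exh n) x))"
    if h: "h \<in> BM" and M: "sets M = sets nonzero_radon_space" for h n M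
  proof -
    have "(\<integral>\<^sup>+\<mu>. ennreal (g n \<mu> * lap (ip h \<mu>)) \<partial>M) + laplace_exp M (en h)
      = (\<integral>\<^sup>+\<mu>. ennreal (g n \<mu> * lap (ip h \<mu>)) + ennreal (1 - lap (ip h \<mu>)) \<partial>M)"
      unfolding laplace_exp_def using gm[OF M] lm[OF h M] by (intro nn_integral_add[symmetric]) simp_all
    also have "\<dots> = laplace_exp M (%x. ennreal (h x + indicator (exh n) x))"
      unfolding laplace_exp_def
    proof (intro nn_integral_cong)
      fix \<mu> assume "\<mu> \<in> space M"
      then have mu: "\<mu> \<in> radon_measures" by (simp add: sp[OF M])
      have "(\<integral>\<^sup>+x. ennreal (h x + indicator (exh n) x) \<partial>\<mu>) = (\<integral>\<^sup>+x. ennreal (h x) + ennreal (indicator (exh n) x) \<partial>\<mu>)"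
        using h by (intro nn_integral_cong) (simp add: BM_nonneg)
      also have "\<dots> = (ip h \<mu>) + (\<integral>\<^sup>+x. ennreal (indicator (exh n) x) \<partial>\<mu>)"
        using h by (intro nn_integral_add borel_measurable_radon[OF mu] measurable_compose[OF _ measurable_ennreal] BM_measurable indicator_exh_BM)
      finally have e: "lap (\<integral>\<^sup>+x. ennreal (h x + indicator (exh n) x) \<partial>\<mu>) = lap (ip h \<mu>) * (1 - g n \<mu>)"
        by (simp add: lap_add g_def)
      show "ennreal (g n \<mu> * lap (ip h \<mu>)) + ennreal (1 - lap (ip h \<mu>)) =
          ennreal (1 - lap (\<integral>\<^sup>+x. ennreal (h x + indicator (exh n) x) \<partial>\<mu>))"
        unfolding e using g01[of n \<mu>] by (subst ennreal_plus[symmetric]) (auto simp: algebra_simps)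
    qed
    finally show ?thesis .
  qed
  have fin': "laplace_exp \<Lambda>' (en h) < top" if "h \<in> BM" for h using fin[OF that] eq[OF that] by simp
  have nneq: "(\<integral>\<^sup>+\<mu>. ennreal (g n \<mu> * lap (ip h \<mu>)) \<partial>\<Lambda>)
     = (\<integral>\<^sup>+\<mu>. ennreal (g n \<mu> * lap (ip h \<mu>)) \<partial>\<Lambda>')" if h: "h \<in> BM" for h n
  proof -
    have "(\<integral>\<^sup>+\<mu>. ennreal (g n \<mu> * lap (ip h \<mu>)) \<partial>\<Lambda>) + laplace_exp \<Lambda> (en h)
      = (\<integral>\<^sup>+\<mu>. ennreal (g n \<mu> * lap (ip h \<mu>)) \<partial>\<Lambda>') + laplace_exp \<Lambda> (en h)"
      using key[OF h s(1), of n] key[OF h s(2), of n] eq[OF h] eq[OF BM_add[OF h indicator_exh_BM[of n]]] by simp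
    then show ?thesis using fin[OF h] by (auto simp: ennreal_add_left_cancel add.commute)
  qed
  have dens: "density \<Lambda> (%\<mu>. ennreal (g n \<mu>)) = density \<Lambda>' (%\<mu>. ennreal (g n \<mu>))" for n
  proof (rule measure_eqI_laplace[where S="- {null_measure borel}"])
    have fd: "finite_measure (density M (%\<mu>. ennreal (g n \<mu>)))"
      if M: "sets M = sets nonzero_radon_space" and f: "laplace_exp M (%x. ennreal (indicator (exh n) x)) < top" for M
    proof (rule finite_measureI)
      have "emeasure (density M (%\<mu>. ennreal (g n \<mu>))) (space M) = (\<integral>\<^sup>+\<mu>. ennreal (g n \<mu>) \<partial>M)"
        using gm[OF M] by (subst emeasure_density) (auto intro!: nn_integral_cong)
      then show "emeasure (density M (%\<mu>. ennreal (g n \<mu>))) (space (density M (%\<mu>. ennreal (g n \<mu>)))) \<noteq> \<infinity>"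
        using f by (simp add: laplace_exp_def g_def)
    qed
    show "finite_measure (density \<Lambda> (%\<mu>. ennreal (g n \<mu>)))" by (rule fd[OF s(1) fin[OF indicator_exh_BM]])
    show "finite_measure (density \<Lambda>' (%\<mu>. ennreal (g n \<mu>)))" by (rule fd[OF s(2) fin'[OF indicator_exh_BM]])
    fix h :: "'x => real" assume h: "h \<in> BM"
    have int: "(\<integral>\<mu>. lap (ip h \<mu>) \<partial>density M (%\<mu>. ennreal (g n \<mu>)))
        = enn2real (\<integral>\<^sup>+\<mu>. ennreal (g n \<mu> * lap (ip h \<mu>)) \<partial>M)"
      if M: "sets M = sets nonzero_radon_space" for M
      using gm[OF M] lm[OF h M] g01
      by (subst integral_density) (auto intro!: integral_eq_nn_integral)
    show "(\<integral>\<mu>. lap (ip h \<mu>) \<partial>density \<Lambda> (%\<mu>. ennreal (g n \<mu>)))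
      = (\<integral>\<mu>. lap (ip h \<mu>) \<partial>density \<Lambda>' (%\<mu>. ennreal (g n \<mu>)))"
      unfolding int[OF s(1)] int[OF s(2)] by (simp add: nneq[OF h])
  qed (use sr s in auto)
  have gmono: "incseq (%n. {\<mu> \<in> space \<Lambda>. 0 < g n \<mu>})"
  proof (rule incseq_SucI, rule subsetI)
    fix n \<mu> assume "\<mu> \<in> {\<mu> \<in> space \<Lambda>. 0 < g n \<mu>}"
    moreover have "(\<integral>\<^sup>+x. ennreal (indicator (exh n) x) \<partial>\<mu>) <= (\<integral>\<^sup>+x. ennreal (indicator (exh (Suc n)) x) \<partial>\<mu>)"
      using exh(3) by (intro nn_integral_mono ennreal_leI) (auto simp: indicator_def incseq_Suc_iff)
    then have "g n \<mu> <= g (Suc n) \<mu>" using lap_antimono by (simp add: g_def)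
    ultimately show "\<mu> \<in> {\<mu> \<in> space \<Lambda>. 0 < g (Suc n) \<mu>}" by auto
  qed
  have cover: "(\<Union>n. {\<mu> \<in> space \<Lambda>. 0 < g n \<mu>}) = space \<Lambda>"
  proof -
    have "\<exists>n. 0 < g n \<mu>" if "\<mu> \<in> space \<Lambda>" for \<mu>
    proof -
      have mu: "\<mu> \<in> radon_measures" "\<mu> \<noteq> null_measure borel" using that by (auto simp: sp[OF s(1)])
      then obtain n where "0 < emeasure \<mu> (exh n)" using nonzero_iff_exh by blast
      then have "0 < g n \<mu>" by (simp add: g_def lap_less_1_iff ennreal_indicator sets_radon_measure[OF mu(1)])
      then show ?thesis ..
    qed
    then show ?thesis by blast
  qed
  show ?thesis
  proof (rule measure_eqI)
    show "sets \<Lambda> = sets \<Lambda>'" using s by simp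
    fix A assume A: "A \<in> sets \<Lambda>"
    have eqn: "emeasure \<Lambda> (A \<inter> {\<mu> \<in> space \<Lambda>. 0 < g n \<mu>}) = emeasure \<Lambda>' (A \<inter> {\<mu> \<in> space \<Lambda>. 0 < g n \<mu>})" for n
    proof -
      \<comment> \<open>The weight is undone by integrating its reciprocal. Points where it vanishes
        are removed by the density itself, which explains the intersection on the left.\<close>
      have e: "emeasure M (A \<inter> {\<mu> \<in> space \<Lambda>. 0 < g n \<mu>}) = (\<integral>\<^sup>+\<mu>. ennreal (1 / g n \<mu>) * indicator A \<mu> \<partial>density M (%\<mu>. ennreal (g n \<mu>)))"
        if M: "sets M = sets nonzero_radon_space" for M
      proof -
        have [measurable]: "A \<in> sets M" using A s(1) M by simp
        have [measurable]: "g n \<in> borel_measurable M" by (rule gm[OF M])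
        have spe: "space \<Lambda> = space M" using sp[OF M] sp[OF s(1)] by simp
        have "(\<integral>\<^sup>+\<mu>. ennreal (1 / g n \<mu>) * indicator A \<mu> \<partial>density M (%\<mu>. ennreal (g n \<mu>)))
          = (\<integral>\<^sup>+\<mu>. ennreal (g n \<mu>) * (ennreal (1 / g n \<mu>) * indicator A \<mu>) \<partial>M)"
          by (intro nn_integral_density) measurable
        also have "\<dots> = (\<integral>\<^sup>+\<mu>. indicator (A \<inter> {\<mu> \<in> space M. 0 < g n \<mu>}) \<mu> \<partial>M)"
        proof (intro nn_integral_cong)
          fix \<mu> assume "\<mu> \<in> space M"
          then show "ennreal (g n \<mu>) * (ennreal (1 / g n \<mu>) * indicator A \<mu>) = indicator (A \<inter> {\<mu> \<in> space M. 0 < g n \<mu>}) \<mu>"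
            using g01[of n \<mu>] by (cases "g n \<mu> = 0") (auto simp: indicator_def ennreal_mult'[symmetric] mult.assoc[symmetric])
        qed
        also have "\<dots> = emeasure M (A \<inter> {\<mu> \<in> space M. 0 < g n \<mu>})"
          by (intro nn_integral_indicator) measurable
        finally show ?thesis by (simp add: spe)
      qed
      show ?thesis unfolding e[OF s(1)] e[OF s(2)] dens ..
    qed
    have lim: "emeasure M A = (SUP n. emeasure M (A \<inter> {\<mu> \<in> space \<Lambda>. 0 < g n \<mu>}))"
      if M: "sets M = sets nonzero_radon_space" for M
    proof -
      have AM: "A \<in> sets M" using A s(1) M by simp
      have spe: "space \<Lambda> = space M" using sp[OF M] sp[OF s(1)] by simp
      have [measurable]: "g n \<in> borel_measurable M" for n by (rule gm[OF M])
      have "{\<mu> \<in> space M. 0 < g n \<mu>} \<in> sets M" for n by measurable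
      then have "(SUP n. emeasure M (A \<inter> {\<mu> \<in> space \<Lambda>. 0 < g n \<mu>})) = emeasure M (\<Union>n. A \<inter> {\<mu> \<in> space \<Lambda>. 0 < g n \<mu>})"
        using AM gmono unfolding spe by (intro SUP_emeasure_incseq) (auto simp: incseq_def)
      also have "(\<Union>n. A \<inter> {\<mu> \<in> space \<Lambda>. 0 < g n \<mu>}) = A"
        using cover sets.sets_into_space[OF A] by blast
      finally show ?thesis ..
    qed
    show "emeasure \<Lambda> A = emeasure \<Lambda>' A" unfolding lim[OF s(1)] lim[OF s(2)] eqn ..
  qed
qed

end

section \<open>Laplace functionals of Poisson processes\<close>

lemma poisson_sums:
  fixes m z :: real
  shows "(%k. exp (- m) * m ^ k / fact k * z ^ k) sums exp (- (m * (1 - z)))"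
proof -
  have "(%k. exp (- m) * ((m * z) ^ k /\<^sub>R fact k)) sums (exp (- m) * exp (m * z))"
    by (intro sums_mult exp_converges)
  moreover have "exp (- m) * exp (m * z) = exp (- (m * (1 - z)))"
    by (simp add: exp_add[symmetric] algebra_simps)
  moreover have "(%k. exp (- m) * ((m * z) ^ k /\<^sub>R fact k)) = (%k. exp (- m) * m ^ k / fact k * z ^ k)"
    by (simp add: power_mult_distrib field_simps)
  ultimately show ?thesis by simp
qed

lemma lap_eq_exp_iff: "0 <= r ==> lap (ennreal u * ennreal r) = exp (- (u * r))" if "0 <= u"
  using that by (simp add: ennreal_mult[symmetric] lap_ennreal)

context
  fixes Q :: "'w measure" and \<Lambda> :: "'a measure" and \<Psi> :: "'w => 'a measure"
  assumes prob: "prob_space Q" and sets_Psi: "!!w. w \<in> space Q ==> sets (\<Psi> w) = sets \<Lambda>"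
    and meas_Psi: "!!A. A \<in> sets \<Lambda> ==> (%w. emeasure (\<Psi> w) A) \<in> borel_measurable Q"
begin

interpretation Q: prob_space Q by (rule prob)

lemma bm_Psi: "w \<in> space Q ==> f \<in> borel_measurable \<Lambda> ==> f \<in> borel_measurable (\<Psi> w)"
  using measurable_cong_sets[OF sets_Psi refl] by blast

lemma measurable_nn_integral_process:
  assumes "g \<in> borel_measurable \<Lambda>"
  shows "(%w. \<integral>\<^sup>+x. g x \<partial>\<Psi> w) \<in> borel_measurable Q"
  using assms
proof (induction g rule: borel_measurable_induct)
  case (cong f g)
  have "(np f (\<Psi> w)) = (np g (\<Psi> w))" if "w \<in> space Q" for w
    using cong(3) sets_eq_imp_space_eq[OF sets_Psi[OF that]] by (intro nn_integral_cong) auto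
  with cong(4) show ?case by (subst measurable_cong) auto
next
  case (set B)
  then show ?case
    by (subst measurable_cong[of _ _ "%w. emeasure (\<Psi> w) B"]) (auto simp: sets_Psi meas_Psi)
next
  case (mult f c)
  have "(\<integral>\<^sup>+x. c * f x \<partial>\<Psi> w) = c * (np f (\<Psi> w))" if "w \<in> space Q" for w
    using mult(2) by (intro nn_integral_cmult bm_Psi[OF that])
  with mult(4) show ?case
    by (subst measurable_cong[of _ _ "%w. c * (np f (\<Psi> w))"]) auto
next
  case (add f g)
  have "(\<integral>\<^sup>+x. g x + f x \<partial>\<Psi> w) = (np g (\<Psi> w)) + (np f (\<Psi> w))" if "w \<in> space Q" for w
    using add(1,3) by (intro nn_integral_add bm_Psi[OF that])
  with add.IH show ?case
    by (subst measurable_cong[of _ _ "%w. (np g (\<Psi> w)) + (np f (\<Psi> w))"]) auto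
next
  case (seq F)
  have eq: "(SUP i. F i) = (%x. SUP i. F i x)" by (rule ext) (simp add: image_comp)
  have "integral\<^sup>N (\<Psi> w) (SUP i. F i) = (SUP i. integral\<^sup>N (\<Psi> w) (F i))" if "w \<in> space Q" for w
    using seq(1,3) unfolding eq
    by (intro nn_integral_monotone_convergence_SUP bm_Psi[OF that])
  with seq show ?case
    by (subst measurable_cong[of _ _ "%w. SUP i. integral\<^sup>N (\<Psi> w) (F i)"]) auto
qed

text \<open>At most one summand is non-zero at each point, so the non-linear map 1 -
  \<open>lap\<close> passes through the sum.\<close>

lemma nn_integral_disjoint_sum:
  fixes s :: "nat => ennreal"
  assumes A: "!!i. i < n ==> A i \<in> sets \<Lambda>" "disjoint_family_on A {..<n}"
  shows "(\<integral>\<^sup>+x. ennreal (1 - lap (\<Sum>i<n. s i * indicator (A i) x)) \<partial>\<Lambda>) = (\<Sum>i<n. ennreal (1 - lap (s i)) * emeasure \<Lambda> (A i))"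
proof -
  have "ennreal (1 - lap (\<Sum>i<n. s i * indicator (A i) x)) = (\<Sum>i<n. ennreal (1 - lap (s i)) * indicator (A i) x)" for x
  proof (cases "\<exists>i<n. x \<in> A i")
    case True
    then obtain i where i: "i < n" "x \<in> A i" by blast
    then have j: "x \<notin> A j" if "j < n" "j \<noteq> i" for j
      using A(2) that by (auto simp: disjoint_family_on_def)
    have "(\<Sum>k<n. c k * indicator (A k) x) = c i" for c :: "nat => ennreal"
    proof -
      have "(\<Sum>k<n. c k * indicator (A k) x) = (\<Sum>k\<in>{i}. c k * indicator (A k) x)"
        using i j by (intro sum.mono_neutral_right) auto
      then show ?thesis using i by simp
    qed
    then show ?thesis by simp
  next
    case False
    then have z: "(\<Sum>i<n. c i * indicator (A i) x) = 0" for c :: "nat => ennreal" by (intro sum.neutral) auto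
    show ?thesis unfolding z by simp
  qed
  then have "(\<integral>\<^sup>+x. ennreal (1 - lap (\<Sum>i<n. s i * indicator (A i) x)) \<partial>\<Lambda>) = (\<integral>\<^sup>+x. (\<Sum>i<n. ennreal (1 - lap (s i)) * indicator (A i) x) \<partial>\<Lambda>)"
    by (simp only:)
  also have "\<dots> = (\<Sum>i<n. \<integral>\<^sup>+x. ennreal (1 - lap (s i)) * indicator (A i) x \<partial>\<Lambda>)"
    using A(1) by (intro nn_integral_sum) auto
  also have "\<dots> = (\<Sum>i<n. ennreal (1 - lap (s i)) * emeasure \<Lambda> (A i))"
    using A(1) by (intro sum.cong refl nn_integral_cmult_indicator) auto
  finally show ?thesis .
qed

lemma nn_integral_process_sum:
  fixes s :: "nat => ennreal"
  assumes A: "!!i. i < n ==> A i \<in> sets \<Lambda>" and "w \<in> space Q"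
  shows "(\<integral>\<^sup>+x. (\<Sum>i<n. s i * indicator (A i) x) \<partial>\<Psi> w) = (\<Sum>i<n. s i * emeasure (\<Psi> w) (A i))"
proof -
  have "(\<integral>\<^sup>+x. (\<Sum>i<n. s i * indicator (A i) x) \<partial>\<Psi> w) = (\<Sum>i<n. \<integral>\<^sup>+x. s i * indicator (A i) x \<partial>\<Psi> w)"
    using A sets_Psi[OF assms(2)] by (intro nn_integral_sum) auto
  also have "\<dots> = (\<Sum>i<n. s i * emeasure (\<Psi> w) (A i))"
    using A sets_Psi[OF assms(2)] by (intro sum.cong refl nn_integral_cmult_indicator) auto
  finally show ?thesis .
qed

lemma integrable_lap:
  "f \<in> borel_measurable Q ==> integrable Q (%w. lap (f w))"
  by (intro Q.integrable_const_bound[where B=1]) auto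

lemma poisson_count_laplace:
  assumes pp: "poisson_process Q \<Lambda> \<Psi>" and A: "A \<in> sets \<Lambda>"
  shows "(\<integral>w. lap (s * emeasure (\<Psi> w) A) \<partial>Q) = lap (ennreal (1 - lap s) * emeasure \<Lambda> A)"
proof (cases "emeasure \<Lambda> A = \<infinity>")
  case True
  then have ae: "AE w in Q. emeasure (\<Psi> w) A = \<infinity>" using pp A unfolding poisson_process_def by blast
  show ?thesis
  proof (cases "s = 0")
    case False
    have "(\<integral>w. lap (s * emeasure (\<Psi> w) A) \<partial>Q) = (\<integral>w. 0 \<partial>Q)"
    proof (rule integral_cong_AE)
      show "AE w in Q. lap (s * emeasure (\<Psi> w) A) = 0" using ae
        by eventually_elim (use False in \<open>auto simp: ennreal_mult_top\<close>)
    qed (use meas_Psi[OF A] in auto)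
    moreover have "ennreal (1 - lap s) \<noteq> 0" using False lap_less_1_iff[of s] by (auto simp: zero_less_iff_neq_zero)
    ultimately show ?thesis using True by (auto simp: ennreal_mult_top)
  qed (simp add: Q.prob_space)
next
  case False
  define m where "m = measure \<Lambda> A"
  define p where "p k = exp (- m) * m ^ k / fact k" for k
  have m: "emeasure \<Lambda> A = ennreal m" "0 <= m" using False by (auto simp: m_def emeasure_eq_ennreal_measure)
  have p0: "0 <= p k" for k using m by (simp add: p_def)
  define E where "E k = {w \<in> space Q. emeasure (\<Psi> w) A = of_nat k}" for k :: nat
  have Em [measurable]: "E k \<in> sets Q" for k
    unfolding E_def using meas_Psi[OF A] by measurable
  have "measure Q (E k) = p k" for k
    using pp A False unfolding poisson_process_def E_def p_def m_def by (auto simp: less_top)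
  then have Ek: "emeasure Q (E k) = ennreal (p k)" for k by (simp add: Q.emeasure_eq_measure)
  have disj: "disjoint_family E" by (auto simp: disjoint_family_on_def E_def)
  have "emeasure Q (\<Union>k. E k) = (\<Sum>k. emeasure Q (E k))"
    by (rule suminf_emeasure[symmetric]) (use disj in auto)
  also have "\<dots> = ennreal (\<Sum>k. p k)"
    unfolding Ek using poisson_sums[of m 1] by (intro suminf_ennreal2 p0) (auto simp: p_def sums_iff)
  also have "(\<Sum>k. p k) = 1" using poisson_sums[of m 1] by (simp add: p_def sums_iff)
  \<comment> \<open>The Poisson weights add up to 1, so the count is almost surely a natural number
    and the expectation becomes a power series.\<close>
  finally have "AE w in Q. w \<in> (\<Union>k. E k)"
    using Q.AE_in_set_eq_1[of "\<Union>k. E k"] by (simp add: Q.emeasure_eq_measure)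
  then have ae: "AE w in Q. ennreal (lap (s * emeasure (\<Psi> w) A)) = (\<Sum>k. ennreal (lap s ^ k) * indicator (E k) w)"
  proof eventually_elim
    case (elim w)
    then obtain j where j: "w \<in> E j" by blast
    have "w \<notin> E k" if "k \<noteq> j" for k using j disj that unfolding disjoint_family_on_def by blast
    then have "(\<Sum>k. ennreal (lap s ^ k) * indicator (E k) w) = (\<Sum>k\<in>{j}. ennreal (lap s ^ k) * indicator (E k) w)"
      by (intro suminf_finite) simp_all
    with j show ?case by (auto simp: E_def mult.commute[of s] lap_of_nat_mult)
  qed
  have "(\<integral>\<^sup>+w. ennreal (lap (s * emeasure (\<Psi> w) A)) \<partial>Q) = (\<integral>\<^sup>+w. (\<Sum>k. ennreal (lap s ^ k) * indicator (E k) w) \<partial>Q)"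
    using ae by (rule nn_integral_cong_AE)
  also have "\<dots> = (\<Sum>k. \<integral>\<^sup>+w. ennreal (lap s ^ k) * indicator (E k) w \<partial>Q)"
    by (intro nn_integral_suminf) measurable
  also have "\<dots> = (\<Sum>k. ennreal (p k * lap s ^ k))"
  proof (intro arg_cong[where f=suminf] ext)
    fix k show "(\<integral>\<^sup>+w. ennreal (lap s ^ k) * indicator (E k) w \<partial>Q) = ennreal (p k * lap s ^ k)"
      by (subst nn_integral_cmult_indicator) (simp_all add: Ek ennreal_mult p0 mult.commute)
  qed
  also have "\<dots> = ennreal (exp (- (m * (1 - lap s))))"
    using poisson_sums[of m "lap s"] m(2) by (subst suminf_ennreal2) (auto simp: p_def sums_iff)
  finally have nn: "(\<integral>\<^sup>+w. ennreal (lap (s * emeasure (\<Psi> w) A)) \<partial>Q) = ennreal (exp (- (m * (1 - lap s))))" .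
  have "(\<integral>w. lap (s * emeasure (\<Psi> w) A) \<partial>Q) = exp (- (m * (1 - lap s)))"
    using nn meas_Psi[OF A] by (subst integral_eq_nn_integral) auto
  then show ?thesis using m by (simp add: lap_eq_exp_iff mult.commute)
qed

text \<open>The level sets of a simple function are disjoint, so their counts are independent and
  the expectation factorises; monotone approximation gives the general case. Level sets of infinite
  intensity are included, as \<open>poisson_count_laplace\<close> covers them.\<close>

lemma poisson_process_laplace:
  assumes pp: "poisson_process Q \<Lambda> \<Psi>" and g: "g \<in> borel_measurable \<Lambda>"
  shows "(\<integral>w. lap (np g (\<Psi> w)) \<partial>Q) = lap (\<integral>\<^sup>+x. ennreal (1 - lap (g x)) \<partial>\<Lambda>)"
proof -
  have simple: "(\<integral>w. lap (np u (\<Psi> w)) \<partial>Q) = lap (\<integral>\<^sup>+x. ennreal (1 - lap (u x)) \<partial>\<Lambda>)"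
    if u: "simple_function \<Lambda> u" for u
  proof -
    have "finite (u ` space \<Lambda>)" using u by (rule simple_functionD)
    then obtain y where y: "bij_betw y {0..<card (u ` space \<Lambda>)} (u ` space \<Lambda>)"
      using ex_bij_betw_nat_finite by blast
    define n where "n = card (u ` space \<Lambda>)"
    define A where "A i = u -` {y i} \<inter> space \<Lambda>" for i
    have yb: "bij_betw y {..<n} (u ` space \<Lambda>)" using y by (simp add: n_def atLeast0LessThan)
    have A: "A i \<in> sets \<Lambda>" for i unfolding A_def using u by (rule simple_functionD)
    have dj: "disjoint_family_on A {..<n}"
      using yb by (auto simp: disjoint_family_on_def A_def bij_betw_def inj_on_def)
    have ueq: "u x = (\<Sum>i<n. y i * indicator (A i) x)" if x: "x \<in> space \<Lambda>" for x
    proof -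
      obtain i where i: "i < n" "y i = u x" using yb x by (auto simp: bij_betw_def image_iff) (metis image_eqI imageE lessThan_iff)
      have "(\<Sum>k<n. y k * indicator (A k) x) = (\<Sum>k\<in>{i}. y k * indicator (A k) x)"
        using i yb by (intro sum.mono_neutral_right) (auto simp: A_def bij_betw_def inj_on_def indicator_def)
      then show ?thesis using i x by (simp add: A_def)
    qed
    have ind: "Q.indep_vars (%_. borel) (%i w. emeasure (\<Psi> w) (A i)) {..<n}"
      using pp A dj unfolding poisson_process_def by blast
    have ind2: "Q.indep_vars (%_. borel) (%i w. lap (y i * emeasure (\<Psi> w) (A i))) {..<n}"
      by (rule Q.indep_vars_compose2[OF ind, where Y="%i z. lap (y i * z)"]) measurable
    have "(\<integral>w. lap (np u (\<Psi> w)) \<partial>Q) = (\<integral>w. (\<Prod>i<n. lap (y i * emeasure (\<Psi> w) (A i))) \<partial>Q)"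
    proof (rule bint_cong)
      fix w assume w: "w \<in> space Q"
      have "(np u (\<Psi> w)) = (\<integral>\<^sup>+x. (\<Sum>i<n. y i * indicator (A i) x) \<partial>\<Psi> w)"
        using ueq sets_eq_imp_space_eq[OF sets_Psi[OF w]] by (intro nn_integral_cong) auto
      also have "\<dots> = (\<Sum>i<n. y i * emeasure (\<Psi> w) (A i))" using A w by (intro nn_integral_process_sum) auto
      finally show "lap (np u (\<Psi> w)) = (\<Prod>i<n. lap (y i * emeasure (\<Psi> w) (A i)))" by (simp add: lap_sum)
    qed simp
    also have "\<dots> = (\<Prod>i<n. \<integral>w. lap (y i * emeasure (\<Psi> w) (A i)) \<partial>Q)"
      using meas_Psi[OF A] by (intro Q.indep_vars_lebesgue_integral ind2) (auto intro!: integrable_lap)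
    also have "\<dots> = (\<Prod>i<n. lap (ennreal (1 - lap (y i)) * emeasure \<Lambda> (A i)))"
      by (simp add: poisson_count_laplace[OF pp A])
    also have "\<dots> = lap (\<integral>\<^sup>+x. ennreal (1 - lap (\<Sum>i<n. y i * indicator (A i) x)) \<partial>\<Lambda>)"
      using A dj by (subst nn_integral_disjoint_sum) (auto simp: lap_sum)
    also have "(\<integral>\<^sup>+x. ennreal (1 - lap (\<Sum>i<n. y i * indicator (A i) x)) \<partial>\<Lambda>) = (\<integral>\<^sup>+x. ennreal (1 - lap (u x)) \<partial>\<Lambda>)"
      by (intro nn_integral_cong) (simp add: ueq)
    finally show ?thesis .
  qed
  obtain f where f: "!!i. simple_function \<Lambda> (f i)" "incseq f" "!!x. (SUP i. f i x) = g x"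
    using borel_measurable_implies_simple_function_sequence'[OF g] by metis
  have fm [measurable]: "f i \<in> borel_measurable \<Lambda>" for i using f(1) by (rule borel_measurable_simple_function)
  have flim: "(%i. f i x) ----> g x" for x
    using f(2) LIMSEQ_SUP[of "%i. f i x"] by (auto simp: f(3) incseq_def le_fun_def)
  have "(%i. \<integral>w. lap (np (f i) (\<Psi> w)) \<partial>Q) ----> (\<integral>w. lap (np g (\<Psi> w)) \<partial>Q)"
  proof (rule integral_dominated_convergence[where w="%_. 1"])
    have "(%i. \<integral>\<^sup>+x. f i x \<partial>\<Psi> w) ----> (np g (\<Psi> w))" if "w \<in> space Q" for w
      by (rule nn_integral_LIMSEQ[OF f(2) bm_Psi[OF that fm] flim])
    then show "AE w in Q. (%i. lap (np (f i) (\<Psi> w))) ----> lap (np g (\<Psi> w))"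
      by (intro AE_I2 tendsto_lap)
  qed (use measurable_nn_integral_process fm g in auto)
  moreover have "(%i. lap (\<integral>\<^sup>+x. ennreal (1 - lap (f i x)) \<partial>\<Lambda>)) ----> lap (\<integral>\<^sup>+x. ennreal (1 - lap (g x)) \<partial>\<Lambda>)"
  proof (intro tendsto_lap nn_integral_LIMSEQ)
    show "incseq (%i x. ennreal (1 - lap (f i x)))"
      using f(2) by (auto simp: incseq_def le_fun_def intro!: ennreal_leI lap_antimono)
    show "(%i. ennreal (1 - lap (f i x))) ----> ennreal (1 - lap (g x))" for x
      by (intro tendsto_ennrealI tendsto_diff tendsto_const tendsto_lap flim)
  qed measurable
  ultimately show ?thesis unfolding simple[OF f(1)] by (rule LIMSEQ_unique)
qed

text \<open>The Poisson law pushed to the extended half-line, where the counts take their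
  values.\<close>

definition poisson_law :: "real => ennreal measure" where
  "poisson_law m = distr (density (count_space UNIV) (%k. ennreal (exp (- m) * m ^ k / fact k))) borel of_nat"

lemma poisson_law_laplace:
  assumes "0 <= m"
  shows "finite_measure (poisson_law m)"
    and "(\<integral>y. lap (s * y) \<partial>poisson_law m) = exp (- (m * (1 - lap s)))"
    and "emeasure (poisson_law m) {of_nat k} = ennreal (exp (- m) * m ^ k / fact k)"
proof -
  have nn: "(\<integral>\<^sup>+y. ennreal (lap (s * y)) \<partial>poisson_law m) = ennreal (exp (- (m * (1 - lap s))))" for s
  proof -
    have "(\<integral>\<^sup>+y. ennreal (lap (s * y)) \<partial>poisson_law m)
      = (\<Sum>k. ennreal (exp (- m) * m ^ k / fact k) * ennreal (lap (s * of_nat k)))"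
      unfolding poisson_law_def by (subst nn_integral_distr; simp add: nn_integral_density nn_integral_count_space_nat)
    also have "\<dots> = (\<Sum>k. ennreal (exp (- m) * m ^ k / fact k * lap s ^ k))"
      using assms by (simp add: mult.commute[of s] lap_of_nat_mult ennreal_mult[symmetric])
    also have "\<dots> = ennreal (exp (- (m * (1 - lap s))))"
      using poisson_sums[of m "lap s"] assms by (subst suminf_ennreal2) (auto simp: sums_iff)
    finally show ?thesis .
  qed
  show "finite_measure (poisson_law m)"
  proof (rule finite_measureI)
    have "(\<integral>\<^sup>+y. 1 \<partial>poisson_law m) = 1" using nn[of 0] by simp
    then show "emeasure (poisson_law m) (space (poisson_law m)) \<noteq> \<infinity>" by simp
  qed
  show "(\<integral>y. lap (s * y) \<partial>poisson_law m) = exp (- (m * (1 - lap s)))"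
    using nn[of s] by (subst integral_eq_nn_integral) (auto simp: poisson_law_def)
  have "of_nat -` {of_nat k :: ennreal} = {k}" by auto
  then have "emeasure (poisson_law m) {of_nat k} = emeasure (density (count_space UNIV) (%k. ennreal (exp (- m) * m ^ k / fact k))) {k}"
    unfolding poisson_law_def by (subst emeasure_distr) auto
  also have "\<dots> = ennreal (exp (- m) * m ^ k / fact k)"
    by (subst emeasure_density) (auto simp: nn_integral_indicator_singleton)
  finally show "emeasure (poisson_law m) {of_nat k} = ennreal (exp (- m) * m ^ k / fact k)" .
qed

text \<open>For \<open>g\<close> a combination of indicators of disjoint sets the hypothesis gives
  the joint Laplace transform of the counts. It factorises and determines their joint law, so the
  counts are independent and Poisson distributed.\<close>

lemma poisson_processI_laplace:
  assumes lapl: "!!g. g \<in> borel_measurable \<Lambda> ==>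
    (\<integral>w. lap (np g (\<Psi> w)) \<partial>Q) = lap (\<integral>\<^sup>+x. ennreal (1 - lap (g x)) \<partial>\<Lambda>)"
  shows "poisson_process Q \<Lambda> \<Psi>"
proof -
  have many: "(\<integral>w. (\<Prod>i<n. lap (s i * emeasure (\<Psi> w) (A i))) \<partial>Q) = (\<Prod>i<n. lap (ennreal (1 - lap (s i)) * emeasure \<Lambda> (A i)))"
    if A: "!!i. i < n ==> A i \<in> sets \<Lambda>" "disjoint_family_on A {..<n}" for n A and s :: "nat => ennreal"
  proof -
    have "(\<integral>w. (\<Prod>i<n. lap (s i * emeasure (\<Psi> w) (A i))) \<partial>Q) = (\<integral>w. lap (\<integral>\<^sup>+x. (\<Sum>i<n. s i * indicator (A i) x) \<partial>\<Psi> w) \<partial>Q)"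
    proof (rule bint_cong)
      fix w assume "w \<in> space Q"
      then have "(\<integral>\<^sup>+x. (\<Sum>i<n. s i * indicator (A i) x) \<partial>\<Psi> w) = (\<Sum>i<n. s i * emeasure (\<Psi> w) (A i))"
        using A(1) by (intro nn_integral_process_sum) auto
      then show "(\<Prod>i<n. lap (s i * emeasure (\<Psi> w) (A i))) = lap (\<integral>\<^sup>+x. (\<Sum>i<n. s i * indicator (A i) x) \<partial>\<Psi> w)"
        by (simp only: lap_sum finite_lessThan)
    qed simp
    also have "\<dots> = lap (\<integral>\<^sup>+x. ennreal (1 - lap (\<Sum>i<n. s i * indicator (A i) x)) \<partial>\<Lambda>)"
      using A(1) by (intro lapl borel_measurable_sum borel_measurable_times borel_measurable_const borel_measurable_indicator) auto
    also have "\<dots> = (\<Prod>i<n. lap (ennreal (1 - lap (s i)) * emeasure \<Lambda> (A i)))"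
      using A by (subst nn_integral_disjoint_sum) (auto simp: lap_sum)
    finally show ?thesis .
  qed
  have one: "(\<integral>w. lap (s * emeasure (\<Psi> w) A) \<partial>Q) = lap (ennreal (1 - lap s) * emeasure \<Lambda> A)"
    if "A \<in> sets \<Lambda>" for A s
    using many[of 1 "%_. A" "%_. s"] that by (simp add: disjoint_family_on_def)
  have c1: "measure Q {w \<in> space Q. emeasure (\<Psi> w) A = of_nat k} = exp (- measure \<Lambda> A) * measure \<Lambda> A ^ k / fact k"
    if A: "A \<in> sets \<Lambda>" "emeasure \<Lambda> A < \<infinity>" for A k
  proof -
    define m where "m = measure \<Lambda> A"
    have m: "emeasure \<Lambda> A = ennreal m" "0 <= m" using A(2) by (auto simp: m_def emeasure_eq_ennreal_measure less_top)
    have [measurable]: "(%w. emeasure (\<Psi> w) A) \<in> borel_measurable Q" by (rule meas_Psi[OF A(1)])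
    have "distr Q borel (%w. emeasure (\<Psi> w) A) = poisson_law m"
    \<comment> \<open>The class is closed under products because the parameters of the exponentials
      add.\<close>
    proof (rule finite_measure_eqI_multiplicative_class[where F="{%y. lap (s * y) | s. True}"])
      show "finite_measure (distr Q borel (%w. emeasure (\<Psi> w) A))" by (intro Q.finite_measure_distr) measurable
      show "finite_measure (poisson_law m)" using m(2) by (rule poisson_law_laplace)
      show "(%_. 1) \<in> {%y. lap (s * y) | s. True}" by (rule CollectI, rule exI[of _ 0]) simp
      fix f assume f: "f \<in> {%y. lap (s * y) | s. True}"
      then obtain s where s: "f = (%y. lap (s * y))" by blast
      show "f \<in> borel_measurable (distr Q borel (%w. emeasure (\<Psi> w) A))" unfolding s by simp
      show "f x \<in> {0..1}" for x by (simp add: s)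
      show "integral\<^sup>L (distr Q borel (%w. emeasure (\<Psi> w) A)) f = integral\<^sup>L (poisson_law m) f"
      proof -
        have "integral\<^sup>L (distr Q borel (%w. emeasure (\<Psi> w) A)) f = (\<integral>w. lap (s * emeasure (\<Psi> w) A) \<partial>Q)"
          unfolding s by (rule integral_distr) simp_all
        also have "\<dots> = exp (- (m * (1 - lap s)))"
          unfolding one[OF A(1)] m(1) using m(2) by (simp add: lap_eq_exp_iff mult.commute[of m])
        also have "\<dots> = integral\<^sup>L (poisson_law m) f" unfolding s by (rule poisson_law_laplace(2)[OF m(2), symmetric])
        finally show ?thesis .
      qed
      fix g assume "g \<in> {%y. lap (s * y) | s. True}"
      then obtain t where t: "g = (%y. lap (t * y))" by blast
      show "(%x. f x * g x) \<in> {%y. lap (s * y) | s. True}"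
        unfolding s t by (rule CollectI, rule exI[of _ "s + t"]) (simp add: distrib_right lap_add)
    next
      fix K :: "ennreal measure"
      assume K: "space K = space (distr Q borel (%w. emeasure (\<Psi> w) A))"
        "!!f. f \<in> {%y. lap (s * y) | s. True} ==> f \<in> borel_measurable K"
      have "(%y. lap (1 * y)) \<in> borel_measurable K" by (rule K(2)) blast
      then have id: "(%y. y) \<in> borel_measurable K" by (simp add: borel_measurable_lap_iff)
      show "sets (distr Q borel (%w. emeasure (\<Psi> w) A)) \<subseteq> sets K"
      proof
        fix B assume "B \<in> sets (distr Q borel (%w. emeasure (\<Psi> w) A))"
        then show "B \<in> sets K" using measurable_sets[OF id, of B] K(1) by simp
      qed
    qed (simp add: poisson_law_def)
    then have "emeasure (distr Q borel (%w. emeasure (\<Psi> w) A)) {of_nat k} = ennreal (exp (- m) * m ^ k / fact k)"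
      using m(2) by (simp add: poisson_law_laplace)
    moreover have "emeasure (distr Q borel (%w. emeasure (\<Psi> w) A)) {of_nat k} = emeasure Q {w \<in> space Q. emeasure (\<Psi> w) A = of_nat k}"
      by (subst emeasure_distr) (auto intro!: arg_cong[where f="emeasure Q"])
    ultimately have "emeasure Q {w \<in> space Q. emeasure (\<Psi> w) A = of_nat k} = ennreal (exp (- m) * m ^ k / fact k)"
      by simp
    then show ?thesis unfolding m_def[symmetric] using m(2) by (subst measure_def) simp
  qed
  have c2: "AE w in Q. emeasure (\<Psi> w) A = \<infinity>" if A: "A \<in> sets \<Lambda>" "emeasure \<Lambda> A = \<infinity>" for A
  proof -
    have [measurable]: "(%w. emeasure (\<Psi> w) A) \<in> borel_measurable Q" by (rule meas_Psi[OF A(1)])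
    \<comment> \<open>On a set of infinite intensity the right-hand side is \<open>lap\<close> of
      infinity, which is 0. A non-negative variable with expectation 0 vanishes almost surely, so
      the count is infinite.\<close>
    have "(1::real) - lap 1 > 0" using lap_less_1_iff[of 1] by simp
    then have "(\<integral>w. lap (emeasure (\<Psi> w) A) \<partial>Q) = 0" using one[OF A(1), of 1] A(2)
      by (simp add: ennreal_mult_top)
    moreover have "integrable Q (%w. lap (emeasure (\<Psi> w) A))" by (intro integrable_lap) measurable
    ultimately have "AE w in Q. lap (emeasure (\<Psi> w) A) = 0"
      by (subst (asm) integral_nonneg_eq_0_iff_AE) auto
    then show ?thesis by (simp add: lap_eq_0_iff)
  qed
  have c3: "Q.indep_vars (%_. borel) (%i w. emeasure (\<Psi> w) (A i)) {..<n}"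
    if A0: "\<forall>i<n. A i \<in> sets \<Lambda>" "disjoint_family_on A {..<n}" for n :: nat and A
  \<comment> \<open>Independence is characterised below by a product law over a non-empty index set,
    so the empty family is treated apart.\<close>
  proof (cases "n = 0")
    case True
    then show ?thesis by (simp add: Q.indep_vars_def Q.indep_sets_def)
  next
    case False
    \<comment> \<open>Beyond the first \<open>n\<close> indices the sets are replaced by the empty
      set, so that all of them are measurable.\<close>
    define B where "B i = (if i < n then A i else {})" for i
    have B: "B i \<in> sets \<Lambda>" for i using A0(1) by (auto simp: B_def)
    have dB: "disjoint_family_on B {..<n}" using A0(2) by (auto simp: disjoint_family_on_def B_def)
    define X where "X i w = emeasure (\<Psi> w) (B i)" for i w
    have Xm [measurable]: "X i \<in> borel_measurable Q" for i unfolding X_def by (rule meas_Psi[OF B])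
    let ?D = "distr Q (\<Pi>\<^sub>M i\<in>{..<n}. borel) (%w. \<lambda>i\<in>{..<n}. X i w)"
    let ?P = "\<Pi>\<^sub>M i\<in>{..<n}. distr Q borel (X i)"
    have pD: "prob_space (distr Q borel (X i))" for i by (intro Q.prob_space_distr) measurable
    interpret P: product_prob_space "%i. distr Q borel (X i)" "{..<n}"
      by (intro product_prob_spaceI pD)
    let ?F = "{%y. \<Prod>i<n. lap (s i * y i) | s :: nat => ennreal. True}"
    have setsP: "sets ?P = sets (\<Pi>\<^sub>M i\<in>{..<n}. borel :: ennreal measure)" by (intro sets_PiM_cong) auto
    have fmeas: "(%y. \<Prod>i<n. lap (s i * y i)) \<in> borel_measurable (\<Pi>\<^sub>M i\<in>{..<n}. borel)" for s :: "nat => ennreal"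
    proof (rule borel_measurable_prod)
      fix i assume "i \<in> {..<n}"
      moreover have "(%z. lap (s i * z)) \<in> borel_measurable borel" by measurable
      ultimately show "(%y. lap (s i * y i)) \<in> borel_measurable (\<Pi>\<^sub>M i\<in>{..<n}. borel)"
        by (rule measurable_compose[OF measurable_component_singleton])
    qed
    have "?D = ?P"
    proof (rule finite_measure_eqI_multiplicative_class[where F="?F"])
      show "finite_measure ?D" by (intro Q.finite_measure_distr) measurable
      show "finite_measure ?P" by unfold_locales
      show "sets ?D = sets ?P" by (simp add: setsP)
      show "(%_. 1) \<in> ?F" by (rule CollectI, rule exI[of _ "%_. 0"]) simp
      fix f assume f: "f \<in> ?F"
      then obtain s where s: "f = (%y. \<Prod>i<n. lap (s i * y i))" by blast
      show "f \<in> borel_measurable ?D" unfolding s measurable_distr_eq1 by (rule fmeas)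
      show "f x \<in> {0..1}" for x by (auto simp: s intro!: prod_nonneg prod_le_1)
      have "integral\<^sup>L ?D f = (\<integral>w. (\<Prod>i<n. lap (s i * X i w)) \<partial>Q)"
        unfolding s
      proof (subst integral_distr)
        show "(%y. \<Prod>i<n. lap (s i * y i)) \<in> borel_measurable (\<Pi>\<^sub>M i\<in>{..<n}. borel)"
          by (rule fmeas)
      qed (auto intro!: bint_cong prod.cong)
      also have "\<dots> = (\<Prod>i<n. lap (ennreal (1 - lap (s i)) * emeasure \<Lambda> (B i)))"
        unfolding X_def using B dB by (intro many) auto
      also have "\<dots> = (\<Prod>i<n. \<integral>w. lap (s i * X i w) \<partial>Q)" unfolding X_def by (simp add: one[OF B])
      also have "\<dots> = (\<Prod>i<n. \<integral>y. lap (s i * y) \<partial>distr Q borel (X i))"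
        by (intro prod.cong refl) (simp add: integral_distr)
      also have "\<dots> = integral\<^sup>L ?P f" unfolding s
      proof (intro P.product_integral_prod[symmetric])
        fix i
        have fD: "finite_measure (distr Q borel (X i))" by (intro Q.finite_measure_distr) measurable
        show "integrable (distr Q borel (X i)) (%y. lap (s i * y))"
          by (intro finite_measure.integrable_const_bound[OF fD, where B=1]) auto
      qed simp
      finally show "integral\<^sup>L ?D f = integral\<^sup>L ?P f" .
      fix g assume "g \<in> ?F"
      then obtain t where t: "g = (%y. \<Prod>i<n. lap (t i * y i))" by blast
      show "(%x. f x * g x) \<in> ?F"
        unfolding s t by (rule CollectI, rule exI[of _ "%i. s i + t i"]) (simp add: distrib_right lap_add prod.distrib)
    next
      fix K :: "(nat => ennreal) measure"
      assume K: "space K = space ?D" "!!f. f \<in> ?F ==> f \<in> borel_measurable K"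
      have "(%y. y i) \<in> borel_measurable K" if i: "i < n" for i
      proof -
        have "(%y. \<Prod>j<n. lap ((if j = i then 1 else 0) * y j)) \<in> borel_measurable K"
          by (rule K(2), rule CollectI, rule exI[of _ "%j. if j = i then 1 else 0"]) simp
        moreover have "(\<Prod>j<n. lap ((if j = i then 1 else 0) * y j)) = lap (y i)" for y
        proof -
          have "(\<Prod>j<n. lap ((if j = i then 1 else 0) * y j)) = (\<Prod>j<n. if j = i then lap (y i) else 1)"
            by (intro prod.cong) auto
          then show ?thesis using i by simp
        qed
        ultimately show ?thesis by (simp add: borel_measurable_lap_iff)
      qed
      then have id: "(%y. y) \<in> measurable K (\<Pi>\<^sub>M i\<in>{..<n}. borel)"
        using K(1) by (intro measurable_PiM_single') (auto simp: space_PiM PiE_def)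
      show "sets ?D \<subseteq> sets K"
      proof
        fix C assume C: "C \<in> sets ?D"
        then have "(%y. y) -` C \<inter> space K \<in> sets K" by (intro measurable_sets[OF id]) simp
        then show "C \<in> sets K" using sets.sets_into_space[OF C] by (simp add: K(1) Int_absorb2)
      qed
    qed
    then have "Q.indep_vars (%_. borel) X {..<n}"
      using False by (subst Q.indep_vars_iff_distr_eq_PiM) auto
    then show ?thesis
      by (rule Q.indep_vars_cong[THEN iffD1, rotated -1]) (auto simp: X_def B_def)
  qed
  show ?thesis unfolding poisson_process_def
    using prob sets_Psi meas_Psi c1 c2 c3 by blast
qed

end

section \<open>Series of random measures\<close>

lemma measurable_nn_integral_series:
  fixes x :: "'w => nat => 'x::topological_space measure"
  assumes x: "!!w i. w \<in> space Q ==> i \<in> I w ==> x w i \<in> radon_measures"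
    and meas: "!!B. B \<in> sets borel ==> (%w. \<integral>\<^sup>+i. emeasure (x w i) B \<partial>count_space (I w)) \<in> borel_measurable Q"
    and h: "h \<in> borel_measurable borel"
  shows "(%w. \<integral>\<^sup>+y. h y \<partial>series_measure (I w) (x w)) \<in> borel_measurable Q"
  using h
proof (induction h rule: borel_measurable_induct)
  case (cong f g)
  have "integral\<^sup>N \<mu> f = integral\<^sup>N \<mu> g" for \<mu> :: "'x measure" using cong(3) by (intro nn_integral_cong) auto
  with cong(4) show ?case by simp
next
  case (set B)
  then show ?case using x
    by (subst measurable_cong[of _ _ "%w. \<integral>\<^sup>+i. emeasure (x w i) B \<partial>count_space (I w)"])
      (auto simp: emeasure_series_measure sets_radon_measure intro!: meas)
next
  case (mult f c)
  have "(\<integral>\<^sup>+x. c * f x \<partial>series_measure (I w) (x w)) = c * (np f (series_measure (I w) (x w)))" for w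
    using mult(2) by (intro nn_integral_cmult borel_measurable_sets_borel[OF sets_series_measure])
  with mult(4) show ?case by simp
next
  case (add f g)
  have "(\<integral>\<^sup>+x. g x + f x \<partial>series_measure (I w) (x w)) = (np g (series_measure (I w) (x w))) + (np f (series_measure (I w) (x w)))" for w
    using add(1,3) by (intro nn_integral_add borel_measurable_sets_borel[OF sets_series_measure])
  with add.IH show ?case by simp
next
  case (seq F)
  have eq: "(SUP i. F i) = (%x. SUP i. F i x)" by (rule ext) (simp add: image_comp)
  have "integral\<^sup>N (series_measure (I w) (x w)) (SUP i. F i) = (SUP i. integral\<^sup>N (series_measure (I w) (x w)) (F i))" for w
    using seq(1,3) unfolding eq
    by (intro nn_integral_monotone_convergence_SUP borel_measurable_sets_borel[OF sets_series_measure])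
  moreover have "(%w. SUP i. integral\<^sup>N (series_measure (I w) (x w)) (F i)) \<in> borel_measurable Q"
    using seq.IH by (intro borel_measurable_SUP) simp_all
  ultimately show ?case by (simp only:)
qed

context lcsc
begin

text \<open>As s decreases to 0, the expectation of \<open>lap (s * v)\<close> tends to the
  probability that v is finite. It coincides with the Laplace transform of the mass that \<zeta>
  gives to \<open>exh n\<close>, and this tends to 1 because \<zeta> is locally finite.\<close>

lemma AE_finite_laplace:
  assumes P: "random_measure P \<zeta>" and Q: "prob_space Q"
    and v [measurable]: "v \<in> borel_measurable Q"
    and lapl: "!!s. 0 < s ==> (\<integral>w. lap (ennreal s * v w) \<partial>Q) = laplace_functional P \<zeta> (%x. s * indicator (exh n) x)"
  shows "AE w in Q. v w < top"
proof -
  interpret Q: prob_space Q by fact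
  interpret P: prob_space P using P by (simp add: random_measure_def)
  have z [measurable]: "\<zeta> \<in> measurable P radon_space" using P by (simp add: random_measure_def)
  have zr: "\<zeta> w \<in> radon_measures" if "w \<in> space P" for w using measurable_space[OF z that] by simp
  define s where "s k = 1 / (real k + 1)" for k
  have s: "0 < s k" for k by (simp add: s_def)
  have "s ----> 0" unfolding s_def[abs_def] using LIMSEQ_Suc[OF lim_1_over_n] by (simp add: add.commute)
  have sv: "(%k. lap (ennreal (s k) * u)) ----> (if u < top then 1 else 0)" for u
  proof (cases "u < top")
    case True
    then obtain r where r: "u = ennreal r" "0 <= r" by (cases u) auto
    have "(%k. s k * r) ----> 0 * r" using \<open>s ----> 0\<close> by (intro tendsto_mult tendsto_const)
    then have "(%k. exp (- (s k * r))) ----> exp (- (0 * r))" by (intro tendsto_exp tendsto_minus)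
    moreover have "lap (ennreal (s k) * u) = exp (- (s k * r))" for k
      using r s[of k] by (simp add: lap_eq_exp_iff)
    ultimately show ?thesis using True by simp
  next
    case False
    then have "u = top" using top.not_eq_extremum by blast
    then have "lap (ennreal (s k) * u) = 0" for k using s[of k] by (simp add: ennreal_mult_top)
    then show ?thesis using False by simp
  qed
  have "(%k. \<integral>w. lap (ennreal (s k) * v w) \<partial>Q) ----> (\<integral>w. (if v w < top then 1 else 0) \<partial>Q)"
    by (rule integral_dominated_convergence[where w="%_. 1"]) (use sv in auto)
  moreover have "(%k. laplace_functional P \<zeta> (%x. s k * indicator (exh n) x)) ----> 1"
  proof -
    have "laplace_functional P \<zeta> (%x. s k * indicator (exh n) x) = (\<integral>w. lap (ennreal (s k) * emeasure (\<zeta> w) (exh n)) \<partial>P)" for k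
    proof -
      have "(%x. s k * indicator (exh n) x) \<in> BM" using s[of k] by (intro BM_scale indicator_exh_BM) simp
      then have "laplace_functional P \<zeta> (%x. s k * indicator (exh n) x) = (\<integral>w. lap (\<integral>\<^sup>+x. ennreal (s k * indicator (exh n) x) \<partial>\<zeta> w) \<partial>P)"
        by (rule random_measure_laplace[OF P])
      also have "\<dots> = (\<integral>w. lap (ennreal (s k) * emeasure (\<zeta> w) (exh n)) \<partial>P)"
      proof (rule bint_cong)
        fix w assume "w \<in> space P"
        then have "exh n \<in> sets (\<zeta> w)" using sets_radon_measure[OF zr] by simp
        then have "(\<integral>\<^sup>+x. ennreal (s k) * indicator (exh n) x \<partial>\<zeta> w) = ennreal (s k) * emeasure (\<zeta> w) (exh n)"
          by (rule nn_integral_cmult_indicator)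
        moreover have "(\<integral>\<^sup>+x. ennreal (s k * indicator (exh n) x) \<partial>\<zeta> w) = (\<integral>\<^sup>+x. ennreal (s k) * indicator (exh n) x \<partial>\<zeta> w)"
          by (intro nn_integral_cong) (auto simp: indicator_def)
        ultimately show "lap (\<integral>\<^sup>+x. ennreal (s k * indicator (exh n) x) \<partial>\<zeta> w) = lap (ennreal (s k) * emeasure (\<zeta> w) (exh n))" by simp
      qed simp
      finally show ?thesis .
    qed
    moreover have "(%k. \<integral>w. lap (ennreal (s k) * emeasure (\<zeta> w) (exh n)) \<partial>P) ----> (\<integral>w. 1 \<partial>P)"
    proof (rule integral_dominated_convergence[where w="%_. 1"])
      show "AE w in P. (%k. lap (ennreal (s k) * emeasure (\<zeta> w) (exh n))) ----> 1"
      proof (rule AE_I2)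
        fix w assume "w \<in> space P"
        then show "(%k. lap (ennreal (s k) * emeasure (\<zeta> w) (exh n))) ----> 1"
          using sv[of "emeasure (\<zeta> w) (exh n)"] radon_exh[OF zr] by simp
      qed
    qed (auto intro!: measurable_compose[OF z measurable_emeasure_radon_space])
    ultimately show ?thesis by (simp add: P.prob_space)
  qed
  ultimately have "(\<integral>w. (if v w < top then 1 else 0) \<partial>Q) = (1 :: real)"
    using lapl[OF s] LIMSEQ_unique by fastforce
  moreover have "(\<integral>w. (if v w < top then 1 else 0) \<partial>Q) = (\<integral>w. indicator {w \<in> space Q. v w < top} w \<partial>Q :: real)"
    by (intro bint_cong) auto
  moreover have "\<dots> = measure Q {w \<in> space Q. v w < top}" by simp
  ultimately have "measure Q {w \<in> space Q. v w < top} = 1" by simp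
  then show ?thesis by (subst (asm) Q.prob_Collect_eq_1) measurable
qed

text \<open>Equality in law with a vaguely convergent series is reduced to one Laplace identity, in
  which the sum may still be infinite. The same identity, applied to multiples of the indicators of
  \<open>exh n\<close>, shows that the sum is almost surely a Radon measure.\<close>

lemma equals_vague_seriesI:
  fixes x :: "'w => nat => 'x measure"
  assumes P: "random_measure P \<zeta>" and Q: "prob_space Q"
    and x: "!!w i. w \<in> space Q ==> i \<in> I w ==> x w i \<in> radon_measures"
    and meas: "!!B. B \<in> sets borel ==> (%w. \<integral>\<^sup>+i. emeasure (x w i) B \<partial>count_space (I w)) \<in> borel_measurable Q"
    and b: "0 < b"
    and lapl: "!!h. h \<in> BM ==> (\<integral>w. lap (ennreal b * (\<integral>\<^sup>+i. (ip h (x w i)) \<partial>count_space (I w))) \<partial>Q)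
      = laplace_functional P \<zeta> h"
  shows "equals_vague_series P \<zeta> Q b I x"
proof -
  interpret Q: prob_space Q by fact
  define S0 where "S0 w = series_measure (I w) (x w)" for w
  have sS0: "sets (S0 w) = sets borel" for w by (simp add: S0_def)
  have S0m: "(%w. \<integral>\<^sup>+y. h y \<partial>S0 w) \<in> borel_measurable Q" if "h \<in> borel_measurable borel" for h
    unfolding S0_def by (rule measurable_nn_integral_series[OF x meas that])
  have S0e [measurable]: "(%w. emeasure (S0 w) B) \<in> borel_measurable Q" if "B \<in> sets borel" for B
    using S0m[of "indicator B"] that by (simp add: sS0)
  have S0i: "(ip h (S0 w)) = (\<integral>\<^sup>+i. (ip h (x w i)) \<partial>count_space (I w))"
    if "h \<in> BM" "w \<in> space Q" for h w
    unfolding S0_def using BM_measurable[OF that(1)] x[OF that(2)]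
    by (intro nn_integral_series_measure) (auto simp: sets_radon_measure)
  have lapS0: "(\<integral>w. lap (ennreal b * (ip h (S0 w))) \<partial>Q) = laplace_functional P \<zeta> h" if h: "h \<in> BM" for h
    unfolding lapl[OF h, symmetric] by (intro bint_cong) (simp_all add: S0i[OF h])
  have fin: "AE w in Q. emeasure (S0 w) (exh n) < top" for n
  proof -
    have "AE w in Q. ennreal b * emeasure (S0 w) (exh n) < top"
    proof (rule AE_finite_laplace[OF P Q])
      show "(%w. ennreal b * emeasure (S0 w) (exh n)) \<in> borel_measurable Q" by measurable
      fix s :: real assume s: "0 < s"
      have h: "(%x. s * indicator (exh n) x) \<in> BM" using s by (intro BM_scale indicator_exh_BM) simp
      have e: "(\<integral>\<^sup>+y. ennreal (s * indicator (exh n) y) \<partial>S0 w) = ennreal s * emeasure (S0 w) (exh n)" for w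
      proof -
        have "(\<integral>\<^sup>+y. ennreal (s * indicator (exh n) y) \<partial>S0 w) = (\<integral>\<^sup>+y. ennreal s * indicator (exh n) y \<partial>S0 w)"
          by (intro nn_integral_cong) (auto simp: indicator_def)
        also have "\<dots> = ennreal s * emeasure (S0 w) (exh n)" by (intro nn_integral_cmult_indicator) (simp add: sS0)
        finally show ?thesis .
      qed
      show "(\<integral>w. lap (ennreal s * (ennreal b * emeasure (S0 w) (exh n))) \<partial>Q) = laplace_functional P \<zeta> (%x. s * indicator (exh n) x)"
        using lapS0[OF h] unfolding e by (simp only: mult.left_commute)
    qed
    then show ?thesis
      by eventually_elim (use b in \<open>auto simp: ennreal_mult_less_top ennreal_zero_less_mult_iff\<close>)
  qed
  \<comment> \<open>Local finiteness amounts to countably many conditions, so the exceptional set is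
    null. On it the sum is replaced by the zero measure, to obtain Radon measures
    everywhere.\<close>
  define G where "G = {w \<in> space Q. \<forall>n. emeasure (S0 w) (exh n) < top}"
  have G [measurable]: "G \<in> sets Q" unfolding G_def by measurable
  have aeG: "AE w in Q. w \<in> G"
    using AE_all_countable[THEN iffD2, OF allI[OF fin]] AE_space by eventually_elim (simp add: G_def)
  define S where "S w = (if w \<in> G then S0 w else null_measure borel)" for w
  have Sr: "S w \<in> radon_measures" for w
    by (auto simp: S_def G_def null_measure_radon intro!: radon_measuresI sS0)
  have Sm: "S \<in> measurable Q radon_space"
  proof (rule measurable_radon_spaceI)
    fix B :: "'x set" assume B [measurable]: "B \<in> sets borel"
    have "(%w. if w \<in> G then emeasure (S0 w) B else 0) \<in> borel_measurable Q" by measurable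
    then show "(%w. emeasure (S w) B) \<in> borel_measurable Q"
      by (rule measurable_cong[THEN iffD1, rotated]) (simp add: S_def)
  qed (rule Sr)
  have rS: "random_measure Q S" using Sm Q by (simp add: random_measure_def)
  have rbS: "random_measure Q (%w. scale_measure (ennreal b) (S w))"
    unfolding random_measure_def using Q by (auto intro!: measurable_scale_measure_radon Sm)
  have "AE w in Q. vague_sums (I w) (x w) (S w)"
    using aeG AE_space
  proof eventually_elim
    case (elim w)
    then have "S w = series_measure (I w) (x w)" by (simp add: S_def S0_def)
    then show ?case using vague_sums_series_measure[of "I w" "x w"] x[OF elim(2)] Sr[of w] by simp
  qed
  moreover have "eq_in_distribution P \<zeta> Q (%w. scale_measure (ennreal b) (S w))"
  proof (rule eq_in_distributionI[OF P rbS])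
    fix h :: "'x => real" assume h: "h \<in> BM"
    have hm: "(en h) \<in> borel_measurable borel" using BM_measurable[OF h] by simp
    have "(\<integral>w. lap (ip h (scale_measure (ennreal b) (S w))) \<partial>Q) = (\<integral>w. lap (ennreal b * (ip h (S0 w))) \<partial>Q)"
    proof (rule integral_cong_AE)
      have "(%w. \<integral>\<^sup>+y. ennreal (h y) \<partial>scale_measure (ennreal b) (S w)) \<in> borel_measurable Q"
        using rbS by (intro measurable_compose[OF _ measurable_np[OF hm]]) (simp add: random_measure_def)
      then show "(%w. lap (ip h (scale_measure (ennreal b) (S w)))) \<in> borel_measurable Q" by simp
      show "(%w. lap (ennreal b * (ip h (S0 w)))) \<in> borel_measurable Q"
        using S0m[OF hm] by simp
      show "AE w in Q. lap (ip h (scale_measure (ennreal b) (S w))) = lap (ennreal b * (ip h (S0 w)))"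
        using aeG
      proof eventually_elim
        case (elim w)
        then have "S w = S0 w" by (simp add: S_def)
        then show ?case using nn_integral_scale_measure'[OF sS0 hm] by simp
      qed
    qed
    then show "(\<integral>w. lap (ip h (\<zeta> w)) \<partial>P) = (\<integral>w. lap (ip h (scale_measure (ennreal b) (S w))) \<partial>Q)"
      using lapS0[OF h] random_measure_laplace[OF P h] by simp
  qed
  ultimately show ?thesis unfolding equals_vague_series_def using rS by blast
qed

text \<open>Summing over the points is integrating against the counting process, so the Poisson
  Laplace formula applies to the map that sends a measure to its pairing with
  \<open>h\<close>.\<close>

lemma poisson_points_series:
  assumes pp: "poisson_points Q \<Lambda> I x" and s: "sets \<Lambda> = sets (nonzero_radon_space :: 'x measure measure)"
  shows "prob_space Q"
    and "w \<in> space Q ==> i \<in> I w ==> x w i \<in> radon_measures"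
    and "h \<in> borel_measurable borel ==> (%w. \<integral>\<^sup>+i. (np h (x w i)) \<partial>count_space (I w)) \<in> borel_measurable Q"
    and "h \<in> borel_measurable borel ==>
      (\<integral>w. lap (\<integral>\<^sup>+i. (np h (x w i)) \<partial>count_space (I w)) \<partial>Q) = lap (laplace_exp \<Lambda> h)"
proof -
  let ?\<Psi> = "%w. distr (count_space (I w)) \<Lambda> (x w)"
  have xs: "x w i \<in> space \<Lambda>" if "w \<in> space Q" "i \<in> I w" for w i
    using pp that by (auto simp: poisson_points_def)
  have P: "poisson_process Q \<Lambda> ?\<Psi>" using pp by (simp add: poisson_points_def)
  then show pr: "prob_space Q" by (simp add: poisson_process_def)
  show xr: "w \<in> space Q ==> i \<in> I w ==> x w i \<in> radon_measures" for w i
    using xs sets_eq_imp_space_eq[OF s] by (auto simp: space_nonzero)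
  have sP: "sets (?\<Psi> w) = sets \<Lambda>" for w by simp
  have mP: "(%w. emeasure (?\<Psi> w) A) \<in> borel_measurable Q" if "A \<in> sets \<Lambda>" for A
    using P that by (simp add: poisson_process_def)
  assume h: "h \<in> borel_measurable borel"
  have gm: "(%\<mu>. \<integral>\<^sup>+y. h y \<partial>\<mu>) \<in> borel_measurable \<Lambda>"
  proof -
    have "(%\<mu>. \<integral>\<^sup>+y. h y \<partial>\<mu>) \<in> borel_measurable nonzero_radon_space"
      unfolding nonzero_radon_space_def using h by (intro measurable_restrict_space1 measurable_np)
    then show ?thesis using measurable_cong_sets[OF s refl] by blast
  qed
  have eq: "(\<integral>\<^sup>+\<mu>. (np h \<mu>) \<partial>?\<Psi> w) = (\<integral>\<^sup>+i. (np h (x w i)) \<partial>count_space (I w))" if "w \<in> space Q" for w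
    using xs[OF that] gm by (intro nn_integral_distr) auto
  have mm: "(%w. \<integral>\<^sup>+\<mu>. (np h \<mu>) \<partial>?\<Psi> w) \<in> borel_measurable Q"
    by (rule measurable_nn_integral_process[OF pr sP mP gm])
  show "(%w. \<integral>\<^sup>+i. (np h (x w i)) \<partial>count_space (I w)) \<in> borel_measurable Q"
    using mm by (rule measurable_cong[THEN iffD1, rotated]) (rule eq)
  have "(\<integral>w. lap (\<integral>\<^sup>+i. (np h (x w i)) \<partial>count_space (I w)) \<partial>Q) = (\<integral>w. lap (\<integral>\<^sup>+\<mu>. (np h \<mu>) \<partial>?\<Psi> w) \<partial>Q)"
    by (intro bint_cong) (simp_all add: eq)
  also have "\<dots> = lap (laplace_exp \<Lambda> h)"
    unfolding laplace_exp_def by (rule poisson_process_laplace[OF pr sP mP P gm])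
  finally show "(\<integral>w. lap (\<integral>\<^sup>+i. (np h (x w i)) \<partial>count_space (I w)) \<partial>Q) = lap (laplace_exp \<Lambda> h)" .
qed

text \<open>Vague limits are unique, so the given limit is the sum of the points as a measure, whose
  Laplace functional is known from the Poisson formula.\<close>

lemma equals_vague_series_laplace:
  assumes P: "random_measure P \<zeta>" and pp: "poisson_points Q \<Lambda> I x"
    and s: "sets \<Lambda> = sets (nonzero_radon_space :: 'x measure measure)"
    and eq: "equals_vague_series P \<zeta> Q 1 I x" and h: "h \<in> BM"
  shows "laplace_functional P \<zeta> h = lap (laplace_exp \<Lambda> (en h))"
proof -
  note pps = poisson_points_series[OF pp s]
  have hm: "(en h) \<in> borel_measurable borel" using BM_measurable[OF h] by simp
  from eq obtain S where S: "random_measure Q S" "AE w in Q. vague_sums (I w) (x w) (S w)"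
    and d: "eq_in_distribution P \<zeta> Q (%w. scale_measure (ennreal 1) (S w))"
    unfolding equals_vague_series_def by blast
  have Sm: "S \<in> measurable Q radon_space" and zm: "\<zeta> \<in> measurable P radon_space"
    using S(1) P by (simp_all add: random_measure_def)
  have lm: "(%\<mu>. lap (ip h \<mu>)) \<in> borel_measurable radon_space"
    using measurable_np[OF hm] by simp
  have sc: "scale_measure (ennreal 1) (S w) = S w" for w by simp
  have dd: "distr Q radon_space S = distr P radon_space \<zeta>"
    using d unfolding eq_in_distribution_def sc by simp
  have "laplace_functional P \<zeta> h = (\<integral>w. lap (ip h (\<zeta> w)) \<partial>P)"
    by (rule random_measure_laplace[OF P h])
  also have "\<dots> = (\<integral>\<mu>. lap (ip h \<mu>) \<partial>distr P radon_space \<zeta>)"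
    by (rule integral_distr[symmetric, OF zm lm])
  also have "\<dots> = (\<integral>w. lap (ip h (S w)) \<partial>Q)"
    unfolding dd[symmetric] by (rule integral_distr[OF Sm lm])
  also have "\<dots> = (\<integral>w. lap (\<integral>\<^sup>+i. (ip h (x w i)) \<partial>count_space (I w)) \<partial>Q)"
  proof (rule integral_cong_AE)
    show "(%w. lap (ip h (S w))) \<in> borel_measurable Q" by (rule measurable_compose[OF Sm lm])
    show "(%w. lap (\<integral>\<^sup>+i. (ip h (x w i)) \<partial>count_space (I w))) \<in> borel_measurable Q"
      using pps(3)[OF hm] by simp
    show "AE w in Q. lap (ip h (S w)) = lap (\<integral>\<^sup>+i. (ip h (x w i)) \<partial>count_space (I w))"
      using S(2) AE_space
    proof eventually_elim
      case (elim w)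
      have "S w = series_measure (I w) (x w)" by (rule vague_sums_unique[OF pps(2)[OF elim(2)] elim(1)])
      moreover have "(ip h (series_measure (I w) (x w))) = (\<integral>\<^sup>+i. (ip h (x w i)) \<partial>count_space (I w))"
        by (rule nn_integral_series_measure[OF _ hm]) (rule sets_radon_measure[OF pps(2)[OF elim(2)]])
      ultimately show ?case by (simp only:)
    qed
  qed
  also have "\<dots> = lap (laplace_exp \<Lambda> (en h))" by (rule pps(4)[OF hm])
  finally show ?thesis .
qed

lemma poisson_points_equals_vague_series:
  assumes P: "random_measure P \<zeta>" and pp: "poisson_points Q \<Lambda> I x"
    and s: "sets \<Lambda> = sets (nonzero_radon_space :: 'x measure measure)"
    and lapl: "!!h. h \<in> BM ==> laplace_functional P \<zeta> h = lap (laplace_exp \<Lambda> (en h))"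
  shows "equals_vague_series P \<zeta> Q 1 I x"
proof (rule equals_vague_seriesI[OF P])
  note pps = poisson_points_series[OF pp s]
  show "prob_space Q" by (rule pps(1))
  show "w \<in> space Q ==> i \<in> I w ==> x w i \<in> radon_measures" for w i by (rule pps(2))
  show "(%w. \<integral>\<^sup>+i. emeasure (x w i) B \<partial>count_space (I w)) \<in> borel_measurable Q" if B: "B \<in> sets borel" for B
  proof -
    have "(%w. \<integral>\<^sup>+i. (np (indicator B) (x w i)) \<partial>count_space (I w)) \<in> borel_measurable Q"
      using B by (intro pps(3)) simp
    then show ?thesis
    proof (rule measurable_cong[THEN iffD1, rotated])
      fix w assume w: "w \<in> space Q"
      show "(\<integral>\<^sup>+i. (np (indicator B) (x w i)) \<partial>count_space (I w)) = (\<integral>\<^sup>+i. emeasure (x w i) B \<partial>count_space (I w))"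
        using sets_radon_measure[OF pps(2)[OF w]] B by (intro nn_integral_cong) simp
    qed
  qed
  show "(\<integral>w. lap (ennreal 1 * (\<integral>\<^sup>+i. (ip h (x w i)) \<partial>count_space (I w))) \<partial>Q) = laplace_functional P \<zeta> h"
    if h: "h \<in> BM" for h
    using pps(4)[of "%y. ennreal (h y)"] BM_measurable[OF h] lapl[OF h] by simp
qed simp

text \<open>Homogeneity says that the image of the intensity under multiplication by
  \<open>t\<close> is \<open>t powr \<alpha>\<close> times the intensity: the preimage of a set is
  that set scaled by 1 / t.\<close>

lemma laplace_exp_scale:
  assumes st: "stable_intensity \<alpha> \<Lambda>" and t: "0 < t" and h: "h \<in> borel_measurable borel"
  shows "laplace_exp \<Lambda> (%x. ennreal t * h x) = ennreal (t powr \<alpha>) * laplace_exp \<Lambda> (h :: 'x => ennreal)"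
proof -
  have s: "sets \<Lambda> = sets nonzero_radon_space" using st by (simp add: stable_intensity_def)
  have sp: "space \<Lambda> = radon_measures - {null_measure borel}"
    using sets_eq_imp_space_eq[OF s] by (simp add: space_nonzero)
  let ?T = "%c. scale_measure (ennreal c) :: 'x measure => 'x measure"
  have inv: "?T c (?T (1 / c) \<mu>) = \<mu>" if "0 < c" for c \<mu>
  proof -
    have "ennreal c * ennreal (1 / c) = 1" using that by (simp add: ennreal_mult[symmetric])
    then show ?thesis by (simp add: mult.commute)
  qed
  have Tsp: "?T c \<mu> \<in> space \<Lambda>" if "0 < c" "\<mu> \<in> space \<Lambda>" for c \<mu>
  proof -
    have "?T c \<mu> \<noteq> null_measure borel"
    proof
      assume "?T c \<mu> = null_measure borel"
      moreover have "?T (1 / c) (null_measure borel) = null_measure borel" by (intro measure_eqI) auto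
      ultimately have "?T (1 / c) (?T c \<mu>) = null_measure borel" by (simp only:)
      with inv[of "1 / c" \<mu>] that show False by (simp add: sp)
    qed
    with that show ?thesis by (auto simp: sp intro: scale_measure_radon)
  qed
  have idm: "(%\<mu>. \<mu>) \<in> measurable \<Lambda> radon_space"
  proof -
    have "(%\<mu>. \<mu>) \<in> measurable nonzero_radon_space radon_space"
      unfolding nonzero_radon_space_def by (rule measurable_restrict_space1) simp
    then show ?thesis using measurable_cong_sets[OF s refl] by blast
  qed
  have Tm: "?T c \<in> measurable \<Lambda> \<Lambda>" if "0 < c" for c
  proof -
    have "?T c \<in> measurable \<Lambda> radon_space" by (intro measurable_scale_measure_radon idm) auto
    then have "?T c \<in> measurable \<Lambda> nonzero_radon_space"
      unfolding nonzero_radon_space_def using Tsp[OF that] by (intro measurable_restrict_space2) (auto simp: sp)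
    then show ?thesis using measurable_cong_sets[OF refl s] by blast
  qed
  have d: "distr \<Lambda> \<Lambda> (?T t) = scale_measure (ennreal (t powr \<alpha>)) \<Lambda>"
  proof (rule measure_eqI)
    fix A assume "A \<in> sets (distr \<Lambda> \<Lambda> (?T t))"
    then have A: "A \<in> sets \<Lambda>" by simp
    have "?T t -` A \<inter> space \<Lambda> = ?T (1 / t) ` A"
    proof (intro set_eqI iffI)
      fix \<mu> assume "\<mu> \<in> ?T t -` A \<inter> space \<Lambda>"
      then show "\<mu> \<in> ?T (1 / t) ` A" using inv[of "1 / t" \<mu>] t by (intro image_eqI[of _ _ "?T t \<mu>"]) auto
    next
      fix \<mu> assume "\<mu> \<in> ?T (1 / t) ` A"
      then obtain \<nu> where "\<nu> \<in> A" "\<mu> = ?T (1 / t) \<nu>" by blast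
      then show "\<mu> \<in> ?T t -` A \<inter> space \<Lambda>"
        using inv[OF t, of \<nu>] Tsp[of "1 / t" \<nu>] sets.sets_into_space[OF A] t by auto
    qed
    then have "emeasure (distr \<Lambda> \<Lambda> (?T t)) A = emeasure \<Lambda> (?T (1 / t) ` A)"
      using A Tm[OF t] by (simp add: emeasure_distr)
    also have "\<dots> = ennreal ((1 / t) powr (- \<alpha>)) * emeasure \<Lambda> A"
      using st A t by (simp add: stable_intensity_def)
    also have "(1 / t) powr (- \<alpha>) = t powr \<alpha>" using t by (simp add: powr_divide powr_minus field_simps)
    finally show "emeasure (distr \<Lambda> \<Lambda> (?T t)) A = emeasure (scale_measure (ennreal (t powr \<alpha>)) \<Lambda>) A" by simp
  qed simp
  have gm: "(%\<mu>. ennreal (1 - lap (np h \<mu>))) \<in> borel_measurable \<Lambda>"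
  proof -
    have "(%\<mu>. ennreal (1 - lap (np h \<mu>))) \<in> borel_measurable radon_space"
      using measurable_np[OF h] by simp
    then show ?thesis using measurable_compose[OF idm] by blast
  qed
  have "laplace_exp \<Lambda> (%x. ennreal t * h x) = (\<integral>\<^sup>+\<mu>. ennreal (1 - lap (np h (?T t \<mu>))) \<partial>\<Lambda>)"
    unfolding laplace_exp_def
  proof (intro nn_integral_cong)
    fix \<mu> assume "\<mu> \<in> space \<Lambda>"
    then have mu: "\<mu> \<in> radon_measures" by (simp add: sp)
    have "(\<integral>\<^sup>+y. ennreal t * h y \<partial>\<mu>) = (np h (?T t \<mu>))"
      unfolding nn_integral_scale_measure'[OF sets_radon_measure[OF mu] h]
      by (intro nn_integral_cmult borel_measurable_radon[OF mu h])
    then show "ennreal (1 - lap (\<integral>\<^sup>+y. ennreal t * h y \<partial>\<mu>)) = ennreal (1 - lap (np h (?T t \<mu>)))" by simp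
  qed
  also have "\<dots> = (\<integral>\<^sup>+\<mu>. ennreal (1 - lap (np h \<mu>)) \<partial>distr \<Lambda> \<Lambda> (?T t))"
    using Tm[OF t] gm by (intro nn_integral_distr[symmetric]) auto
  also have "\<dots> = ennreal (t powr \<alpha>) * laplace_exp \<Lambda> h"
    unfolding d laplace_exp_def by (intro nn_integral_scale_measure gm)
  finally show ?thesis .
qed

text \<open>The exponent is homogeneous of degree \<alpha>, so the two scaled copies contribute t
  times and 1 - t times the exponent of \<zeta>.\<close>

lemma strictly_stableI:
  assumes P: "random_measure P \<zeta>" and a: "0 < \<alpha>" and st: "stable_intensity \<alpha> \<Lambda>"
    and lapl: "!!h. h \<in> BM ==> laplace_functional P \<zeta> h = lap (laplace_exp \<Lambda> (%x. ennreal ((h :: 'x => real) x)))"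
  shows "strictly_stable \<alpha> P \<zeta>"
  unfolding strictly_stable_def
proof
  fix t :: real assume t: "t \<in> {0..1}"
  interpret P: prob_space P using P by (simp add: random_measure_def)
  interpret PP: pair_prob_space P P ..
  have zm: "\<zeta> \<in> measurable P radon_space" using P by (simp add: random_measure_def)
  have zr: "\<zeta> w \<in> radon_measures" if "w \<in> space P" for w using measurable_space[OF zm that] by simp
  define c d where "c = t powr (1 / \<alpha>)" and "d = (1 - t) powr (1 / \<alpha>)"
  have lx: "laplace_functional P \<zeta> (%x. u powr (1 / \<alpha>) * h x) = lap (ennreal u * laplace_exp \<Lambda> (en h))"
    if h: "h \<in> BM" and u: "0 <= u" for h u
  proof -
    have "laplace_functional P \<zeta> (%x. u powr (1 / \<alpha>) * h x) = lap (laplace_exp \<Lambda> (%x. ennreal (u powr (1 / \<alpha>) * h x)))"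
      using h by (intro lapl BM_scale) auto
    also have "laplace_exp \<Lambda> (%x. ennreal (u powr (1 / \<alpha>) * h x)) = ennreal u * laplace_exp \<Lambda> (en h)"
    proof (cases "u = 0")
      case True
      then show ?thesis by (simp add: laplace_exp_def)
    next
      case False
      with u have u0: "0 < u" by simp
      have "laplace_exp \<Lambda> (%x. ennreal (u powr (1 / \<alpha>) * h x)) = laplace_exp \<Lambda> (%x. ennreal (u powr (1 / \<alpha>)) * ennreal (h x))"
        by (simp add: ennreal_mult BM_nonneg[OF h])
      also have "\<dots> = ennreal ((u powr (1 / \<alpha>)) powr \<alpha>) * laplace_exp \<Lambda> (en h)"
        using u0 BM_measurable[OF h] by (intro laplace_exp_scale[OF st]) auto
      also have "(u powr (1 / \<alpha>)) powr \<alpha> = u" using u0 a by (simp add: powr_powr)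
      finally show ?thesis .
    qed
    finally show ?thesis .
  qed
  let ?\<eta> = "%(w', w''). add_measure (scale_measure (ennreal c) (\<zeta> w')) (scale_measure (ennreal d) (\<zeta> w''))"
  have em: "?\<eta> \<in> measurable (P \<Otimes>\<^sub>M P) radon_space"
    unfolding case_prod_beta
    by (intro measurable_add_measure_radon measurable_scale_measure_radon measurable_compose[OF measurable_fst zm]
        measurable_compose[OF measurable_snd zm]) auto
  have re: "random_measure (P \<Otimes>\<^sub>M P) ?\<eta>"
    unfolding random_measure_def using em PP.prob_space_axioms by blast
  have "eq_in_distribution (P \<Otimes>\<^sub>M P) ?\<eta> P \<zeta>"
  proof (rule eq_in_distributionI[OF re P])
    fix h :: "'x => real" assume h: "h \<in> BM"
    have hm: "(en h) \<in> borel_measurable borel" using BM_measurable[OF h] by simp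
    define f where "f u w = lap (ennreal u * (ip h (\<zeta> w)))" for u w
    have fm [measurable]: "f u \<in> borel_measurable P" for u
      unfolding f_def[abs_def] using measurable_compose[OF zm measurable_np[OF hm]] by simp
    have fint: "integrable P (f u)" for u
      by (intro P.integrable_const_bound[where B=1]) (auto simp: f_def)
    have fL: "(\<integral>w. f (u powr (1 / \<alpha>)) w \<partial>P) = lap (ennreal u * laplace_exp \<Lambda> (en h))" if u: "0 <= u" for u
    proof -
      have "(\<integral>w. f (u powr (1 / \<alpha>)) w \<partial>P) = (\<integral>w. lap (\<integral>\<^sup>+x. ennreal (u powr (1 / \<alpha>) * h x) \<partial>\<zeta> w) \<partial>P)"
      proof (rule bint_cong)
        fix w assume w: "w \<in> space P"
        have "(\<integral>\<^sup>+x. ennreal (u powr (1 / \<alpha>) * h x) \<partial>\<zeta> w) = (\<integral>\<^sup>+x. ennreal (u powr (1 / \<alpha>)) * ennreal (h x) \<partial>\<zeta> w)"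
          by (simp add: ennreal_mult BM_nonneg[OF h])
        also have "\<dots> = ennreal (u powr (1 / \<alpha>)) * (ip h (\<zeta> w))"
          by (intro nn_integral_cmult borel_measurable_radon[OF zr[OF w] hm])
        finally show "f (u powr (1 / \<alpha>)) w = lap (\<integral>\<^sup>+x. ennreal (u powr (1 / \<alpha>) * h x) \<partial>\<zeta> w)" by (simp add: f_def)
      qed simp
      also have "\<dots> = laplace_functional P \<zeta> (%x. u powr (1 / \<alpha>) * h x)"
        using h by (intro random_measure_laplace[OF P, symmetric] BM_scale) auto
      finally show ?thesis using lx[OF h u] by simp
    qed
    have "(\<integral>w. lap (ip h (?\<eta> w)) \<partial>(P \<Otimes>\<^sub>M P)) = (\<integral>w. f c (fst w) * f d (snd w) \<partial>(P \<Otimes>\<^sub>M P))"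
    proof (rule bint_cong)
      fix w assume "w \<in> space (P \<Otimes>\<^sub>M P)"
      then have w: "fst w \<in> space P" "snd w \<in> space P" by (auto simp: space_pair_measure)
      note s1 = sets_radon_measure[OF zr[OF w(1)]] and s2 = sets_radon_measure[OF zr[OF w(2)]]
      show "lap (ip h (?\<eta> w)) = f c (fst w) * f d (snd w)"
        using hm by (simp add: case_prod_beta nn_integral_add_measure s1 s2 nn_integral_scale_measure' lap_add f_def)
    qed simp
    also have "\<dots> = (\<integral>w'. (\<integral>w''. f c w' * f d w'' \<partial>P) \<partial>P)"
    proof -
      have "integrable (P \<Otimes>\<^sub>M P) (%w. f c (fst w) * f d (snd w))"
      proof (intro PP.P.integrable_const_bound[where B=1] AE_I2)
        show "(%w. f c (fst w) * f d (snd w)) \<in> borel_measurable (P \<Otimes>\<^sub>M P)" by measurable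
        show "norm (f c (fst w) * f d (snd w)) <= 1" for w by (auto simp: f_def abs_mult intro!: mult_le_one)
      qed
      from PP.integral_fst'[OF this] show ?thesis by simp
    qed
    also have "\<dots> = (\<integral>w. f c w \<partial>P) * (\<integral>w. f d w \<partial>P)" by simp
    also have "\<dots> = lap (ennreal t * laplace_exp \<Lambda> (en h) + ennreal (1 - t) * laplace_exp \<Lambda> (en h))"
      unfolding c_def d_def lap_add using t by (simp add: fL)
    also have "ennreal t * laplace_exp \<Lambda> (en h) + ennreal (1 - t) * laplace_exp \<Lambda> (en h) = laplace_exp \<Lambda> (en h)"
      using t by (simp add: distrib_right[symmetric] ennreal_plus[symmetric] del: ennreal_plus)
    also have "lap \<dots> = (\<integral>w. lap (ip h (\<zeta> w)) \<partial>P)"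
      using lapl[OF h] random_measure_laplace[OF P h] by simp
    finally show "(\<integral>w. lap (ip h (?\<eta> w)) \<partial>(P \<Otimes>\<^sub>M P)) = (\<integral>w. lap (ip h (\<zeta> w)) \<partial>P)" .
  qed
  then show "eq_in_distribution (P \<Otimes>\<^sub>M P) (%(w', w''). add_measure (scale_measure (ennreal (t powr (1 / \<alpha>))) (\<zeta> w')) (scale_measure (ennreal ((1 - t) powr (1 / \<alpha>))) (\<zeta> w''))) P \<zeta>"
    by (simp only: c_def d_def)
qed

text \<open>Integrability of one minus the exponential bounds, by Markov's inequality, the mass of
  the open set where the pairing with \<open>bump n\<close> exceeds 1 / (k + 1). These sets cover
  the non-zero measures, and finitely many of them cover a relatively compact set.\<close>

lemma stable_intensity_radon:
  assumes st: "stable_intensity \<alpha> (\<Lambda> :: 'x measure measure)"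
  shows "radon_on_nonzero \<Lambda>"
proof -
  have s: "sets \<Lambda> = sets nonzero_radon_space" using st by (simp add: stable_intensity_def)
  have sp: "space \<Lambda> = radon_measures - {null_measure borel}"
    using sets_eq_imp_space_eq[OF s] by (simp add: space_nonzero)
  define T where "T = subtopology vague_topology (- {null_measure borel :: 'x measure})"
  have tT: "topspace T = space \<Lambda>" by (auto simp: T_def topspace_vague sp)
  define W where "W n = {\<mu> \<in> radon_measures. integral\<^sup>L \<mu> (bump n) \<in> {0<..}} \<inter> - {null_measure borel}" for n
  define W' where "W' n k = {\<mu> \<in> radon_measures. integral\<^sup>L \<mu> (bump n) \<in> {1 / (real k + 1)<..}} \<inter> - {null_measure borel}" for n k :: nat
  have oW: "openin T (W' n k)" for n k
  proof -
    have "openin vague_topology {\<mu> \<in> radon_measures. integral\<^sup>L \<mu> (bump n) \<in> {1 / (real k + 1)<..}}"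
      by (intro openin_vague_topologyI bump) simp
    then show ?thesis unfolding T_def W'_def by (simp add: openin_subtopology_Int)
  qed
  have ib: "(ip (bump n) \<mu>) = ennreal (integral\<^sup>L \<mu> (bump n))" if "\<mu> \<in> radon_measures" for \<mu> n
    using nn_integral_BM_finite[OF bump_BM[of n] that] by (simp add: integral_BM[OF bump_BM that])
  have cover: "\<exists>n k. \<mu> \<in> W' n k" if "\<mu> \<in> space \<Lambda>" for \<mu>
  proof -
    have mu: "\<mu> \<in> radon_measures" "\<mu> \<noteq> null_measure borel" using that by (auto simp: sp)
    then obtain n where n: "0 < emeasure \<mu> (exh n)" using nonzero_iff_exh by blast
    also have "emeasure \<mu> (exh n) = (\<integral>\<^sup>+x. indicator (exh n) x \<partial>\<mu>)"
      by (rule nn_integral_indicator[symmetric]) (simp add: sets_radon_measure[OF mu(1)])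
    also have "\<dots> <= (ip (bump n) \<mu>)"
    proof (rule nn_integral_mono)
      fix y show "indicator (exh n) y <= ennreal (bump n y)"
        using bump(3)[of y n] closure_subset[of "exh n"] by (cases "y \<in> exh n") auto
    qed
    finally have "0 < integral\<^sup>L \<mu> (bump n)" unfolding ib[OF mu(1)] by simp
    then obtain k where "inverse (real (Suc k)) < integral\<^sup>L \<mu> (bump n)" using reals_Archimedean by blast
    then have "\<mu> \<in> W' n k" using mu by (simp add: W'_def inverse_eq_divide add.commute)
    then show ?thesis by blast
  qed
  have finW: "emeasure \<Lambda> (W' n k) < top" for n k
  proof -
    define d where "d = 1 - exp (- (1 / (real k + 1)))"
    have d: "0 < d" by (simp add: d_def)
    define G where "G \<mu> = lap (ip (bump n) \<mu>)" for \<mu>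
    have gm [measurable]: "G \<in> borel_measurable \<Lambda>"
      unfolding G_def[abs_def]
      using BM_measurable[OF bump_BM[of n]] s unfolding nonzero_radon_space_def
      by (intro measurable_lap_nn_integral) auto
    have sub: "W' n k \<subseteq> {\<mu> \<in> space \<Lambda>. 1 <= ennreal (1 / d) * ennreal (1 - G \<mu>)}"
    proof
      fix \<mu> assume "\<mu> \<in> W' n k"
      then have mu: "\<mu> \<in> space \<Lambda>" "\<mu> \<in> radon_measures" "1 / (real k + 1) < integral\<^sup>L \<mu> (bump n)"
        by (auto simp: W'_def sp)
      then have "exp (- integral\<^sup>L \<mu> (bump n)) <= exp (- (1 / (real k + 1)))" by simp
      then have "d <= 1 - G \<mu>"
        using exp_integral_BM[OF bump_BM[of n] mu(2)] by (simp add: d_def G_def)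
      then have "1 <= (1 / d) * (1 - G \<mu>)" using d by (simp add: field_simps)
      then have "ennreal 1 <= ennreal ((1 / d) * (1 - G \<mu>))" by (rule ennreal_leI)
      then show "\<mu> \<in> {\<mu> \<in> space \<Lambda>. 1 <= ennreal (1 / d) * ennreal (1 - G \<mu>)}"
        using mu(1) d by (simp add: ennreal_mult[symmetric])
    qed
    have "emeasure \<Lambda> (W' n k) <= emeasure \<Lambda> {\<mu> \<in> space \<Lambda>. 1 <= ennreal (1 / d) * ennreal (1 - G \<mu>)}"
      using gm by (intro emeasure_mono sub) measurable
    also have "\<dots> <= ennreal (1 / d) * (\<integral>\<^sup>+\<mu>. ennreal (1 - G \<mu>) * indicator (space \<Lambda>) \<mu> \<partial>\<Lambda>)"
      using nn_integral_Markov_inequality[of "%\<mu>. ennreal (1 - G \<mu>)" "space \<Lambda>" \<Lambda> "ennreal (1 / d)"] gm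
      by simp
    also have "(\<integral>\<^sup>+\<mu>. ennreal (1 - G \<mu>) * indicator (space \<Lambda>) \<mu> \<partial>\<Lambda>) = laplace_exp \<Lambda> (en (bump n))"
      unfolding laplace_exp_def by (intro nn_integral_cong) (simp add: G_def)
    also have "ennreal (1 / d) * laplace_exp \<Lambda> (en (bump n)) < top"
      using st bump_BM[of n] laplace_exponent_eq[OF bump_BM[of n] s] by (auto simp: stable_intensity_def ennreal_mult_less_top)
    finally show ?thesis .
  qed
  have Wm: "W' n k \<in> sets \<Lambda>" for n k
  proof -
    have "(%\<mu>. \<integral>\<^sup>+x. ennreal (bump n x) \<partial>\<mu>) \<in> borel_measurable nonzero_radon_space"
      unfolding nonzero_radon_space_def using BM_measurable[OF bump_BM[of n]]
      by (intro measurable_restrict_space1 measurable_np) simp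
    then have [measurable]: "(%\<mu>. \<integral>\<^sup>+x. ennreal (bump n x) \<partial>\<mu>) \<in> borel_measurable \<Lambda>"
      using measurable_cong_sets[OF s refl] by blast
    have "{\<mu> \<in> space \<Lambda>. ennreal (1 / (real k + 1)) < (ip (bump n) \<mu>)} \<in> sets \<Lambda>" by measurable
    also have "{\<mu> \<in> space \<Lambda>. ennreal (1 / (real k + 1)) < (ip (bump n) \<mu>)} = W' n k"
      by (auto simp: W'_def sp ib ennreal_less_iff)
    finally show ?thesis .
  qed
  have "emeasure \<Lambda> A < \<infinity>" if A: "A \<in> sets \<Lambda>" and c: "compactin T (T closure_of A)" for A
  proof -
    have AT: "A \<subseteq> T closure_of A" using sets.sets_into_space[OF A] by (intro closure_of_subset) (simp add: tT)
    have "T closure_of A \<subseteq> \<Union>(range (%(n, k). W' n k))"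
      using cover closure_of_subset_topspace[of T A] unfolding tT by fastforce
    then obtain \<F> where F: "finite \<F>" "\<F> \<subseteq> range (%(n, k). W' n k)" "T closure_of A \<subseteq> \<Union>\<F>"
      using c oW unfolding compactin_def by (metis (mono_tags, lifting) imageE case_prod_beta)
    have FS: "V \<in> sets \<Lambda> \<and> emeasure \<Lambda> V < top" if "V \<in> \<F>" for V
      using F(2) that Wm finW by auto
    then have FS': "(%V. V) ` \<F> \<subseteq> sets \<Lambda>" by auto
    have "emeasure \<Lambda> A <= emeasure \<Lambda> (\<Union>\<F>)"
      using AT F Wm by (intro emeasure_mono) (auto intro!: sets.finite_Union)
    also have "\<dots> <= (\<Sum>V\<in>\<F>. emeasure \<Lambda> V)"
      using emeasure_subadditive_finite[OF F(1) FS'] by simp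
    also have "\<dots> < top" using F(1) FS by simp
    finally show ?thesis by simp
  qed
  then show ?thesis unfolding radon_on_nonzero_def Let_def T_def by blast
qed

end

section \<open>Arrival times of a unit rate Poisson process\<close>

definition exp_law :: "real measure" where
  "exp_law = density lborel (%x. ennreal (exponential_density 1 x))"

lemma sets_exp_law [simp, measurable_cong]: "sets exp_law = sets borel"
  by (simp add: exp_law_def)

lemma space_exp_law [simp]: "space exp_law = UNIV"
  by (simp add: exp_law_def)

lemma prob_space_exp_law: "prob_space exp_law"
  unfolding exp_law_def by (rule prob_space_exponential_density) simp

lemma nn_integral_exp_law:
  assumes [measurable]: "f \<in> borel_measurable borel"
  shows "(np f exp_law) = (\<integral>\<^sup>+u. ennreal (exp (- u)) * f u * indicator {0..} u \<partial>lborel)"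
proof -
  have "(np f exp_law) = (\<integral>\<^sup>+u. ennreal (exponential_density 1 u) * f u \<partial>lborel)"
    unfolding exp_law_def by (rule nn_integral_density) measurable
  also have "\<dots> = (\<integral>\<^sup>+u. ennreal (exp (- u)) * f u * indicator {0..} u \<partial>lborel)"
    by (intro nn_integral_cong) (auto simp: exponential_density_def indicator_def)
  finally show ?thesis .
qed

interpretation expseq: sequence_space exp_law
proof -
  interpret prob_space exp_law by (rule prob_space_exp_law)
  show "sequence_space exp_law" by unfold_locales
qed

definition arr :: "nat => (nat => real) => real" where "arr k \<xi> = (\<Sum>j<k. \<xi> j)"

abbreviation (input) arrp :: "(real => real) => nat => (nat => real) => real" where "arrp \<phi> n \<xi> \<equiv> (\<Prod>k<n. \<phi> (arr (Suc k) \<xi>))"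

lemma arr_meas [measurable]: "arr k \<in> borel_measurable expseq.S"
  unfolding arr_def[abs_def] by (intro borel_measurable_sum) (simp add: measurable_component_singleton)

lemma arr_Suc_case: "arr (Suc k) (case_nat u w) = u + arr k w"
  unfolding arr_def sum.lessThan_Suc_shift by simp

text \<open>Conditioning on the first waiting time: the remaining sequence has the original law.
  Both inductions over arrival times rest on this.\<close>

lemma nn_integral_expseq_Suc:
  assumes f: "f \<in> borel_measurable expseq.S"
  shows "(\<integral>\<^sup>+\<xi>. f \<xi> \<partial>expseq.S) = (\<integral>\<^sup>+u. (\<integral>\<^sup>+w. f (case_nat u w) \<partial>expseq.S) \<partial>exp_law)"
proof -
  have m: "(%(s, w). case_nat s w) \<in> measurable (exp_law \<Otimes>\<^sub>M expseq.S) expseq.S"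
    by measurable
  have "(\<integral>\<^sup>+\<xi>. f \<xi> \<partial>expseq.S) = (\<integral>\<^sup>+\<xi>. f \<xi> \<partial>distr (exp_law \<Otimes>\<^sub>M expseq.S) expseq.S (%(s, w). case_nat s w))"
    by (simp only: expseq.PiM_iter)
  also have "\<dots> = (\<integral>\<^sup>+p. f ((%(s, w). case_nat s w) p) \<partial>(exp_law \<Otimes>\<^sub>M expseq.S))"
    by (rule nn_integral_distr[OF m]) (use f in simp)
  also have "\<dots> = (\<integral>\<^sup>+u. (\<integral>\<^sup>+w. f (case_nat u w) \<partial>expseq.S) \<partial>exp_law)"
    using measurable_compose[OF m f] by (subst expseq.P.nn_integral_fst[symmetric]) auto
  finally show ?thesis .
qed

text \<open>A quantitative form of the divergence of the arrival times: it controls the event that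
  the n-th one stays below a fixed level.\<close>

lemma nn_integral_exp_arr: "(\<integral>\<^sup>+\<xi>. ennreal (exp (- arr n \<xi>)) \<partial>expseq.S) = ennreal ((1 / 2) ^ n)"
proof (induction n)
  case 0
  then show ?case by (simp add: arr_def expseq.P.emeasure_space_1)
next
  case (Suc n)
  have half: "(\<integral>\<^sup>+u. ennreal (exp (- u)) \<partial>exp_law) = ennreal (1 / 2)"
  proof -
    have "(\<integral>\<^sup>+u. ennreal (exp (- u)) \<partial>exp_law) = (\<integral>\<^sup>+u. ennreal (exp (- (2 * u))) * indicator {0..} u \<partial>lborel)"
      by (subst nn_integral_exp_law) (auto intro!: nn_integral_cong simp: ennreal_mult'[symmetric] exp_add[symmetric])
    also have "\<dots> = ennreal (0 - (- exp (- (2 * 0)) / 2))"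
    proof (rule nn_integral_FTC_atLeast)
      show "((%v. - exp (- (2 * v)) / 2) has_real_derivative exp (- (2 * x))) (at x)" for x :: real
        by (auto intro!: derivative_eq_intros)
      show "((%v. - exp (- (2 * v)) / 2) \<longlongrightarrow> (0::real)) at_top" by real_asymp
    qed auto
    finally show ?thesis by simp
  qed
  have "(\<integral>\<^sup>+\<xi>. ennreal (exp (- arr (Suc n) \<xi>)) \<partial>expseq.S)
    = (\<integral>\<^sup>+u. (\<integral>\<^sup>+w. ennreal (exp (- arr (Suc n) (case_nat u w))) \<partial>expseq.S) \<partial>exp_law)"
    by (rule nn_integral_expseq_Suc) measurable
  also have "\<dots> = (\<integral>\<^sup>+u. ennreal (exp (- u)) * ennreal ((1 / 2) ^ n) \<partial>exp_law)"
  proof (intro nn_integral_cong)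
    fix u
    have "(\<integral>\<^sup>+w. ennreal (exp (- arr (Suc n) (case_nat u w))) \<partial>expseq.S) = (\<integral>\<^sup>+w. ennreal (exp (- u)) * ennreal (exp (- arr n w)) \<partial>expseq.S)"
      by (intro nn_integral_cong) (simp add: arr_Suc_case ennreal_mult'[symmetric] exp_add[symmetric])
    also have "\<dots> = ennreal (exp (- u)) * ennreal ((1 / 2) ^ n)" by (subst nn_integral_cmult) (auto simp: Suc)
    finally show "(\<integral>\<^sup>+w. ennreal (exp (- arr (Suc n) (case_nat u w))) \<partial>expseq.S) = ennreal (exp (- u)) * ennreal ((1 / 2) ^ n)" .
  qed
  also have "\<dots> = ennreal (1 / 2) * ennreal ((1 / 2) ^ n)" by (subst nn_integral_multc) (auto simp: half)
  also have "\<dots> = ennreal ((1 / 2) ^ Suc n)" by (subst ennreal_mult'[symmetric]) simp_all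
  finally show ?case .
qed

definition tail :: "(real => real) => real => ennreal" where
  "tail \<phi> s = (\<integral>\<^sup>+x. ennreal (1 - \<phi> x) * indicator {s..} x \<partial>lborel)"

context
  fixes \<phi> :: "real => real"
  assumes cont: "continuous_on UNIV \<phi>" and range: "!!x. 0 <= \<phi> x" "!!x. \<phi> x <= 1"
    and fin: "tail \<phi> 0 < top"
begin

lemma phi_meas [measurable]: "\<phi> \<in> borel_measurable borel"
  using cont by (rule borel_measurable_continuous_onI)

text \<open>\<open>A\<close> is an antiderivative of 1 - \<phi> and \<open>L\<close> its limit at
  infinity, so the tail integral becomes the differentiable function L - A.\<close>

lemma tail_primitive:
  "\<exists>A L. (\<forall>x. (A has_real_derivative (1 - \<phi> x)) (at x)) \<and> (\<forall>s\<ge>0. tail \<phi> s = ennreal (L - A s) \<and> A s <= L)"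
proof -
  have "\<exists>F. \<forall>x::real. -\<infinity> < ereal x --> ereal x < \<infinity> --> (F has_vector_derivative (1 - \<phi> x)) (at x)"
    using cont by (intro einterval_antiderivative) (auto simp: continuous_on_eq_continuous_at)
  then obtain A where A: "!!x. (A has_real_derivative (1 - \<phi> x)) (at x)"
    by (auto simp: has_real_derivative_iff_has_vector_derivative)
  define L where "L = A 0 + enn2real (tail \<phi> 0)"
  have "tail \<phi> s = ennreal (L - A s) \<and> A s <= L" if s: "0 <= s" for s
  proof -
    have FTC: "(\<integral>\<^sup>+x. ennreal (1 - \<phi> x) * indicator {0..s} x \<partial>lborel) = ennreal (A s - A 0)"
      using A range s by (intro nn_integral_FTC_Icc) auto
    have mono: "A 0 <= A s"
      using A range s by (intro DERIV_nonneg_imp_nondecreasing[OF s]) (auto intro!: exI[of _ "1 - \<phi> _"])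
    have "tail \<phi> 0 = (\<integral>\<^sup>+x. ennreal (1 - \<phi> x) * indicator {0..s} x + ennreal (1 - \<phi> x) * indicator {s..} x \<partial>lborel)"
      unfolding tail_def
    proof (rule nn_integral_cong_AE)
      have "AE x in lborel. x \<noteq> s" by (rule AE_lborel_singleton)
      then show "AE x in lborel. ennreal (1 - \<phi> x) * indicator {0..} x = ennreal (1 - \<phi> x) * indicator {0..s} x + ennreal (1 - \<phi> x) * indicator {s..} x"
        by eventually_elim (use s in \<open>auto simp: indicator_def\<close>)
    qed
    also have "\<dots> = ennreal (A s - A 0) + tail \<phi> s"
      unfolding tail_def FTC[symmetric] by (rule nn_integral_add) measurable
    finally have e: "tail \<phi> 0 = ennreal (A s - A 0) + tail \<phi> s" .
    with fin have "tail \<phi> s < top" by (simp add: ennreal_add_eq_top less_top)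
    then obtain r where r: "tail \<phi> s = ennreal r" "0 <= r" by (cases "tail \<phi> s") auto
    have "tail \<phi> 0 = ennreal (A s - A 0 + r)" using e r mono by (simp add: ennreal_plus[symmetric] del: ennreal_plus)
    then have "enn2real (tail \<phi> 0) = A s - A 0 + r" using r(2) mono by (simp del: ennreal_plus)
    then have "L - A s = r" by (simp add: L_def)
    then show ?thesis using r by simp
  qed
  with A show ?thesis by blast
qed

text \<open>After the substitution v = s + u the integrand is exp s times \<phi> v * exp (A v - v -
  L). This is the derivative of - exp (A v - v - L), because A has derivative 1 - \<phi>; the
  fundamental theorem of calculus finishes the computation.\<close>

lemma tail_fixed_point:
  assumes s: "0 <= s"
  shows "(\<integral>\<^sup>+u. ennreal (\<phi> (s + u) * lap (tail \<phi> (s + u))) \<partial>exp_law) = ennreal (lap (tail \<phi> s))"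
proof -
  obtain A L where A: "!!x. (A has_real_derivative (1 - \<phi> x)) (at x)"
    and L: "!!s. 0 <= s ==> tail \<phi> s = ennreal (L - A s)" "!!s. 0 <= s ==> A s <= L" using tail_primitive by blast
  have lt: "lap (tail \<phi> v) = exp (A v - L)" if "0 <= v" for v
    using L[OF that] by (simp add: lap_ennreal)
  have Am [measurable]: "A \<in> borel_measurable borel"
    using A by (intro borel_measurable_continuous_onI) (meson DERIV_isCont continuous_at_imp_continuous_on)
  have tm: "(%u. \<phi> (s + u) * exp (A (s + u) - L)) \<in> borel_measurable borel" by measurable
  have "(\<integral>\<^sup>+u. ennreal (\<phi> (s + u) * lap (tail \<phi> (s + u))) \<partial>exp_law)
    = (\<integral>\<^sup>+u. ennreal (\<phi> (s + u) * exp (A (s + u) - L)) \<partial>exp_law)"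
  proof (rule nn_integral_cong_AE)
    have "AE u in exp_law. 0 <= u"
      unfolding exp_law_def by (subst AE_density) (auto simp: exponential_density_def)
    then show "AE u in exp_law. ennreal (\<phi> (s + u) * lap (tail \<phi> (s + u))) = ennreal (\<phi> (s + u) * exp (A (s + u) - L))"
      by eventually_elim (use s lt in simp)
  qed
  also have "\<dots> = (\<integral>\<^sup>+u. ennreal (exp (- u)) * ennreal (\<phi> (s + u) * exp (A (s + u) - L)) * indicator {0..} u \<partial>lborel)"
    using tm by (intro nn_integral_exp_law) simp
  also have "\<dots> = (\<integral>\<^sup>+u. ennreal (exp s) * (ennreal (\<phi> (s + 1 * u) * exp (A (s + 1 * u) - (s + 1 * u) - L)) * indicator {s..} (s + 1 * u)) \<partial>lborel)"
  proof (intro nn_integral_cong)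
    fix u
    have "exp (- u) * (\<phi> (s + u) * exp (A (s + u) - L)) = exp s * (\<phi> (s + u) * exp (A (s + u) - (s + u) - L))"
      by (simp add: exp_add[symmetric] exp_diff exp_minus field_simps)
    then have "ennreal (exp (- u)) * ennreal (\<phi> (s + u) * exp (A (s + u) - L)) = ennreal (exp s) * ennreal (\<phi> (s + u) * exp (A (s + u) - (s + u) - L))"
      by (simp only: ennreal_mult'[symmetric] exp_ge_zero)
    then show "ennreal (exp (- u)) * ennreal (\<phi> (s + u) * exp (A (s + u) - L)) * indicator {0..} u
       = ennreal (exp s) * (ennreal (\<phi> (s + 1 * u) * exp (A (s + 1 * u) - (s + 1 * u) - L)) * indicator {s..} (s + 1 * u))"
      by (cases "0 <= u") (simp_all add: indicator_def)
  qed
  also have "\<dots> = ennreal (exp s) * (\<integral>\<^sup>+u. ennreal (\<phi> (s + 1 * u) * exp (A (s + 1 * u) - (s + 1 * u) - L)) * indicator {s..} (s + 1 * u) \<partial>lborel)"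
    by (rule nn_integral_cmult) measurable
  also have "(\<integral>\<^sup>+u. ennreal (\<phi> (s + 1 * u) * exp (A (s + 1 * u) - (s + 1 * u) - L)) * indicator {s..} (s + 1 * u) \<partial>lborel)
      = (\<integral>\<^sup>+v. ennreal (\<phi> v * exp (A v - v - L)) * indicator {s..} v \<partial>lborel)"
    using nn_integral_real_affine[of "%v. ennreal (\<phi> v * exp (A v - v - L)) * indicator {s..} v" 1 s] by simp
  also have "\<dots> = ennreal (0 - (- exp (A s - s - L)))"
  proof (rule nn_integral_FTC_atLeast)
    show "(%v. \<phi> v * exp (A v - v - L)) \<in> borel_measurable borel" by measurable
    show "((%v. - exp (A v - v - L)) has_real_derivative \<phi> x * exp (A x - x - L)) (at x)" for x
      by (auto intro!: derivative_eq_intros A simp: algebra_simps)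
    show "0 <= \<phi> x * exp (A x - x - L)" for x using range by simp
    show "((%v. - exp (A v - v - L)) \<longlongrightarrow> 0) at_top"
    proof (rule Lim_null_comparison)
      show "\<forall>\<^sub>F v in at_top. norm (- exp (A v - v - L)) <= exp (- v)"
        using eventually_ge_at_top[of 0] by eventually_elim (use L(2) in auto)
      show "((%v. exp (- v)) \<longlongrightarrow> (0::real)) at_top"
        using exp_at_bot filterlim_uminus_at_bot_at_top by (rule filterlim_compose)
    qed
  qed
  also have "ennreal (exp s) * ennreal (0 - (- exp (A s - s - L))) = ennreal (lap (tail \<phi> s))"
    using s by (simp add: lt ennreal_mult'[symmetric] exp_add[symmetric])
  finally show ?thesis .
qed

lemma tail_lap_meas [measurable]: "(%s. lap (tail \<phi> s)) \<in> borel_measurable borel"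
proof -
  have "mono (%s. lap (tail \<phi> s))"
    unfolding tail_def by (intro monoI lap_antimono nn_integral_mono) (auto simp: indicator_def)
  then show ?thesis by (rule borel_measurable_mono)
qed

lemma arr_fixed_point:
  "0 <= s ==> (\<integral>\<^sup>+\<xi>. ennreal ((\<Prod>k<n. \<phi> (s + arr (Suc k) \<xi>)) * lap (tail \<phi> (s + arr n \<xi>))) \<partial>expseq.S) = ennreal (lap (tail \<phi> s))"
proof (induction n arbitrary: s)
  case 0
  then show ?case by (simp add: arr_def expseq.P.emeasure_space_1)
next
  case (Suc n)
  have "(\<integral>\<^sup>+\<xi>. ennreal ((\<Prod>k<Suc n. \<phi> (s + arr (Suc k) \<xi>)) * lap (tail \<phi> (s + arr (Suc n) \<xi>))) \<partial>expseq.S)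
    = (\<integral>\<^sup>+u. (\<integral>\<^sup>+w. ennreal ((\<Prod>k<Suc n. \<phi> (s + arr (Suc k) (case_nat u w))) * lap (tail \<phi> (s + arr (Suc n) (case_nat u w)))) \<partial>expseq.S) \<partial>exp_law)"
    by (rule nn_integral_expseq_Suc) measurable
  also have "\<dots> = (\<integral>\<^sup>+u. ennreal (\<phi> (s + u) * lap (tail \<phi> (s + u))) \<partial>exp_law)"
  proof (rule nn_integral_cong_AE)
    have "AE u in exp_law. 0 <= u"
      unfolding exp_law_def by (subst AE_density) (auto simp: exponential_density_def)
    then show "AE u in exp_law. (\<integral>\<^sup>+w. ennreal ((\<Prod>k<Suc n. \<phi> (s + arr (Suc k) (case_nat u w))) * lap (tail \<phi> (s + arr (Suc n) (case_nat u w)))) \<partial>expseq.S)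
      = ennreal (\<phi> (s + u) * lap (tail \<phi> (s + u)))"
    proof eventually_elim
      case (elim u)
      have "(\<integral>\<^sup>+w. ennreal ((\<Prod>k<Suc n. \<phi> (s + arr (Suc k) (case_nat u w))) * lap (tail \<phi> (s + arr (Suc n) (case_nat u w)))) \<partial>expseq.S)
        = (\<integral>\<^sup>+w. ennreal (\<phi> (s + u)) * ennreal ((\<Prod>k<n. \<phi> (s + u + arr (Suc k) w)) * lap (tail \<phi> (s + u + arr n w))) \<partial>expseq.S)"
      proof (intro nn_integral_cong)
        fix w
        have "(\<Prod>k<Suc n. \<phi> (s + arr (Suc k) (case_nat u w))) = \<phi> (s + u) * (\<Prod>k<n. \<phi> (s + u + arr (Suc k) w))"
          unfolding prod.lessThan_Suc_shift arr_Suc_case by (simp add: arr_def add.assoc)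
        then show "ennreal ((\<Prod>k<Suc n. \<phi> (s + arr (Suc k) (case_nat u w))) * lap (tail \<phi> (s + arr (Suc n) (case_nat u w))))
          = ennreal (\<phi> (s + u)) * ennreal ((\<Prod>k<n. \<phi> (s + u + arr (Suc k) w)) * lap (tail \<phi> (s + u + arr n w)))"
          using range by (simp only: arr_Suc_case) (simp add: ennreal_mult'[symmetric] mult.assoc add.assoc)
      qed
      also have "\<dots> = ennreal (\<phi> (s + u)) * ennreal (lap (tail \<phi> (s + u)))"
        using Suc elim by (subst nn_integral_cmult) auto
      also have "\<dots> = ennreal (\<phi> (s + u) * lap (tail \<phi> (s + u)))" using range by (simp add: ennreal_mult'[symmetric])
      finally show ?case .
    qed
  qed
  also have "\<dots> = ennreal (lap (tail \<phi> s))" by (rule tail_fixed_point[OF Suc.prems])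
  finally show ?case .
qed

lemma tail_tendsto_0: "(%n. tail \<phi> (real n)) ----> 0"
proof -
  have "(%n. tail \<phi> (real n)) ----> (\<integral>\<^sup>+x. 0 \<partial>(lborel :: real measure))"
    unfolding tail_def
  proof (rule nn_integral_dominated_convergence[where u="%n x. ennreal (1 - \<phi> x) * indicator {real n..} x"
        and u'="%_. 0" and w="%x. ennreal (1 - \<phi> x) * indicator {0..} x"])
    show "(\<integral>\<^sup>+x. ennreal (1 - \<phi> x) * indicator {0..} x \<partial>lborel) < \<infinity>" using fin by (simp add: tail_def)
    show "AE x in lborel. ennreal (1 - \<phi> x) * indicator {real n..} x <= ennreal (1 - \<phi> x) * indicator {0..} x" for n
      by (auto simp: indicator_def)
    show "AE x in lborel. (%n. ennreal (1 - \<phi> x) * indicator {real n..} x) ----> 0"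
    proof (rule AE_I2)
      fix x :: real
      obtain n0 :: nat where n0: "x < real n0" using reals_Archimedean2 by blast
      have "\<forall>\<^sub>F n in sequentially. ennreal (1 - \<phi> x) * indicator {real n..} x = 0"
        using eventually_ge_at_top[of n0] by eventually_elim (use n0 in \<open>auto simp: indicator_def\<close>)
      then show "(%n. ennreal (1 - \<phi> x) * indicator {real n..} x) ----> 0" by (rule tendsto_eventually)
    qed
  qed measurable
  then show ?thesis by simp
qed

text \<open>Compared with \<open>arr_fixed_point\<close>, the factor
  \<open>lap (tail \<phi> (arr n \<xi>))\<close> has to be removed. It is at most 1, which gives one
  bound, and it is close to 1 with high probability since the arrival times diverge, which gives the
  other.\<close>

lemma arrival_product:
  "(%n. \<integral>\<^sup>+\<xi>. ennreal (arrp \<phi> n \<xi>) \<partial>expseq.S) ----> ennreal (lap (tail \<phi> 0))"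
proof -
  define a where "a n = (\<integral>\<^sup>+\<xi>. ennreal (arrp \<phi> n \<xi>) \<partial>expseq.S)" for n
  define H where "H x = lap (tail \<phi> x)" for x
  have Hm [measurable]: "H \<in> borel_measurable borel" unfolding H_def[abs_def] by measurable
  have H01: "0 <= H x" "H x <= 1" for x by (simp_all add: H_def)
  have Hmono: "H x <= H y" if "x <= y" for x y
    unfolding H_def tail_def using that by (intro lap_antimono nn_integral_mono) (auto simp: indicator_def)
  have p01: "0 <= (arrp \<phi> n \<xi>)" "(arrp \<phi> n \<xi>) <= 1" for n \<xi>
    using range by (auto intro!: prod_nonneg prod_le_1)
  have fp: "(\<integral>\<^sup>+\<xi>. ennreal ((arrp \<phi> n \<xi>) * H (arr n \<xi>)) \<partial>expseq.S) = ennreal (H 0)" for n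
    using arr_fixed_point[of 0 n] by (simp add: H_def)
  have low: "ennreal (H 0) <= a n" for n
    unfolding fp[of n, symmetric] a_def
  proof (intro nn_integral_mono ennreal_leI)
    fix \<xi> show "(arrp \<phi> n \<xi>) * H (arr n \<xi>) <= (arrp \<phi> n \<xi>)"
      using p01[of \<xi> n] H01[of "arr n \<xi>"] by (simp add: mult_left_le)
  qed
  have up: "a n <= ennreal (H 0 + (1 - H R) + exp R * (1 / 2) ^ n)" for n R
  proof -
    \<comment> \<open>Split at the level R: beyond it \<open>H\<close> is at least
      \<open>H R\<close>, and below it 1 is at most exp (R - arr n \<xi>).\<close>
    have pt: "(arrp \<phi> n \<xi>) <= (arrp \<phi> n \<xi>) * H (arr n \<xi>) + ((1 - H R) + exp R * exp (- arr n \<xi>))" for \<xi>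
    proof -
      have "1 - H (arr n \<xi>) <= (1 - H R) + exp R * exp (- arr n \<xi>)"
      proof (cases "R <= arr n \<xi>")
        case True
        have "0 <= exp R * exp (- arr n \<xi>)" by simp
        then show ?thesis using Hmono[OF True] by linarith
      next
        case False
        then have "1 <= exp (R - arr n \<xi>)" by simp
        also have "\<dots> = exp R * exp (- arr n \<xi>)" by (simp add: exp_diff exp_minus field_simps)
        finally show ?thesis using H01[of R] H01[of "arr n \<xi>"] by linarith
      qed
      moreover have "(arrp \<phi> n \<xi>) * (1 - H (arr n \<xi>)) <= 1 * (1 - H (arr n \<xi>))"
        using p01[of \<xi> n] H01[of "arr n \<xi>"] by (intro mult_right_mono) auto
      ultimately show ?thesis by (simp add: right_diff_distrib)
    qed
    have "a n <= (\<integral>\<^sup>+\<xi>. ennreal ((arrp \<phi> n \<xi>) * H (arr n \<xi>)) + (ennreal (1 - H R) + ennreal (exp R) * ennreal (exp (- arr n \<xi>))) \<partial>expseq.S)"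
      unfolding a_def
    proof (intro nn_integral_mono)
      fix \<xi>
      have nn: "0 <= (arrp \<phi> n \<xi>) * H (arr n \<xi>)" using p01[of \<xi> n] H01 by simp
      have "ennreal (arrp \<phi> n \<xi>) <= ennreal ((arrp \<phi> n \<xi>) * H (arr n \<xi>) + ((1 - H R) + exp R * exp (- arr n \<xi>)))"
        by (rule ennreal_leI[OF pt])
      also have "\<dots> = ennreal ((arrp \<phi> n \<xi>) * H (arr n \<xi>)) + (ennreal (1 - H R) + ennreal (exp R) * ennreal (exp (- arr n \<xi>)))"
        using nn H01[of R] by (simp add: ennreal_plus ennreal_mult')
      finally show "ennreal (arrp \<phi> n \<xi>) <= ennreal ((arrp \<phi> n \<xi>) * H (arr n \<xi>)) + (ennreal (1 - H R) + ennreal (exp R) * ennreal (exp (- arr n \<xi>)))" .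
    qed
    also have "\<dots> = ennreal (H 0) + (ennreal (1 - H R) + ennreal (exp R) * ennreal ((1 / 2) ^ n))"
      by (subst nn_integral_add; simp add: fp nn_integral_add nn_integral_cmult nn_integral_exp_arr expseq.P.emeasure_space_1)
    also have "\<dots> = ennreal (H 0 + (1 - H R) + exp R * (1 / 2) ^ n)"
      using H01 by (simp add: ennreal_plus[symmetric] ennreal_mult'[symmetric] add.assoc del: ennreal_plus)
    finally show ?thesis .
  qed
  have "a ----> ennreal (H 0)"
  proof (rule order_tendstoI)
    fix y assume "y < ennreal (H 0)"
    then show "\<forall>\<^sub>F n in sequentially. y < a n" by (intro always_eventually allI less_le_trans[OF _ low])
  next
    fix y assume y: "ennreal (H 0) < y"
    obtain e where e: "0 < e" "ennreal (H 0 + e) < y"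
    proof -
      obtain z where z: "ennreal (H 0) < z" "z < y" using dense[OF y] by blast
      then obtain r where r: "z = ennreal r" "0 <= r" by (cases z) (auto simp: top_unique)
      with z H01 have "H 0 < r" by (simp add: ennreal_less_iff)
      then show ?thesis using that[of "r - H 0"] z r by simp
    qed
    \<comment> \<open>The level is fixed first, at a natural number \<open>m\<close> where
      \<open>H\<close> is within e / 2 of 1; only then does \<open>n\<close> grow.\<close>
    have "(%n. H (real n)) ----> 1" using tendsto_lap[OF tail_tendsto_0] by (simp add: H_def)
    then have "\<forall>\<^sub>F n in sequentially. 1 - e / 2 < H (real n)" using e(1) by (intro order_tendstoD) auto
    then obtain m where m: "1 - e / 2 < H (real m)" using eventually_happens by fastforce
    have t: "(%n. exp (real m) * (1 / 2) ^ n) ----> (0::real)"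
      by (intro tendsto_mult_right_zero LIMSEQ_realpow_zero) auto
    have "\<forall>\<^sub>F n in sequentially. exp (real m) * (1 / 2) ^ n < e / 2" using order_tendstoD(2)[OF t, of "e / 2"] e(1) by simp
    then show "\<forall>\<^sub>F n in sequentially. a n < y"
    proof eventually_elim
      case (elim n)
      have "a n <= ennreal (H 0 + (1 - H (real m)) + exp (real m) * (1 / 2) ^ n)" by (rule up)
      also have "\<dots> <= ennreal (H 0 + e)" using m elim by (intro ennreal_leI) linarith
      finally show ?case using e(2) by order
    qed
  qed
  then show ?thesis by (simp add: a_def[abs_def] H_def)
qed

end

declare phi_meas [measurable del] tail_lap_meas [measurable del]

section \<open>One-dimensional stable exponents\<close>

text \<open>The substitution u = s powr (- 1 / \<alpha>) gives the integral of (1 - exp (- u x))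
  against \<alpha> u powr (- \<alpha> - 1), so the value is \<Gamma>(1 - \<alpha>) x powr \<alpha>
  for finite x and 0 < \<alpha> < 1. The variable s is kept because the arrival times live on that
  scale.\<close>

definition kap :: "real => ennreal => ennreal" where
  "kap \<alpha> x = (\<integral>\<^sup>+s. ennreal (1 - lap (ennreal (s powr (- 1 / \<alpha>)) * x)) * indicator {0<..} s \<partial>lborel)"

lemma powr_borel_measurable [measurable]: "(%s::real. s powr c) \<in> borel_measurable borel"
  by measurable

text \<open>The factor b is absorbed by replacing s with b powr \<alpha> times s.\<close>

lemma kap_scale:
  assumes a: "0 < \<alpha>" and b: "0 < b"
  shows "kap \<alpha> (ennreal b * x) = ennreal (b powr \<alpha>) * kap \<alpha> x"
proof -
  have "kap \<alpha> (ennreal b * x) = ennreal \<bar>b powr \<alpha>\<bar> * (\<integral>\<^sup>+s. ennreal (1 - lap (ennreal ((0 + b powr \<alpha> * s) powr (- 1 / \<alpha>)) * (ennreal b * x))) * indicator {0<..} (0 + b powr \<alpha> * s) \<partial>lborel)"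
    unfolding kap_def using b by (intro nn_integral_real_affine) auto
  also have "(\<integral>\<^sup>+s. ennreal (1 - lap (ennreal ((0 + b powr \<alpha> * s) powr (- 1 / \<alpha>)) * (ennreal b * x))) * indicator {0<..} (0 + b powr \<alpha> * s) \<partial>lborel) = kap \<alpha> x"
    unfolding kap_def
  proof (intro nn_integral_cong)
    fix s :: real
    show "ennreal (1 - lap (ennreal ((0 + b powr \<alpha> * s) powr (- 1 / \<alpha>)) * (ennreal b * x))) * indicator {0<..} (0 + b powr \<alpha> * s)
      = ennreal (1 - lap (ennreal (s powr (- 1 / \<alpha>)) * x)) * indicator {0<..} s"
    proof (cases "0 < s")
      case True
      have "(b powr \<alpha> * s) powr (- 1 / \<alpha>) * b = (b powr \<alpha>) powr (- 1 / \<alpha>) * s powr (- 1 / \<alpha>) * b"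
        using True b by (simp add: powr_mult)
      also have "(b powr \<alpha>) powr (- 1 / \<alpha>) = 1 / b" using a b by (simp add: powr_powr powr_minus_divide)
      finally have "(b powr \<alpha> * s) powr (- 1 / \<alpha>) * b = s powr (- 1 / \<alpha>)" using b by simp
      then have "ennreal ((b powr \<alpha> * s) powr (- 1 / \<alpha>)) * (ennreal b * x) = ennreal (s powr (- 1 / \<alpha>)) * x"
        using b by (simp add: mult.assoc[symmetric] ennreal_mult'[symmetric])
      then show ?thesis using True b by simp
    next
      case False
      then have "\<not> 0 < b powr \<alpha> * s" using b by (simp add: zero_less_mult_iff)
      then show ?thesis using False by simp
    qed
  qed
  finally show ?thesis by simp
qed

lemma kap_0 [simp]: "kap \<alpha> 0 = 0"
  by (simp add: kap_def)

definition kapc :: "real => real" where "kapc \<alpha> = enn2real (kap \<alpha> 1)"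

text \<open>The integrand is at most 1 below s = 1 and at most s powr (- 1 / \<alpha>) above, which
  is integrable there because \<alpha> < 1. It is positive on the whole half-line, so the constant
  is not 0.\<close>

lemma kap_1:
  assumes a: "0 < \<alpha>" "\<alpha> < 1"
  shows "kap \<alpha> 1 = ennreal (kapc \<alpha>)" "0 < kapc \<alpha>"
proof -
  have "kap \<alpha> 1 <= (\<integral>\<^sup>+s. indicator {0..<1} s + ennreal (s powr (- 1 / \<alpha>)) * indicator {1..} s \<partial>lborel)"
    unfolding kap_def
  proof (intro nn_integral_mono)
    fix s :: real
    show "ennreal (1 - lap (ennreal (s powr (- 1 / \<alpha>)) * 1)) * indicator {0<..} s <= indicator {0..<1} s + ennreal (s powr (- 1 / \<alpha>)) * indicator {1..} s"
      using one_minus_lap_le[of "ennreal (s powr (- 1 / \<alpha>))"] by (auto simp: indicator_def)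
  qed
  also have "\<dots> = 1 + (\<integral>\<^sup>+s. ennreal (s powr (- 1 / \<alpha>)) * indicator {1..} s \<partial>lborel)"
    by (subst nn_integral_add) auto
  also have "(\<integral>\<^sup>+s. ennreal (s powr (- 1 / \<alpha>)) * indicator {1..} s \<partial>lborel) = ennreal (0 - (1 powr (1 - 1 / \<alpha>) / (1 - 1 / \<alpha>)))"
  proof (rule nn_integral_FTC_atLeast[where F="%s. s powr (1 - 1 / \<alpha>) / (1 - 1 / \<alpha>)"])
    have p: "1 - 1 / \<alpha> < 0" using a by (simp add: field_simps)
    show "((%s. s powr (1 - 1 / \<alpha>) / (1 - 1 / \<alpha>)) has_real_derivative x powr (- 1 / \<alpha>)) (at x)" if "1 <= x" for x
      using that p by (auto intro!: derivative_eq_intros)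
    have "((%s. s powr (1 - 1 / \<alpha>)) \<longlongrightarrow> 0) at_top"
      using p by (intro tendsto_neg_powr filterlim_ident) auto
    then show "((%s. s powr (1 - 1 / \<alpha>) / (1 - 1 / \<alpha>)) \<longlongrightarrow> 0) at_top" by (rule tendsto_divide_zero)
  qed auto
  finally have "kap \<alpha> 1 < top" by (rule order_le_less_trans) simp
  then show 1: "kap \<alpha> 1 = ennreal (kapc \<alpha>)" by (simp add: kapc_def)
  have "kap \<alpha> 1 \<noteq> 0"
  proof
    assume "kap \<alpha> 1 = 0"
    then have "AE s in lborel. ennreal (1 - lap (ennreal (s powr (- 1 / \<alpha>)) * 1)) * indicator {0<..} s = 0"
      unfolding kap_def by (subst (asm) nn_integral_0_iff_AE) auto
    moreover have "ennreal (1 - lap (ennreal (s powr (- 1 / \<alpha>)) * 1)) * indicator {0<..} s \<noteq> 0" if "s \<in> {0<..<1}" for s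
      using that lap_less_1_iff[of "ennreal (s powr (- 1 / \<alpha>))"] by (auto simp: zero_less_iff_neq_zero)
    ultimately have "AE s in lborel. s \<notin> {0<..<1::real}" by (rule_tac eventually_mono) blast+
    then have "emeasure lborel {0<..<1::real} = 0"
      by (subst (asm) AE_iff_measurable[where N="{0<..<1}"]) auto
    then show False by simp
  qed
  then show "0 < kapc \<alpha>" unfolding 1 by (simp add: ennreal_eq_0_iff not_le)
qed

lemma kap_eq:
  assumes a: "0 < \<alpha>" "\<alpha> < 1" and r: "0 <= r"
  shows "kap \<alpha> (ennreal r) = ennreal (kapc \<alpha> * r powr \<alpha>)"
proof (cases "r = 0")
  case False
  then have "kap \<alpha> (ennreal r * 1) = ennreal (r powr \<alpha>) * kap \<alpha> 1" using r a by (intro kap_scale) auto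
  then show ?thesis using kap_1[OF a] by (simp add: ennreal_mult'[symmetric] mult.commute)
qed simp

section \<open>Polar decomposition\<close>

lemma sigma_finite_density_pos: "sigma_finite_measure (density lborel (indicator {0<..}) :: real measure)"
proof -
  have "sigma_finite_measure (density lborel (indicator {0<..} :: real => ennreal)) \<longleftrightarrow>
      (AE x in lborel. indicator {0<..} (x :: real) \<noteq> (\<infinity> :: ennreal))"
    by (rule sigma_finite_measure.sigma_finite_iff_density_finite[OF sigma_finite_lborel]) simp
  then show ?thesis by (simp add: indicator_def)
qed

context lcsc
begin

context
  fixes B :: "nat => 'x set"
  assumes rcb: "relatively_compact_base B"
begin

text \<open>The radial coordinate. A positive factor leaves \<open>first_index\<close> unchanged, so
  \<open>rad\<close> is homogeneous of degree 1, and the sphere is the set of Radon measures where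
  it equals 1.\<close>

definition rad :: "'x measure => ennreal" where "rad \<mu> = emeasure \<mu> (B (first_index B \<mu>))"

definition hat :: "'x measure => 'x measure" where "hat \<mu> = scale_measure (inverse (rad \<mu>)) \<mu>"

lemma base_borel [measurable]: "B i \<in> sets borel"
proof (cases "i = 0")
  case False
  then have "open (B i)" using rcb unfolding relatively_compact_base_def
    by (intro topological_basis_open[of "B ` {1..}"]) auto
  then show ?thesis by simp
qed (use rcb in \<open>simp add: relatively_compact_base_def\<close>)

text \<open>The base sets with index at least 1 cover the space and are relatively compact. A
  non-zero Radon measure charges one of them, with finite mass, so the least index in
  \<open>first_index\<close> exists.\<close>

lemma rad_pos:
  assumes mu: "\<mu> \<in> radon_measures" "\<mu> \<noteq> null_measure borel"
  shows "0 < rad \<mu>" "rad \<mu> < top"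
proof -
  have tb: "topological_basis (B ` {1..})" using rcb by (simp add: relatively_compact_base_def)
  have "\<exists>i\<ge>1. 0 < emeasure \<mu> (B i)"
  proof (rule ccontr)
    assume "\<not> ?thesis"
    then have z: "emeasure \<mu> (B i) = 0" if "1 <= i" for i using that by (auto simp: zero_less_iff_neq_zero)
    have "exh n \<subseteq> (\<Union>i\<in>{1..}. B i)" for n
    proof
      fix x assume "x \<in> exh n"
      obtain b where "b \<in> B ` {1..}" "x \<in> b" using topological_basisE[OF tb open_UNIV UNIV_I, of x] by metis
      then show "x \<in> (\<Union>i\<in>{1..}. B i)" by blast
    qed
    then have "emeasure \<mu> (exh n) <= emeasure \<mu> (\<Union>i\<in>{1..}. B i)" for n
      by (intro emeasure_mono) (auto simp: sets_radon_measure[OF mu(1)])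
    moreover have "emeasure \<mu> (\<Union>i\<in>{1..}. B i) = 0"
      using z by (intro null_setsD1 null_sets_UN') (auto simp: null_sets_def sets_radon_measure[OF mu(1)])
    ultimately show False using nonzero_iff_exh[OF mu(1)] mu(2) by auto
  qed
  then obtain i where i: "1 <= i" "0 < emeasure \<mu> (B i)" by blast
  then have "emeasure \<mu> (B i) < \<infinity>" using mu(1) rcb base_borel by (auto simp: relatively_compact_base_def radon_measures_def)
  with i have "0 < emeasure \<mu> (B (first_index B \<mu>)) \<and> emeasure \<mu> (B (first_index B \<mu>)) < \<infinity>"
    unfolding first_index_def by (intro LeastI) simp
  then show "0 < rad \<mu>" "rad \<mu> < top" by (simp_all add: rad_def)
qed

lemma rad_scale:
  assumes "0 < t"
  shows "rad (scale_measure (ennreal t) \<mu>) = ennreal t * rad \<mu>"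
proof -
  have "0 < ennreal t * x \<and> ennreal t * x < \<infinity> \<longleftrightarrow> 0 < x \<and> x < \<infinity>" for x
    using assms by (auto simp: ennreal_zero_less_mult_iff ennreal_mult_less_top)
  then show ?thesis by (simp add: rad_def first_index_def)
qed

lemma rad_measurable [measurable]: "rad \<in> borel_measurable radon_space"
proof -
  have "first_index B \<in> measurable radon_space (count_space UNIV)"
    unfolding first_index_def[abs_def] by measurable
  then show ?thesis unfolding rad_def[abs_def]
    by (intro measurable_compose_countable[where f="%i \<mu>. emeasure \<mu> (B i)" and g="first_index B"]) measurable
qed

lemma sphere_eq: "sphere_of B = {\<mu> \<in> radon_measures. rad \<mu> = 1}"
  by (auto simp: sphere_of_def rad_def)

lemma sphere_sets [measurable]: "sphere_of B \<in> sets radon_space"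
proof -
  have "{\<mu> \<in> space radon_space. rad \<mu> = 1} \<in> sets radon_space" by measurable
  then show ?thesis by (simp add: sphere_eq)
qed

abbreviation "SB \<equiv> restrict_space radon_space (sphere_of B)"

lemma space_SB: "space SB = sphere_of B"
  by (auto simp: space_restrict_space sphere_eq)

lemma rad_hat_cancel:
  assumes "\<mu> \<in> space nonzero_radon_space"
  shows "scale_measure (rad \<mu>) (hat \<mu>) = \<mu>" "hat \<mu> \<in> sphere_of B" "hat \<mu> \<in> radon_measures"
proof -
  have mu: "\<mu> \<in> radon_measures" "\<mu> \<noteq> null_measure borel" using assms by (auto simp: space_nonzero)
  note r = rad_pos[OF mu]
  obtain x where x: "rad \<mu> = ennreal x" "0 < x" using r by (cases "rad \<mu>") auto
  have t: "inverse (rad \<mu>) = ennreal (inverse x)" "0 < inverse x" using x by (simp_all add: inverse_ennreal)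
  have 1: "rad \<mu> * inverse (rad \<mu>) = 1" unfolding t(1) using x by (simp add: ennreal_mult'[symmetric])
  show "scale_measure (rad \<mu>) (hat \<mu>) = \<mu>" using 1 by (simp add: hat_def mult.commute)
  show h: "hat \<mu> \<in> radon_measures" unfolding hat_def t using mu by (intro scale_measure_radon) auto
  have "rad (hat \<mu>) = 1" unfolding hat_def t(1) rad_scale[OF t(2)] using 1 t(1) by (simp add: mult.commute)
  then show "hat \<mu> \<in> sphere_of B" using h by (simp add: sphere_eq)
qed

lemma hat_scale:
  assumes "\<mu> \<in> sphere_of B" "0 < t"
  shows "hat (scale_measure (ennreal t) \<mu>) = \<mu>" "rad (scale_measure (ennreal t) \<mu>) = ennreal t"
    "scale_measure (ennreal t) \<mu> \<in> space nonzero_radon_space"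
proof -
  have mu: "\<mu> \<in> radon_measures" "rad \<mu> = 1" using assms(1) by (auto simp: sphere_eq)
  show r: "rad (scale_measure (ennreal t) \<mu>) = ennreal t" using mu rad_scale[OF assms(2)] by simp
  have "inverse (ennreal t) * ennreal t = 1" using assms(2) by (simp add: inverse_ennreal ennreal_mult'[symmetric])
  then show "hat (scale_measure (ennreal t) \<mu>) = \<mu>" unfolding hat_def r by simp
  have "rad (null_measure borel) = 0" by (simp add: rad_def)
  then have "scale_measure (ennreal t) \<mu> \<noteq> null_measure borel" using r assms(2) by auto
  then show "scale_measure (ennreal t) \<mu> \<in> space nonzero_radon_space"
    using mu(1) by (auto simp: space_nonzero intro: scale_measure_radon)
qed

context
  fixes \<alpha> :: real and \<Lambda> :: "'x measure measure"
  assumes \<alpha>: "0 < \<alpha>" "\<alpha> < 1" and st: "stable_intensity \<alpha> \<Lambda>"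
begin

lemma sL: "sets \<Lambda> = sets nonzero_radon_space" using st by (simp add: stable_intensity_def)

lemma spL: "space \<Lambda> = space nonzero_radon_space" by (rule sets_eq_imp_space_eq[OF sL])

lemma measurable_from_radon: "f \<in> measurable radon_space N ==> f \<in> measurable \<Lambda> N"
  unfolding measurable_cong_sets[OF sL refl] nonzero_radon_space_def by (rule measurable_restrict_space1)

lemma rad_measL [measurable]: "rad \<in> borel_measurable \<Lambda>"
  by (rule measurable_from_radon[OF rad_measurable])

lemma hat_measL [measurable]: "hat \<in> measurable \<Lambda> SB"
proof (rule measurable_restrict_space2)
  show "hat \<in> space \<Lambda> \<rightarrow> sphere_of B" using rad_hat_cancel(2) by (auto simp: spL)
  have "(%\<mu>. scale_measure (inverse (rad \<mu>)) \<mu>) \<in> measurable \<Lambda> radon_space"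
  proof (rule measurable_scale_measure_radon)
    show "(%\<mu>. \<mu>) \<in> measurable \<Lambda> radon_space" by (rule measurable_from_radon) simp
    fix \<mu> assume "\<mu> \<in> space \<Lambda>"
    then have "0 < rad \<mu>" by (intro rad_pos) (auto simp: spL space_nonzero)
    then show "inverse (rad \<mu>) < top" by (simp add: less_top[symmetric] ennreal_inverse_eq_top_iff)
  qed measurable
  then show "hat \<in> measurable \<Lambda> radon_space" by (simp add: hat_def[abs_def])
qed

text \<open>The spectral measure without its gamma factor, built as an image measure so that
  countable additivity needs no proof; \<open>spectral_measure_eq\<close> identifies it with the
  prescribed set function.\<close>

definition shat :: "'x measure measure" where
  "shat = distr (density \<Lambda> (indicator {\<nu> \<in> space \<Lambda>. 1 <= rad \<nu>})) SB hat"

lemma outer_sets [measurable]: "{\<nu> \<in> space \<Lambda>. 1 <= rad \<nu>} \<in> sets \<Lambda>" by measurable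

lemma sets_shat [simp]: "sets shat = sets SB" by (simp add: shat_def)

lemma space_shat: "space shat = sphere_of B" by (simp add: shat_def space_SB)

lemma emeasure_shat:
  assumes A: "A \<in> sets SB"
  shows "emeasure shat A = emeasure \<Lambda> {\<nu> \<in> space \<Lambda>. 1 <= rad \<nu> \<and> hat \<nu> \<in> A}"
proof -
  have m: "hat -` A \<inter> space \<Lambda> \<in> sets \<Lambda>" using hat_measL A by (rule measurable_sets)
  have "emeasure shat A = emeasure (density \<Lambda> (indicator {\<nu> \<in> space \<Lambda>. 1 <= rad \<nu>})) (hat -` A \<inter> space \<Lambda>)"
    unfolding shat_def using A by (subst emeasure_distr) auto
  also have "\<dots> = (\<integral>\<^sup>+\<nu>. indicator {\<nu> \<in> space \<Lambda>. 1 <= rad \<nu>} \<nu> * indicator (hat -` A \<inter> space \<Lambda>) \<nu> \<partial>\<Lambda>)"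
    by (intro emeasure_density borel_measurable_indicator outer_sets m)
  also have "\<dots> = (\<integral>\<^sup>+\<nu>. indicator ({\<nu> \<in> space \<Lambda>. 1 <= rad \<nu>} \<inter> (hat -` A \<inter> space \<Lambda>)) \<nu> \<partial>\<Lambda>)"
    by (intro nn_integral_cong) (auto simp: indicator_def)
  also have "\<dots> = emeasure \<Lambda> ({\<nu> \<in> space \<Lambda>. 1 <= rad \<nu>} \<inter> (hat -` A \<inter> space \<Lambda>))"
    using m by (intro nn_integral_indicator) auto
  also have "{\<nu> \<in> space \<Lambda>. 1 <= rad \<nu>} \<inter> (hat -` A \<inter> space \<Lambda>) = {\<nu> \<in> space \<Lambda>. 1 <= rad \<nu> \<and> hat \<nu> \<in> A}" by auto
  finally show ?thesis .
qed

lemma cone_eq: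
  assumes A: "A \<subseteq> sphere_of B" and r: "0 < r"
  shows "{scale_measure (ennreal t) \<mu> | t \<mu>. \<mu> \<in> A \<and> r <= t} = {\<nu> \<in> space \<Lambda>. ennreal r <= rad \<nu> \<and> hat \<nu> \<in> A}"
proof (intro set_eqI iffI)
  fix \<nu> assume "\<nu> \<in> {scale_measure (ennreal t) \<mu> | t \<mu>. \<mu> \<in> A \<and> r <= t}"
  then obtain t \<mu> where t: "\<nu> = scale_measure (ennreal t) \<mu>" "\<mu> \<in> A" "r <= t" by blast
  have mu: "\<mu> \<in> sphere_of B" and t0: "0 < t" using t A r by auto
  show "\<nu> \<in> {\<nu> \<in> space \<Lambda>. ennreal r <= rad \<nu> \<and> hat \<nu> \<in> A}"
    using hat_scale[OF mu t0] t by (auto simp: spL intro: ennreal_leI)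
next
  fix \<nu> assume "\<nu> \<in> {\<nu> \<in> space \<Lambda>. ennreal r <= rad \<nu> \<and> hat \<nu> \<in> A}"
  then have nu: "\<nu> \<in> space nonzero_radon_space" "ennreal r <= rad \<nu>" "hat \<nu> \<in> A" by (auto simp: spL)
  then have "rad \<nu> < top" by (intro rad_pos) (auto simp: space_nonzero)
  then obtain t where t: "rad \<nu> = ennreal t" "0 <= t" by (cases "rad \<nu>") auto
  have "r <= t" using nu(2) t by simp
  moreover have "\<nu> = scale_measure (ennreal t) (hat \<nu>)" using rad_hat_cancel(1)[OF nu(1)] t by simp
  ultimately show "\<nu> \<in> {scale_measure (ennreal t) \<mu> | t \<mu>. \<mu> \<in> A \<and> r <= t}" using nu(3) by blast
qed

lemma spectral_measure_eq: "spectral_measure \<alpha> B \<Lambda> = scale_measure (ennreal (Gamma (1 - \<alpha>))) shat"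
proof -
  have "measure_of (sphere_of B) (sets SB) (%A. emeasure \<Lambda> {scale_measure (ennreal t) \<mu> | t \<mu>. \<mu> \<in> A \<and> 1 <= t})
    = measure_of (space shat) (sets shat) (emeasure shat)"
    unfolding space_shat sets_shat
  proof (rule measure_of_eq)
    show "sets SB \<subseteq> Pow (sphere_of B)" using sets.sets_into_space[of _ SB] by (auto simp: space_SB)
    fix A assume "A \<in> sigma_sets (sphere_of B) (sets SB)"
    then have A: "A \<in> sets SB" using sets.sigma_sets_eq[of SB] by (simp add: space_SB)
    then have "A \<subseteq> sphere_of B" using sets.sets_into_space[OF A] by (simp add: space_SB)
    from cone_eq[OF this zero_less_one] emeasure_shat[OF A]
    show "emeasure \<Lambda> {scale_measure (ennreal t) \<mu> | t \<mu>. \<mu> \<in> A \<and> 1 <= t} = emeasure shat A" by simp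
  qed
  also have "\<dots> = shat" by (rule measure_of_of_measure)
  finally show ?thesis unfolding spectral_measure_def by (simp only:)
qed

text \<open>By homogeneity the cone above radius r has r powr (- \<alpha>) times the mass of the
  cone above radius 1. The radius s powr (- 1 / \<alpha>) makes this factor equal to s.\<close>

lemma cone_measure:
  assumes A: "A \<in> sets SB" and s: "0 < s"
  shows "emeasure \<Lambda> {\<nu> \<in> space \<Lambda>. ennreal (s powr (- 1 / \<alpha>)) <= rad \<nu> \<and> hat \<nu> \<in> A} = ennreal s * emeasure shat A"
proof -
  define r where "r = s powr (- 1 / \<alpha>)"
  have r: "0 < r" using s by (simp add: r_def)
  have As: "A \<subseteq> sphere_of B" using sets.sets_into_space[OF A] by (simp add: space_SB)
  have "{\<nu> \<in> space \<Lambda>. ennreal r <= rad \<nu> \<and> hat \<nu> \<in> A} = scale_measure (ennreal r) ` {\<nu> \<in> space \<Lambda>. ennreal 1 <= rad \<nu> \<and> hat \<nu> \<in> A}"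
    unfolding cone_eq[OF As r, symmetric] cone_eq[OF As zero_less_one, symmetric]
  proof (intro set_eqI iffI)
    fix \<nu> assume "\<nu> \<in> {scale_measure (ennreal t) \<mu> | t \<mu>. \<mu> \<in> A \<and> r <= t}"
    then obtain t \<mu> where t: "\<nu> = scale_measure (ennreal t) \<mu>" "\<mu> \<in> A" "r <= t" by blast
    have "\<nu> = scale_measure (ennreal r) (scale_measure (ennreal (t / r)) \<mu>)"
      using t r by (simp add: ennreal_mult'[symmetric])
    moreover have "1 <= t / r" using t r by simp
    ultimately show "\<nu> \<in> scale_measure (ennreal r) ` {scale_measure (ennreal t) \<mu> | t \<mu>. \<mu> \<in> A \<and> 1 <= t}"
      using t(2) by blast
  next
    fix \<nu> assume "\<nu> \<in> scale_measure (ennreal r) ` {scale_measure (ennreal t) \<mu> | t \<mu>. \<mu> \<in> A \<and> 1 <= t}"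
    then obtain t \<mu> where t: "\<nu> = scale_measure (ennreal r) (scale_measure (ennreal t) \<mu>)" "\<mu> \<in> A" "1 <= t" by blast
    have "\<nu> = scale_measure (ennreal (r * t)) \<mu>" using t r by (simp add: ennreal_mult')
    moreover have "r <= r * t" using t r by simp
    ultimately show "\<nu> \<in> {scale_measure (ennreal t) \<mu> | t \<mu>. \<mu> \<in> A \<and> r <= t}" using t(2) by blast
  qed
  moreover have "{\<nu> \<in> space \<Lambda>. ennreal 1 <= rad \<nu> \<and> hat \<nu> \<in> A} \<in> sets \<Lambda>"
  proof -
    have "hat -` A \<inter> space \<Lambda> \<in> sets \<Lambda>" using hat_measL A by (rule measurable_sets)
    then have "{\<nu> \<in> space \<Lambda>. 1 <= rad \<nu>} \<inter> (hat -` A \<inter> space \<Lambda>) \<in> sets \<Lambda>" by (rule sets.Int[OF outer_sets])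
    also have "{\<nu> \<in> space \<Lambda>. 1 <= rad \<nu>} \<inter> (hat -` A \<inter> space \<Lambda>) = {\<nu> \<in> space \<Lambda>. ennreal 1 <= rad \<nu> \<and> hat \<nu> \<in> A}" by auto
    finally show ?thesis .
  qed
  ultimately have "emeasure \<Lambda> {\<nu> \<in> space \<Lambda>. ennreal r <= rad \<nu> \<and> hat \<nu> \<in> A} = ennreal (r powr - \<alpha>) * emeasure \<Lambda> {\<nu> \<in> space \<Lambda>. ennreal 1 <= rad \<nu> \<and> hat \<nu> \<in> A}"
    using st r unfolding stable_intensity_def by simp
  also have "r powr - \<alpha> = s" using \<alpha> s by (simp add: r_def powr_powr)
  finally show ?thesis by (simp add: r_def emeasure_shat[OF A])
qed

text \<open>In the coordinate rad powr (- \<alpha>) the radial part of the intensity becomes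
  Lebesgue measure on the positive half-line. By \<open>cone_measure\<close> both sides agree on
  products of half-lines \<open>{..s}\<close> with sets of directions, which form a generating
  \<pi>-system.\<close>

lemma polar_distr:
  assumes fin: "emeasure shat (sphere_of B) < top"
  shows "distr \<Lambda> (borel \<Otimes>\<^sub>M SB) (%\<nu>. (enn2real (rad \<nu>) powr (- \<alpha>), hat \<nu>)) = density lborel (indicator {0<..}) \<Otimes>\<^sub>M shat"
    (is "?L = ?D \<Otimes>\<^sub>M shat")
proof -
  interpret S: finite_measure shat by (rule finite_measureI) (use fin in \<open>simp add: space_shat\<close>)
  define E where "E = {a \<times> b | a b. a \<in> range (%s::real. {..s}) \<and> b \<in> sets SB}"
  have Tm: "(%\<nu>. (enn2real (rad \<nu>) powr (- \<alpha>), hat \<nu>)) \<in> measurable \<Lambda> (borel \<Otimes>\<^sub>M SB)" by measurable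
  have gen: "sets (borel \<Otimes>\<^sub>M SB) = sigma_sets (UNIV \<times> sphere_of B) E"
  proof -
    have "sets (borel \<Otimes>\<^sub>M SB) = sets (sigma (space borel \<times> space SB) {a \<times> b | a b. a \<in> range (%s::real. {..s}) \<and> b \<in> sets SB})"
    proof (rule sets_pair_eq[where Ca="range (%n::nat. {..real n})" and Cb="{sphere_of B}"])
      show "sets (borel :: real measure) = sigma_sets (space borel) (range (%s::real. {..s}))"
        by (subst borel_eq_atMost) simp
      show "\<Union> (range (%n::nat. {..real n})) = space borel" using real_arch_simple by auto
      show "sets SB = sigma_sets (space SB) (sets SB)" by (rule sets.sigma_sets_eq[symmetric])
      show "sets SB \<subseteq> Pow (space SB)" using sets.sets_into_space by blast
      show "{sphere_of B} \<subseteq> sets SB" using sets.top[of SB] by (simp add: space_SB)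
    qed (auto simp: space_SB)
    also have "\<dots> = sigma_sets (UNIV \<times> sphere_of B) E"
      using sets.sets_into_space[of _ SB] by (subst sets_measure_of) (auto simp: space_SB E_def)
    finally show ?thesis .
  qed
  have L: "emeasure ?L ({..s} \<times> A) = ennreal (max 0 s) * emeasure shat A" if A: "A \<in> sets SB" for s A
  proof -
    have AB: "{..s} \<times> A \<in> sets (borel \<Otimes>\<^sub>M SB)" using A by auto
    have "emeasure ?L ({..s} \<times> A) = emeasure \<Lambda> {\<nu> \<in> space \<Lambda>. enn2real (rad \<nu>) powr (- \<alpha>) <= s \<and> hat \<nu> \<in> A}"
      using Tm AB by (subst emeasure_distr) (auto intro!: arg_cong[where f="emeasure \<Lambda>"])
    also have "\<dots> = ennreal (max 0 s) * emeasure shat A"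
    proof (cases "0 < s")
      case True
      have "enn2real (rad \<nu>) powr (- \<alpha>) <= s \<longleftrightarrow> ennreal (s powr (- 1 / \<alpha>)) <= rad \<nu>" if nu: "\<nu> \<in> space \<Lambda>" for \<nu>
      proof -
        have "0 < rad \<nu>" "rad \<nu> < top" using nu by (auto simp: spL space_nonzero intro!: rad_pos)
        then obtain x where x: "rad \<nu> = ennreal x" "0 < x" by (cases "rad \<nu>") auto
        have "x powr (- \<alpha>) <= s \<longleftrightarrow> s powr (- 1 / \<alpha>) <= x"
        proof
          assume "x powr (- \<alpha>) <= s"
          then have "s powr (- 1 / \<alpha>) <= (x powr (- \<alpha>)) powr (- 1 / \<alpha>)" using \<alpha> x by (intro powr_mono2') auto
          then show "s powr (- 1 / \<alpha>) <= x" using \<alpha> x by (simp add: powr_powr)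
        next
          assume "s powr (- 1 / \<alpha>) <= x"
          then have "x powr (- \<alpha>) <= (s powr (- 1 / \<alpha>)) powr (- \<alpha>)" using \<alpha> True by (intro powr_mono2') auto
          then show "x powr (- \<alpha>) <= s" using \<alpha> True by (simp add: powr_powr)
        qed
        then show ?thesis using x by simp
      qed
      then have "{\<nu> \<in> space \<Lambda>. enn2real (rad \<nu>) powr (- \<alpha>) <= s \<and> hat \<nu> \<in> A} = {\<nu> \<in> space \<Lambda>. ennreal (s powr (- 1 / \<alpha>)) <= rad \<nu> \<and> hat \<nu> \<in> A}"
        by blast
      then show ?thesis using cone_measure[OF A True] True by simp
    next
      case False
      have emp: "{\<nu> \<in> space \<Lambda>. enn2real (rad \<nu>) powr (- \<alpha>) <= s \<and> hat \<nu> \<in> A} = {}"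
      proof -
        have "0 < enn2real (rad \<nu>) powr (- \<alpha>)" if "\<nu> \<in> space \<Lambda>" for \<nu>
        proof -
          have "0 < rad \<nu>" "rad \<nu> < top" using that by (auto simp: spL space_nonzero intro!: rad_pos)
          then obtain x where "rad \<nu> = ennreal x" "0 < x" by (cases "rad \<nu>") auto
          then show ?thesis by simp
        qed
        then have "s < enn2real (rad \<nu>) powr (- \<alpha>)" if "\<nu> \<in> space \<Lambda>" for \<nu>
          using False that by (meson less_le_trans not_less order_le_less_trans)
        then show ?thesis by (auto simp: not_le[symmetric])
      qed
      show ?thesis unfolding emp using False by (simp add: max_def)
    qed
    finally show ?thesis .
  qed
  have Dm: "emeasure ?D {..s} = ennreal (max 0 s)" for s :: real
  proof -
    have "emeasure ?D {..s} = (\<integral>\<^sup>+x. indicator {0<..} x * indicator {..s} x \<partial>lborel)"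
      by (rule emeasure_density) simp_all
    also have "\<dots> = (\<integral>\<^sup>+x. indicator {0<..s} x \<partial>lborel)"
      by (intro nn_integral_cong) (auto simp: indicator_def)
    also have "\<dots> = emeasure lborel {0<..s}" by (rule nn_integral_indicator) simp
    finally have "emeasure ?D {..s} = emeasure lborel {0<..s}" .
    then show ?thesis by (cases "0 <= s") auto
  qed
  have sD: "sets (?D \<Otimes>\<^sub>M shat) = sets (borel \<Otimes>\<^sub>M SB)" by (intro sets_pair_measure_cong) simp_all
  show ?thesis
  proof (rule measure_eqI_generator_eq[where E=E and \<Omega>="UNIV \<times> sphere_of B" and A="%n::nat. {..real n} \<times> sphere_of B"])
    show "Int_stable E"
    proof (rule Int_stableI)
      fix a b assume "a \<in> E" "b \<in> E"
      then obtain s A t A' where "a = {..s} \<times> A" "A \<in> sets SB" "b = {..t} \<times> A'" "A' \<in> sets SB"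
        unfolding E_def by blast
      then have "a \<inter> b = {..min s t} \<times> (A \<inter> A')" "A \<inter> A' \<in> sets SB" by auto
      then show "a \<inter> b \<in> E" unfolding E_def by blast
    qed
    show "E \<subseteq> Pow (UNIV \<times> sphere_of B)"
      using sets.sets_into_space[of _ SB] by (auto simp: E_def space_SB)
    show "sets ?L = sigma_sets (UNIV \<times> sphere_of B) E" using gen by simp
    show "sets (?D \<Otimes>\<^sub>M shat) = sigma_sets (UNIV \<times> sphere_of B) E" using gen sD by simp
    have top: "sphere_of B \<in> sets SB" using sets.top[of SB] by (simp add: space_SB)
    then show "range (%n::nat. {..real n} \<times> sphere_of B) \<subseteq> E" by (auto simp: E_def)
    show "(\<Union>n::nat. {..real n} \<times> sphere_of B) = UNIV \<times> sphere_of B" using real_arch_simple by auto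
    show "emeasure ?L ({..real n} \<times> sphere_of B) \<noteq> \<infinity>" for n
      using fin by (simp add: L[OF top] ennreal_mult_eq_top_iff less_top)
    fix X assume "X \<in> E"
    then obtain s A where X: "X = {..s} \<times> A" "A \<in> sets SB" unfolding E_def by blast
    have "emeasure (?D \<Otimes>\<^sub>M shat) X = emeasure ?D {..s} * emeasure shat A"
      unfolding X(1) using X(2) by (intro S.emeasure_pair_measure_Times) auto
    then show "emeasure ?L X = emeasure (?D \<Otimes>\<^sub>M shat) X" using X L[OF X(2)] Dm by simp
  qed
qed

text \<open>In polar coordinates the integral over the radius comes first and leaves
  \<open>kap\<close> of the pairing with the direction.\<close>

lemma laplace_exp_polar:
  assumes fin: "emeasure shat (sphere_of B) < top" and h: "h \<in> borel_measurable borel"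
  shows "laplace_exp \<Lambda> h = (\<integral>\<^sup>+\<mu>. kap \<alpha> (np h \<mu>) \<partial>shat)"
proof -
  interpret S: finite_measure shat by (rule finite_measureI) (use fin in \<open>simp add: space_shat\<close>)
  let ?D = "density lborel (indicator {0<..}) :: real measure"
  define F where "F = (%(s, \<mu>). ennreal (1 - lap (ennreal (s powr (- 1 / \<alpha>)) * (np h \<mu>))))"
  have hS [measurable]: "(%\<mu>. \<integral>\<^sup>+x. h x \<partial>\<mu>) \<in> borel_measurable SB"
    using h by (intro measurable_restrict_space1 measurable_np)
  have Fm: "F \<in> borel_measurable (borel \<Otimes>\<^sub>M SB)" unfolding F_def case_prod_beta
  proof -
    have "(%p. \<integral>\<^sup>+x. h x \<partial>snd p) \<in> borel_measurable (borel \<Otimes>\<^sub>M SB)"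
      by (rule measurable_compose[OF measurable_snd hS])
    then show "(%p. ennreal (1 - lap (ennreal (fst p powr (- 1 / \<alpha>)) * (np h (snd p))))) \<in> borel_measurable (borel \<Otimes>\<^sub>M SB)"
      by measurable
  qed
  have Fm2: "F \<in> borel_measurable (?D \<Otimes>\<^sub>M shat)"
  proof -
    have "sets (?D \<Otimes>\<^sub>M shat) = sets (borel \<Otimes>\<^sub>M SB)" by (intro sets_pair_measure_cong) simp_all
    from measurable_cong_sets[OF this refl] Fm show ?thesis by blast
  qed
  have Fs: "(%s. F (s, \<mu>)) \<in> borel_measurable borel" for \<mu> unfolding F_def by simp
  have "laplace_exp \<Lambda> h = (\<integral>\<^sup>+\<nu>. F (enn2real (rad \<nu>) powr (- \<alpha>), hat \<nu>) \<partial>\<Lambda>)"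
    unfolding laplace_exp_def
  proof (intro nn_integral_cong)
    fix \<nu> assume nu: "\<nu> \<in> space \<Lambda>"
    then have r: "0 < rad \<nu>" "rad \<nu> < top" by (auto simp: spL space_nonzero intro!: rad_pos)
    then obtain x where x: "rad \<nu> = ennreal x" "0 < x" by (cases "rad \<nu>") auto
    have n2: "\<nu> \<in> space nonzero_radon_space" using nu by (simp add: spL)
    have "(x powr (- \<alpha>)) powr (- 1 / \<alpha>) = x" using x \<alpha> by (simp add: powr_powr)
    then have "F (enn2real (rad \<nu>) powr (- \<alpha>), hat \<nu>) = ennreal (1 - lap (rad \<nu> * (np h (hat \<nu>))))"
      using x by (simp add: F_def)
    also have "rad \<nu> * (np h (hat \<nu>)) = (np h (scale_measure (rad \<nu>) (hat \<nu>)))"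
      by (rule nn_integral_scale_measure'[OF sets_radon_measure[OF rad_hat_cancel(3)[OF n2]] h, symmetric])
    finally show "ennreal (1 - lap (np h \<nu>)) = F (enn2real (rad \<nu>) powr (- \<alpha>), hat \<nu>)"
      by (simp only: rad_hat_cancel(1)[OF n2])
  qed
  also have "\<dots> = (np F (distr \<Lambda> (borel \<Otimes>\<^sub>M SB) (%\<nu>. (enn2real (rad \<nu>) powr (- \<alpha>), hat \<nu>))))"
    by (rule nn_integral_distr[symmetric]) (use Fm in measurable)
  also have "\<dots> = (np F (?D \<Otimes>\<^sub>M shat))" by (simp only: polar_distr[OF fin])
  also have "\<dots> = (\<integral>\<^sup>+\<mu>. (\<integral>\<^sup>+s. F (s, \<mu>) \<partial>?D) \<partial>shat)"
  proof -
    have "sigma_finite_measure ?D" by (rule sigma_finite_density_pos)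
    then interpret D: sigma_finite_measure ?D .
    interpret pair_sigma_finite ?D shat ..
    show ?thesis by (rule nn_integral_snd[OF Fm2, symmetric])
  qed
  also have "\<dots> = (\<integral>\<^sup>+\<mu>. kap \<alpha> (np h \<mu>) \<partial>shat)"
  proof (intro nn_integral_cong)
    fix \<mu> :: "'x measure"
    have "(\<integral>\<^sup>+s. F (s, \<mu>) \<partial>?D) = (\<integral>\<^sup>+s. indicator {0<..} s * F (s, \<mu>) \<partial>lborel)"
      using Fs by (intro nn_integral_density) auto
    then show "(\<integral>\<^sup>+s. F (s, \<mu>) \<partial>?D) = kap \<alpha> (np h \<mu>)"
      by (simp add: kap_def F_def mult.commute)
  qed
  finally show ?thesis .
qed

end

end

declare base_borel [measurable del]

end

section \<open>The LePage series\<close>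

lemma kap_measurable: "kap \<alpha> \<in> borel_measurable borel"
  unfolding kap_def[abs_def] by (rule lborel.borel_measurable_nn_integral) measurable

lemma stable_intensity_laplace_exp:
  assumes "stable_intensity \<alpha> \<Lambda>" "h \<in> BM"
  shows "laplace_exp \<Lambda> (en h) < top"
proof -
  have "sets \<Lambda> = sets nonzero_radon_space" "laplace_exponent \<Lambda> h < \<infinity>"
    using assms unfolding stable_intensity_def by blast+
  then show ?thesis using laplace_exponent_eq[OF assms(2)] by simp
qed

text \<open>Independence of the two generated \<sigma>-algebras yields the product formula on
  rectangles; the two variables may take values in different types.\<close>

lemma (in prob_space) distr_pair_indep_set:
  assumes X [measurable]: "X \<in> measurable M A" and Y [measurable]: "Y \<in> measurable M C"
    and ind: "indep_set {X -` a \<inter> space M | a. a \<in> sets A} {Y -` c \<inter> space M | c. c \<in> sets C}"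
  shows "distr M (A \<Otimes>\<^sub>M C) (%w. (X w, Y w)) = distr M A X \<Otimes>\<^sub>M distr M C Y"
proof (rule pair_measure_eqI[symmetric])
  show "sigma_finite_measure (distr M A X)" "sigma_finite_measure (distr M C Y)"
    by (auto intro!: prob_space_imp_sigma_finite prob_space_distr)
  show "sets (distr M A X \<Otimes>\<^sub>M distr M C Y) = sets (distr M (A \<Otimes>\<^sub>M C) (%w. (X w, Y w)))"
    by (simp cong: sets_pair_measure_cong)
  fix a c assume "a \<in> sets (distr M A X)" "c \<in> sets (distr M C Y)"
  then have ac: "a \<in> sets A" "c \<in> sets C" by simp_all
  have "prob ((X -` a \<inter> space M) \<inter> (Y -` c \<inter> space M)) = prob (X -` a \<inter> space M) * prob (Y -` c \<inter> space M)"
    using ac by (intro indep_setD[OF ind]) blast+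
  moreover have "(X -` a \<inter> space M) \<inter> (Y -` c \<inter> space M) = (%w. (X w, Y w)) -` (a \<times> c) \<inter> space M" by auto
  ultimately show "emeasure (distr M A X) a * emeasure (distr M C Y) c = emeasure (distr M (A \<Otimes>\<^sub>M C) (%w. (X w, Y w))) (a \<times> c)"
    using ac by (simp add: emeasure_distr emeasure_eq_measure ennreal_mult''[symmetric])
qed

text \<open>The factor exp (- b s powr (- 1 / \<alpha>) a) that a point with arrival time s and
  pairing a contributes to the Laplace transform. For s \<le> 0 the coefficient is infinite, as in
  the limit s to 0 from the right; this makes the weight continuous on the whole line, as the lemmas
  on arrival times demand.\<close>

definition wt :: "real => real => real => ennreal => real" where
  "wt \<alpha> b s a = lap ((if s <= 0 then top else ennreal (b * s powr (- 1 / \<alpha>))) * a)"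

lemma wt_measurable [measurable]: "(%p. wt \<alpha> b (fst p) (snd p)) \<in> borel_measurable (borel \<Otimes>\<^sub>M borel)"
  unfolding wt_def by measurable

lemma wt_range: "0 <= wt \<alpha> b s a" "wt \<alpha> b s a <= 1"
  by (simp_all add: wt_def)

lemma continuous_wt:
  assumes b: "0 < b" and \<alpha>: "0 < \<alpha>" and a: "a < top"
  shows "continuous_on UNIV (%s. wt \<alpha> b s a)"
proof (cases "a = 0")
  case True
  then show ?thesis by (simp add: wt_def)
next
  case False
  define r where "r = enn2real a"
  have r: "a = ennreal r" "0 < r"
    using a False by (simp_all add: r_def less_top[symmetric] enn2real_positive_iff zero_less_iff_neq_zero)
  define k where "k = b * r"
  have k: "0 < k" using b r by (simp add: k_def)
  have eq: "wt \<alpha> b s a = (if s <= 0 then 0 else exp (- (k * s powr (- 1 / \<alpha>))))" for s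
    using r b by (simp add: wt_def k_def ennreal_mult_top ennreal_top_mult ennreal_mult'[symmetric] lap_ennreal mult_ac)
  have "isCont (%s. wt \<alpha> b s a) s" for s
  proof -
    consider "s < 0" | "s = 0" | "0 < s" by linarith
    then show ?thesis
    proof cases
      case 1
      then have "\<forall>\<^sub>F x in nhds s. wt \<alpha> b x a = 0"
        using eventually_nhds_in_open[of "{..<0}" s] by (auto elim!: eventually_mono simp: eq)
      then show ?thesis by (subst isCont_cong[where g="%_. 0"]) auto
    next
      case 3
      then have "\<forall>\<^sub>F x in nhds s. wt \<alpha> b x a = exp (- (k * x powr (- 1 / \<alpha>)))"
        using eventually_nhds_in_open[of "{0<..}" s] by (auto elim!: eventually_mono simp: eq)
      moreover have "isCont (%x. exp (- (k * x powr (- 1 / \<alpha>)))) s"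
        using 3 by (intro continuous_intros) auto
      ultimately show ?thesis by (subst isCont_cong) auto
    next
      case 2
      have l: "((%s. wt \<alpha> b s a) \<longlongrightarrow> 0) (at_left 0)"
        by (rule tendsto_eventually) (auto simp: eventually_at_filter eq)
      have "filterlim (%x::real. x powr (- 1 / \<alpha>)) at_top (at_right 0)"
      proof -
        define c where "c = 1 / \<alpha>"
        have "0 < c" using \<alpha> by (simp add: c_def)
        then have "filterlim (%x::real. x powr (- c)) at_top (at_right 0)" by real_asymp
        then show ?thesis by (simp add: c_def)
      qed
      then have "filterlim (%x::real. k * x powr (- 1 / \<alpha>)) at_top (at_right 0)"
        using k by (intro filterlim_tendsto_pos_mult_at_top[OF tendsto_const]) auto
      then have "((%x. exp (- (k * x powr (- 1 / \<alpha>)))) \<longlongrightarrow> 0) (at_right 0)"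
        by (intro filterlim_compose[OF exp_at_bot] filterlim_uminus_at_bot_at_top[THEN filterlim_compose])
      then have r: "((%s. wt \<alpha> b s a) \<longlongrightarrow> 0) (at_right 0)"
        by (rule Lim_transform_eventually) (auto simp: eventually_at_filter eq)
      show ?thesis unfolding 2 isCont_def using l r by (auto simp: eq intro: filterlim_split_at_real filterlim_split_at)
    qed
  qed
  then show ?thesis by (simp add: continuous_at_imp_continuous_on)
qed

lemma nn_integral_wt:
  assumes b: "0 < b" and \<alpha>: "0 < \<alpha>"
  shows "(\<integral>\<^sup>+s. ennreal (1 - wt \<alpha> b s a) * indicator {0..} s \<partial>lborel) = ennreal (b powr \<alpha>) * kap \<alpha> a"
proof -
  have "(\<integral>\<^sup>+s. ennreal (1 - wt \<alpha> b s a) * indicator {0..} s \<partial>lborel) = kap \<alpha> (ennreal b * a)"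
    unfolding kap_def
  proof (rule nn_integral_cong_AE)
    have "AE s in lborel. s \<noteq> (0::real)" by (rule AE_lborel_singleton)
    then show "AE s in lborel. ennreal (1 - wt \<alpha> b s a) * indicator {0..} s = ennreal (1 - lap (ennreal (s powr (- 1 / \<alpha>)) * (ennreal b * a))) * indicator {0<..} s"
    proof eventually_elim
      case (elim s)
      show ?case
      proof (cases "0 < s")
        case True
        have "ennreal (s powr (- 1 / \<alpha>)) * (ennreal b * a) = ennreal (b * s powr (- 1 / \<alpha>)) * a"
          by (simp only: ennreal_mult'[OF less_imp_le[OF b]] mult_ac)
        then show ?thesis using True by (simp add: wt_def)
      qed (use elim in simp)
    qed
  qed
  then show ?thesis by (simp add: kap_scale[OF \<alpha> b])
qed

abbreviation (input) lpw :: "real => (nat => 'w => real) => 'w => nat => real" where "lpw \<alpha> \<xi> w k \<equiv> (\<Sum>j\<le>k. \<xi> j w) powr (- 1 / \<alpha>)"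

context lcsc
begin

text \<open>Given the arrival times the factors are independent, and each has conditional
  expectation \<phi> at its arrival time, where \<phi> averages the weight over the law \<nu> of the
  directions. \<open>arrival_product\<close> then applies, and Fubini identifies the integral of 1 -
  \<phi> over the half-line with \<open>el\<close>.\<close>

lemma lepage_laplace:
  fixes \<Lambda> :: "'x measure measure" and \<epsilon> :: "nat => 'q => 'x measure" and \<xi> :: "nat => 'q => real"
  assumes Q: "prob_space Q" and b: "0 < b" and \<alpha>: "0 < \<alpha>"
    and ie: "prob_space.indep_vars Q (%_. radon_space) \<epsilon> UNIV"
    and de: "!!k. distr Q radon_space (\<epsilon> k) = \<nu>"
    and ix: "prob_space.indep_vars Q (%_. borel) \<xi> UNIV"
    and dx: "!!k. distributed Q lborel (\<xi> k) (exponential_density 1)"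
    and iex: "prob_space.indep_set Q
       {(%w k. \<epsilon> k w) -` A \<inter> space Q | A. A \<in> sets (PiM UNIV (%_. radon_space))}
       {(%w k. \<xi> k w) -` A \<inter> space Q | A. A \<in> sets (PiM UNIV (%_. borel))}"
    and h: "h \<in> BM"
    and L: "(\<integral>\<^sup>+\<mu>. ennreal (b powr \<alpha>) * kap \<alpha> (ip h \<mu>) \<partial>\<nu>) = el" and Lfin: "el < top"
  shows "(\<integral>w. lap (ennreal b * (\<integral>\<^sup>+k. (ip h (scale_measure (ennreal (lpw \<alpha> \<xi> w k)) (\<epsilon> k w))) \<partial>count_space UNIV)) \<partial>Q) = lap el"
proof -
  interpret Q: prob_space Q by fact
  have hm: "(en h) \<in> borel_measurable borel" using BM_measurable[OF h] by simp
  have em [measurable]: "\<epsilon> k \<in> measurable Q radon_space" for k using ie by (auto simp: Q.indep_vars_def)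
  have xm [measurable]: "\<xi> k \<in> borel_measurable Q" for k using ix by (auto simp: Q.indep_vars_def)
  have er: "\<epsilon> k w \<in> radon_measures" if "w \<in> space Q" for k w using measurable_space[OF em that] by simp
  define a where "a \<mu> = (ip h \<mu>)" for \<mu> :: "'x measure"
  have am [measurable]: "a \<in> borel_measurable radon_space"
    unfolding a_def[abs_def] by (rule measurable_np[OF hm])
  have afin: "a \<mu> < top" if "\<mu> \<in> radon_measures" for \<mu> unfolding a_def by (rule nn_integral_BM_finite[OF h that])
  have sn: "sets \<nu> = sets radon_space" using de[of 0] by auto
  have spn: "space \<nu> = radon_measures" using sets_eq_imp_space_eq[OF sn] by simp
  have pn: "prob_space \<nu>" unfolding de[of 0, symmetric] by (rule Q.prob_space_distr) measurable
  interpret N: prob_space \<nu> by (rule pn)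
  have amn [measurable]: "a \<in> borel_measurable \<nu>" using am measurable_cong_sets[OF sn refl] by blast
  define W where "W s \<mu> = wt \<alpha> b s (a \<mu>)" for s \<mu>
  have Wm: "(%p. W (fst p) (snd p)) \<in> borel_measurable (borel \<Otimes>\<^sub>M radon_space)"
  proof -
    have "(%p. (fst p, a (snd p))) \<in> measurable (borel \<Otimes>\<^sub>M radon_space) (borel \<Otimes>\<^sub>M borel)" by measurable
    from measurable_compose[OF this wt_measurable[of \<alpha> b]] show ?thesis by (simp add: W_def)
  qed
  have Ws: "W s \<in> borel_measurable radon_space" for s
    using measurable_compose[OF measurable_Pair1' Wm, of s] by simp
  have Wsn [measurable]: "W s \<in> borel_measurable \<nu>" for s using Ws measurable_cong_sets[OF sn refl] by blast
  have W01: "0 <= W s \<mu>" "W s \<mu> <= 1" for s \<mu> by (simp_all add: W_def wt_range)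
  have Wint: "integrable \<nu> (W s)" for s by (intro N.integrable_const_bound[where B=1]) (auto simp: W01)
  define \<phi> where "\<phi> s = (\<integral>\<mu>. W s \<mu> \<partial>\<nu>)" for s
  have phi01: "0 <= \<phi> s" "\<phi> s <= 1" for s
  proof -
    show "0 <= \<phi> s" unfolding \<phi>_def by (intro integral_nonneg_AE) (simp add: W01)
    have "\<phi> s <= (\<integral>\<mu>. 1 \<partial>\<nu>)" unfolding \<phi>_def by (intro integral_mono Wint) (auto simp: W01)
    then show "\<phi> s <= 1" by (simp add: N.prob_space)
  qed
  have cont: "continuous_on UNIV \<phi>"
    unfolding continuous_on_sequentially
  proof (intro allI ballI impI)
    fix x :: "nat => real" and l assume "l \<in> UNIV" and "(\<forall>n. x n \<in> UNIV) \<and> x ----> l"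
    then have x: "x ----> l" by simp
    have "(%n. \<integral>\<mu>. W (x n) \<mu> \<partial>\<nu>) ----> (\<integral>\<mu>. W l \<mu> \<partial>\<nu>)"
    proof (rule integral_dominated_convergence[where w="%_. 1"])
      show "AE \<mu> in \<nu>. (%n. W (x n) \<mu>) ----> W l \<mu>"
      proof (rule AE_I2)
        fix \<mu> assume "\<mu> \<in> space \<nu>"
        then have "continuous_on UNIV (%s. W s \<mu>)" unfolding W_def by (intro continuous_wt b \<alpha> afin) (simp add: spn)
        then have "isCont (%s. W s \<mu>) l" by (simp add: continuous_on_eq_continuous_at)
        then show "(%n. W (x n) \<mu>) ----> W l \<mu>" using x by (rule isCont_tendsto_compose)
      qed
    qed (auto simp: W01)
    then show "(\<phi> \<circ> x) ----> \<phi> l" by (simp add: o_def \<phi>_def)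
  qed
  have tail: "tail \<phi> 0 = el"
  proof -
    interpret P: pair_sigma_finite lborel \<nu> ..
    have Wp: "(%p. ennreal (1 - W (fst p) (snd p)) * indicator {0..} (fst p)) \<in> borel_measurable (lborel \<Otimes>\<^sub>M \<nu>)"
    proof -
      have "sets (lborel \<Otimes>\<^sub>M \<nu>) = sets (borel \<Otimes>\<^sub>M radon_space)" by (intro sets_pair_measure_cong) (simp_all add: sn)
      then have "(%p. W (fst p) (snd p)) \<in> borel_measurable (lborel \<Otimes>\<^sub>M \<nu>)"
        using Wm measurable_cong_sets[of "lborel \<Otimes>\<^sub>M \<nu>" "borel \<Otimes>\<^sub>M radon_space" borel borel] by blast
      then show ?thesis by measurable
    qed
    have "tail \<phi> 0 = (\<integral>\<^sup>+s. (\<integral>\<^sup>+\<mu>. ennreal (1 - W s \<mu>) * indicator {0..} s \<partial>\<nu>) \<partial>lborel)"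
      unfolding tail_def
    proof (intro nn_integral_cong)
      fix s
      have "1 - \<phi> s = (\<integral>\<mu>. 1 - W s \<mu> \<partial>\<nu>)" unfolding \<phi>_def using Wint[of s] by (simp add: N.prob_space)
      also have "ennreal \<dots> = (\<integral>\<^sup>+\<mu>. ennreal (1 - W s \<mu>) \<partial>\<nu>)"
        using Wint[of s] W01 by (intro nn_integral_eq_integral[symmetric]) auto
      finally show "ennreal (1 - \<phi> s) * indicator {0..} s = (\<integral>\<^sup>+\<mu>. ennreal (1 - W s \<mu>) * indicator {0..} s \<partial>\<nu>)"
        by (subst nn_integral_multc) auto
    qed
    also have "\<dots> = (\<integral>\<^sup>+\<mu>. (\<integral>\<^sup>+s. ennreal (1 - W s \<mu>) * indicator {0..} s \<partial>lborel) \<partial>\<nu>)"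
      using P.Fubini[OF Wp] by simp
    also have "\<dots> = el" unfolding W_def nn_integral_wt[OF b \<alpha>] L[symmetric] a_def ..
    finally show ?thesis .
  qed
  have fin: "tail \<phi> 0 < top" using tail Lfin by simp
  let ?A = "PiM UNIV (%_::nat. radon_space :: 'x measure measure)"
  define X where "X w = (%k. \<xi> k w)" for w
  define E where "E w = (%k. \<epsilon> k w)" for w
  have Xm: "X \<in> measurable Q (PiM UNIV (%_. borel))" unfolding X_def[abs_def] by (intro measurable_PiM_single') auto
  have Em: "E \<in> measurable Q ?A"
    unfolding E_def[abs_def] using em by (intro measurable_PiM_single') (auto intro: er)
  have SS: "sets expseq.S = sets (PiM UNIV (%_::nat. borel :: real measure))" by (intro sets_PiM_cong) auto
  have Xd: "distr Q (PiM UNIV (%_. borel)) X = expseq.S"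
  proof -
    have "distr Q borel (\<xi> k) = exp_law" for k
    proof -
      have "distr Q borel (\<xi> k) = distr Q lborel (\<xi> k)" by (intro distr_cong) auto
      then show ?thesis using dx[of k] by (simp add: distributed_def exp_law_def)
    qed
    moreover have "distr Q (PiM UNIV (%_. borel)) (%w. \<lambda>i\<in>UNIV. \<xi> i w) = PiM UNIV (%i. distr Q borel (\<xi> i))"
      using ix by (subst (asm) Q.indep_vars_iff_distr_eq_PiM) auto
    ultimately show ?thesis by (simp add: X_def[abs_def] restrict_def)
  qed
  have prodI: "(\<integral>\<^sup>+w. F (E w, X w) \<partial>Q) = (\<integral>\<^sup>+x. (\<integral>\<^sup>+w. F (E w, x) \<partial>Q) \<partial>expseq.S)"
    if F: "F \<in> borel_measurable (?A \<Otimes>\<^sub>M PiM UNIV (%_. borel))" for F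
  proof -
    have pE: "prob_space (distr Q ?A E)" by (rule Q.prob_space_distr[OF Em])
    interpret P: pair_prob_space "distr Q ?A E" expseq.S
      using pE expseq.P.prob_space_axioms by (simp add: pair_prob_space_def pair_sigma_finite_def prob_space_imp_sigma_finite)
    have "(\<integral>\<^sup>+w. F (E w, X w) \<partial>Q) = (np F (distr Q (?A \<Otimes>\<^sub>M PiM UNIV (%_. borel)) (%w. (E w, X w))))"
      using F by (intro nn_integral_distr[symmetric] measurable_Pair Em Xm) simp
    also have "\<dots> = (np F (distr Q ?A E \<Otimes>\<^sub>M expseq.S))"
      using Q.distr_pair_indep_set[OF Em Xm] iex unfolding Xd by (simp add: E_def[abs_def] X_def[abs_def])
    also have "\<dots> = (\<integral>\<^sup>+x. (\<integral>\<^sup>+e. F (e, x) \<partial>distr Q ?A E) \<partial>expseq.S)"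
    proof (rule P.nn_integral_snd[symmetric])
      have "sets (distr Q ?A E \<Otimes>\<^sub>M expseq.S) = sets (?A \<Otimes>\<^sub>M PiM UNIV (%_. borel))"
        by (intro sets_pair_measure_cong) (simp_all add: SS)
      then show "F \<in> borel_measurable (distr Q ?A E \<Otimes>\<^sub>M expseq.S)"
        using F measurable_cong_sets[OF _ refl] by blast
    qed
    also have "\<dots> = (\<integral>\<^sup>+x. (\<integral>\<^sup>+w. F (E w, x) \<partial>Q) \<partial>expseq.S)"
    proof (intro nn_integral_cong)
      fix x assume "x \<in> space expseq.S"
      then have "x \<in> space (PiM UNIV (%_::nat. borel :: real measure))" by (simp add: space_PiM)
      then have "(%e. F (e, x)) \<in> borel_measurable ?A" using measurable_compose[OF measurable_Pair2' F] by simp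
      then show "(\<integral>\<^sup>+e. F (e, x) \<partial>distr Q ?A E) = (\<integral>\<^sup>+w. F (E w, x) \<partial>Q)" by (intro nn_integral_distr Em) simp
    qed
    finally show ?thesis .
  qed
  have Wcomp: "(%w. W (s w) (e w)) \<in> borel_measurable M" if "s \<in> borel_measurable M" "e \<in> measurable M radon_space" for s e and M :: "'z measure"
    using measurable_compose[OF measurable_Pair[OF that] Wm] by simp
  have Wcomp2: "(%w. W (s w) (e w)) \<in> borel_measurable M" if "s \<in> borel_measurable M" "e \<in> measurable M radon_space" for s e and M :: "((nat => 'x measure) \<times> (nat => real)) measure"
    using measurable_compose[OF measurable_Pair[OF that] Wm] by simp
  have Wcomp3: "(%w. W (s w) (e w)) \<in> borel_measurable M" if "s \<in> borel_measurable M" "e \<in> measurable M radon_space" for s e and M :: "'q measure"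
    using measurable_compose[OF measurable_Pair[OF that] Wm] by simp
  have step: "(\<integral>\<^sup>+w. ennreal (\<Prod>k<n. W (arr (Suc k) (X w)) (\<epsilon> k w)) \<partial>Q) = (\<integral>\<^sup>+x. ennreal (\<Prod>k<n. \<phi> (arr (Suc k) x)) \<partial>expseq.S)" for n
  proof -
    define F where "F p = ennreal (\<Prod>k<n. W (arr (Suc k) (snd p)) (fst p k))" for p :: "(nat => 'x measure) \<times> (nat => real)"
    have arrm: "arr k \<in> borel_measurable (PiM UNIV (%_. borel))" for k
      using arr_meas[of k] measurable_cong_sets[OF SS refl] by blast
    have Fm: "F \<in> borel_measurable (?A \<Otimes>\<^sub>M PiM UNIV (%_. borel))"
      unfolding F_def[abs_def]
      by (intro measurable_compose[OF _ measurable_ennreal] borel_measurable_prod Wcomp2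
          measurable_compose[OF measurable_snd arrm] measurable_compose[OF measurable_fst measurable_component_singleton]) auto
    have "(\<integral>\<^sup>+w. ennreal (\<Prod>k<n. W (arr (Suc k) (X w)) (\<epsilon> k w)) \<partial>Q) = (\<integral>\<^sup>+w. F (E w, X w) \<partial>Q)"
      by (simp add: F_def E_def)
    also have "\<dots> = (\<integral>\<^sup>+x. (\<integral>\<^sup>+w. F (E w, x) \<partial>Q) \<partial>expseq.S)" by (rule prodI[OF Fm])
    also have "\<dots> = (\<integral>\<^sup>+x. ennreal (\<Prod>k<n. \<phi> (arr (Suc k) x)) \<partial>expseq.S)"
    proof (intro nn_integral_cong)
      fix x :: "nat => real"
      have i1: "Q.indep_vars (%_. borel) (%k w. W (arr (Suc k) x) (\<epsilon> k w)) {..<n}"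
        by (rule Q.indep_vars_compose2[OF Q.indep_vars_subset[OF ie], where Y="%k. W (arr (Suc k) x)"]) (auto intro: Ws)
      have int: "integrable Q (%w. W s (\<epsilon> k w))" for s k
        by (intro Q.integrable_const_bound[where B=1]) (auto simp: W01 intro: measurable_compose[OF em Ws])
      have "(\<integral>w. (\<Prod>k<n. W (arr (Suc k) x) (\<epsilon> k w)) \<partial>Q) = (\<Prod>k<n. \<integral>w. W (arr (Suc k) x) (\<epsilon> k w) \<partial>Q)"
        by (rule Q.indep_vars_lebesgue_integral[OF _ i1]) (auto intro: int)
      also have "\<dots> = (\<Prod>k<n. \<phi> (arr (Suc k) x))"
      proof (intro prod.cong refl)
        fix k
        have "(\<integral>w. W (arr (Suc k) x) (\<epsilon> k w) \<partial>Q) = (\<integral>\<mu>. W (arr (Suc k) x) \<mu> \<partial>distr Q radon_space (\<epsilon> k))"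
          by (rule integral_distr[OF em Ws, symmetric])
        then show "(\<integral>w. W (arr (Suc k) x) (\<epsilon> k w) \<partial>Q) = \<phi> (arr (Suc k) x)" by (simp add: de \<phi>_def)
      qed
      finally have e: "(\<integral>w. (\<Prod>k<n. W (arr (Suc k) x) (\<epsilon> k w)) \<partial>Q) = (\<Prod>k<n. \<phi> (arr (Suc k) x))" .
      have p01: "0 <= (\<Prod>k<n. W (arr (Suc k) x) (\<epsilon> k w))" "(\<Prod>k<n. W (arr (Suc k) x) (\<epsilon> k w)) <= 1" for w
        by (auto intro!: prod_nonneg prod_le_1 simp: W01)
      have "integrable Q (%w. \<Prod>k<n. W (arr (Suc k) x) (\<epsilon> k w))"
        using p01 by (intro Q.integrable_const_bound[where B=1] AE_I2 borel_measurable_prod measurable_compose[OF em Ws]) (simp add: abs_of_nonneg)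
      then have "(\<integral>\<^sup>+w. ennreal (\<Prod>k<n. W (arr (Suc k) x) (\<epsilon> k w)) \<partial>Q) = ennreal (\<integral>w. (\<Prod>k<n. W (arr (Suc k) x) (\<epsilon> k w)) \<partial>Q)"
        using p01 by (intro nn_integral_eq_integral) auto
      then show "(\<integral>\<^sup>+w. F (E w, x) \<partial>Q) = ennreal (\<Prod>k<n. \<phi> (arr (Suc k) x))" by (simp add: F_def E_def e)
    qed
    finally show ?thesis .
  qed
  define Z where "Z w = lap (ennreal b * (\<integral>\<^sup>+k. (ip h (scale_measure (ennreal (lpw \<alpha> \<xi> w k)) (\<epsilon> k w))) \<partial>count_space UNIV))" for w
  define V where "V n w = (\<Prod>k<n. W (arr (Suc k) (X w)) (\<epsilon> k w))" for n w
  \<comment> \<open>The waiting times are almost surely positive, hence so are the arrival times,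
    and the value of \<open>wt\<close> at s \<le> 0 is not met.\<close>
  have xpos: "AE w in Q. \<forall>k. 0 < \<xi> k w"
  proof (subst AE_all_countable, rule allI)
    fix k
    have "AE x in distr Q lborel (\<xi> k). 0 < x"
    proof -
      have "distr Q lborel (\<xi> k) = density lborel (exponential_density 1)" using dx[of k] by (simp add: distributed_def)
      moreover have "AE x in density lborel (exponential_density 1). 0 < (x::real)"
      proof (subst AE_density)
        have "AE x in lborel. x \<noteq> (0::real)" by (rule AE_lborel_singleton)
        then show "AE x in lborel. 0 < ennreal (exponential_density 1 x) --> 0 < x"
          by eventually_elim (auto simp: exponential_density_def split: if_splits)
      qed simp
      ultimately show ?thesis by (simp only:)
    qed
    then show "AE w in Q. 0 < \<xi> k w" by (subst (asm) AE_distr_iff) auto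
  qed
  have Vm [measurable]: "V n \<in> borel_measurable Q" for n
  proof -
    have "arr k \<in> borel_measurable (PiM UNIV (%_. borel))" for k
      using arr_meas[of k] measurable_cong_sets[OF SS refl] by blast
    then have "(%w. arr k (X w)) \<in> borel_measurable Q" for k by (rule measurable_compose[OF Xm])
    then show ?thesis unfolding V_def[abs_def] by (intro borel_measurable_prod Wcomp3 em)
  qed
  have V01: "0 <= V n w" "V n w <= 1" for n w
    unfolding V_def by (auto intro!: prod_nonneg prod_le_1 simp: W01)
  have lim: "AE w in Q. (%n. V n w) ----> Z w"
    using xpos AE_space
  proof eventually_elim
    case (elim w)
    have ap: "0 < arr (Suc k) (X w)" for k unfolding arr_def X_def using elim(1) by (intro sum_pos) auto
    have t: "(ip h (scale_measure (ennreal (lpw \<alpha> \<xi> w k)) (\<epsilon> k w))) = ennreal (arr (Suc k) (X w) powr (- 1 / \<alpha>)) * a (\<epsilon> k w)" for k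
      unfolding a_def nn_integral_scale_measure'[OF sets_radon_measure[OF er[OF elim(2)]] hm]
      by (simp add: arr_def X_def lessThan_Suc_atMost)
    have "V n w = lap (ennreal b * (\<Sum>k\<in>UNIV \<inter> {..<n}. ennreal (arr (Suc k) (X w) powr (- 1 / \<alpha>)) * a (\<epsilon> k w)))" for n
    proof -
      have "V n w = (\<Prod>k<n. lap (ennreal b * (ennreal (arr (Suc k) (X w) powr (- 1 / \<alpha>)) * a (\<epsilon> k w))))"
      proof -
        have "(arr (Suc k) (X w) <= 0) = False" for k using ap[of k] by simp
        then show ?thesis unfolding V_def W_def wt_def using b
          by (intro prod.cong refl) (simp add: ennreal_mult' mult.assoc)
      qed
      then show ?thesis by (simp add: lap_sum sum_distrib_left)
    qed
    moreover have "(%n. lap (ennreal b * (\<Sum>k\<in>UNIV \<inter> {..<n}. ennreal (arr (Suc k) (X w) powr (- 1 / \<alpha>)) * a (\<epsilon> k w)))) ----> Z w"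
      unfolding Z_def t
      by (intro tendsto_lap ennreal_tendsto_cmult nn_integral_count_space_LIMSEQ) simp
    ultimately show ?case by simp
  qed
  have Zm: "Z \<in> borel_measurable Q"
  proof -
    have sm: "(%w. ennreal (lpw \<alpha> \<xi> w k) * a (\<epsilon> k w)) \<in> borel_measurable Q" for k
      using measurable_compose[OF em am, of k] by measurable
    have "Z w = lap (ennreal b * (\<Sum>k. ennreal (lpw \<alpha> \<xi> w k) * a (\<epsilon> k w)))" if "w \<in> space Q" for w
      unfolding Z_def a_def nn_integral_scale_measure'[OF sets_radon_measure[OF er[OF that]] hm] nn_integral_count_space_nat ..
    moreover have "(%w. lap (ennreal b * (\<Sum>k. ennreal (lpw \<alpha> \<xi> w k) * a (\<epsilon> k w)))) \<in> borel_measurable Q"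
      using sm by measurable
    ultimately show ?thesis by (simp cong: measurable_cong)
  qed
  have "(%n. \<integral>w. V n w \<partial>Q) ----> (\<integral>w. Z w \<partial>Q)"
    using lim Zm by (intro integral_dominated_convergence[where w="%_. 1"]) (auto simp: V01)
  moreover have "(%n. \<integral>w. V n w \<partial>Q) ----> lap el"
  proof -
    have "(%n. \<integral>\<^sup>+w. ennreal (V n w) \<partial>Q) ----> ennreal (lap el)"
      using arrival_product[OF cont phi01 fin] unfolding V_def step tail by simp
    then have "(%n. enn2real (\<integral>\<^sup>+w. ennreal (V n w) \<partial>Q)) ----> lap el" by (rule tendsto_enn2real) simp
    then show ?thesis using V01 by (simp add: integral_eq_nn_integral)
  qed
  ultimately have "(\<integral>w. Z w \<partial>Q) = lap el" by (rule LIMSEQ_unique)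
  then show ?thesis by (simp only: Z_def)
qed

lemma lepage_equals_vague_series:
  fixes \<Lambda> :: "'x measure measure" and \<epsilon> :: "nat => 'q => 'x measure" and \<xi> :: "nat => 'q => real"
  assumes P: "random_measure P \<zeta>" and \<alpha>: "0 < \<alpha>" "\<alpha> < 1" and st: "stable_intensity \<alpha> \<Lambda>"
    and lapl: "!!h. h \<in> BM ==> laplace_functional P \<zeta> h = lap (laplace_exp \<Lambda> (en h))"
    and rcb: "relatively_compact_base B" and fin: "emeasure (spectral_measure \<alpha> B \<Lambda>) (sphere_of B) < \<infinity>"
    and c: "c = measure (spectral_measure \<alpha> B \<Lambda>) (sphere_of B)" and bd: "b = (c / Gamma (1 - \<alpha>)) powr (1 / \<alpha>)"
    and lv: "lepage_variables Q (spectral_measure \<alpha> B \<Lambda>) c \<epsilon> \<xi>"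
  shows "equals_vague_series P \<zeta> Q b (%_. UNIV)
    (%w k. scale_measure (ennreal (lpw \<alpha> \<xi> w k)) (\<epsilon> k w))"
proof -
  note se = spectral_measure_eq[OF rcb \<alpha> st]
  let ?s = "shat B \<Lambda>"
  have sS: "sets ?s = sets (restrict_space radon_space (sphere_of B))" by (rule sets_shat[OF rcb \<alpha> st])
  have spS: "space ?s = sphere_of B" by (rule space_shat[OF rcb \<alpha> st])
  have Q: "prob_space Q" using lv by (simp add: lepage_variables_def)
  interpret Q: prob_space Q by fact
  have ie: "Q.indep_vars (%_. radon_space) \<epsilon> UNIV" and ix: "Q.indep_vars (%_. borel) \<xi> UNIV"
    and dx: "!!k. distributed Q lborel (\<xi> k) (exponential_density 1)"
    and de: "!!k. distr Q radon_space (\<epsilon> k) = distr (scale_measure (ennreal (1 / c)) (spectral_measure \<alpha> B \<Lambda>)) radon_space (%\<mu>. \<mu>)"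
    and iex: "Q.indep_set
       {(%w k. \<epsilon> k w) -` A \<inter> space Q | A. A \<in> sets (PiM UNIV (%_. radon_space))}
       {(%w k. \<xi> k w) -` A \<inter> space Q | A. A \<in> sets (PiM UNIV (%_. borel))}"
    using lv by (auto simp: lepage_variables_def)
  have em [measurable]: "\<epsilon> k \<in> measurable Q radon_space" for k using ie by (auto simp: Q.indep_vars_def)
  have xm [measurable]: "\<xi> k \<in> borel_measurable Q" for k using ix by (auto simp: Q.indep_vars_def)
  have er: "\<epsilon> k w \<in> radon_measures" if "w \<in> space Q" for k w using measurable_space[OF em that] by simp
  have G: "0 < Gamma (1 - \<alpha>)" using \<alpha> by (intro Gamma_real_pos) simp
  have idm: "(%\<mu>. \<mu>) \<in> measurable ?s radon_space"
  proof -
    have "(%\<mu>. \<mu>) \<in> measurable (restrict_space radon_space (sphere_of B)) radon_space" by (rule measurable_restrict_space1) simp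
    then show ?thesis using measurable_cong_sets[OF sS refl] by blast
  qed
  have idz: "(%\<mu>. \<mu>) \<in> measurable (scale_measure r (spectral_measure \<alpha> B \<Lambda>)) radon_space" for r
  proof -
    have "sets (scale_measure r (spectral_measure \<alpha> B \<Lambda>)) = sets ?s" by (simp add: se)
    from measurable_cong_sets[OF this refl] idm show ?thesis by blast
  qed
  \<comment> \<open>For c = 0 the convention 1 / 0 = 0 would make the law of \<epsilon> the zero
    measure, which is not a probability measure.\<close>
  have c0: "c \<noteq> 0"
  proof
    assume "c = 0"
    then have "distr Q radon_space (\<epsilon> 0) = distr (scale_measure 0 (spectral_measure \<alpha> B \<Lambda>)) radon_space (%\<mu>. \<mu>)" using de[of 0] by simp
    moreover have "emeasure (distr (scale_measure 0 (spectral_measure \<alpha> B \<Lambda>)) radon_space (%\<mu>. \<mu>)) radon_measures = 0"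
      using sets.top[of "radon_space :: 'x measure measure"] by (subst emeasure_distr[OF idz]) simp_all
    moreover have "emeasure (distr Q radon_space (\<epsilon> 0)) radon_measures = 1"
      using prob_space.emeasure_space_1[OF Q.prob_space_distr[OF em[of 0]]] by simp
    ultimately show False by simp
  qed
  have sfin: "emeasure ?s (sphere_of B) < top"
    using fin G unfolding se by (auto simp: ennreal_mult_less_top)
  define d where "d = measure ?s (sphere_of B)"
  \<comment> \<open>The gamma factor of the spectral measure cancels in b, so that b powr \<alpha>
    is the total mass \<open>d\<close> of \<open>shat\<close>.\<close>
  have cd: "c = Gamma (1 - \<alpha>) * d" unfolding c se using G by (simp add: d_def measure_scale_measure)
  have d: "0 < d" using c0 cd G by (simp add: d_def zero_less_measure_iff less_le)
  have bd2: "b = d powr (1 / \<alpha>)" using bd cd G by simp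
  have b: "0 < b" using bd2 d by simp
  have ba: "b powr \<alpha> = d" using bd2 d \<alpha> by (simp add: powr_powr)
  define \<nu> where "\<nu> = distr (scale_measure (ennreal (1 / c)) (spectral_measure \<alpha> B \<Lambda>)) radon_space (%\<mu>. \<mu>)"
  have nn: "(\<integral>\<^sup>+\<mu>. f \<mu> \<partial>\<nu>) = ennreal (1 / d) * (\<integral>\<^sup>+\<mu>. f \<mu> \<partial>?s)" if f: "f \<in> borel_measurable radon_space" for f
  proof -
    have fs: "f \<in> borel_measurable ?s" by (rule measurable_compose[OF idm f])
    have "(\<integral>\<^sup>+\<mu>. f \<mu> \<partial>\<nu>) = (\<integral>\<^sup>+\<mu>. f \<mu> \<partial>scale_measure (ennreal (1 / c)) (scale_measure (ennreal (Gamma (1 - \<alpha>))) ?s))"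
      unfolding \<nu>_def se[symmetric] by (rule nn_integral_distr[OF idz]) (simp add: f)
    also have "\<dots> = ennreal (1 / c) * (ennreal (Gamma (1 - \<alpha>)) * (\<integral>\<^sup>+\<mu>. f \<mu> \<partial>?s))"
      using fs by (subst nn_integral_scale_measure; simp add: nn_integral_scale_measure)
    also have "\<dots> = ennreal (1 / c * Gamma (1 - \<alpha>)) * (\<integral>\<^sup>+\<mu>. f \<mu> \<partial>?s)"
    proof -
      have "0 <= 1 / c" using G d cd by simp
      then show ?thesis by (simp only: ennreal_mult' mult.assoc)
    qed
    also have "1 / c * Gamma (1 - \<alpha>) = 1 / d" using G d cd by simp
    finally show ?thesis .
  qed
  show ?thesis
  proof (rule equals_vague_seriesI[OF P Q _ _ b])
    fix w k assume "w \<in> space Q"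
    then show "scale_measure (ennreal (lpw \<alpha> \<xi> w k)) (\<epsilon> k w) \<in> radon_measures"
      by (intro scale_measure_radon er) auto
  next
    fix C :: "'x set" assume C: "C \<in> sets borel"
    have "(%w. \<Sum>k. ennreal (lpw \<alpha> \<xi> w k) * emeasure (\<epsilon> k w) C) \<in> borel_measurable Q"
      using measurable_compose[OF em measurable_emeasure_radon_space[OF C]] by measurable
    then show "(%w. \<integral>\<^sup>+k. emeasure (scale_measure (ennreal (lpw \<alpha> \<xi> w k)) (\<epsilon> k w)) C \<partial>count_space UNIV) \<in> borel_measurable Q"
      by (simp add: nn_integral_count_space_nat)
  next
    fix h :: "'x => real" assume h: "h \<in> BM"
    have hm: "(en h) \<in> borel_measurable borel" using BM_measurable[OF h] by simp
    have km: "(%\<mu>. ennreal (b powr \<alpha>) * kap \<alpha> (ip h \<mu>)) \<in> borel_measurable radon_space"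
    proof -
      from measurable_compose[OF measurable_np[OF hm] kap_measurable] show ?thesis by simp
    qed
    have "(\<integral>\<^sup>+\<mu>. ennreal (b powr \<alpha>) * kap \<alpha> (ip h \<mu>) \<partial>\<nu>) = ennreal (1 / d) * (\<integral>\<^sup>+\<mu>. ennreal d * kap \<alpha> (ip h \<mu>) \<partial>?s)"
      using nn[OF km] by (simp add: ba)
    also have "(\<integral>\<^sup>+\<mu>. ennreal d * kap \<alpha> (ip h \<mu>) \<partial>?s) = ennreal d * (\<integral>\<^sup>+\<mu>. kap \<alpha> (ip h \<mu>) \<partial>?s)"
    proof (rule nn_integral_cmult)
      show "(%\<mu>. kap \<alpha> (ip h \<mu>)) \<in> borel_measurable ?s"
        by (rule measurable_compose[OF measurable_compose[OF idm measurable_np[OF hm]] kap_measurable])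
    qed
    also have "(\<integral>\<^sup>+\<mu>. kap \<alpha> (ip h \<mu>) \<partial>?s) = laplace_exp \<Lambda> (en h)"
      by (rule laplace_exp_polar[OF rcb \<alpha> st sfin hm, symmetric])
    also have "ennreal (1 / d) * (ennreal d * laplace_exp \<Lambda> (en h)) = laplace_exp \<Lambda> (en h)"
      using d by (simp add: mult.assoc[symmetric] ennreal_mult'[symmetric])
    finally have L: "(\<integral>\<^sup>+\<mu>. ennreal (b powr \<alpha>) * kap \<alpha> (ip h \<mu>) \<partial>\<nu>) = laplace_exp \<Lambda> (en h)" .
    have Lfin: "laplace_exp \<Lambda> (en h) < top"
      by (rule stable_intensity_laplace_exp[OF st h])
    show "(\<integral>w. lap (ennreal b * (\<integral>\<^sup>+k. (ip h (scale_measure (ennreal (lpw \<alpha> \<xi> w k)) (\<epsilon> k w))) \<partial>count_space UNIV)) \<partial>Q) = laplace_functional P \<zeta> h"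
      unfolding lapl[OF h]
      by (rule lepage_laplace[OF Q b \<alpha>(1) ie de[folded \<nu>_def] ix dx iex h L Lfin])
  qed
qed

end

section \<open>Existence of Poisson processes\<close>

lemma (in product_prob_space) nn_integral_PiM_prod:
  fixes f :: "'i => 'a => ennreal"
  assumes J: "finite J" "J \<subseteq> I" and f: "!!i. i \<in> J ==> f i \<in> borel_measurable (M i)"
  shows "(\<integral>\<^sup>+w. (\<Prod>i\<in>J. f i (w i)) \<partial>PiM I M) = (\<Prod>i\<in>J. \<integral>\<^sup>+x. f i x \<partial>M i)"
proof -
  interpret J: finite_product_sigma_finite M J by unfold_locales fact
  have rm: "(%w. restrict w J) \<in> measurable (PiM I M) (PiM J M)" using J(2) by (rule measurable_restrict_subset)
  have fm: "(%w. \<Prod>i\<in>J. f i (w i)) \<in> borel_measurable (PiM J M)"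
  proof (rule borel_measurable_prod_ennreal)
    fix i assume i: "i \<in> J"
    show "(%w. f i (w i)) \<in> borel_measurable (PiM J M)"
      by (rule measurable_compose[where f="%w. w i" and g="f i", OF measurable_component_singleton[of i J M, OF i] f[OF i]])
  qed
  have "(\<integral>\<^sup>+w. (\<Prod>i\<in>J. f i (w i)) \<partial>PiM I M) = (\<integral>\<^sup>+w. (\<Prod>i\<in>J. f i (restrict w J i)) \<partial>PiM I M)"
    by (intro nn_integral_cong prod.cong) auto
  also have "\<dots> = (\<integral>\<^sup>+w. (\<Prod>i\<in>J. f i (w i)) \<partial>distr (PiM I M) (PiM J M) (%w. restrict w J))"
    using fm by (intro nn_integral_distr[symmetric] rm) simp
  also have "\<dots> = (\<integral>\<^sup>+w. (\<Prod>i\<in>J. f i (w i)) \<partial>PiM J M)"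
    using J by (simp add: distr_PiM_restrict_finite)
  also have "\<dots> = (\<Prod>i\<in>J. \<integral>\<^sup>+x. f i x \<partial>M i)"
    by (intro product_nn_integral_prod J f)
  finally show ?thesis .
qed

definition poisson_nat :: "real => nat measure" where
  "poisson_nat m = density (count_space UNIV) (%k. ennreal (exp (- m) * m ^ k / fact k))"

lemma nn_integral_poisson_nat:
  assumes m: "0 <= m" and q: "0 <= q"
  shows "(\<integral>\<^sup>+k. ennreal (q ^ k) \<partial>poisson_nat m) = ennreal (exp (- (m * (1 - q))))"
proof -
  have "(\<integral>\<^sup>+k. ennreal (q ^ k) \<partial>poisson_nat m) = (\<Sum>k. ennreal (exp (- m) * m ^ k / fact k) * ennreal (q ^ k))"
    unfolding poisson_nat_def by (simp add: nn_integral_density nn_integral_count_space_nat)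
  also have "\<dots> = (\<Sum>k. ennreal (exp (- m) * m ^ k / fact k * q ^ k))"
    using m q by (simp add: ennreal_mult[symmetric])
  also have "\<dots> = ennreal (exp (- (m * (1 - q))))"
    using poisson_sums[of m q] m q by (subst suminf_ennreal2) (auto simp: sums_iff)
  finally show ?thesis .
qed

lemma prob_space_poisson_nat: "0 <= m ==> prob_space (poisson_nat m)"
proof (rule prob_spaceI)
  assume "0 <= m"
  then have "(\<integral>\<^sup>+k. ennreal (1 ^ k) \<partial>poisson_nat m) = ennreal (exp (- (m * (1 - 1))))" by (intro nn_integral_poisson_nat) auto
  then show "emeasure (poisson_nat m) (space (poisson_nat m)) = 1" by simp
qed

text \<open>This is a Poisson number of independent points. Given that the number is n, the
  expectation of the exponential is q ^ n, and the generating function of the Poisson law gives the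
  formula.\<close>

lemma compound_poisson_laplace:
  fixes \<pi> :: "'a measure" and g :: "'a => ennreal"
  assumes pi: "prob_space \<pi>" and m: "0 <= m" and g [measurable]: "g \<in> borel_measurable \<pi>"
  defines "K \<equiv> poisson_nat m \<Otimes>\<^sub>M PiM (UNIV :: nat set) (%_. \<pi>)"
  shows "prob_space K"
    and "(%p. \<Sum>k<fst p. g (snd p k)) \<in> borel_measurable K"
    and "(\<integral>\<^sup>+p. ennreal (lap (\<Sum>k<fst p. g (snd p k))) \<partial>K) = ennreal (exp (- (m * (1 - enn2real (\<integral>\<^sup>+x. ennreal (lap (g x)) \<partial>\<pi>)))))"
proof -
  interpret pi: prob_space \<pi> by (rule pi)
  interpret N: prob_space "poisson_nat m" using m by (rule prob_space_poisson_nat)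
  interpret S: product_prob_space "%_::nat. \<pi>" UNIV by unfold_locales
  interpret PP: pair_prob_space "poisson_nat m" "PiM (UNIV :: nat set) (%_. \<pi>)" by unfold_locales
  show "prob_space K" unfolding K_def by unfold_locales
  have sN: "sets (poisson_nat m) = sets (count_space UNIV)" by (simp add: poisson_nat_def)
  have fstm: "fst \<in> measurable K (count_space UNIV)"
    using measurable_cong_sets[OF refl sN, of K] unfolding K_def by (metis measurable_fst)
  have gk: "(%p. g (snd p k)) \<in> borel_measurable K" for k
  proof -
    have "(%s. g (s k)) \<in> borel_measurable (PiM (UNIV :: nat set) (%_. \<pi>))"
      by (rule measurable_compose[where f="%w. w k" and g=g, OF measurable_component_singleton[of k UNIV "%_. \<pi>", OF UNIV_I] g])
    then show ?thesis unfolding K_def by (rule measurable_compose[OF measurable_snd])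
  qed
  show Ym: "(%p. \<Sum>k<fst p. g (snd p k)) \<in> borel_measurable K"
  proof (rule measurable_compose_countable[OF _ fstm])
    show "(%p. \<Sum>k<n. g (snd p k)) \<in> borel_measurable K" for n using gk by measurable
  qed
  define q where "q = enn2real (\<integral>\<^sup>+x. ennreal (lap (g x)) \<partial>\<pi>)"
  have "(\<integral>\<^sup>+x. ennreal (lap (g x)) \<partial>\<pi>) <= (\<integral>\<^sup>+x. 1 \<partial>\<pi>)"
    by (intro nn_integral_mono) (metis ennreal_1 ennreal_leI lap_le_1)
  then have "(\<integral>\<^sup>+x. ennreal (lap (g x)) \<partial>\<pi>) < top" by (simp add: pi.emeasure_space_1 order_le_less_trans[OF _ ennreal_one_less_top])
  then have q: "(\<integral>\<^sup>+x. ennreal (lap (g x)) \<partial>\<pi>) = ennreal q" "0 <= q" by (simp_all add: q_def)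
  have inner: "(\<integral>\<^sup>+s. ennreal (lap (\<Sum>k<n. g (s k))) \<partial>PiM UNIV (%_. \<pi>)) = ennreal (q ^ n)" for n
  proof -
    have "(\<integral>\<^sup>+s. ennreal (lap (\<Sum>k<n. g (s k))) \<partial>PiM UNIV (%_. \<pi>)) = (\<integral>\<^sup>+s. (\<Prod>k<n. ennreal (lap (g (s k)))) \<partial>PiM UNIV (%_. \<pi>))"
      by (simp add: lap_sum prod_ennreal)
    also have "\<dots> = (\<Prod>k<n. \<integral>\<^sup>+x. ennreal (lap (g x)) \<partial>\<pi>)"
      by (rule S.nn_integral_PiM_prod) auto
    also have "\<dots> = ennreal (q ^ n)" using q by (simp add: ennreal_power)
    finally show ?thesis .
  qed
  have "(%p. ennreal (lap (\<Sum>k<fst p. g (snd p k)))) \<in> borel_measurable K" using Ym by simp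
  then have "(\<integral>\<^sup>+p. ennreal (lap (\<Sum>k<fst p. g (snd p k))) \<partial>K) = (\<integral>\<^sup>+n. (\<integral>\<^sup>+s. ennreal (lap (\<Sum>k<n. g (s k))) \<partial>PiM UNIV (%_. \<pi>)) \<partial>poisson_nat m)"
    unfolding K_def by (subst S.P.nn_integral_fst[symmetric]) auto
  also have "\<dots> = (\<integral>\<^sup>+n. ennreal (q ^ n) \<partial>poisson_nat m)" by (simp add: inner)
  also have "\<dots> = ennreal (exp (- (m * (1 - q))))" by (rule nn_integral_poisson_nat[OF m q(2)])
  finally show "(\<integral>\<^sup>+p. ennreal (lap (\<Sum>k<fst p. g (snd p k))) \<partial>K) = ennreal (exp (- (m * (1 - enn2real (\<integral>\<^sup>+x. ennreal (lap (g x)) \<partial>\<pi>)))))"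
    by (simp add: q_def)
qed

text \<open>The law is the normalised restriction of the intensity to \<open>A\<close>. A null set
  cannot be normalised, but there the factor \<open>measure \<Lambda> A\<close> is 0 and any law
  satisfies the formula; the Dirac law at \<open>a0\<close> is taken.\<close>

lemma finite_piece:
  fixes \<Lambda> :: "'a measure"
  assumes A: "A \<in> sets \<Lambda>" "emeasure \<Lambda> A \<noteq> \<infinity>" and a0: "a0 \<in> space \<Lambda>"
  shows "\<exists>\<pi>. prob_space \<pi> \<and> sets \<pi> = sets \<Lambda> \<and> (\<forall>g\<in>borel_measurable \<Lambda>.
    exp (- (measure \<Lambda> A * (1 - enn2real (\<integral>\<^sup>+x. ennreal (lap (g x)) \<partial>\<pi>)))) = lap (\<integral>\<^sup>+x. ennreal (1 - lap (g x)) * indicator A x \<partial>\<Lambda>))"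
proof (cases "emeasure \<Lambda> A = 0")
  case True
  have "(\<integral>\<^sup>+x. ennreal (1 - lap (g x)) * indicator A x \<partial>\<Lambda>) = 0" for g
  proof -
    have "AE x in \<Lambda>. x \<notin> A" using True A by (intro AE_not_in) (auto simp: null_sets_def)
    then have "(\<integral>\<^sup>+x. ennreal (1 - lap (g x)) * indicator A x \<partial>\<Lambda>) = (\<integral>\<^sup>+x. 0 \<partial>\<Lambda>)"
      by (intro nn_integral_cong_AE) (auto simp: indicator_def)
    then show ?thesis by simp
  qed
  moreover have "measure \<Lambda> A = 0" using True by (simp add: measure_def)
  ultimately show ?thesis using a0 by (intro exI[of _ "return \<Lambda> a0"]) (auto simp: prob_space_return)
next
  case False
  let ?\<pi> = "uniform_measure \<Lambda> A"
  define m where "m = measure \<Lambda> A"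
  have m: "emeasure \<Lambda> A = ennreal m" "0 < m"
  proof -
    show e: "emeasure \<Lambda> A = ennreal m" unfolding m_def by (rule emeasure_eq_ennreal_measure) (use A(2) in simp)
    have "m \<noteq> 0" using False e by auto
    then show "0 < m" using measure_nonneg[of \<Lambda> A] by (simp add: m_def less_le)
  qed
  have p: "prob_space ?\<pi>" using A False by (intro prob_space_uniform_measure) auto
  interpret p: prob_space ?\<pi> by (rule p)
  have "exp (- (m * (1 - enn2real (\<integral>\<^sup>+x. ennreal (lap (g x)) \<partial>?\<pi>)))) = lap (\<integral>\<^sup>+x. ennreal (1 - lap (g x)) * indicator A x \<partial>\<Lambda>)"
    if g [measurable]: "g \<in> borel_measurable \<Lambda>" for g
  proof -
    have gp [measurable]: "g \<in> borel_measurable ?\<pi>" by simp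
    have int: "integrable ?\<pi> (%x. lap (g x))" by (intro p.integrable_const_bound[where B=1]) auto
    have q: "enn2real (\<integral>\<^sup>+x. ennreal (lap (g x)) \<partial>?\<pi>) = (\<integral>x. lap (g x) \<partial>?\<pi>)"
      by (subst integral_eq_nn_integral) auto
    have "ennreal (1 - (\<integral>x. lap (g x) \<partial>?\<pi>)) = ennreal (\<integral>x. 1 - lap (g x) \<partial>?\<pi>)"
      using int by (simp add: p.prob_space[simplified])
    also have "\<dots> = (\<integral>\<^sup>+x. ennreal (1 - lap (g x)) \<partial>?\<pi>)"
      using int by (intro nn_integral_eq_integral[symmetric]) auto
    also have "\<dots> = (\<integral>\<^sup>+x. ennreal (1 - lap (g x)) * indicator A x \<partial>\<Lambda>) / emeasure \<Lambda> A"
      using A(1) by (intro nn_integral_uniform_measure) auto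
    finally have e: "ennreal (1 - (\<integral>x. lap (g x) \<partial>?\<pi>)) = (\<integral>\<^sup>+x. ennreal (1 - lap (g x)) * indicator A x \<partial>\<Lambda>) / ennreal m"
      by (simp add: m(1))
    have le1: "(\<integral>x. lap (g x) \<partial>?\<pi>) <= 1"
    proof -
      have "(\<integral>x. lap (g x) \<partial>?\<pi>) <= (\<integral>x. 1 \<partial>?\<pi>)" using int by (intro integral_mono) auto
      then show ?thesis by (simp add: p.prob_space[simplified])
    qed
    have "(\<integral>\<^sup>+x. ennreal (1 - lap (g x)) * indicator A x \<partial>\<Lambda>) = ennreal m * ennreal (1 - (\<integral>x. lap (g x) \<partial>?\<pi>))"
      unfolding e using m(2) by (simp add: ennreal_times_divide mult.commute[of "ennreal m"] mult_divide_eq_ennreal)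
    also have "\<dots> = ennreal (m * (1 - (\<integral>x. lap (g x) \<partial>?\<pi>)))" using m(2) by (simp add: ennreal_mult')
    finally show ?thesis unfolding q using m(2) le1 by (simp add: lap_ennreal)
  qed
  then show ?thesis using p by (intro exI[of _ ?\<pi>]) (auto simp: m_def)
qed

text \<open>Independent finite pieces are superposed. Their Laplace transforms multiply, so their
  exponents add up to the integral over the whole space, and \<open>poisson_processI_laplace\<close>
  recognises the process.\<close>

lemma poisson_points_exist:
  fixes \<Lambda> :: "'a measure"
  assumes sf: "sigma_finite_measure \<Lambda>" and ne: "space \<Lambda> \<noteq> {}"
  shows "\<exists>(Q :: 'a poisson_sample measure) I x. poisson_points Q \<Lambda> I x"
proof -
  obtain A :: "nat => 'a set" where A: "range A \<subseteq> sets \<Lambda>" "(\<Union>i. A i) = space \<Lambda>" "!!i. emeasure \<Lambda> (A i) \<noteq> \<infinity>" "disjoint_family A"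
    using sigma_finite_measure.sigma_finite_disjoint[OF sf] by metis
  have As: "A n \<in> sets \<Lambda>" for n using A(1) by auto
  obtain a0 where a0: "a0 \<in> space \<Lambda>" using ne by blast
  have "\<forall>n. \<exists>\<pi>. prob_space \<pi> \<and> sets \<pi> = sets \<Lambda> \<and> (\<forall>g\<in>borel_measurable \<Lambda>.
    exp (- (measure \<Lambda> (A n) * (1 - enn2real (\<integral>\<^sup>+x. ennreal (lap (g x)) \<partial>\<pi>)))) = lap (\<integral>\<^sup>+x. ennreal (1 - lap (g x)) * indicator (A n) x \<partial>\<Lambda>))"
    using finite_piece[OF As A(3) a0] by blast
  from choice[OF this] obtain \<pi> where pi: "\<forall>n. prob_space (\<pi> n) \<and> sets (\<pi> n) = sets \<Lambda> \<and> (\<forall>g\<in>borel_measurable \<Lambda>.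
    exp (- (measure \<Lambda> (A n) * (1 - enn2real (\<integral>\<^sup>+x. ennreal (lap (g x)) \<partial>\<pi> n)))) = lap (\<integral>\<^sup>+x. ennreal (1 - lap (g x)) * indicator (A n) x \<partial>\<Lambda>))" ..
  have pp: "prob_space (\<pi> n)" and ps: "sets (\<pi> n) = sets \<Lambda>" for n using pi by auto
  have pe: "exp (- (measure \<Lambda> (A n) * (1 - enn2real (\<integral>\<^sup>+x. ennreal (lap (g x)) \<partial>\<pi> n)))) = lap (\<integral>\<^sup>+x. ennreal (1 - lap (g x)) * indicator (A n) x \<partial>\<Lambda>)"
    if "g \<in> borel_measurable \<Lambda>" for g n using pi that by blast
  have bmp: "g \<in> borel_measurable (\<pi> n)" if "g \<in> borel_measurable \<Lambda>" for g :: "'a => ennreal" and n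
    using that measurable_cong_sets[OF ps refl] by blast
  define K where "K n = poisson_nat (measure \<Lambda> (A n)) \<Otimes>\<^sub>M PiM (UNIV :: nat set) (%_. \<pi> n)" for n
  have pK: "prob_space (K n)" for n unfolding K_def by (rule compound_poisson_laplace(1)[OF pp measure_nonneg, where g="%_. 0"]) simp
  interpret P: product_prob_space K UNIV by (intro product_prob_spaceI pK)
  let ?Q = "PiM UNIV K"
  \<comment> \<open>An index encodes a pair (n, k), the k-th point of the n-th piece. It counts when
    k is below the Poisson number of that piece.\<close>
  define I where "I w = {i. case prod_decode i of (n, k) => k < fst (w n)}" for w :: "'a poisson_sample"
  define x where "x w i = (case prod_decode i of (n, k) => snd (w n) k)" for w :: "'a poisson_sample" and i
  have xs: "x w i \<in> space \<Lambda>" if "w \<in> space ?Q" for w i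
  proof -
    obtain n k where nk: "prod_decode i = (n, k)" by fastforce
    have "w n \<in> space (K n)" using that by (simp add: space_PiM PiE_def Pi_iff)
    then have "snd (w n) k \<in> space (\<pi> n)" by (auto simp: K_def space_pair_measure space_PiM PiE_def)
    then show ?thesis using sets_eq_imp_space_eq[OF ps] by (simp add: x_def nk)
  qed
  let ?\<Psi> = "%w. distr (count_space (I w)) \<Lambda> (x w)"
  define Y where "Y g n p = (\<Sum>k<fst p. g (snd p k))" for g :: "'a => ennreal" and n :: nat and p :: "nat \<times> (nat => 'a)"
  have Psi: "(np g (?\<Psi> w)) = (\<Sum>n. Y g n (w n))" if g: "g \<in> borel_measurable \<Lambda>" and w: "w \<in> space ?Q" for g w
  proof -
    have "(np g (?\<Psi> w)) = (\<integral>\<^sup>+i. g (x w i) \<partial>count_space (I w))"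
      using g xs[OF w] by (intro nn_integral_distr) auto
    also have "\<dots> = (\<integral>\<^sup>+i. g (x w i) * indicator (I w) i \<partial>count_space UNIV)"
      by (rule nn_integral_count_space_indicator) simp
    also have "\<dots> = (\<integral>\<^sup>+p. g (x w (prod_encode p)) * indicator (I w) (prod_encode p) \<partial>count_space UNIV)"
      by (rule nn_integral_bij_count_space[symmetric]) (rule bij_prod_encode)
    also have "\<dots> = (\<integral>\<^sup>+n. (\<integral>\<^sup>+k. g (x w (prod_encode (n, k))) * indicator (I w) (prod_encode (n, k)) \<partial>count_space UNIV) \<partial>count_space UNIV)"
      by (rule nn_integral_fst_count_space[symmetric])
    also have "\<dots> = (\<integral>\<^sup>+n. Y g n (w n) \<partial>count_space UNIV)"
    proof (intro nn_integral_cong)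
      fix n
      have "(\<integral>\<^sup>+k. g (x w (prod_encode (n, k))) * indicator (I w) (prod_encode (n, k)) \<partial>count_space UNIV)
        = (\<Sum>k. g (snd (w n) k) * indicator {..<fst (w n)} k)"
        by (simp add: nn_integral_count_space_nat x_def I_def indicator_def)
      also have "\<dots> = (\<Sum>k<fst (w n). g (snd (w n) k) * indicator {..<fst (w n)} k)"
        by (rule suminf_finite) auto
      also have "\<dots> = Y g n (w n)" unfolding Y_def by (intro sum.cong) auto
      finally show "(\<integral>\<^sup>+k. g (x w (prod_encode (n, k))) * indicator (I w) (prod_encode (n, k)) \<partial>count_space UNIV) = Y g n (w n)" .
    qed
    also have "\<dots> = (\<Sum>n. Y g n (w n))" by (rule nn_integral_count_space_nat)
    finally show ?thesis .
  qed
  have Ym: "Y g n \<in> borel_measurable (K n)" if "g \<in> borel_measurable \<Lambda>" for g n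
    unfolding Y_def[abs_def] K_def by (rule compound_poisson_laplace(2)[OF pp measure_nonneg bmp[OF that]])
  have Ymq: "(%w. Y g n (w n)) \<in> borel_measurable ?Q" if "g \<in> borel_measurable \<Lambda>" for g n
    by (rule measurable_compose[where f="%w. w n" and g="Y g n", OF measurable_component_singleton[of n UNIV K, OF UNIV_I] Ym[OF that]])
  have SYm: "(%w. \<Sum>n. Y g n (w n)) \<in> borel_measurable ?Q" if "g \<in> borel_measurable \<Lambda>" for g
    using Ymq[OF that] by measurable
  have lapl: "(\<integral>w. lap (\<Sum>n. Y g n (w n)) \<partial>?Q) = lap (\<integral>\<^sup>+z. ennreal (1 - lap (g z)) \<partial>\<Lambda>)" if g: "g \<in> borel_measurable \<Lambda>" for g
  proof -
    define e where "e n = (\<integral>\<^sup>+z. ennreal (1 - lap (g z)) * indicator (A n) z \<partial>\<Lambda>)" for n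
    have step: "(\<integral>w. lap (\<Sum>n<m. Y g n (w n)) \<partial>?Q) = lap (\<Sum>n<m. e n)" for m
    proof -
      have "(\<integral>\<^sup>+w. ennreal (lap (\<Sum>n<m. Y g n (w n))) \<partial>?Q) = (\<integral>\<^sup>+w. (\<Prod>n<m. ennreal (lap (Y g n (w n)))) \<partial>?Q)"
        by (simp add: lap_sum prod_ennreal)
      also have "\<dots> = (\<Prod>n<m. \<integral>\<^sup>+p. ennreal (lap (Y g n p)) \<partial>K n)"
        by (rule P.nn_integral_PiM_prod) (use Ym[OF g] in auto)
      also have "\<dots> = (\<Prod>n<m. ennreal (lap (e n)))"
        unfolding Y_def K_def compound_poisson_laplace(3)[OF pp measure_nonneg bmp[OF g]] pe[OF g] e_def ..
      also have "\<dots> = ennreal (lap (\<Sum>n<m. e n))" by (simp add: lap_sum prod_ennreal)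
      finally have nn: "(\<integral>\<^sup>+w. ennreal (lap (\<Sum>n<m. Y g n (w n))) \<partial>?Q) = ennreal (lap (\<Sum>n<m. e n))" .
      have "(%w. \<Sum>n<m. Y g n (w n)) \<in> borel_measurable ?Q" using Ymq[OF g] by measurable
      then show ?thesis using nn by (subst integral_eq_nn_integral) auto
    qed
    have "(%m. \<integral>w. lap (\<Sum>n<m. Y g n (w n)) \<partial>?Q) ----> (\<integral>w. lap (\<Sum>n. Y g n (w n)) \<partial>?Q)"
    proof (rule integral_dominated_convergence[where w="%_. 1"])
      show "AE w in ?Q. (%m. lap (\<Sum>n<m. Y g n (w n))) ----> lap (\<Sum>n. Y g n (w n))"
        by (intro AE_I2 tendsto_lap summable_LIMSEQ) simp
      show "(%w. lap (\<Sum>n<m. Y g n (w n))) \<in> borel_measurable ?Q" for m using Ymq[OF g] by measurable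
      show "(%w. lap (\<Sum>n. Y g n (w n))) \<in> borel_measurable ?Q" using SYm[OF g] by measurable
    qed auto
    moreover have "(%m. lap (\<Sum>n<m. e n)) ----> lap (\<Sum>n. e n)" by (intro tendsto_lap summable_LIMSEQ) simp
    moreover have "(\<Sum>n. e n) = (\<integral>\<^sup>+z. ennreal (1 - lap (g z)) \<partial>\<Lambda>)"
    proof -
      have "(\<Sum>n. e n) = (\<integral>\<^sup>+z. (\<Sum>n. ennreal (1 - lap (g z)) * indicator (A n) z) \<partial>\<Lambda>)"
        unfolding e_def using g As by (intro nn_integral_suminf[symmetric]) (auto intro!: borel_measurable_times_ennreal borel_measurable_indicator)
      also have "\<dots> = (\<integral>\<^sup>+z. ennreal (1 - lap (g z)) \<partial>\<Lambda>)"
      proof (intro nn_integral_cong)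
        fix z assume "z \<in> space \<Lambda>"
        then obtain j where j: "z \<in> A j" using A(2) by blast
        then have "z \<notin> A n" if "n \<noteq> j" for n using A(4) that unfolding disjoint_family_on_def by blast
        then have "(\<Sum>n. ennreal (1 - lap (g z)) * indicator (A n) z) = (\<Sum>n\<in>{j}. ennreal (1 - lap (g z)) * indicator (A n) z)"
          by (intro suminf_finite) auto
        then show "(\<Sum>n. ennreal (1 - lap (g z)) * indicator (A n) z) = ennreal (1 - lap (g z))" using j by simp
      qed
      finally show ?thesis .
    qed
    ultimately show ?thesis unfolding step using LIMSEQ_unique by metis
  qed
  have "poisson_process ?Q \<Lambda> ?\<Psi>"
  proof (rule poisson_processI_laplace[OF P.P.prob_space_axioms])
    show "sets (?\<Psi> w) = sets \<Lambda>" for w by simp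
    show "(%w. emeasure (?\<Psi> w) B) \<in> borel_measurable ?Q" if B: "B \<in> sets \<Lambda>" for B
    proof (rule measurable_cong[THEN iffD2])
      fix w assume w: "w \<in> space ?Q"
      have "emeasure (?\<Psi> w) B = (np (indicator B) (?\<Psi> w))" using B by simp
      also have "\<dots> = (\<Sum>n. Y (indicator B) n (w n))" using B by (intro Psi w) simp
      finally show "emeasure (?\<Psi> w) B = (\<Sum>n. Y (indicator B) n (w n))" .
    next
      show "(%w. \<Sum>n. Y (indicator B) n (w n)) \<in> borel_measurable ?Q" using B by (intro SYm) simp
    qed
    show "(\<integral>w. lap (np g (?\<Psi> w)) \<partial>?Q) = lap (\<integral>\<^sup>+z. ennreal (1 - lap (g z)) \<partial>\<Lambda>)" if g: "g \<in> borel_measurable \<Lambda>" for g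
      unfolding lapl[OF g, symmetric] by (intro bint_cong refl) (simp only: Psi[OF g])
  qed
  then have "poisson_points ?Q \<Lambda> I x" unfolding poisson_points_def using xs by blast
  then show ?thesis by blast
qed

text \<open>The sets where k times \<open>f n\<close> is at least 1 have finite measure by Markov's
  inequality, and every point lies in one of them.\<close>

lemma sigma_finite_measureI_integrable:
  fixes f :: "nat => 'a => ennreal"
  assumes fm [measurable]: "!!n. f n \<in> borel_measurable M" and fin: "!!n. (np (f n) M) < top"
    and pos: "!!x. x \<in> space M ==> \<exists>n. 0 < f n x"
  shows "sigma_finite_measure M"
proof
  define W where "W n k = {x \<in> space M. 1 <= of_nat k * f n x}" for n k :: nat
  have Wm: "W n k \<in> sets M" for n k unfolding W_def by measurable
  have Wf: "emeasure M (W n k) < top" for n k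
  proof -
    have "emeasure M (W n k) <= of_nat k * (\<integral>\<^sup>+x. f n x * indicator (space M) x \<partial>M)"
      unfolding W_def by (rule nn_integral_Markov_inequality) measurable
    also have "(\<integral>\<^sup>+x. f n x * indicator (space M) x \<partial>M) = (np (f n) M)" by (intro nn_integral_cong) simp
    finally have le: "emeasure M (W n k) <= of_nat k * (np (f n) M)" .
    have "of_nat k * (np (f n) M) < top" using fin[of n] by (simp add: ennreal_mult_less_top of_nat_less_top)
    then show ?thesis by (rule order_le_less_trans[OF le])
  qed
  have "\<exists>n k. x \<in> W n k" if x: "x \<in> space M" for x
  proof -
    obtain n where n: "0 < f n x" using pos[OF x] by blast
    obtain k :: nat where "1 <= of_nat k * f n x"
    proof (cases "f n x = top")
      case True
      then show ?thesis using that[of 1] by simp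
    next
      case False
      define r where "r = enn2real (f n x)"
      have r: "f n x = ennreal r" "0 < r" using False n by (simp_all add: r_def enn2real_positive_iff less_top)
      obtain k :: nat where "1 / r < real k" using reals_Archimedean2 by blast
      then have "1 <= real k * r" using r by (simp add: field_simps)
      then have "ennreal 1 <= ennreal (real k * r)" by (rule ennreal_leI)
      then show ?thesis using that[of k] r by (simp add: ennreal_mult' ennreal_of_nat_eq_real_of_nat)
    qed
    then show ?thesis using x by (auto simp: W_def)
  qed
  then have "\<Union> (range (%p. W (fst p) (snd p))) = space M" by (auto simp: W_def)
  then show "\<exists>A. countable A \<and> A \<subseteq> sets M \<and> \<Union> A = space M \<and> (\<forall>a\<in>A. emeasure M a \<noteq> \<infinity>)"
    using Wm Wf by (intro exI[of _ "range (%p. W (fst p) (snd p))"]) (auto simp: less_top)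
qed

section \<open>Weak limits of sequences of numbers in the unit interval\<close>

text \<open>Schoenberg's trick: a point of the Hilbert cube is encoded by a real number whose ternary digits
  are the binary digits of the coordinates. The decoder is continuous on the whole real line, since
  \<open>cdig\<close> reads the first ternary digit of \<open>t\<close> modulo 2 continuously whenever it is \<open>0\<close> or \<open>2\<close>.\<close>

definition cdig :: "real => real" where "cdig t = max 0 (min 1 (1 / 2 - cos (pi * t)))"

definition bdig :: "real => nat => real" where "bdig y k = real_of_int (\<lfloor>2 ^ k * y\<rfloor> mod 2)"

definition code :: "(nat => real) => real" where
  "code y = (\<Sum>m. 2 * bdig (y (fst (prod_decode m))) (snd (prod_decode m)) * (1 / 3) ^ Suc m)"

definition dec :: "nat => real => real" where
  "dec i t = min 1 (\<Sum>k. cdig (3 ^ prod_encode (i, k) * t) * (1 / 2) ^ k)"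

lemma cdig_range: "0 <= cdig t" "cdig t <= 1" by (auto simp: cdig_def)

lemma bdig_01: "bdig y k = 0 \<or> bdig y k = 1" unfolding bdig_def by auto

text \<open>The digit with index 0 is the integer part, so that y = 1 has the expansion 1, 0, 0, and
  so on. The partial sums are the floors of 2 ^ n * y divided by 2 ^ n.\<close>

lemma bdig_sums:
  assumes y: "0 <= y" "y <= 1"
  shows "(%k. bdig y k * (1 / 2) ^ k) sums y"
proof -
  have part: "(\<Sum>k<Suc n. bdig y k * (1 / 2) ^ k) = real_of_int \<lfloor>2 ^ n * y\<rfloor> / 2 ^ n" for n
  proof (induction n)
    case 0
    have "\<lfloor>y\<rfloor> = 0 \<or> \<lfloor>y\<rfloor> = 1" using y by linarith
    then show ?case by (auto simp: bdig_def)
  next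
    case (Suc n)
    have "\<lfloor>2 ^ Suc n * y\<rfloor> div 2 = \<lfloor>2 ^ n * y\<rfloor>"
      using floor_divide_real_eq_div[of 2 "2 ^ Suc n * y"] by simp
    then have "\<lfloor>2 ^ Suc n * y\<rfloor> = 2 * \<lfloor>2 ^ n * y\<rfloor> + \<lfloor>2 ^ Suc n * y\<rfloor> mod 2" by (metis mult_div_mod_eq)
    then have "real_of_int \<lfloor>2 ^ Suc n * y\<rfloor> = 2 * real_of_int \<lfloor>2 ^ n * y\<rfloor> + bdig y (Suc n)"
      unfolding bdig_def by linarith
    then show ?case using Suc by (simp add: field_simps)
  qed
  have "(%n. real_of_int \<lfloor>2 ^ n * y\<rfloor> / 2 ^ n) ----> y"
  proof (rule tendsto_sandwich[OF _ _ _ tendsto_const])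
    show "\<forall>\<^sub>F n in sequentially. y - (1 / 2) ^ n <= real_of_int \<lfloor>2 ^ n * y\<rfloor> / 2 ^ n"
    proof (rule always_eventually, rule allI)
      fix n
      have "(2 ^ n * y - 1) / 2 ^ n <= real_of_int \<lfloor>2 ^ n * y\<rfloor> / 2 ^ n" by (intro divide_right_mono) (linarith, simp)
      then show "y - (1 / 2) ^ n <= real_of_int \<lfloor>2 ^ n * y\<rfloor> / 2 ^ n" by (simp add: diff_divide_distrib power_one_over)
    qed
    show "\<forall>\<^sub>F n in sequentially. real_of_int \<lfloor>2 ^ n * y\<rfloor> / 2 ^ n <= y"
    proof (rule always_eventually, rule allI)
      fix n
      have "real_of_int \<lfloor>2 ^ n * y\<rfloor> <= 2 ^ n * y" by linarith
      then show "real_of_int \<lfloor>2 ^ n * y\<rfloor> / 2 ^ n <= y" by (simp add: field_simps)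
    qed
    have "(%n. y - (1 / 2) ^ n) ----> y - 0" by (intro tendsto_diff tendsto_const LIMSEQ_realpow_zero) auto
    then show "(%n. y - (1 / 2) ^ n) ----> y" by simp
  qed
  then have "(%n. \<Sum>k<Suc n. bdig y k * (1 / 2) ^ k) ----> y" unfolding part .
  then show ?thesis unfolding sums_def by (rule LIMSEQ_imp_Suc)
qed

lemma sums_geometric_tail: "(%k. 2 * (1 / 3) ^ Suc (Suc k) :: real) sums (1 / 3)"
  using sums_mult[OF geometric_sums[of "1 / 3 :: real"], of "2 / 9"] by (simp add: field_simps)

text \<open>Multiplication by 3 ^ m turns the digits before position m into an even integer, which
  the period 2 of \<open>cdig\<close> removes. There remains 2 * a m / 3 + r with 0 \<le> r \<le> 1
  / 3, and the cosine of \<pi> times this number is at least 1 / 2 or at most - 1 / 2 according to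
  the digit.\<close>

lemma cdig_ternary:
  fixes a :: "nat => real"
  assumes a: "!!m. a m = 0 \<or> a m = 1"
  shows "cdig (3 ^ m * (\<Sum>k. 2 * a k * (1 / 3) ^ Suc k)) = a m"
proof -
  have a01: "0 <= a k" "a k <= 1" for k using a[of k] by auto
  let ?f = "%k. 2 * a k * (1 / 3) ^ Suc k"
  have sm: "summable ?f"
  proof (rule summable_comparison_test')
    show "summable (%k. 2 * (1 / 3 :: real) ^ k)" by (intro summable_mult summable_geometric) simp
    show "norm (?f k) <= 2 * (1 / 3) ^ k" if "0 <= k" for k
      using a01[of k] mult_mono[of "a k" 1 "(1 / 3 :: real) ^ Suc k" "(1 / 3) ^ k"] by (simp add: abs_mult)
  qed
  define r where "r = (\<Sum>k. 2 * a (k + Suc m) * (1 / 3) ^ Suc (Suc k))"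
  have rs: "summable (%k. 2 * a (k + Suc m) * (1 / 3) ^ Suc (Suc k))"
  proof (rule summable_comparison_test')
    show "summable (%k. 2 * (1 / 3 :: real) ^ Suc (Suc k))" using sums_geometric_tail by (rule sums_summable)
    show "norm (2 * a (k + Suc m) * (1 / 3) ^ Suc (Suc k)) <= 2 * (1 / 3) ^ Suc (Suc k)" if "0 <= k" for k
      using a01[of "k + Suc m"] by (simp add: abs_mult mult_left_le_one_le)
  qed
  have r: "0 <= r" "r <= 1 / 3"
  proof -
    show "0 <= r" unfolding r_def using a01 by (intro suminf_nonneg rs) auto
    have "r <= (\<Sum>k. 2 * (1 / 3) ^ Suc (Suc k))"
      unfolding r_def using a01 by (intro suminf_le rs sums_summable[OF sums_geometric_tail]) (simp add: mult_left_le_one_le)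
    then show "r <= 1 / 3" using sums_unique[OF sums_geometric_tail] by simp
  qed
  have ev: "\<exists>j::int. 3 ^ m * (\<Sum>k<m. ?f k) = 2 * real_of_int j"
  proof -
    have "3 ^ m * (\<Sum>k<m. ?f k) = (\<Sum>k<m. 2 * real_of_int (\<lfloor>a k\<rfloor> * 3 ^ (m - Suc k)))"
      unfolding sum_distrib_left
    proof (intro sum.cong refl)
      fix k assume "k \<in> {..<m}"
      then have "m = (m - Suc k) + Suc k" by simp
      then have "(3::real) ^ m = 3 ^ (m - Suc k) * 3 ^ Suc k" by (metis power_add)
      then have "3 ^ m * ?f k = 2 * (a k * 3 ^ (m - Suc k))" by (simp add: field_simps)
      moreover have fl: "real_of_int \<lfloor>a k\<rfloor> = a k" using a[of k] by auto
      ultimately show "3 ^ m * ?f k = 2 * real_of_int (\<lfloor>a k\<rfloor> * 3 ^ (m - Suc k))" by (simp only: of_int_mult fl of_int_power of_int_numeral)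
    qed
    also have "\<dots> = 2 * real_of_int (\<Sum>k<m. \<lfloor>a k\<rfloor> * 3 ^ (m - Suc k))" by (simp add: sum_distrib_left)
    finally show ?thesis by blast
  qed
  then obtain j :: int where j: "3 ^ m * (\<Sum>k<m. ?f k) = 2 * real_of_int j" ..
  have sp: "(\<Sum>k. ?f k) = (\<Sum>k. ?f (k + Suc m)) + ((\<Sum>k<m. ?f k) + ?f m)"
    using suminf_split_initial_segment[OF sm, of "Suc m"] by simp
  have tm: "3 ^ m * ?f m = 2 * a m / 3" by (simp add: power_one_over field_simps)
  have tl: "3 ^ m * (\<Sum>k. ?f (k + Suc m)) = r"
  proof -
    have "3 ^ m * ?f (k + Suc m) = 2 * a (k + Suc m) * (1 / 3) ^ Suc (Suc k)" for k
      by (simp add: power_add field_simps)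
    then show ?thesis unfolding r_def suminf_mult[OF summable_ignore_initial_segment[OF sm], symmetric] by (simp only:)
  qed
  have "3 ^ m * (\<Sum>k. ?f k) = 2 * real_of_int j + (2 * a m / 3 + r)"
    unfolding sp distrib_left tm tl j by simp
  then have "cos (pi * (3 ^ m * (\<Sum>k. ?f k))) = cos (pi * (2 * a m / 3 + r) + 2 * pi * real_of_int j)"
    by (simp add: algebra_simps)
  also have "\<dots> = cos (pi * (2 * a m / 3 + r))"
    by (simp add: cos_add cos_int_2pin sin_int_2pin)
  finally have c: "cos (pi * (3 ^ m * (\<Sum>k. ?f k))) = cos (pi * (2 * a m / 3 + r))" .
  from a[of m] show ?thesis
  proof
    assume z: "a m = 0"
    have "cos (pi * r) \<ge> cos (pi / 3)" using r by (intro cos_monotone_0_pi_le) auto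
    then show ?thesis unfolding cdig_def c using z by (simp add: cos_60)
  next
    assume o: "a m = 1"
    have "cos (pi * (2 / 3 + r)) <= cos (pi * (2 / 3))" using r by (intro cos_monotone_0_pi_le) (auto simp: field_simps)
    also have "\<dots> = - cos (pi / 3)" using cos_pi_minus[of "pi / 3"] by (simp add: field_simps)
    finally show ?thesis unfolding cdig_def c using o by (simp add: cos_60)
  qed
qed

lemma dec_code:
  assumes y: "!!i. 0 <= y i" "!!i. y i <= 1"
  shows "dec i (code y) = y i"
proof -
  have "cdig (3 ^ prod_encode (i, k) * code y) = bdig (y i) k" for k
    unfolding code_def by (subst cdig_ternary) (auto simp: bdig_01)
  then show ?thesis using sums_unique[OF bdig_sums[OF y(1)[of i] y(2)[of i]]] y(2)[of i] unfolding dec_def by simp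
qed

lemma dec_summable: "summable (%k. cdig (c k * t) * (1 / 2) ^ k)"
proof (rule summable_comparison_test')
  show "summable (%k. (1 / 2 :: real) ^ k)" by (rule summable_geometric) simp
  show "norm (cdig (c k * t) * (1 / 2) ^ k) <= (1 / 2) ^ k" if "0 <= k" for k
    using cdig_range[of "c k * t"] by (simp add: abs_mult mult_left_le_one_le)
qed

text \<open>The upper bound comes from the cap in \<open>dec\<close>: the weights start with 1, so
  the series itself is bounded by 2 only.\<close>

lemma dec_range: "0 <= dec i t" "dec i t <= 1"
  unfolding dec_def using dec_summable cdig_range by (auto intro!: suminf_nonneg)

lemma continuous_dec: "continuous_on UNIV (dec i)"
proof -
  have "uniform_limit UNIV (%n t. \<Sum>k<n. cdig (3 ^ prod_encode (i, k) * t) * (1 / 2) ^ k)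
    (%t. \<Sum>k. cdig (3 ^ prod_encode (i, k) * t) * (1 / 2) ^ k) sequentially"
  proof (rule Weierstrass_m_test)
    show "norm (cdig (3 ^ prod_encode (i, k) * t) * (1 / 2) ^ k) <= (1 / 2) ^ k" for k t
      using cdig_range[of "3 ^ prod_encode (i, k) * t"] by (simp add: abs_mult mult_left_le_one_le)
  qed (auto intro: summable_geometric)
  then have "continuous_on UNIV (%t. \<Sum>k. cdig (3 ^ prod_encode (i, k) * t) * (1 / 2) ^ k)"
    by (rule uniform_limit_theorem[rotated])
      (auto intro!: always_eventually continuous_intros simp: cdig_def)
  then show ?thesis unfolding dec_def[abs_def] by (intro continuous_intros)
qed

lemma dec_measurable [measurable]: "dec i \<in> borel_measurable borel"
  using continuous_dec by (rule borel_measurable_continuous_onI)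

lemma code_measurable:
  assumes [measurable]: "!!i. Y i \<in> borel_measurable M"
  shows "(%w. code (%i. Y i w)) \<in> borel_measurable M"
proof -
  have b: "(%y. bdig y k) \<in> borel_measurable borel" for k
  proof -
    \<comment> \<open>The residue modulo 2 is written with two floors, since taking the floor of a
      real number is a measurable operation.\<close>
    have eq: "(%y. bdig y k) = (%y. real_of_int \<lfloor>2 ^ k * y\<rfloor> - 2 * real_of_int \<lfloor>real_of_int \<lfloor>2 ^ k * y\<rfloor> / 2\<rfloor>)"
      unfolding bdig_def by (simp add: floor_divide_of_int_eq[of _ 2, simplified] minus_mult_div_eq_mod[symmetric])
    have "(%y :: real. real_of_int \<lfloor>2 ^ k * y\<rfloor>) \<in> borel_measurable borel"
      by (rule measurable_compose[OF _ borel_measurable_real_floor]) simp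
    moreover have "(%y :: real. real_of_int \<lfloor>real_of_int \<lfloor>2 ^ k * y\<rfloor> / 2\<rfloor>) \<in> borel_measurable borel"
      by (rule measurable_compose[OF _ borel_measurable_real_floor]) (use calculation in simp)
    ultimately show ?thesis unfolding eq by simp
  qed
  have [measurable]: "(%w. bdig (Y i w) k) \<in> borel_measurable M" for i k
    by (rule measurable_compose[OF _ b]) simp
  show ?thesis unfolding code_def by measurable
qed

lemma code_range: "0 <= code y" "code y <= 1"
proof -
  have b: "0 <= bdig y k" "bdig y k <= 1" for y k using bdig_01[of y k] by auto
  have s: "(%m. 2 * (1 / 3) ^ Suc m :: real) sums 1"
    using sums_mult[OF geometric_sums[of "1 / 3 :: real"], of "2 / 3"] by (simp add: field_simps)
  have le: "2 * bdig (y (fst (prod_decode m))) (snd (prod_decode m)) * (1 / 3) ^ Suc m <= 2 * (1 / 3) ^ Suc m" for m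
    using b(2)[of "y (fst (prod_decode m))" "snd (prod_decode m)"] by (simp add: mult_left_le_one_le b)
  have sm: "summable (%m. 2 * bdig (y (fst (prod_decode m))) (snd (prod_decode m)) * (1 / 3) ^ Suc m)"
    using le b by (intro summable_comparison_test'[OF sums_summable[OF s], of 0]) auto
  show "0 <= code y" unfolding code_def using b by (intro suminf_nonneg sm) auto
  show "code y <= 1" unfolding code_def using suminf_le[OF le sm sums_summable[OF s]] sums_unique[OF s] by simp
qed

text \<open>\<open>code\<close> is discontinuous, but only functions of the decoded coordinates are
  tested. These are continuous in the code, and decoding inverts coding exactly, so weak convergence
  of one-dimensional laws suffices; tightness is automatic on a bounded interval.\<close>

lemma cube_weak_limit:
  fixes N :: "nat => 'w measure" and Y :: "nat => 'w => real"
  assumes prob: "!!n. prob_space (N n)" and Ym: "!!n i. Y i \<in> borel_measurable (N n)"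
    and Y01: "!!i w. 0 <= Y i w" "!!i w. Y i w <= 1"
  shows "\<exists>(\<rho> :: real measure) r. real_distribution \<rho> \<and> strict_mono r \<and>
    (\<forall>(G :: (nat => real) => real) c. continuous_on UNIV (%t. G (%i. dec i t)) \<and> (\<forall>t. \<bar>G (%i. dec i t)\<bar> <= c) -->
      (%n. \<integral>w. G (%i. Y i w) \<partial>N (r n)) ----> (\<integral>t. G (%i. dec i t) \<partial>\<rho>))"
proof -
  let ?C = "%w. code (%i. Y i w)"
  have Cm: "?C \<in> borel_measurable (N n)" for n by (rule code_measurable[OF Ym])
  define \<mu> where "\<mu> n = distr (N n) borel ?C" for n
  have rd: "real_distribution (\<mu> n)" for n
    unfolding \<mu>_def real_distribution_def real_distribution_axioms_def
    by (simp add: prob_space.prob_space_distr[OF prob Cm])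
  \<comment> \<open>Tightness is stated with half-open intervals. The left end lies below 0 because
    a code can be 0.\<close>
  have full: "measure (\<mu> n) {-1<..1} = 1" for n
  proof -
    have "?C -` {-1<..1} \<inter> space (N n) = space (N n)" using code_range[of "%i. Y i _"] by (auto simp: less_le_trans[of _ 0])
    then show ?thesis unfolding \<mu>_def using Cm[of n] by (simp add: measure_distr prob_space.prob_space[OF prob])
  qed
  have "tight \<mu>"
    unfolding tight_def
  proof (intro conjI allI impI)
    fix \<epsilon> :: real assume "0 < \<epsilon>"
    then have "(- 1 :: real) < 1 \<and> (\<forall>n. 1 - \<epsilon> < measure (\<mu> n) {- 1<..1})" using full by simp
    then show "\<exists>a b. a < b \<and> (\<forall>n. 1 - \<epsilon> < measure (\<mu> n) {a<..b})" by blast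
  qed (simp_all add: rd)
  from tight_imp_convergent_subsubsequence[OF this strict_mono_id]
  obtain r M where r: "strict_mono r" and M: "real_distribution M" and w: "weak_conv_m (\<mu> \<circ> id \<circ> r) M" by blast
  have "(%n. \<integral>w. G (%i. Y i w) \<partial>N (r n)) ----> (\<integral>t. G (%i. dec i t) \<partial>M)"
    if G: "continuous_on UNIV (%t. G (%i. dec i t))" "\<forall>t. \<bar>G (%i. dec i t)\<bar> <= c" for G :: "(nat => real) => real" and c
  proof -
    have "(%n. \<integral>t. G (%i. dec i t) \<partial>(\<mu> \<circ> id \<circ> r) n) ----> (\<integral>t. G (%i. dec i t) \<partial>M)"
    proof (rule weak_conv_imp_integral_bdd_continuous_conv[OF _ M w])
      show "real_distribution ((\<mu> \<circ> id \<circ> r) n)" for n using rd by simp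
      show "isCont (%t. G (%i. dec i t)) x" for x using G(1) by (simp add: continuous_on_eq_continuous_at)
      show "norm (G (%i. dec i t)) <= c" for t using G(2) by simp
    qed
    moreover have "(\<integral>t. G (%i. dec i t) \<partial>(\<mu> \<circ> id \<circ> r) n) = (\<integral>w. G (%i. Y i w) \<partial>N (r n))" for n
    proof -
      have "(\<integral>t. G (%i. dec i t) \<partial>(\<mu> \<circ> id \<circ> r) n) = (\<integral>w. G (%i. dec i (?C w)) \<partial>N (r n))"
        unfolding \<mu>_def comp_def id_def
        by (rule integral_distr[OF Cm borel_measurable_continuous_onI[OF G(1)]])
      then show ?thesis by (simp add: dec_code Y01)
    qed
    ultimately show ?thesis by simp
  qed
  then show ?thesis using r M by blast
qed

section \<open>Step functions and quantiles\<close>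

text \<open>Cauchy's functional equation: monotonicity squeezes n * L s between consecutive
  multiples of L 1, so that L s differs from s * L 1 by at most L 1 / n.\<close>

lemma additive_mono_linear:
  fixes L :: "real => real"
  assumes add: "!!a b. 0 <= a ==> 0 <= b ==> L (a + b) = L a + L b"
    and mono: "!!a b. 0 <= a ==> a <= b ==> L a <= L b" and s: "0 <= s"
  shows "L s = s * L 1"
proof -
  have L0: "L 0 = 0" using add[of 0 0] by simp
  have mult: "L (real n * a) = real n * L a" if a: "0 <= a" for n a
  proof (induction n)
    case (Suc n)
    have "L (real n * a + a) = L (real n * a) + L a" using a by (intro add) auto
    then show ?case using Suc by (simp add: algebra_simps)
  qed (simp add: L0)
  have L1: "0 <= L 1" using mono[of 0 1] L0 by simp
  have bound: "real n * \<bar>L s - s * L 1\<bar> <= L 1" for n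
  proof -
    define k where "k = nat \<lfloor>real n * s\<rfloor>"
    have k: "real k <= real n * s" "real n * s <= real (Suc k)"
      using s unfolding k_def by (simp_all add: of_nat_nat) linarith
    have "L (real k * 1) <= L (real n * s)" "L (real n * s) <= L (real (Suc k) * 1)"
      using k s by (auto intro!: mono)
    then have "real k * L 1 <= real n * L s" "real n * L s <= real (Suc k) * L 1"
      using mult[of 1 k] mult[of 1 "Suc k"] mult[OF s, of n] by simp_all
    moreover have "real k * L 1 <= real n * s * L 1" "real n * s * L 1 <= real (Suc k) * L 1"
      using k L1 by (auto intro!: mult_right_mono)
    ultimately have "\<bar>real n * L s - real n * s * L 1\<bar> <= L 1" by (simp add: algebra_simps)
    then have "\<bar>real n * (L s - s * L 1)\<bar> <= L 1" by (simp only: right_diff_distrib mult.assoc)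
    then show ?thesis by (simp add: abs_mult)
  qed
  have "\<bar>L s - s * L 1\<bar> = 0"
  proof (rule ccontr)
    assume "\<bar>L s - s * L 1\<bar> \<noteq> 0"
    then have p: "0 < \<bar>L s - s * L 1\<bar>" by simp
    obtain n :: nat where "L 1 < real n * \<bar>L s - s * L 1\<bar>" using reals_Archimedean3[OF p] by blast
    then show False using bound[of n] by simp
  qed
  then show ?thesis by simp
qed

text \<open>The sets in question are the upper sections of the ordered set \<open>J\<close>, and
  these form a chain. A function on the chain that vanishes at the empty set telescopes, with c x
  the increment when x is added.\<close>

lemma step_combination:
  fixes J :: "real set" and \<phi> :: "real set => real"
  assumes "finite J" "\<phi> {} = 0"
  shows "\<exists>c. \<forall>A. A \<subseteq> J --> (\<forall>a\<in>A. \<forall>b\<in>J. a < b --> b \<in> A) --> \<phi> A = (\<Sum>x\<in>A. c x)"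
  using assms
proof (induction J arbitrary: \<phi> rule: finite_linorder_max_induct)
  case empty
  then show ?case by auto
next
  case (insert b J)
  have "\<exists>c. \<forall>A. A \<subseteq> J --> (\<forall>a\<in>A. \<forall>b\<in>J. a < b --> b \<in> A) --> \<phi> (Set.insert b A) - \<phi> {b} = (\<Sum>x\<in>A. c x)"
    by (rule insert.IH[of "%A. \<phi> (Set.insert b A) - \<phi> {b}"]) simp
  then obtain c :: "real => real" where c: "!!A. A \<subseteq> J ==> (\<forall>a\<in>A. \<forall>b\<in>J. a < b --> b \<in> A) ==> \<phi> (Set.insert b A) - \<phi> {b} = (\<Sum>x\<in>A. c x)"
    by blast
  have "\<phi> A = (\<Sum>x\<in>A. (c(b := \<phi> {b})) x)"
    if A: "A \<subseteq> Set.insert b J" "\<forall>a\<in>A. \<forall>b'\<in>Set.insert b J. a < b' --> b' \<in> A" for A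
  proof (cases "A = {}")
    case False
    have bJ: "b \<notin> J" using insert.hyps(2) by blast
    have bA: "b \<in> A"
    proof -
      obtain a where a: "a \<in> A" using False by blast
      then have "a = b \<or> a < b" using A(1) insert.hyps(2) by blast
      then show ?thesis using a A(2) by blast
    qed
    have "A - {b} \<subseteq> J" using A(1) by blast
    moreover have "\<forall>a\<in>A - {b}. \<forall>b'\<in>J. a < b' --> b' \<in> A - {b}" using A(2) bJ by blast
    ultimately have "\<phi> (Set.insert b (A - {b})) - \<phi> {b} = (\<Sum>x\<in>A - {b}. c x)" by (rule c)
    moreover have "finite A" using A(1) insert.hyps(1) finite_subset by blast
    moreover have "Set.insert b (A - {b}) = A" using bA by blast
    moreover have "(\<Sum>x\<in>A - {b}. (c(b := \<phi> {b})) x) = (\<Sum>x\<in>A - {b}. c x)" by (intro sum.cong) auto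
    ultimately show ?thesis using bA sum.remove[of A b "c(b := \<phi> {b})"] by simp
  qed (simp add: insert.prems)
  then show ?case by blast
qed

text \<open>A step function is encoded by an arbitrary function \<phi> of the set of thresholds
  above y. In this form, composing with f just composes \<phi> with f, so truncation to the unit
  interval stays within the class.\<close>

inductive stepcl :: "(real => real) => bool" where
  step: "finite J ==> \<phi> {} = 0 ==> stepcl (%y. \<phi> {x\<in>J. y < x})" for \<phi> :: "real set => real"
| lim: "(!!n. stepcl (k n)) ==> (!!y. (%n. k n y) ----> l y) ==> stepcl l" for k :: "nat => real => real"

lemma stepcl_map: "stepcl k ==> continuous_on UNIV f ==> f 0 = 0 ==> stepcl (%y. f (k y))"
proof (induction rule: stepcl.induct)
  case (step \<phi> J)
  then show ?case using stepcl.step[of J "%A. f (\<phi> A)"] by simp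
next
  case (lim k l)
  show ?case
  proof (rule stepcl.lim)
    show "stepcl (%y. f (k n y))" for n using lim by blast
    show "(%n. f (k n y)) ----> f (l y)" for y
      using lim(2)[of y] lim(4) by (intro continuous_on_tendsto_compose[of UNIV f]) auto
  qed
qed

lemma stepcl_add:
  assumes "stepcl k" "stepcl l" shows "stepcl (%y. k y + l y)"
  using assms(1)
proof (induction rule: stepcl.induct)
  case (step \<phi> J)
  show ?case using assms(2)
  proof (induction rule: stepcl.induct)
    case (step \<phi>' J')
    have eq: "{x \<in> J. y < x} = {x \<in> J \<union> J'. y < x} \<inter> J" "{x \<in> J'. y < x} = {x \<in> J \<union> J'. y < x} \<inter> J'" for y :: real by auto
    have "stepcl (%y. (%A. \<phi> (A \<inter> J) + \<phi>' (A \<inter> J')) {x \<in> J \<union> J'. y < x})"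
      using \<open>finite J\<close> \<open>\<phi> {} = 0\<close> step by (intro stepcl.step) auto
    then show ?case by (simp only: eq[symmetric])
  next
    case (lim k' l')
    show ?case by (rule stepcl.lim[of "%n y. \<phi> {x \<in> J. y < x} + k' n y"]) (use lim in \<open>auto intro: tendsto_add\<close>)
  qed
next
  case (lim k' l')
  show ?case by (rule stepcl.lim[of "%n y. k' n y + l y"]) (use lim in \<open>auto intro: tendsto_add\<close>)
qed

lemma stepcl_scale: "stepcl k ==> stepcl (%y. c * k y)"
  using stepcl_map[of k "%z. c * z"] by (simp add: continuous_intros)

lemma stepcl_lessThan: "stepcl (indicator {..<x})"
proof -
  have "stepcl (%y. (%A. if A = {} then 0 else 1 :: real) {z \<in> {x}. y < z})" by (rule stepcl.step) auto
  moreover have "(%A. if A = {} then 0 else 1 :: real) {z \<in> {x}. y < z} = indicator {..<x} y" for y by auto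
  ultimately show ?thesis by (simp only:)
qed

lemma stepcl_indicator:
  assumes "A \<in> sets (borel :: real measure)" shows "stepcl (indicator A)"
proof -
  have A: "A \<in> sigma_sets UNIV (range lessThan)" using assms by (simp add: borel_Iio)
  have one: "stepcl (%_. 1)"
  proof (rule stepcl.lim[of "%n. indicator {..<real n}"])
    show "stepcl (indicator {..<real n})" for n by (rule stepcl_lessThan)
    show "(%n. indicator {..<real n} y) ----> 1" for y :: real
    proof (rule tendsto_eventually)
      obtain N :: nat where "y < real N" using reals_Archimedean2 by blast
      then show "\<forall>\<^sub>F n in sequentially. indicator {..<real n} y = 1"
        by (intro eventually_sequentiallyI[of N]) (auto simp: indicator_def)
    qed
  qed
  have "{..<a} \<inter> {..<b} \<in> range lessThan" for a b :: real by (intro image_eqI[of _ _ "min a b"]) auto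
  then have "Int_stable (range (lessThan :: real => real set))" by (auto simp: Int_stable_def)
  then show ?thesis
  proof (rule sigma_sets_induct_disjoint[OF _ _ A])
    show "stepcl (indicator B)" if "B \<in> range lessThan" for B using that stepcl_lessThan by auto
    have "stepcl (%y. 0 * 1)" by (rule stepcl_scale[OF one])
    then show "stepcl (indicator {})" by (simp add: indicator_def[abs_def])
    show "stepcl (indicator (UNIV - B))" if "stepcl (indicator B)" for B
    proof -
      have "stepcl (%y. 1 + (- 1) * indicator B y)" by (intro stepcl_add one stepcl_scale that)
      moreover have "1 + (- 1) * indicator B y = (indicator (UNIV - B) y :: real)" for y by (auto simp: indicator_def)
      ultimately show ?thesis by (simp only:)
    qed
    show "stepcl (indicator (\<Union>i. B i))"
      if B: "disjoint_family B" "!!i. stepcl (indicator (B i))" for B :: "nat => real set"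
    proof (rule stepcl.lim)
      show "stepcl (%y. \<Sum>i<n. indicator (B i) y)" for n
      proof (induction n)
        case 0
        show ?case using stepcl_scale[OF one, of 0] by simp
      next
        case (Suc n)
        then show ?case using B(2)[of n] by (simp add: stepcl_add)
      qed
      show "(%n. \<Sum>i<n. indicator (B i) y) ----> (indicator (\<Union>i. B i) y :: real)" for y
        using indicator_sums[of B y] B(1) unfolding sums_def disjoint_family_on_def by blast
    qed
  qed auto
qed

text \<open>An identity that survives pointwise limits thus needs to be checked on step functions
  only.\<close>

lemma stepcl_borel:
  assumes "k \<in> borel_measurable borel" "!!y. 0 <= k y" shows "stepcl k"
  using assms
proof (induction rule: borel_measurable_induct_real)
  case (seq U)
  show ?case by (rule stepcl.lim[of U]) (use seq in auto)
qed (auto intro: stepcl_indicator stepcl_scale stepcl_add)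

text \<open>A finite-stage approximation from below to the supremum of the values attached to the
  points q i < x. It depends on finitely many coordinates and continuously so, which is what a weak
  limit can handle.\<close>

primrec mx :: "(nat => real) => real => (nat => real) => nat => real" where
  "mx q x y 0 = 0"
| "mx q x y (Suc m) = max (mx q x y m) (if q m < x then y m else 0)"

definition cut :: "(nat => real) => real => nat => real set" where
  "cut q x m = (\<Union>i\<in>{i. i < m \<and> q i < x}. {..<q i})"

lemma mx_range:
  assumes "!!i. 0 <= y i" "!!i. y i <= 1" shows "0 <= mx q x y m" "mx q x y m <= 1"
  using assms by (induction m) (auto simp: max_def)

lemma mx_mono: "m <= m' ==> mx q x y m <= mx q x y m'"
  by (rule lift_Suc_mono_le[of "mx q x y"]) auto

lemma le_mx_iff:
  assumes "0 < u" shows "u <= mx q x y m \<longleftrightarrow> (\<exists>i<m. q i < x \<and> u <= y i)"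
  using assms by (induction m) (auto simp: le_max_iff_disj less_Suc_eq)

lemma continuous_mx:
  assumes "!!i. continuous_on UNIV (D i)"
  shows "continuous_on UNIV (%t. mx q x (%i. D i t) m)"
proof (induction m)
  case (Suc m)
  then show ?case by (cases "q m < x") (auto intro!: continuous_on_max assms)
qed simp

lemma measurable_mx:
  assumes "!!i. D i \<in> borel_measurable M"
  shows "(%t. mx q x (%i. D i t) m) \<in> borel_measurable M"
proof (induction m)
  case (Suc m)
  then show ?case by (cases "q m < x") (auto intro!: borel_measurable_max assms)
qed simp

lemma cut_Suc: "cut q x (Suc m) = cut q x m \<union> (if q m < x then {..<q m} else {})"
  by (auto simp: cut_def less_Suc_eq)

text \<open>The half-lines below the points q i are nested, so the largest of the values F {..<q i}
  is the value at their union. For genuine distribution functions the non-linear functional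
  \<open>mx\<close> thus becomes the evaluation of a measure.\<close>

lemma mx_cut:
  assumes F: "!!A B. A \<subseteq> B ==> F A <= F B" "F {} = (0 :: real)"
  shows "mx q x (%i. F {..<q i}) m = F (cut q x m)"
proof (induction m)
  case 0
  then show ?case by (simp add: cut_def F)
next
  case (Suc m)
  have F0: "0 <= F A" for A using F(1)[of "{}" A] F(2) by simp
  show ?case
  proof (cases "q m < x")
    case True
    have "{..<q m} \<subseteq> cut q x m \<or> cut q x m \<subseteq> {..<q m}"
    proof (cases "\<exists>i<m. q i < x \<and> q m <= q i")
      case False
      then show ?thesis by (force simp: cut_def)
    qed (force simp: cut_def)
    then have "F (cut q x m \<union> {..<q m}) = max (F (cut q x m)) (F {..<q m})"
    proof
      assume s: "{..<q m} \<subseteq> cut q x m"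
      then have "cut q x m \<union> {..<q m} = cut q x m" by blast
      then show ?thesis using F(1)[OF s] by simp
    next
      assume s: "cut q x m \<subseteq> {..<q m}"
      then have "cut q x m \<union> {..<q m} = {..<q m}" by blast
      then show ?thesis using F(1)[OF s] by simp
    qed
    then show ?thesis using True Suc by (simp add: cut_Suc)
  qed (use Suc F0 in \<open>simp add: cut_Suc\<close>)
qed

text \<open>The quantile function of the (possibly not monotone) distribution function \<open>q i \<mapsto> D i\<close>.\<close>

definition quant :: "(nat => real) => (nat => real) => real => real" where
  "quant q D u = (if 0 < u \<and> u <= 1 then Inf {q i | i. u <= D i} else 0)"

text \<open>The two boundary conditions on D make the set under the infimum non-empty and bounded
  below for 0 < u \<le> 1, so the infimum is a genuine one.\<close>

lemma quant_less_iff: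
  assumes q: "\<exists>i. 1 < q i" and D: "!!i. 1 < q i ==> D i = 1" "!!i. q i <= 0 ==> D i = 0"
    and u: "0 < u" "u <= 1"
  shows "quant q D u < x \<longleftrightarrow> (\<exists>i. q i < x \<and> u <= D i)"
proof -
  obtain i where i: "1 < q i" using q ..
  have "q i \<in> {q i | i. u <= D i}" using D(1)[OF i] u by auto
  then have ne: "{q i | i. u <= D i} \<noteq> {}" by blast
  have "bdd_below {q i | i. u <= D i}"
  proof (rule bdd_belowI)
    fix z assume "z \<in> {q i | i. u <= D i}"
    then obtain j where j: "z = q j" "u <= D j" by blast
    show "0 <= z"
    proof (rule ccontr)
      assume "\<not> 0 <= z"
      then have "D j = 0" using j by (intro D(2)) simp
      then show False using j(2) u(1) by simp
    qed
  qed
  from cInf_less_iff[OF ne this, of x] show ?thesis using u by (auto simp: quant_def)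
qed

lemma measurable_quant:
  assumes q: "\<exists>i. 1 < q i" and D: "!!i t. 1 < q i ==> D i t = 1" "!!i t. q i <= 0 ==> D i t = 0"
    and Dm [measurable]: "!!i. D i \<in> borel_measurable M"
  shows "(%p. quant q (%i. D i (fst p)) (snd p)) \<in> borel_measurable (M \<Otimes>\<^sub>M borel)"
proof (rule borel_measurable_iff_less[THEN iffD2], rule allI)
  fix x :: real
  have "{p \<in> space (M \<Otimes>\<^sub>M borel). quant q (%i. D i (fst p)) (snd p) < x} =
    {p \<in> space (M \<Otimes>\<^sub>M borel). if 0 < snd p \<and> snd p <= 1 then \<exists>i. q i < x \<and> snd p <= D i (fst p) else 0 < x}"
    (is "_ = ?R")
  proof (intro Collect_cong conj_cong refl)
    fix p :: "'a \<times> real"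
    show "quant q (%i. D i (fst p)) (snd p) < x \<longleftrightarrow> (if 0 < snd p \<and> snd p <= 1 then \<exists>i. q i < x \<and> snd p <= D i (fst p) else 0 < x)"
    proof (cases "0 < snd p \<and> snd p <= 1")
      case True
      then show ?thesis using quant_less_iff[of q "%i. D i (fst p)" "snd p" x] q D by simp
    qed (auto simp: quant_def)
  qed
  moreover have "?R \<in> sets (M \<Otimes>\<^sub>M borel)" by measurable
  ultimately show "{p \<in> space (M \<Otimes>\<^sub>M borel). quant q (%i. D i (fst p)) (snd p) < x} \<in> sets (M \<Otimes>\<^sub>M borel)" by (simp only:)
qed

definition unif01 :: "real measure" where "unif01 = density lborel (indicator {0<..1})"

lemma sets_unif01 [simp, measurable_cong]: "sets unif01 = sets borel" by (simp add: unif01_def)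

lemma space_unif01 [simp]: "space unif01 = UNIV" by (simp add: unif01_def)

lemma emeasure_unif01: "A \<in> sets borel ==> emeasure unif01 A = emeasure lborel ({0<..1} \<inter> A)"
  unfolding unif01_def by (subst emeasure_density) (auto simp: indicator_inter_arith[symmetric] Int_commute)

lemma prob_space_unif01: "prob_space unif01"
  by (rule prob_spaceI) (simp add: emeasure_unif01)

text \<open>For 0 < u \<le> 1 the quantile lies below x exactly when u is at most some
  \<open>mx q x D m\<close>. The interval from 0 to \<open>mx q x D m\<close> has that length under
  the uniform law, and these intervals increase with m. No monotonicity of D enters.\<close>

lemma quant_mx_limit:
  assumes q: "\<exists>i. 1 < q i" and D: "!!i. 1 < q i ==> D i = 1" "!!i. q i <= 0 ==> D i = 0"
    and D01: "!!i. 0 <= D i" "!!i. D i <= 1"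
  shows "(%m. mx q x D m) ----> measure unif01 {u. quant q D u < x}"
proof -
  interpret U: prob_space unif01 by (rule prob_space_unif01)
  have qm: "(%u. quant q D u) \<in> borel_measurable borel"
  proof -
    have "(%p. quant q (%i. D i) (snd p)) \<in> borel_measurable (count_space (UNIV :: unit set) \<Otimes>\<^sub>M borel)"
      by (rule measurable_quant[where D="%i _. D i"]) (use q D in auto)
    from measurable_compose[OF measurable_Pair1', OF _ this, of "()"] show ?thesis by simp
  qed
  have S: "{u. quant q D u < x} \<in> sets borel" using borel_measurable_less[OF qm, of "%_. x"] by simp
  have *: "measure unif01 ({0<..mx q x D m}) = mx q x D m" for m
  proof -
    have "{0<..1} \<inter> {0<..mx q x D m} = {0<..mx q x D m}" using mx_range(2)[of D q x m] D01 by auto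
    then have "emeasure unif01 {0<..mx q x D m} = ennreal (mx q x D m)"
      using mx_range(1)[of D q x m] D01 by (simp add: emeasure_unif01)
    then show ?thesis using mx_range(1)[of D q x m] D01 by (simp add: measure_def)
  qed
  have "(%m. measure unif01 {0<..mx q x D m}) ----> measure unif01 (\<Union>m. {0<..mx q x D m})"
    by (rule U.finite_Lim_measure_incseq) (auto simp: incseq_def intro: order_trans[OF _ mx_mono])
  moreover have "measure unif01 (\<Union>m. {0<..mx q x D m}) = measure unif01 {u. quant q D u < x}"
  proof -
    have "(\<Union>m. {0<..mx q x D m}) = {0<..1} \<inter> {u. quant q D u < x}"
    proof (intro set_eqI)
      fix u
      have "(\<exists>m. u <= mx q x D m) \<longleftrightarrow> (\<exists>i. q i < x \<and> u <= D i)" if "0 < u"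
        using le_mx_iff[OF that, of q x D] by blast
      moreover have "u <= 1" if "u <= mx q x D m" for m using that mx_range(2)[of D q x m] D01 by simp
      ultimately show "u \<in> (\<Union>m. {0<..mx q x D m}) \<longleftrightarrow> u \<in> {0<..1} \<inter> {u. quant q D u < x}"
        using quant_less_iff[of q D u x, OF q D] by auto
    qed
    then show ?thesis using S by (simp add: measure_def emeasure_unif01)
  qed
  ultimately show ?thesis by (simp add: *)
qed

section \<open>A Borel embedding into the unit interval\<close>

context lcsc
begin

text \<open>Urysohn functions for pairs of base sets, one with closure inside the other, separate
  points and give a continuous injection into the Hilbert cube. Images of closed sets are countable
  unions of compact sets, so the inverse is Borel; \<open>code\<close> and \<open>dec\<close> carry
  this over to the unit interval.\<close>

lemma borel_embedding:
  "\<exists>(g :: 'x => real) (j :: real => 'x). g \<in> borel_measurable borel \<and> j \<in> measurable borel borel \<and>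
    (\<forall>x. 0 <= g x \<and> g x <= 1) \<and> (\<forall>x. j (g x) = x)"
proof -
  have "\<exists>e :: 'x => real. continuous_on UNIV e \<and> (\<forall>x. e x \<in> {0..1}) \<and>
    (closure (nb i) \<subseteq> nb k --> (\<forall>x\<in>nb i. e x = 1) \<and> (\<forall>x. x \<notin> nb k --> e x = 0))" for i k
  proof (cases "closure (nb i) \<subseteq> nb k")
    case True
    from Urysohn_compact_support[OF nb(3) nb(2) this] obtain e :: "'x => real"
      where "continuous_on UNIV e" "\<forall>x. e x \<in> {0..1}" "\<forall>x\<in>closure (nb i). e x = 1" "\<forall>x. x \<notin> nb k --> e x = 0" by blast
    then show ?thesis using closure_subset[of "nb i"] by (intro exI[of _ e]) auto
  next
    case False
    then show ?thesis by (intro exI[of _ "%_. 0"]) simp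
  qed
  then have "\<forall>m. \<exists>e :: 'x => real. continuous_on UNIV e \<and> (\<forall>x. e x \<in> {0..1}) \<and>
    (closure (nb (fst (prod_decode m))) \<subseteq> nb (snd (prod_decode m)) -->
      (\<forall>x\<in>nb (fst (prod_decode m)). e x = 1) \<and> (\<forall>x. x \<notin> nb (snd (prod_decode m)) --> e x = 0))" by blast
  from choice[OF this] obtain e :: "nat => 'x => real" where e: "!!m. continuous_on UNIV (e m)" "!!m x. e m x \<in> {0..1}"
    "!!m. closure (nb (fst (prod_decode m))) \<subseteq> nb (snd (prod_decode m)) ==>
      (\<forall>x\<in>nb (fst (prod_decode m)). e m x = 1) \<and> (\<forall>x. x \<notin> nb (snd (prod_decode m)) --> e m x = 0)" by blast
  define E where "E x = (%m. e m x)" for x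
  have Ec: "continuous_on UNIV E" unfolding E_def by (intro continuous_on_coordinatewise_then_product e(1))
  have inj: "inj E"
  proof (rule injI, rule ccontr)
    fix x y assume eq: "E x = E y" and ne: "x \<noteq> y"
    from separation_t2[of x y] ne obtain W where W: "open W" "x \<in> W" "y \<notin> W" by blast
    then obtain k where k: "x \<in> nb k" "nb k \<subseteq> W" using topological_basisE[OF nb(1)] by (metis rangeE)
    obtain V where V: "open V" "x \<in> V" "closure V \<subseteq> nb k" using open_compact_nbhd[OF nb(2) k(1)] by blast
    then obtain i where i: "x \<in> nb i" "nb i \<subseteq> V" using topological_basisE[OF nb(1)] by (metis rangeE)
    have "closure (nb i) \<subseteq> nb k" using i(2) V(3) closure_mono by blast
    then have "e (prod_encode (i, k)) x = 1" "e (prod_encode (i, k)) y = 0"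
      using e(3)[of "prod_encode (i, k)"] i(1) k(2) W(3) by auto
    then show False using eq by (auto simp: E_def fun_eq_iff)
  qed
  have EF: "E ` F \<in> sets borel" if F: "closed F" for F
  proof -
    have "E ` F = (\<Union>n. E ` (F \<inter> closure (exh n)))"
    proof -
      have "F = (\<Union>n. F \<inter> closure (exh n))" using exh(4) closure_subset by blast
      then show ?thesis by (metis image_UN)
    qed
    moreover have "closed (E ` (F \<inter> closure (exh n)))" for n
    proof (intro compact_imp_closed compact_continuous_image)
      show "compact (F \<inter> closure (exh n))" using F exh(2) closed_Int_compact by blast
      show "continuous_on (F \<inter> closure (exh n)) E" using Ec continuous_on_subset by blast
    qed
    ultimately show ?thesis by (simp add: borel_closed)
  qed
  define d where "d t = (%m. dec m t)" for t
  have dm: "d \<in> borel_measurable borel" unfolding d_def by (intro measurable_coordinatewise_then_product) simp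
  define j where "j t = (if d t \<in> range E then inv E (d t) else undefined)" for t
  define g where "g x = code (E x)" for x
  have gm: "g \<in> borel_measurable borel"
    unfolding g_def[abs_def] E_def by (intro code_measurable borel_measurable_continuous_onI e(1))
  have jg: "j (g x) = x" for x
  proof -
    have "d (g x) = E x" unfolding d_def g_def using e(2) by (subst dec_code) (auto simp: E_def)
    then show ?thesis using inj by (simp add: j_def)
  qed
  have "j \<in> measurable borel borel"
  proof (rule borel_measurableI)
    fix S :: "'x set" assume S: "open S"
    have "d -` (E ` (- S)) \<inter> space borel \<in> sets borel" "d -` (E ` UNIV) \<inter> space borel \<in> sets borel"
      using measurable_sets[OF dm EF[of "- S"]] measurable_sets[OF dm EF[OF closed_UNIV]] S by (auto simp: closed_def)
    \<comment> \<open>The preimage is described by its complement, since the images under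
      \<open>E\<close> are known to be Borel for closed sets. The second part accounts for the
      default value of \<open>j\<close> off the range of \<open>E\<close>.\<close>
    moreover have "j -` S \<inter> space borel = - ((d -` (E ` (- S)) \<inter> space borel) \<union> (if undefined \<in> S then {} else - (d -` (E ` UNIV) \<inter> space borel)))"
      (is "?L = ?R")
    proof (rule set_eqI)
      fix t show "t \<in> ?L \<longleftrightarrow> t \<in> ?R" by (cases "d t \<in> range E") (use inj in \<open>auto simp: j_def inj_image_mem_iff dest: injD\<close>)
    qed
    moreover have "- A \<in> sets borel" if "A \<in> sets (borel :: real measure)" for A
      using that sets.compl_sets[of A borel] by (simp add: Compl_eq_Diff_UNIV)
    ultimately show "j -` S \<inter> space borel \<in> sets borel" by simp
  qed
  then show ?thesis using gm jg code_range by (intro exI[of _ g] exI[of _ j]) (auto simp: g_def)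
qed

end

section \<open>Laplace transforms of stable random measures\<close>

abbreviation (input) pr :: "('w => 'x measure) => ('x => ennreal) => 'w => ennreal" where
  "pr \<zeta> h w \<equiv> (np h (\<zeta> w))"

definition psi :: "'w measure => ('w => 'x measure) => ('x => ennreal) => real" where
  "psi P \<zeta> h = - ln (\<integral>w. lap (pr \<zeta> h w) \<partial>P)"

lemma one_minus_lap_sum_le: "1 - lap (\<Sum>i<n. x i) <= (\<Sum>i<n. 1 - lap (x i))" for n :: nat
proof (induction n)
  case (Suc n)
  have "0 <= (1 - lap (\<Sum>i<n. x i)) * (1 - lap (x n))" by (intro mult_nonneg_nonneg) auto
  then show ?case using Suc by (simp add: lap_add algebra_simps)
qed simp

locale stable_lcsc = lcsc X for X :: "'x::{second_countable_topology, t2_space} itself" +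
  fixes P :: "'w measure" and \<zeta> :: "'w => 'x measure" and \<alpha> :: real
  assumes P: "random_measure P \<zeta>" and a0: "0 < \<alpha>" and a1: "\<alpha> < 1" and stab: "strictly_stable \<alpha> P \<zeta>"
begin

sublocale P: prob_space P using P by (simp add: random_measure_def)

lemma zm: "\<zeta> \<in> measurable P radon_space" using P by (simp add: random_measure_def)

lemma zr: "w \<in> space P ==> \<zeta> w \<in> radon_measures" using measurable_space[OF zm] by simp

lemma pr_measurable: "h \<in> borel_measurable borel ==> pr \<zeta> h \<in> borel_measurable P"
  using measurable_compose[OF zm measurable_np] .

lemma pr_cmult: "w \<in> space P ==> h \<in> borel_measurable borel ==> pr \<zeta> (%x. c * h x) w = c * pr \<zeta> h w"
  by (intro nn_integral_cmult borel_measurable_radon[OF zr])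

lemma lap_integrable: "Y \<in> borel_measurable P ==> integrable P (%w. lap (Y w))"
  by (intro P.integrable_const_bound[where B=1]) auto

text \<open>Stability is used with t = u / (u + v) and tested with (u + v) powr (1 / \<alpha>) times
  h.\<close>

lemma stable_laplace_add:
  assumes h: "h \<in> borel_measurable borel" and uv: "0 <= u" "0 <= v"
  shows "(\<integral>w. lap (ennreal ((u + v) powr (1 / \<alpha>)) * pr \<zeta> h w) \<partial>P) =
    (\<integral>w. lap (ennreal (u powr (1 / \<alpha>)) * pr \<zeta> h w) \<partial>P) * (\<integral>w. lap (ennreal (v powr (1 / \<alpha>)) * pr \<zeta> h w) \<partial>P)"
proof (cases "u + v = 0")
  case True
  then have "u = 0" "v = 0" using uv by auto
  then show ?thesis by (simp add: P.prob_space)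
next
  case False
  define s where "s = u + v"
  have s: "0 < s" using False uv by (simp add: s_def)
  define t where "t = u / s"
  have t: "t \<in> {0..1}" "s * t = u" "s * (1 - t) = v" using s uv by (auto simp: t_def s_def field_simps)
  define c d where "c = t powr (1 / \<alpha>)" and "d = (1 - t) powr (1 / \<alpha>)"
  define k where "k x = ennreal (s powr (1 / \<alpha>)) * h x" for x
  have km: "k \<in> borel_measurable borel" unfolding k_def using h by simp
  have sp: "s powr (1 / \<alpha>) * c = u powr (1 / \<alpha>)" "s powr (1 / \<alpha>) * d = v powr (1 / \<alpha>)"
    using s t unfolding c_def d_def by (simp_all add: powr_mult[symmetric])
  interpret PP: pair_prob_space P P ..
  let ?\<eta> = "%(w', w''). add_measure (scale_measure (ennreal c) (\<zeta> w')) (scale_measure (ennreal d) (\<zeta> w''))"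
  have em: "?\<eta> \<in> measurable (P \<Otimes>\<^sub>M P) radon_space"
    unfolding case_prod_beta
    by (intro measurable_add_measure_radon measurable_scale_measure_radon measurable_compose[OF measurable_fst zm]
        measurable_compose[OF measurable_snd zm]) auto
  define f where "f r w = lap (ennreal (r powr (1 / \<alpha>)) * pr \<zeta> h w)" for r w
  have fm [measurable]: "f r \<in> borel_measurable P" for r
    unfolding f_def[abs_def] using pr_measurable[OF h] by simp
  have lm: "(%\<mu>. lap (np k \<mu>)) \<in> borel_measurable radon_space" using measurable_np[OF km] by simp
  have "eq_in_distribution (P \<Otimes>\<^sub>M P) ?\<eta> P \<zeta>"
    using stab t(1) unfolding strictly_stable_def c_def d_def by blast
  then have de: "distr (P \<Otimes>\<^sub>M P) radon_space ?\<eta> = distr P radon_space \<zeta>" unfolding eq_in_distribution_def .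
  have "(\<integral>w. f s w \<partial>P) = (\<integral>w. lap (pr \<zeta> k w) \<partial>P)"
    by (intro bint_cong refl) (simp add: f_def k_def pr_cmult h)
  also have "\<dots> = (\<integral>\<mu>. lap (np k \<mu>) \<partial>distr P radon_space \<zeta>)" by (rule integral_distr[OF zm lm, symmetric])
  also have "\<dots> = (\<integral>w. lap (np k (?\<eta> w)) \<partial>(P \<Otimes>\<^sub>M P))" unfolding de[symmetric] by (rule integral_distr[OF em lm])
  also have "\<dots> = (\<integral>w. f u (fst w) * f v (snd w) \<partial>(P \<Otimes>\<^sub>M P))"
  proof (rule bint_cong)
    fix w assume "w \<in> space (P \<Otimes>\<^sub>M P)"
    then have w: "fst w \<in> space P" "snd w \<in> space P" by (auto simp: space_pair_measure)
    note s1 = sets_radon_measure[OF zr[OF w(1)]] and s2 = sets_radon_measure[OF zr[OF w(2)]]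
    have "(np k (?\<eta> w)) = ennreal c * pr \<zeta> k (fst w) + ennreal d * pr \<zeta> k (snd w)"
      using km by (simp add: case_prod_beta nn_integral_add_measure s1 s2 nn_integral_scale_measure')
    also have "\<dots> = ennreal (u powr (1 / \<alpha>)) * pr \<zeta> h (fst w) + ennreal (v powr (1 / \<alpha>)) * pr \<zeta> h (snd w)"
      unfolding k_def pr_cmult[OF w(1) h] pr_cmult[OF w(2) h] sp[symmetric]
      by (simp add: ennreal_mult c_def d_def mult_ac)
    finally show "lap (np k (?\<eta> w)) = f u (fst w) * f v (snd w)" by (simp only: lap_add f_def)
  qed simp
  also have "\<dots> = (\<integral>w'. (\<integral>w''. f u w' * f v w'' \<partial>P) \<partial>P)"
  proof -
    have "integrable (P \<Otimes>\<^sub>M P) (%w. f u (fst w) * f v (snd w))"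
    proof (intro PP.P.integrable_const_bound[where B=1] AE_I2)
      show "(%w. f u (fst w) * f v (snd w)) \<in> borel_measurable (P \<Otimes>\<^sub>M P)" by measurable
      show "norm (f u (fst w) * f v (snd w)) <= 1" for w by (auto simp: f_def abs_mult intro!: mult_le_one)
    qed
    from PP.integral_fst'[OF this] show ?thesis by simp
  qed
  also have "\<dots> = (\<integral>w. f u w \<partial>P) * (\<integral>w. f v w \<partial>P)" by simp
  finally show ?thesis unfolding f_def s_def .
qed

lemma laplace_pos:
  assumes "Y \<in> borel_measurable P" "AE w in P. Y w < top"
  shows "0 < (\<integral>w. lap (Y w) \<partial>P)"
proof (rule ccontr)
  assume "\<not> ?thesis"
  moreover have "0 <= (\<integral>w. lap (Y w) \<partial>P)" by simp
  ultimately have "(\<integral>w. lap (Y w) \<partial>P) = 0" by linarith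
  then have "AE w in P. lap (Y w) = 0"
    using integral_nonneg_eq_0_iff_AE[OF lap_integrable[OF assms(1)]] by simp
  with assms(2) have "AE w in P. False" by eventually_elim (simp add: lap_eq_0_iff)
  then show False by simp
qed

lemma laplace_le_1: "(\<integral>w. lap (Y w) \<partial>P) <= 1" if "Y \<in> borel_measurable P"
proof -
  have "(\<integral>w. lap (Y w) \<partial>P) <= (\<integral>w. 1 \<partial>P)" using lap_integrable[OF that] by (intro integral_mono) auto
  then show ?thesis by (simp add: P.prob_space)
qed

text \<open>Minus the logarithm of the transform, as a function of u = s powr \<alpha>, is additive
  by \<open>stable_laplace_add\<close> and monotone, hence linear. Almost sure finiteness keeps the
  transform positive, so that the logarithm is meaningful.\<close>

lemma stable_laplace:
  assumes h: "h \<in> borel_measurable borel" and fin: "AE w in P. pr \<zeta> h w < top"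
  shows "0 <= psi P \<zeta> h" and "0 <= s ==> (\<integral>w. lap (ennreal s * pr \<zeta> h w) \<partial>P) = exp (- (s powr \<alpha> * psi P \<zeta> h))"
proof -
  note hm [measurable] = pr_measurable[OF h]
  define \<Phi> where "\<Phi> u = (\<integral>w. lap (ennreal (u powr (1 / \<alpha>)) * pr \<zeta> h w) \<partial>P)" for u
  have m: "(%w. ennreal c * pr \<zeta> h w) \<in> borel_measurable P" for c by measurable
  have pos: "0 < \<Phi> u" for u unfolding \<Phi>_def
  proof (rule laplace_pos[OF m])
    show "AE w in P. ennreal (u powr (1 / \<alpha>)) * pr \<zeta> h w < top" using fin by eventually_elim (simp add: ennreal_mult_less_top)
  qed
  have "- ln (\<Phi> r) = r * (- ln (\<Phi> 1))" if "0 <= r" for r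
  proof (rule additive_mono_linear[OF _ _ that])
    show "- ln (\<Phi> (u + v)) = - ln (\<Phi> u) + - ln (\<Phi> v)" if "0 <= u" "0 <= v" for u v
      using stable_laplace_add[OF h that] pos[of u] pos[of v] unfolding \<Phi>_def[symmetric] by (simp add: ln_mult)
    show "- ln (\<Phi> u) <= - ln (\<Phi> v)" if "0 <= u" "u <= v" for u v
    proof -
      have "\<Phi> v <= \<Phi> u" unfolding \<Phi>_def using that a0
        by (intro integral_mono lap_integrable m lap_antimono mult_right_mono ennreal_leI powr_mono2) auto
      then show ?thesis using pos by simp
    qed
  qed
  moreover have "\<Phi> 1 = (\<integral>w. lap (pr \<zeta> h w) \<partial>P)" by (simp add: \<Phi>_def)
  ultimately have L: "ln (\<Phi> r) = - (r * psi P \<zeta> h)" if "0 <= r" for r using that by (simp add: psi_def)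
  show "0 <= psi P \<zeta> h" using laplace_le_1[OF hm] laplace_pos[OF hm fin] by (simp add: psi_def)
  assume s: "0 <= s"
  have "\<Phi> (s powr \<alpha>) = exp (- (s powr \<alpha> * psi P \<zeta> h))" using L[of "s powr \<alpha>"] pos[of "s powr \<alpha>"] exp_ln by (metis powr_ge_zero)
  moreover have "(s powr \<alpha>) powr (1 / \<alpha>) = s" using s a0 by (simp add: powr_powr)
  ultimately show "(\<integral>w. lap (ennreal s * pr \<zeta> h w) \<partial>P) = exp (- (s powr \<alpha> * psi P \<zeta> h))" by (simp add: \<Phi>_def)
qed

text \<open>f is a series of indicators of base sets. Its coefficients are so small that their
  \<alpha>-th powers, weighted by the exponents of the base sets, have sum at most 1. The Laplace
  transform of its pairing T with \<zeta> at \<epsilon> then differs from 1 by at most \<epsilon>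
  powr \<alpha>, which forces T to be almost surely finite.\<close>

lemma normalizing_function:
  "\<exists>f :: 'x => real. f \<in> borel_measurable borel \<and> (\<forall>x. 0 < f x) \<and> (\<forall>n. \<exists>c>0. \<forall>x\<in>exh n. c <= f x) \<and>
    (AE w in P. pr \<zeta> (en f) w < top)"
proof -
  define X' where "X' i = pr \<zeta> (indicator (nb i))" for i
  have ib: "(indicator (nb i) :: 'x => ennreal) \<in> borel_measurable borel" for i using nb(2)[of i] by (intro borel_measurable_indicator) simp
  have Xm [measurable]: "X' i \<in> borel_measurable P" for i unfolding X'_def using ib by (rule pr_measurable)
  have Xf: "X' i w < top" if "w \<in> space P" for i w
  proof -
    have "nb i \<in> sets borel" using nb(2)[of i] by simp
    moreover have "compact (closure (nb i))" by (rule nb)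
    ultimately have "emeasure (\<zeta> w) (nb i) < top" "nb i \<in> sets (\<zeta> w)"
      using zr[OF that] by (auto simp: radon_measures_def)
    then show ?thesis by (simp add: X'_def)
  qed
  define p where "p i = psi P \<zeta> (indicator (nb i))" for i
  have p: "0 <= p i" and lp: "0 <= s ==> (\<integral>w. lap (ennreal s * X' i w) \<partial>P) = exp (- (s powr \<alpha> * p i))" for i s
    unfolding p_def X'_def using stable_laplace[OF ib] Xf[unfolded X'_def] by auto
  \<comment> \<open>The power 1 / \<alpha> compensates the exponent \<alpha> of stability, and the
    summand 1 keeps the denominator positive. As 1 / \<alpha> > 1, the coefficients stay below the
    powers of 1 / 2, so the series for f converges.\<close>
  define a where "a i = ((1 / 2) ^ Suc i / (1 + p i)) powr (1 / \<alpha>)" for i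
  have a_pos: "0 < a i" for i using p[of i] by (simp add: a_def)
  have aa: "a i powr \<alpha> = (1 / 2) ^ Suc i / (1 + p i)" for i using p[of i] a0 by (simp add: a_def powr_powr)
  have a_le: "a i <= (1 / 2) ^ Suc i" for i
  proof -
    have z: "(1 / 2) ^ Suc i / (1 + p i) <= (1 / 2 :: real) ^ Suc i" using p[of i] by (simp add: divide_le_eq)
    have l1: "(1 / 2 :: real) ^ Suc i <= 1" by (intro power_le_one) auto
    have "a i <= ((1 / 2) ^ Suc i / (1 + p i)) powr 1"
      unfolding a_def using a0 a1 p[of i] order_trans[OF z l1] by (intro powr_mono') auto
    also have "\<dots> = (1 / 2) ^ Suc i / (1 + p i)" using p[of i] by simp
    finally show ?thesis using z by linarith
  qed
  define f where "f x = (\<Sum>i. a i * indicator (nb i) x)" for x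
  have sm: "summable (%i. a i * indicator (nb i) x)" for x
  proof (rule summable_comparison_test'[of "%i. (1 / 2) ^ Suc i"])
    show "summable (%i. (1 / 2 :: real) ^ Suc i)" using power_half_series by (rule sums_summable)
    show "norm (a i * indicator (nb i) x) <= (1 / 2) ^ Suc i" if "0 <= i" for i
      using a_pos[of i] a_le[of i] by (auto simp: indicator_def)
  qed
  have f_ge: "a i <= f x" if "x \<in> nb i" for i x
    unfolding f_def using sum_le_suminf[OF sm[of x], of "{i}"] a_pos that by (simp add: less_imp_le)
  have [measurable]: "nb i \<in> sets borel" for i using nb(2)[of i] by simp
  have fm: "f \<in> borel_measurable borel" unfolding f_def by measurable
  have f_pos: "0 < f x" for x
  proof -
    obtain i where "x \<in> nb i" using nb_cover by blast
    then show ?thesis using f_ge[of x i] a_pos[of i] by simp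
  qed
  have f_low: "\<exists>c>0. \<forall>x\<in>exh n. c <= f x" for n
  proof (intro exI conjI ballI)
    show "0 < Min (insert 1 (a ` {..<n}))" using a_pos by simp
    fix x assume "x \<in> exh n"
    then obtain i where "i < n" "x \<in> nb i" by (auto simp: exh_def)
    then show "Min (insert 1 (a ` {..<n})) <= f x" using f_ge[of x i] by (intro order_trans[OF Min_le[of _ "a i"]]) auto
  qed
  define T where "T = pr \<zeta> (en f)"
  have Tm [measurable]: "T \<in> borel_measurable P" unfolding T_def using fm by (intro pr_measurable) simp
  have Ts: "T w = (\<Sum>i. ennreal (a i) * X' i w)" if w: "w \<in> space P" for w
  proof -
    have "ennreal (f x) = (\<Sum>i. ennreal (a i) * indicator (nb i) x)" for x
      unfolding f_def using a_pos sm
      by (subst suminf_ennreal2[symmetric]) (auto simp: less_imp_le ennreal_mult' ennreal_indicator)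
    then have "T w = (\<integral>\<^sup>+x. (\<Sum>i. ennreal (a i) * indicator (nb i) x) \<partial>\<zeta> w)" by (simp add: T_def)
    also have "\<dots> = (\<Sum>i. \<integral>\<^sup>+x. ennreal (a i) * indicator (nb i) x \<partial>\<zeta> w)"
      by (intro nn_integral_suminf borel_measurable_radon[OF zr[OF w]] borel_measurable_times_ennreal borel_measurable_const ib)
    also have "\<dots> = (\<Sum>i. ennreal (a i) * X' i w)" by (simp add: pr_cmult[OF w ib] X'_def)
    finally show ?thesis .
  qed
  have bound: "1 - (\<integral>w. lap (ennreal \<epsilon> * T w) \<partial>P) <= \<epsilon> powr \<alpha>" if e: "0 <= \<epsilon>" for \<epsilon>
  proof -
    have "1 - (\<integral>w. lap (\<Sum>i<n. ennreal (\<epsilon> * a i) * X' i w) \<partial>P) <= \<epsilon> powr \<alpha>" for n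
    proof -
      have i1: "integrable P (%w. lap (ennreal (\<epsilon> * a i) * X' i w))" for i by (intro lap_integrable) simp
      have "1 - (\<integral>w. lap (\<Sum>i<n. ennreal (\<epsilon> * a i) * X' i w) \<partial>P) = (\<integral>w. 1 - lap (\<Sum>i<n. ennreal (\<epsilon> * a i) * X' i w) \<partial>P)"
        by (subst Bochner_Integration.integral_diff) (auto intro!: lap_integrable simp: P.prob_space)
      also have "\<dots> <= (\<integral>w. (\<Sum>i<n. 1 - lap (ennreal (\<epsilon> * a i) * X' i w)) \<partial>P)"
        by (intro integral_mono one_minus_lap_sum_le Bochner_Integration.integrable_sum Bochner_Integration.integrable_diff i1 lap_integrable) auto
      also have "\<dots> = (\<Sum>i<n. 1 - exp (- ((\<epsilon> * a i) powr \<alpha> * p i)))"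
        using i1 e a_pos by (subst Bochner_Integration.integral_sum) (auto simp: P.prob_space lp less_imp_le)
      also have "\<dots> <= (\<Sum>i<n. \<epsilon> powr \<alpha> * (1 / 2) ^ Suc i)"
      proof (rule sum_mono)
        fix i
        have "1 - exp (- ((\<epsilon> * a i) powr \<alpha> * p i)) <= (\<epsilon> * a i) powr \<alpha> * p i"
          using exp_ge_add_one_self[of "- ((\<epsilon> * a i) powr \<alpha> * p i)"] by linarith
        also have "\<dots> = \<epsilon> powr \<alpha> * ((1 / 2) ^ Suc i * (p i / (1 + p i)))"
          using e a_pos[of i] by (simp add: powr_mult aa)
        also have "\<dots> <= \<epsilon> powr \<alpha> * ((1 / 2) ^ Suc i * 1)" using p[of i] by (intro mult_left_mono) auto
        finally show "1 - exp (- ((\<epsilon> * a i) powr \<alpha> * p i)) <= \<epsilon> powr \<alpha> * (1 / 2) ^ Suc i" by simp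
      qed
      also have "\<dots> = \<epsilon> powr \<alpha> * (\<Sum>i<n. (1 / 2) ^ Suc i)" by (simp only: sum_distrib_left)
      also have "\<dots> <= \<epsilon> powr \<alpha> * 1"
        using sum_le_suminf[OF sums_summable[OF power_half_series], of "{..<n}"] sums_unique[OF power_half_series]
        by (intro mult_left_mono) auto
      finally show ?thesis by simp
    qed
    moreover have "(%n. 1 - (\<integral>w. lap (\<Sum>i<n. ennreal (\<epsilon> * a i) * X' i w) \<partial>P)) ----> 1 - (\<integral>w. lap (ennreal \<epsilon> * T w) \<partial>P)"
    proof (intro tendsto_diff tendsto_const integral_dominated_convergence[where w="%_. 1"])
      show "AE w in P. (%n. lap (\<Sum>i<n. ennreal (\<epsilon> * a i) * X' i w)) ----> lap (ennreal \<epsilon> * T w)"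
      proof (rule AE_I2)
        fix w assume w: "w \<in> space P"
        have "ennreal \<epsilon> * T w = (\<Sum>i. ennreal (\<epsilon> * a i) * X' i w)"
          unfolding Ts[OF w] ennreal_suminf_cmult[symmetric] using e a_pos by (simp add: ennreal_mult less_imp_le mult.assoc)
        then show "(%n. lap (\<Sum>i<n. ennreal (\<epsilon> * a i) * X' i w)) ----> lap (ennreal \<epsilon> * T w)"
          by (simp only:) (intro tendsto_lap summable_LIMSEQ summableI)
      qed
    qed auto
    ultimately show ?thesis by (intro LIMSEQ_le_const2) auto
  qed
  \<comment> \<open>On the event that T is infinite, 1 - \<open>lap (\<epsilon> * T)\<close> equals
    1 for every positive \<epsilon>.\<close>
  have "P.prob {w \<in> space P. T w = top} <= \<epsilon> powr \<alpha>" if e: "0 < \<epsilon>" for \<epsilon>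
  proof -
    have "P.prob {w \<in> space P. T w = top} = (\<integral>w. indicator {w \<in> space P. T w = top} w \<partial>P)" by simp
    also have "\<dots> <= (\<integral>w. 1 - lap (ennreal \<epsilon> * T w) \<partial>P)"
      using e by (intro integral_mono Bochner_Integration.integrable_diff lap_integrable integrable_real_indicator)
        (auto simp: indicator_def ennreal_mult_top P.emeasure_eq_measure)
    also have "\<dots> = 1 - (\<integral>w. lap (ennreal \<epsilon> * T w) \<partial>P)"
      by (subst Bochner_Integration.integral_diff) (auto intro!: lap_integrable simp: P.prob_space)
    finally show ?thesis using bound[of \<epsilon>] e by simp
  qed
  then have "P.prob {w \<in> space P. T w = top} <= (e powr (1 / \<alpha>)) powr \<alpha>" if "0 < e" for e
    using that by simp
  then have le: "P.prob {w \<in> space P. T w = top} <= e" if "0 < e" for e using that a0 by (simp add: powr_powr)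
  have "P.prob {w \<in> space P. T w = top} = 0"
    using le measure_nonneg[of P] field_le_epsilon[of "P.prob {w \<in> space P. T w = top}" 0] by (auto intro: antisym)
  then have "AE w in P. \<not> (T w = top)"
    by (subst P.prob_Collect_eq_0[symmetric]) measurable
  then have "AE w in P. T w < top" by eventually_elim (simp add: less_top)
  then show ?thesis using fm f_pos f_low unfolding T_def by blast
qed

end

section \<open>Fractional moments and the angular limit\<close>

text \<open>With v = u powr \<alpha>, concavity puts v powr \<gamma> between v and the tangent 1 +
  \<gamma> (v - 1) at 1. The bound is uniform in u, so the exponent can be changed under laws that
  themselves vary with \<gamma>.\<close>

lemma powr_diff_le:
  fixes u :: real
  assumes u: "0 <= u" "u <= 1" and a: "0 < \<alpha>" and g: "0 < \<gamma>" "\<gamma> <= 1"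
  shows "\<bar>u powr (\<alpha> * \<gamma>) - u powr \<alpha>\<bar> <= 1 - \<gamma>"
proof (cases "u = 0")
  case False
  define v where "v = u powr \<alpha>"
  have v: "0 < v" "v <= 1" using u a False powr_mono2[of \<alpha> u 1] by (auto simp: v_def)
  have "u powr (\<alpha> * \<gamma>) = v powr \<gamma>" by (simp add: v_def powr_powr)
  moreover have "v powr \<gamma> <= 1 + \<gamma> * (v - 1)"
    using Youngs_inequality_0[of \<gamma> "1 - \<gamma>" v 1] v g by (simp add: algebra_simps)
  moreover have "v powr 1 <= v powr \<gamma>" using v g by (intro powr_mono') auto
  moreover have "1 + \<gamma> * (v - 1) - v <= 1 - \<gamma>"
  proof -
    have "(1 - \<gamma>) * (1 - v) <= (1 - \<gamma>) * 1" using v g by (intro mult_left_mono) auto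
    then show ?thesis by (simp add: algebra_simps)
  qed
  ultimately show ?thesis using v by (simp add: v_def)
qed (use g in simp)

lemma step_indicator:
  fixes c :: "real => real"
  assumes "finite J" and c: "!!A. A \<subseteq> J ==> (\<forall>a\<in>A. \<forall>b\<in>J. a < b --> b \<in> A) ==> \<phi> A = (\<Sum>x\<in>A. c x)"
    and S: "!!x x'. x < x' ==> S x \<subseteq> S x'"
  shows "\<phi> {x\<in>J. u \<in> S x} = (\<Sum>x\<in>J. c x * indicator (S x) u)"
proof -
  have "\<phi> {x\<in>J. u \<in> S x} = (\<Sum>x\<in>{x\<in>J. u \<in> S x}. c x)" using S by (intro c) blast+
  also have "\<dots> = (\<Sum>x\<in>J. if u \<in> S x then c x else 0)" using assms(1) by (rule sum.inter_filter)
  finally show ?thesis by (auto simp: indicator_def intro: sum.cong)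
qed

text \<open>The sequence \<gamma> of the limit: strictly inside the unit interval, where
  \<open>kapc\<close> is finite and positive, and tending to 1.\<close>

definition gm :: "nat => real" where "gm n = real (n + 1) / real (n + 2)"

lemma gm: "0 < gm n" "gm n < 1" "gm ----> 1"
proof -
  show "0 < gm n" "gm n < 1" by (simp_all add: gm_def)
  have "(%n. real (Suc n) / real (Suc (Suc n))) ----> 1" using LIMSEQ_Suc[OF LIMSEQ_n_over_Suc_n] by simp
  then show "gm ----> 1" unfolding gm_def[abs_def] by simp
qed

definition rt :: "nat => real" where "rt i = real_of_rat (from_nat i)"

lemma rt_dense: "x < y ==> \<exists>i. x < rt i \<and> rt i < y"
proof -
  assume "x < y"
  then obtain r where "x < real_of_rat r" "real_of_rat r < y" using of_rat_dense by blast
  moreover obtain i :: nat where "r = from_nat i" using surj_from_nat by (metis surjD)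
  ultimately show ?thesis by (auto simp: rt_def)
qed

lemma cut_lim:
  assumes "finite J"
  shows "\<forall>\<^sub>F m in sequentially. {x\<in>J. y \<in> cut rt x m} = {x\<in>J. y < x}"
proof -
  have "\<forall>\<^sub>F m in sequentially. y \<in> cut rt x m \<longleftrightarrow> y < x" for x
  proof (cases "y < x")
    case True
    then obtain i where "y < rt i" "rt i < x" using rt_dense by blast
    then have "y \<in> cut rt x m" if "Suc i <= m" for m using that by (auto simp: cut_def intro!: exI[of _ i])
    then show ?thesis using True by (intro eventually_sequentiallyI[of "Suc i"]) blast
  qed (auto simp: cut_def)
  then have "\<forall>\<^sub>F m in sequentially. \<forall>x\<in>J. y \<in> cut rt x m \<longleftrightarrow> y < x" using assms by (intro eventually_ball_finite) auto
  then show ?thesis by eventually_elim blast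
qed

lemma cut_mono: "x < x' ==> cut q x m \<subseteq> cut q x' m" by (auto simp: cut_def intro: less_trans)

lemma cut_borel [measurable]: "cut q x m \<in> sets borel" unfolding cut_def by (intro borel_open open_UN) simp

text \<open>With \<beta> = \<alpha> * \<gamma>, the power of order \<beta> is
  \<open>kap \<beta>\<close> up to a constant, that is, an integral of Laplace transforms over s.
  Their stable form turns s powr (- 1 / \<beta>) into s powr (- 1 / \<gamma>), and the integral is
  again \<open>kap\<close>, now with index \<gamma> and argument
  \<open>psi P \<zeta> h\<close>.\<close>

lemma (in stable_lcsc) stable_moment:
  assumes h: "h \<in> borel_measurable borel" and fin: "AE w in P. pr \<zeta> h w < top" and g: "0 < \<gamma>" "\<gamma> < 1"
  shows "(\<integral>\<^sup>+w. ennreal (enn2real (pr \<zeta> h w) powr (\<alpha> * \<gamma>)) \<partial>P) = ennreal (kapc \<gamma> / kapc (\<alpha> * \<gamma>) * psi P \<zeta> h powr \<gamma>)"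
proof -
  note hm [measurable] = pr_measurable[OF h]
  define \<beta> where "\<beta> = \<alpha> * \<gamma>"
  have b: "0 < \<beta>" "\<beta> < 1" using a0 a1 g mult_strict_mono[of \<alpha> 1 \<gamma> 1] by (auto simp: \<beta>_def)
  interpret L: pair_sigma_finite P "lborel :: real measure" ..
  have ps: "0 <= psi P \<zeta> h" by (rule stable_laplace(1)[OF h fin])
  have "ennreal (kapc \<beta>) * (\<integral>\<^sup>+w. ennreal (enn2real (pr \<zeta> h w) powr \<beta>) \<partial>P) = (\<integral>\<^sup>+w. ennreal (kapc \<beta>) * ennreal (enn2real (pr \<zeta> h w) powr \<beta>) \<partial>P)"
    by (rule nn_integral_cmult[symmetric]) measurable
  also have "\<dots> = (\<integral>\<^sup>+w. kap \<beta> (pr \<zeta> h w) \<partial>P)"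
  proof (rule nn_integral_cong_AE)
    show "AE w in P. ennreal (kapc \<beta>) * ennreal (enn2real (pr \<zeta> h w) powr \<beta>) = kap \<beta> (pr \<zeta> h w)"
      using fin
    proof eventually_elim
      fix w assume "pr \<zeta> h w < top"
      then have "kap \<beta> (ennreal (enn2real (pr \<zeta> h w))) = kap \<beta> (pr \<zeta> h w)" by (simp add: less_top)
      then show "ennreal (kapc \<beta>) * ennreal (enn2real (pr \<zeta> h w) powr \<beta>) = kap \<beta> (pr \<zeta> h w)"
        using kap_eq[OF b, of "enn2real (pr \<zeta> h w)"] kap_1(2)[OF b] by (simp add: ennreal_mult')
    qed
  qed
  also have "\<dots> = (\<integral>\<^sup>+s. \<integral>\<^sup>+w. ennreal (1 - lap (ennreal (s powr (- 1 / \<beta>)) * pr \<zeta> h w)) * indicator {0<..} s \<partial>P \<partial>lborel)"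
    unfolding kap_def by (rule L.Fubini'[symmetric]) measurable
  also have "\<dots> = (\<integral>\<^sup>+s. ennreal (1 - lap (ennreal (s powr (- 1 / \<gamma>)) * ennreal (psi P \<zeta> h))) * indicator {0<..} s \<partial>lborel)"
  proof (intro nn_integral_cong)
    fix s :: real
    show "(\<integral>\<^sup>+w. ennreal (1 - lap (ennreal (s powr (- 1 / \<beta>)) * pr \<zeta> h w)) * indicator {0<..} s \<partial>P) =
      ennreal (1 - lap (ennreal (s powr (- 1 / \<gamma>)) * ennreal (psi P \<zeta> h))) * indicator {0<..} s"
    proof (cases "0 < s")
      case True
      have "(\<integral>\<^sup>+w. ennreal (1 - lap (ennreal (s powr (- 1 / \<beta>)) * pr \<zeta> h w)) \<partial>P)
        = ennreal (\<integral>w. 1 - lap (ennreal (s powr (- 1 / \<beta>)) * pr \<zeta> h w) \<partial>P)"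
        by (intro nn_integral_eq_integral Bochner_Integration.integrable_diff lap_integrable) auto
      also have "(\<integral>w. 1 - lap (ennreal (s powr (- 1 / \<beta>)) * pr \<zeta> h w) \<partial>P) = 1 - exp (- ((s powr (- 1 / \<beta>)) powr \<alpha> * psi P \<zeta> h))"
        by (subst Bochner_Integration.integral_diff) (auto intro!: lap_integrable simp: P.prob_space stable_laplace(2)[OF h fin])
      also have "(s powr (- 1 / \<beta>)) powr \<alpha> = s powr (- 1 / \<gamma>)" using a0 g by (simp add: powr_powr \<beta>_def)
      also have "exp (- (s powr (- 1 / \<gamma>) * psi P \<zeta> h)) = lap (ennreal (s powr (- 1 / \<gamma>)) * ennreal (psi P \<zeta> h))"
        using ps by (simp add: lap_eq_exp_iff)
      finally show ?thesis using True by simp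
    qed simp
  qed
  also have "\<dots> = ennreal (kapc \<gamma> * psi P \<zeta> h powr \<gamma>)" using kap_eq[OF g ps] unfolding kap_def .
  finally have e: "ennreal (kapc \<beta>) * (\<integral>\<^sup>+w. ennreal (enn2real (pr \<zeta> h w) powr \<beta>) \<partial>P) = ennreal (kapc \<gamma> * psi P \<zeta> h powr \<gamma>)" .
  have kb: "0 < kapc \<beta>" by (rule kap_1(2)[OF b])
  have "(\<integral>\<^sup>+w. ennreal (enn2real (pr \<zeta> h w) powr \<beta>) \<partial>P) = ennreal (1 / kapc \<beta>) * (ennreal (kapc \<beta>) * (\<integral>\<^sup>+w. ennreal (enn2real (pr \<zeta> h w) powr \<beta>) \<partial>P))"
    using kb by (simp add: mult.assoc[symmetric] ennreal_mult'[symmetric])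
  also have "\<dots> = ennreal (kapc \<gamma> / kapc \<beta> * psi P \<zeta> h powr \<gamma>)"
    unfolding e using kb by (simp add: ennreal_mult'[symmetric])
  finally show ?thesis by (simp add: \<beta>_def)
qed

section \<open>Reweighted laws and the limits of ratios\<close>

locale stable_normalized = stable_lcsc X P \<zeta> \<alpha>
  for X :: "'x::{second_countable_topology, t2_space} itself" and P :: "'w measure" and \<zeta> \<alpha> +
  fixes f g :: "'x => real"
  assumes fm [measurable]: "f \<in> borel_measurable borel" and f_pos: "!!x. 0 < f x"
    and gm' [measurable]: "g \<in> borel_measurable borel" and g01: "!!x. 0 <= g x" "!!x. g x <= 1"
    and fin: "AE w in P. pr \<zeta> (en f) w < top" and psf: "0 < psi P \<zeta> (en f)"
begin

text \<open>Test functions k live on the unit interval, are pulled back by g and multiplied by f;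
  \<open>U (%_. 1)\<close> is the total mass T by which the random measure is divided.\<close>

definition U :: "(real => real) => 'w => real" where
  "U k w = enn2real (pr \<zeta> (%x. ennreal (f x * k (g x))) w)"

definition ps :: "(real => real) => real" where "ps k = psi P \<zeta> (%x. ennreal (f x * k (g x)))"

definition uk :: "(real => real) => bool" where
  "uk k \<longleftrightarrow> k \<in> borel_measurable borel \<and> (\<forall>y. 0 <= k y \<and> k y <= 1)"

lemma uk_1: "uk (%_. 1)" by (simp add: uk_def)

lemma ps_1: "0 < ps (%_. 1)" using psf by (simp add: ps_def)

lemma km: "uk k ==> (%x. ennreal (f x * k (g x))) \<in> borel_measurable borel"
  unfolding uk_def by (intro measurable_compose[OF _ measurable_ennreal] borel_measurable_times fm measurable_compose[OF gm']) auto

lemma pr_le: "uk k ==> pr \<zeta> (%x. ennreal (f x * k (g x))) w <= pr \<zeta> (en f) w"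
  using f_pos by (intro nn_integral_mono ennreal_leI) (auto simp: uk_def mult_left_le less_imp_le)

lemma pr_fin: "uk k ==> AE w in P. pr \<zeta> (%x. ennreal (f x * k (g x))) w < top"
  using fin by eventually_elim (rule order_le_less_trans[OF pr_le])

lemma U_measurable: "uk k ==> U k \<in> borel_measurable P"
  unfolding U_def[abs_def] using pr_measurable[OF km[of k]] by simp

lemma U_nonneg: "0 <= U k w" by (simp add: U_def)

lemma U_le: "uk k ==> pr \<zeta> (en f) w < top ==> U k w <= U (%_. 1) w"
  unfolding U_def using pr_le[of k w] by (simp add: enn2real_mono)

lemma U_integral:
  assumes k: "k \<in> borel_measurable borel" "!!y. 0 <= k y" and w: "w \<in> space P"
  shows "U k w = (\<integral>x. k (g x) \<partial>density (\<zeta> w) (en f))"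
proof -
  note bm = borel_measurable_radon[OF zr[OF w]]
  have [measurable]: "(%x. k (g x)) \<in> borel_measurable (\<zeta> w)" "f \<in> borel_measurable (\<zeta> w)"
    using measurable_compose[OF gm' k(1)] by (auto intro!: bm fm)
  have "(\<integral>x. k (g x) \<partial>density (\<zeta> w) (en f)) = enn2real (\<integral>\<^sup>+x. ennreal (k (g x)) \<partial>density (\<zeta> w) (en f))"
    using k(2) by (intro integral_eq_nn_integral) auto
  also have "(\<integral>\<^sup>+x. ennreal (k (g x)) \<partial>density (\<zeta> w) (en f)) = pr \<zeta> (%x. ennreal (f x * k (g x))) w"
    using f_pos k(2) by (subst nn_integral_density) (auto simp: ennreal_mult less_imp_le)
  finally show ?thesis by (simp add: U_def)
qed

text \<open>By \<open>stable_moment\<close> this is the moment of T of order \<alpha> * gm n, which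
  makes \<open>N n\<close> a probability measure.\<close>

definition M1 :: "nat => real" where "M1 n = kapc (gm n) / kapc (\<alpha> * gm n) * ps (%_. 1) powr gm n"

lemma gma: "0 < \<alpha> * gm n" "\<alpha> * gm n < 1"
  using a0 a1 gm(1)[of n] gm(2)[of n] mult_strict_mono[of \<alpha> 1 "gm n" 1] by auto

lemma M1_pos: "0 < M1 n"
  unfolding M1_def using kap_1(2)[OF gm(1,2)] kap_1(2)[OF gma] ps_1 by simp

definition N :: "nat => 'w measure" where
  "N n = density P (%w. ennreal (U (%_. 1) w powr (\<alpha> * gm n) / M1 n))"

lemma N_moment:
  assumes k: "uk k"
  shows "(\<integral>\<^sup>+w. ennreal ((U k w / U (%_. 1) w) powr (\<alpha> * gm n)) \<partial>N n) = ennreal ((ps k / ps (%_. 1)) powr gm n)"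
proof -
  note [measurable] = U_measurable[OF k] U_measurable[OF uk_1]
  have "(\<integral>\<^sup>+w. ennreal ((U k w / U (%_. 1) w) powr (\<alpha> * gm n)) \<partial>N n) =
    (\<integral>\<^sup>+w. ennreal (U (%_. 1) w powr (\<alpha> * gm n) / M1 n) * ennreal ((U k w / U (%_. 1) w) powr (\<alpha> * gm n)) \<partial>P)"
    unfolding N_def by (rule nn_integral_density) measurable
  also have "\<dots> = (\<integral>\<^sup>+w. ennreal (1 / M1 n) * ennreal (U k w powr (\<alpha> * gm n)) \<partial>P)"
  proof (rule nn_integral_cong_AE)
    show "AE w in P. ennreal (U (%_. 1) w powr (\<alpha> * gm n) / M1 n) * ennreal ((U k w / U (%_. 1) w) powr (\<alpha> * gm n)) =
      ennreal (1 / M1 n) * ennreal (U k w powr (\<alpha> * gm n))"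
      using fin
    proof eventually_elim
      fix w assume "pr \<zeta> (en f) w < top"
      then have le: "U k w <= U (%_. 1) w" by (rule U_le[OF k])
      have "U (%_. 1) w powr (\<alpha> * gm n) / M1 n * (U k w / U (%_. 1) w) powr (\<alpha> * gm n) = 1 / M1 n * U k w powr (\<alpha> * gm n)"
      proof (cases "U (%_. 1) w = 0")
        case True
        then have "U k w = 0" using le U_nonneg[of k w] by simp
        then show ?thesis by simp
      next
        case False
        then show ?thesis using U_nonneg[of k w] U_nonneg[of "%_. 1" w] by (simp add: powr_divide)
      qed
      then show "ennreal (U (%_. 1) w powr (\<alpha> * gm n) / M1 n) * ennreal ((U k w / U (%_. 1) w) powr (\<alpha> * gm n)) =
        ennreal (1 / M1 n) * ennreal (U k w powr (\<alpha> * gm n))"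
        using M1_pos[of n] by (simp only: ennreal_mult'[symmetric] powr_ge_zero divide_nonneg_pos zero_le_one)
    qed
  qed
  also have "\<dots> = ennreal (1 / M1 n) * (\<integral>\<^sup>+w. ennreal (U k w powr (\<alpha> * gm n)) \<partial>P)" by (rule nn_integral_cmult) measurable
  also have "(\<integral>\<^sup>+w. ennreal (U k w powr (\<alpha> * gm n)) \<partial>P) = ennreal (kapc (gm n) / kapc (\<alpha> * gm n) * ps k powr gm n)"
    unfolding U_def ps_def by (rule stable_moment[OF km[OF k] pr_fin[OF k] gm(1,2)])
  also have "ennreal (1 / M1 n) * \<dots> = ennreal (1 / M1 n * (kapc (gm n) / kapc (\<alpha> * gm n) * ps k powr gm n))"
    using M1_pos[of n] by (simp only: ennreal_mult'[symmetric] divide_nonneg_pos zero_le_one)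
  also have "1 / M1 n * (kapc (gm n) / kapc (\<alpha> * gm n) * ps k powr gm n) = (ps k / ps (%_. 1)) powr gm n"
    using kap_1(2)[OF gm(1,2), of n] kap_1(2)[OF gma, of n] ps_1 stable_laplace(1)[OF km[OF k] pr_fin[OF k], folded ps_def]
    unfolding M1_def by (simp add: powr_divide)
  finally show ?thesis .
qed

lemma prob_N: "prob_space (N n)"
proof (rule prob_spaceI)
  have "(\<integral>\<^sup>+w. 1 \<partial>N n) = (\<integral>\<^sup>+w. ennreal ((U (%_. 1) w / U (%_. 1) w) powr (\<alpha> * gm n)) \<partial>N n)"
    unfolding N_def using U_measurable[OF uk_1] by (subst (1 2) nn_integral_density) (auto intro!: nn_integral_cong)
  also have "\<dots> = 1" using ps_1 by (simp only: N_moment[OF uk_1]) simp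
  finally show "emeasure (N n) (space (N n)) = 1" by simp
qed

lemma AE_N: "AE w in N n. w \<in> space P \<and> pr \<zeta> (en f) w < top \<and> 0 < U (%_. 1) w"
proof -
  have "AE w in P. 0 < ennreal (U (%_. 1) w powr (\<alpha> * gm n) / M1 n) -->
      w \<in> space P \<and> pr \<zeta> (en f) w < top \<and> 0 < U (%_. 1) w"
    using fin AE_space
  proof eventually_elim
    case (elim w)
    show ?case
    proof
      assume "0 < ennreal (U (%_. 1) w powr (\<alpha> * gm n) / M1 n)"
      then have "U (%_. 1) w \<noteq> 0" by auto
      then show "w \<in> space P \<and> pr \<zeta> (en f) w < top \<and> 0 < U (%_. 1) w" using elim U_nonneg[of "%_. 1" w] by simp
    qed
  qed
  then show ?thesis unfolding N_def using U_measurable[OF uk_1] by (subst AE_density) auto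
qed

text \<open>The ratio is almost surely at most 1, so \<open>powr_diff_le\<close> replaces the
  exponent \<alpha> * gm n, for which \<open>N_moment\<close> is exact, by \<alpha> at the cost of 1
  - gm n.\<close>

lemma ratio_limit:
  assumes k: "uk k"
  shows "(%n. \<integral>w. (U k w / U (%_. 1) w) powr \<alpha> \<partial>N n) ----> ps k / ps (%_. 1)"
proof -
  have [measurable]: "U k \<in> borel_measurable (N n)" "U (%_. 1) \<in> borel_measurable (N n)" for n
    unfolding N_def using U_measurable[OF k] U_measurable[OF uk_1] by auto
  define R where "R w = U k w / U (%_. 1) w" for w
  have Rm [measurable]: "R \<in> borel_measurable (N n)" for n unfolding R_def by measurable
  have R0: "0 <= R w" for w by (simp add: R_def U_nonneg)
  have R1: "AE w in N n. R w <= 1" for n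
    using AE_N[of n] by eventually_elim (use U_le[OF k] in \<open>auto simp: R_def divide_le_eq_1\<close>)
  have int: "integrable (N n) (%w. R w powr c)" if c: "0 < c" for n c
  proof (rule finite_measure.integrable_const_bound[where B=1])
    show "finite_measure (N n)" using prob_N[of n] by (rule prob_space.finite_measure)
    show "AE w in N n. norm (R w powr c) <= 1" using R1[of n]
      by eventually_elim (use powr_mono2[of c _ 1] c R0 in auto)
  qed measurable
  have m: "(\<integral>w. R w powr (\<alpha> * gm n) \<partial>N n) = (ps k / ps (%_. 1)) powr gm n" for n
    using N_moment[OF k, of n] by (subst integral_eq_nn_integral) (auto simp: R_def)
  have "\<bar>(\<integral>w. R w powr \<alpha> \<partial>N n) - (ps k / ps (%_. 1)) powr gm n\<bar> <= 1 - gm n" for n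
  proof -
    interpret Nn: prob_space "N n" by (rule prob_N)
    have "(\<integral>w. R w powr \<alpha> \<partial>N n) - (ps k / ps (%_. 1)) powr gm n = (\<integral>w. R w powr \<alpha> - R w powr (\<alpha> * gm n) \<partial>N n)"
      unfolding m[symmetric] using int a0 gma[of n] by (intro Bochner_Integration.integral_diff[symmetric]) auto
    also have "\<bar>\<dots>\<bar> <= (\<integral>w. \<bar>R w powr \<alpha> - R w powr (\<alpha> * gm n)\<bar> \<partial>N n)" by (rule integral_abs_bound)
    also have "\<dots> <= (\<integral>w. 1 - gm n \<partial>N n)"
    proof (rule integral_mono_AE)
      show "integrable (N n) (%w. \<bar>R w powr \<alpha> - R w powr (\<alpha> * gm n)\<bar>)" using int a0 gma[of n] by (intro integrable_abs Bochner_Integration.integrable_diff) auto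
      show "AE w in N n. \<bar>R w powr \<alpha> - R w powr (\<alpha> * gm n)\<bar> <= 1 - gm n" using R1[of n]
        by eventually_elim (use powr_diff_le[OF R0 _ a0 gm(1)[of n]] gm(2)[of n] in \<open>auto simp: abs_minus_commute\<close>)
    qed simp
    finally show ?thesis by (simp add: Nn.prob_space)
  qed
  then have "\<forall>\<^sub>F n in sequentially. norm ((\<integral>w. R w powr \<alpha> \<partial>N n) - (ps k / ps (%_. 1)) powr gm n) <= 1 - gm n" by simp
  moreover have "(%n. 1 - gm n) ----> 0" using tendsto_diff[OF tendsto_const gm(3), of 1] by simp
  ultimately have "(%n. (\<integral>w. R w powr \<alpha> \<partial>N n) - (ps k / ps (%_. 1)) powr gm n) ----> 0" by (rule Lim_null_comparison)
  moreover have "(%n. (ps k / ps (%_. 1)) powr gm n) ----> ps k / ps (%_. 1)"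
  proof (cases "ps k = 0")
    case False
    then have "0 < ps k / ps (%_. 1)" using ps_1 stable_laplace(1)[OF km[OF k] pr_fin[OF k], folded ps_def] by simp
    then have "(%n. (ps k / ps (%_. 1)) powr gm n) ----> (ps k / ps (%_. 1)) powr 1" using False ps_1 by (intro tendsto_powr tendsto_const gm(3)) auto
    then show ?thesis by (simp only: powr_one[OF less_imp_le[OF \<open>0 < ps k / ps (%_. 1)\<close>]])
  qed simp
  ultimately show ?thesis using tendsto_add[of _ 0 sequentially] unfolding R_def by fastforce
qed

text \<open>Dominated convergence with dominating function f, whose pairing is almost surely finite.
  Countable additivity of \<zeta> enters the limit procedure here.\<close>

lemma ps_limit:
  assumes k: "!!m. uk (k m)" "uk l" and lim: "!!y. (%m. k m y) ----> l y"
  shows "(%m. ps (k m)) ----> ps l"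
proof -
  let ?h = "%k x. ennreal (f x * k (g x))"
  have "(%m. \<integral>w. lap (pr \<zeta> (?h (k m)) w) \<partial>P) ----> (\<integral>w. lap (pr \<zeta> (?h l) w) \<partial>P)"
  proof (rule integral_dominated_convergence[where w="%_. 1"])
    show "AE w in P. (%m. lap (pr \<zeta> (?h (k m)) w)) ----> lap (pr \<zeta> (?h l) w)"
      using fin AE_space
    proof eventually_elim
      case (elim w)
      show ?case
      proof (rule tendsto_lap, rule nn_integral_dominated_convergence[where w="%x. ennreal (f x)"])
        show "?h (k m) \<in> borel_measurable (\<zeta> w)" "?h l \<in> borel_measurable (\<zeta> w)" "(en f) \<in> borel_measurable (\<zeta> w)" for m
          using km k fm by (auto intro!: borel_measurable_radon[OF zr[OF elim(2)]])
        show "AE x in \<zeta> w. ?h (k m) x <= ennreal (f x)" for m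
          using k(1)[of m] f_pos by (intro AE_I2 ennreal_leI) (auto simp: uk_def mult_left_le less_imp_le)
        show "AE x in \<zeta> w. (%m. ?h (k m) x) ----> ?h l x" by (intro AE_I2 tendsto_ennrealI tendsto_mult_left lim)
      qed (use elim in simp)
    qed
  qed (use pr_measurable[OF km] k in auto)
  then show ?thesis unfolding ps_def psi_def
    using laplace_pos[OF pr_measurable[OF km[OF k(2)]] pr_fin[OF k(2)]] by (intro tendsto_minus tendsto_ln) auto
qed

end

section \<open>Distribution functions of the normalised measure and their weak limit\<close>

lemma step_borel:
  fixes \<phi> :: "real set => real"
  assumes J: "finite J" and phi: "\<phi> {} = 0"
  shows "(%y. \<phi> {x\<in>J. y < x}) \<in> borel_measurable borel"
proof -
  from step_combination[of J \<phi>, OF J phi] obtain c :: "real => real"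
    where c: "!!A. A \<subseteq> J ==> (\<forall>a\<in>A. \<forall>b\<in>J. a < b --> b \<in> A) ==> \<phi> A = (\<Sum>x\<in>A. c x)" by blast
  have "\<phi> {x\<in>J. y \<in> {..<x}} = (\<Sum>x\<in>J. c x * indicator {..<x} y)" for y
    by (rule step_indicator[where c=c, OF J c]) auto
  then have "(%y. \<phi> {x\<in>J. y < x}) = (%y. \<Sum>x\<in>J. c x * indicator {..<x} y)" by simp
  then show ?thesis by simp
qed

context stable_normalized
begin

definition Y :: "nat => 'w => real" where
  "Y i w = min 1 (U (indicator {..<rt i}) w / U (%_. 1) w)"

text \<open>Outside the unit interval the values are prescribed. For the random measures they are
  the true ones, because g maps into the unit interval; for the limit they provide the boundary
  conditions of the quantile function.\<close>

definition md :: "(nat => real) => nat => real" where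
  "md y i = (if 1 < rt i then 1 else if rt i <= 0 then 0 else y i)"

lemma uk_indicator: "A \<in> sets borel ==> uk (indicator A)" by (auto simp: uk_def indicator_def)

lemma Y_measurable: "Y i \<in> borel_measurable P"
  unfolding Y_def[abs_def] using U_measurable[OF uk_1] U_measurable[OF uk_indicator[of "{..<rt i}"]] by simp

text \<open>By \<open>mx_cut\<close> each \<open>mx\<close> is a ratio for the indicator of a cut.
  The step function is the combination of these indicators with coefficients c, so linearity of the
  integral against the random measure gives the identity.\<close>

lemma step_limit_pre:
  assumes J: "finite J" and phi: "\<phi> {} = 0" "!!A. 0 <= \<phi> A \<and> \<phi> A <= (1 :: real)"
    and c: "!!A. A \<subseteq> J ==> (\<forall>a\<in>A. \<forall>b\<in>J. a < b --> b \<in> A) ==> \<phi> A = (\<Sum>x\<in>A. c x)"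
    and w: "w \<in> space P" "pr \<zeta> (en f) w < top" "0 < U (%_. 1) w"
  shows "(\<Sum>x\<in>J. c x * mx rt x (md (%i. Y i w)) m) = U (%y. \<phi> {x\<in>J. y \<in> cut rt x m}) w / U (%_. 1) w"
proof -
  let ?M = "density (\<zeta> w) (en f)"
  define F where "F A = U (indicator A) w / U (%_. 1) w" for A
  have fin: "pr \<zeta> (%x. ennreal (f x * indicator A (g x))) w < top" for A :: "real set"
  proof -
    have "pr \<zeta> (%x. ennreal (f x * indicator A (g x))) w <= pr \<zeta> (en f) w"
      using f_pos by (intro nn_integral_mono ennreal_leI) (auto simp: indicator_def less_imp_le)
    then show ?thesis using w(2) by (rule order_le_less_trans)
  qed
  have Fmono: "F A <= F B" if "A \<subseteq> B" for A B
  proof -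
    have "pr \<zeta> (%x. ennreal (f x * indicator A (g x))) w <= pr \<zeta> (%x. ennreal (f x * indicator B (g x))) w"
      using f_pos that by (intro nn_integral_mono ennreal_leI) (auto simp: indicator_def less_imp_le)
    then show ?thesis unfolding F_def U_def using fin[of B] by (intro divide_right_mono enn2real_mono) auto
  qed
  have F0: "F {} = 0" by (simp add: F_def U_def)
  have F1: "F A <= 1" for A
  proof -
    have "F UNIV = 1" using w(3) by (simp add: F_def)
    then show ?thesis using Fmono[of A UNIV] by simp
  qed
  have "md (%i. Y i w) i = F {..<rt i}" for i
  proof -
    have "F {..<rt i} = 1" if "1 < rt i"
    proof -
      have "indicator {..<rt i} (g x) = (1 :: real)" for x using g01(2)[of x] that by simp
      then show ?thesis using w(3) by (simp add: F_def U_def)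
    qed
    moreover have "F {..<rt i} = 0" if "rt i <= 0"
    proof -
      have "indicator {..<rt i} (g x) = (0 :: real)" for x using g01(1)[of x] that by simp
      then show ?thesis by (simp add: F_def U_def)
    qed
    moreover have "Y i w = F {..<rt i}" using F1[of "{..<rt i}"] by (simp add: Y_def F_def)
    ultimately show ?thesis by (simp add: md_def)
  qed
  then have "md (%i. Y i w) = (%i. F {..<rt i})" by (rule ext)
  then have mc: "mx rt x (md (%i. Y i w)) m = F (cut rt x m)" for x using mx_cut[of F rt x m, OF Fmono F0] by simp
  have gz [measurable]: "g \<in> borel_measurable (\<zeta> w)" by (rule borel_measurable_radon[OF zr[OF w(1)] gm'])
  have Mf: "finite_measure ?M"
  proof (rule finite_measureI)
    have "emeasure ?M (space ?M) = pr \<zeta> (en f) w"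
      using borel_measurable_radon[OF zr[OF w(1)], of "%x. ennreal (f x)"] by (subst emeasure_density) (auto intro!: nn_integral_cong)
    then show "emeasure ?M (space ?M) \<noteq> \<infinity>" using w(2) by simp
  qed
  interpret M: finite_measure ?M by (rule Mf)
  have step: "\<phi> {x\<in>J. y \<in> cut rt x m} = (\<Sum>x\<in>J. c x * indicator (cut rt x m) y)" for y
    by (rule step_indicator[where c=c, OF J c]) (auto dest: cut_mono[of _ _ rt m])
  have "(%y. \<Sum>x\<in>J. c x * indicator (cut rt x m) y) \<in> borel_measurable borel" by measurable
  then have km: "(%y. \<phi> {x\<in>J. y \<in> cut rt x m}) \<in> borel_measurable borel" by (simp only: step)
  have "U (%y. \<phi> {x\<in>J. y \<in> cut rt x m}) w = (\<integral>z. \<phi> {x\<in>J. g z \<in> cut rt x m} \<partial>?M)"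
    using phi(2) by (intro U_integral[OF km _ w(1)]) auto
  also have "\<dots> = (\<integral>z. (\<Sum>x\<in>J. c x * indicator (cut rt x m) (g z)) \<partial>?M)" unfolding step ..
  also have "\<dots> = (\<Sum>x\<in>J. c x * (\<integral>z. indicator (cut rt x m) (g z) \<partial>?M))"
  proof -
    have "integrable ?M (%z. indicator (cut rt x m) (g z) :: real)" for x
      by (intro M.integrable_const_bound[where B=1]) (auto simp: indicator_def)
    then show ?thesis by (subst Bochner_Integration.integral_sum) auto
  qed
  also have "\<dots> = (\<Sum>x\<in>J. c x * U (indicator (cut rt x m)) w)"
    using U_integral[OF _ _ w(1), of "indicator (cut rt _ m)"] by (intro sum.cong refl) simp
  finally show ?thesis unfolding mc F_def by (simp add: sum_divide_distrib)
qed

text \<open>With u uniformly distributed this is a random point of the limiting measure with code t.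
  The quantile transform applies although the decoded values need not be monotone in
  \<open>rt i\<close>.\<close>

definition Qt :: "real => real => real" where "Qt t u = quant rt (md (%i. dec i t)) u"

lemma rt_big: "\<exists>i. 1 < rt i" using rt_dense[of 1 2] by auto

lemma md_dec: "1 < rt i ==> md (%i. dec i t) i = 1" "rt i <= 0 ==> md (%i. dec i t) i = 0"
  "0 <= md (%i. dec i t) i" "md (%i. dec i t) i <= 1"
  using dec_range by (auto simp: md_def)

lemma continuous_md_dec: "continuous_on UNIV (%t. md (%i. dec i t) i)"
  using continuous_dec[of i] by (cases "1 < rt i"; cases "rt i <= 0") (simp_all add: md_def)

lemma Qt_measurable [measurable]: "(%p. Qt (fst p) (snd p)) \<in> borel_measurable (borel \<Otimes>\<^sub>M borel)"
  unfolding Qt_def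
proof (rule measurable_quant[where D="%i t. md (%i. dec i t) i", OF rt_big])
  show "(%t. md (%i. dec i t) i) \<in> borel_measurable borel" for i
    by (rule borel_measurable_continuous_onI[OF continuous_md_dec])
qed (auto simp: md_dec)

lemma Qt_measurable2 [measurable]: "Qt t \<in> borel_measurable borel"
  using measurable_compose[OF measurable_Pair1', OF _ Qt_measurable, of t] by simp

lemma Qk_measurable:
  fixes k :: "real => real"
  assumes "k \<in> borel_measurable borel"
  shows "(%t. \<integral>u. k (Qt t u) \<partial>unif01) \<in> borel_measurable borel"
proof -
  interpret V: prob_space unif01 by (rule prob_space_unif01)
  have "(%p. k (Qt (fst p) (snd p))) \<in> borel_measurable (borel \<Otimes>\<^sub>M borel)" by (rule measurable_compose[OF Qt_measurable assms])
  then have "(%(t, u). k (Qt t u)) \<in> borel_measurable (borel \<Otimes>\<^sub>M unif01)"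
    using measurable_cong_sets[OF sets_pair_measure_cong[OF refl sets_unif01] refl, of borel borel] by (auto simp: case_prod_beta')
  then show ?thesis using V.borel_measurable_lebesgue_integral[of "%t u. k (Qt t u)" borel] by simp
qed

text \<open>The counterpart of \<open>step_limit_pre\<close> on the side of the limit: there the
  functional of finitely many rationals only converges, and \<open>quant_mx_limit\<close> identifies
  what it converges to.\<close>

lemma quantile_step:
  fixes \<phi> :: "real set => real" and c :: "real => real"
  assumes J: "finite J" and c: "!!A. A \<subseteq> J ==> (\<forall>a\<in>A. \<forall>b\<in>J. a < b --> b \<in> A) ==> \<phi> A = (\<Sum>x\<in>A. c x)"
  shows "(%m. \<Sum>x\<in>J. c x * mx rt x (md (%i. dec i t)) m) ----> (\<integral>u. \<phi> {x\<in>J. Qt t u < x} \<partial>unif01)"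
proof -
  interpret V: prob_space unif01 by (rule prob_space_unif01)
  have Qs: "{u. Qt t u < x} \<in> sets borel" for x using borel_measurable_less[OF Qt_measurable2, of "%_. x" t] by simp
  have "\<phi> {x\<in>J. u \<in> {u. Qt t u < x}} = (\<Sum>x\<in>J. c x * indicator {u. Qt t u < x} u)" for u
    by (rule step_indicator[where c=c, OF J c]) auto
  then have "(\<integral>u. \<phi> {x\<in>J. Qt t u < x} \<partial>unif01) = (\<integral>u. (\<Sum>x\<in>J. c x * indicator {u. Qt t u < x} u) \<partial>unif01)" by simp
  also have "\<dots> = (\<Sum>x\<in>J. c x * measure unif01 {u. Qt t u < x})"
  proof -
    have "integrable unif01 (indicator {u. Qt t u < x} :: real => real)" for x
      using Qs by (intro V.integrable_const_bound[where B=1]) (auto simp: indicator_def)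
    then show ?thesis by (subst Bochner_Integration.integral_sum) auto
  qed
  finally have e: "(\<integral>u. \<phi> {x\<in>J. Qt t u < x} \<partial>unif01) = (\<Sum>x\<in>J. c x * measure unif01 {u. Qt t u < x})" .
  have "(%m. mx rt x (md (%i. dec i t)) m) ----> measure unif01 {u. Qt t u < x}" for x
    unfolding Qt_def by (rule quant_mx_limit[OF rt_big]) (use md_dec in auto)
  then show ?thesis unfolding e by (intro tendsto_sum tendsto_mult_left)
qed

lemma clamp_id:
  assumes "uk k" shows "max 0 (min 1 (k y)) = k y"
proof -
  have "0 <= k y" "k y <= 1" using assms by (auto simp: uk_def)
  then show ?thesis by simp
qed

text \<open>For fixed m the functional is a bounded continuous function of the code, so n goes to
  infinity first. Then m does: \<open>quantile_step\<close> treats the left side and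
  \<open>ps_limit\<close> the right side. This settles step functions, and pointwise limits reach
  all Borel functions with values in the unit interval.\<close>

lemma angular_measure:
  "\<exists>\<rho>. prob_space \<rho> \<and> sets \<rho> = sets borel \<and>
    (\<forall>k. uk k --> (\<integral>t. (\<integral>u. k (Qt t u) \<partial>unif01) powr \<alpha> \<partial>\<rho>) = ps k / ps (%_. 1))"
proof -
  interpret V: prob_space unif01 by (rule prob_space_unif01)
  have Ym: "Y i \<in> borel_measurable (N n)" for i n unfolding N_def using Y_measurable by simp
  have Y01: "0 <= Y i w" "Y i w <= 1" for i w by (auto simp: Y_def U_nonneg)
  from cube_weak_limit[of N Y, OF prob_N Ym Y01] obtain \<rho> :: "real measure" and r where \<rho>: "real_distribution \<rho>" and r: "strict_mono r"
    and lim0: "\<forall>(G :: (nat => real) => real) c. continuous_on UNIV (%t. G (%i. dec i t)) \<and> (\<forall>t. \<bar>G (%i. dec i t)\<bar> <= c) -->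
      (%n. \<integral>w. G (%i. Y i w) \<partial>N (r n)) ----> (\<integral>t. G (%i. dec i t) \<partial>\<rho>)" by blast
  have lim: "(%n. \<integral>w. G (%i. Y i w) \<partial>N (r n)) ----> (\<integral>t. G (%i. dec i t) \<partial>\<rho>)"
    if "continuous_on UNIV (%t. G (%i. dec i t))" "!!t. \<bar>G (%i. dec i t)\<bar> <= C" for G :: "(nat => real) => real" and C
    by (rule lim0[rule_format, of G C]) (use that in blast)
  interpret R: real_distribution \<rho> by (rule \<rho>)
  have sR: "sets \<rho> = sets borel" by (rule R.events_eq_borel)
  have bR: "h \<in> borel_measurable \<rho>" if "h \<in> borel_measurable borel" for h :: "real => real"
    using that measurable_cong_sets[OF sR refl] by blast
  have Qpm: "(%t. (\<integral>u. k (Qt t u) \<partial>unif01) powr \<alpha>) \<in> borel_measurable \<rho>" if "uk k" for k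
  proof (rule bR)
    have [measurable]: "(%t. \<integral>u. k (Qt t u) \<partial>unif01) \<in> borel_measurable borel"
      using that by (intro Qk_measurable) (simp add: uk_def)
    show "(%t. (\<integral>u. k (Qt t u) \<partial>unif01) powr \<alpha>) \<in> borel_measurable borel" by measurable
  qed
  define S where "S k \<longleftrightarrow> (\<integral>t. (\<integral>u. k (Qt t u) \<partial>unif01) powr \<alpha> \<partial>\<rho>) = ps k / ps (%_. 1)" for k :: "real => real"
  have kint: "0 <= (\<integral>u. k (Qt t u) \<partial>unif01)" "(\<integral>u. k (Qt t u) \<partial>unif01) <= 1" if "uk k" for k t
  proof -
    show "0 <= (\<integral>u. k (Qt t u) \<partial>unif01)" using that by (intro Bochner_Integration.integral_nonneg) (auto simp: uk_def)
    have "(\<integral>u. k (Qt t u) \<partial>unif01) <= (\<integral>u. 1 \<partial>unif01)"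
    proof (rule integral_mono)
      show "integrable unif01 (%u. k (Qt t u))"
        using that measurable_compose[OF Qt_measurable2, of k] by (intro V.integrable_const_bound[where B=1]) (auto simp: uk_def)
    qed (use that in \<open>auto simp: uk_def\<close>)
    then show "(\<integral>u. k (Qt t u) \<partial>unif01) <= 1" by (simp add: V.prob_space[simplified])
  qed
  have S_step: "S (%y. \<phi> {x\<in>J. y < x})"
    if J: "finite J" and phi: "\<phi> {} = 0" "!!A. 0 <= \<phi> A \<and> \<phi> A <= (1 :: real)" for J \<phi>
  proof -
    from step_combination[of J \<phi>, OF J phi(1)] obtain c :: "real => real"
      where c: "!!A. A \<subseteq> J ==> (\<forall>a\<in>A. \<forall>b\<in>J. a < b --> b \<in> A) ==> \<phi> A = (\<Sum>x\<in>A. c x)" by blast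
    define k where "k m y = \<phi> {x\<in>J. y \<in> cut rt x m}" for m y
    have keq: "k m = (%y. \<Sum>x\<in>J. c x * indicator (cut rt x m) y)" for m
      unfolding k_def by (rule ext, rule step_indicator[where c=c, OF J c]) (auto dest: cut_mono[of _ _ rt m])
    have "k m \<in> borel_measurable borel" for m unfolding keq by measurable
    then have uk: "uk (k m)" for m using phi(2) unfolding uk_def k_def by blast
    have ul: "uk (%y. \<phi> {x\<in>J. y < x})" using step_borel[of J \<phi>, OF J phi(1)] phi(2) unfolding uk_def by blast
    have kl: "(%m. k m y) ----> \<phi> {x\<in>J. y < x}" for y
      using cut_lim[OF J, of y] by (intro tendsto_eventually) (auto simp: k_def elim: eventually_mono)
    \<comment> \<open>The maximum with 0 makes the base of the power visibly non-negative, as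
      continuity of the power at 0 requires.\<close>
    define G where "G m y = (max 0 (\<Sum>x\<in>J. c x * mx rt x (md y) m)) powr \<alpha>" for m y
    have Gc: "continuous_on UNIV (%t. G m (%i. dec i t))" for m
      unfolding G_def using a0
      by (intro continuous_on_powr' continuous_on_max continuous_on_const continuous_on_sum continuous_on_mult_left continuous_mx continuous_md_dec) auto
    define C where "C = (\<Sum>x\<in>J. \<bar>c x\<bar>)"
    have mb: "\<bar>\<Sum>x\<in>J. c x * mx rt x (md (%i. dec i t)) m\<bar> <= C" for m t
    proof -
      have "\<bar>\<Sum>x\<in>J. c x * mx rt x (md (%i. dec i t)) m\<bar> <= (\<Sum>x\<in>J. \<bar>c x * mx rt x (md (%i. dec i t)) m\<bar>)" by (rule sum_abs)
      also have "\<dots> <= C" unfolding C_def using mx_range[of "md (%i. dec i t)" rt _ m, OF md_dec(3,4)]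
        by (intro sum_mono) (simp add: abs_mult mult_left_le)
      finally show ?thesis .
    qed
    have Gb: "\<bar>G m (%i. dec i t)\<bar> <= C powr \<alpha>" for m t
    proof -
      have "0 <= C" by (simp add: C_def sum_nonneg)
      then have "max 0 (\<Sum>x\<in>J. c x * mx rt x (md (%i. dec i t)) m) <= C" using mb[of t m] by simp
      then show ?thesis unfolding G_def using a0 by (simp add: powr_mono2)
    qed
    have GN: "(\<integral>w. G m (%i. Y i w) \<partial>N n) = (\<integral>w. (U (k m) w / U (%_. 1) w) powr \<alpha> \<partial>N n)" for m n
    proof (rule integral_cong_AE)
      have "(%w. \<Sum>x\<in>J. c x * mx rt x (%i. md (%i. Y i w) i) m) \<in> borel_measurable (N n)"
      proof (intro borel_measurable_sum borel_measurable_times borel_measurable_const measurable_mx)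
        show "(%w. md (%i. Y i w) i) \<in> borel_measurable (N n)" for i unfolding md_def using Ym by simp
      qed
      then show "(%w. G m (%i. Y i w)) \<in> borel_measurable (N n)" unfolding G_def by simp
      show "(%w. (U (k m) w / U (%_. 1) w) powr \<alpha>) \<in> borel_measurable (N n)"
        unfolding N_def using U_measurable[OF uk] U_measurable[OF uk_1] by simp
      show "AE w in N n. G m (%i. Y i w) = (U (k m) w / U (%_. 1) w) powr \<alpha>"
        using AE_N
      proof eventually_elim
        fix w assume w: "w \<in> space P \<and> pr \<zeta> (en f) w < top \<and> 0 < U (%_. 1) w"
        show "G m (%i. Y i w) = (U (k m) w / U (%_. 1) w) powr \<alpha>"
        proof -
          have k': "k m = (%y. \<phi> {x\<in>J. y \<in> cut rt x m})" by (rule ext) (simp only: k_def)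
          have e: "(\<Sum>x\<in>J. c x * mx rt x (md (%i. Y i w)) m) = U (k m) w / U (%_. 1) w"
            unfolding k' by (rule step_limit_pre[where c=c, OF J phi c]) (use w in blast)+
          have "0 <= U (k m) w / U (%_. 1) w" by (simp only: U_nonneg divide_nonneg_nonneg)
          then show ?thesis unfolding G_def e by (simp only: max_absorb2)
        qed
      qed
    qed
    have Gm: "(\<integral>t. G m (%i. dec i t) \<partial>\<rho>) = ps (k m) / ps (%_. 1)" for m
    proof (rule LIMSEQ_unique)
      show "(%n. \<integral>w. G m (%i. Y i w) \<partial>N (r n)) ----> (\<integral>t. G m (%i. dec i t) \<partial>\<rho>)" by (rule lim[of "G m", OF Gc Gb])
      show "(%n. \<integral>w. G m (%i. Y i w) \<partial>N (r n)) ----> ps (k m) / ps (%_. 1)"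
        unfolding GN using LIMSEQ_subseq_LIMSEQ[OF ratio_limit[OF uk] r] by (simp add: comp_def)
    qed
    have "(%m. \<integral>t. G m (%i. dec i t) \<partial>\<rho>) ----> (\<integral>t. (\<integral>u. \<phi> {x\<in>J. Qt t u < x} \<partial>unif01) powr \<alpha> \<partial>\<rho>)"
    proof (rule integral_dominated_convergence[where w="%_. C powr \<alpha>"])
      show "AE t in \<rho>. (%m. G m (%i. dec i t)) ----> (\<integral>u. \<phi> {x\<in>J. Qt t u < x} \<partial>unif01) powr \<alpha>"
      proof (rule AE_I2)
        fix t
        have "(%m. max 0 (\<Sum>x\<in>J. c x * mx rt x (md (%i. dec i t)) m)) ----> max 0 (\<integral>u. \<phi> {x\<in>J. Qt t u < x} \<partial>unif01)"
          using quantile_step[of J \<phi> c t, OF J c] by (intro tendsto_max tendsto_const)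
        then have "(%m. max 0 (\<Sum>x\<in>J. c x * mx rt x (md (%i. dec i t)) m)) ----> (\<integral>u. \<phi> {x\<in>J. Qt t u < x} \<partial>unif01)"
          using kint(1)[OF ul, of t] by simp
        then show "(%m. G m (%i. dec i t)) ----> (\<integral>u. \<phi> {x\<in>J. Qt t u < x} \<partial>unif01) powr \<alpha>"
          unfolding G_def using a0 by (intro tendsto_powr' tendsto_const) auto
      qed
      show "(%t. (\<integral>u. \<phi> {x\<in>J. Qt t u < x} \<partial>unif01) powr \<alpha>) \<in> borel_measurable \<rho>"
        by (rule Qpm[OF ul])
      show "(%t. G m (%i. dec i t)) \<in> borel_measurable \<rho>" for m by (intro bR borel_measurable_continuous_onI Gc)
    qed (use Gb in auto)
    moreover have "(%m. ps (k m) / ps (%_. 1)) ----> ps (%y. \<phi> {x\<in>J. y < x}) / ps (%_. 1)"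
      using ps_1 by (intro tendsto_divide tendsto_const ps_limit uk ul kl) simp
    ultimately show ?thesis unfolding S_def Gm by (rule LIMSEQ_unique)
  qed
  have ukc: "uk (%y. max 0 (min 1 (k y)))" if "k \<in> borel_measurable borel" for k :: "real => real"
    using that by (auto simp: uk_def)
  \<comment> \<open>The identity is claimed for truncations: functions in \<open>stepcl\<close> need
    not take values in the unit interval, while dominated convergence needs this bound.\<close>
  have S_cl: "k \<in> borel_measurable borel \<and> S (%y. max 0 (min 1 (k y)))" if "stepcl k" for k
    using that
  proof (induction rule: stepcl.induct)
    case (step \<phi> J)
    show ?case using S_step[of J "%A. max 0 (min 1 (\<phi> A))"] step step_borel[of J \<phi>] by simp
  next
    case (lim k l)
    have lm: "l \<in> borel_measurable borel" by (rule borel_measurable_LIMSEQ_real[of _ k]) (use lim in auto)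
    define k' l' where "k' n y = max 0 (min 1 (k n y))" and "l' y = max 0 (min 1 (l y))" for n y
    have k': "uk (k' n)" "S (k' n)" for n unfolding k'_def using lim(3) ukc by auto
    have l': "uk l'" unfolding l'_def by (rule ukc[OF lm])
    have kl: "(%n. k' n y) ----> l' y" for y unfolding k'_def l'_def by (intro tendsto_max tendsto_min tendsto_const lim)
    have "(%n. \<integral>t. (\<integral>u. k' n (Qt t u) \<partial>unif01) powr \<alpha> \<partial>\<rho>) ----> (\<integral>t. (\<integral>u. l' (Qt t u) \<partial>unif01) powr \<alpha> \<partial>\<rho>)"
    proof (rule integral_dominated_convergence[where w="%_. 1"])
      show "AE t in \<rho>. (%n. (\<integral>u. k' n (Qt t u) \<partial>unif01) powr \<alpha>) ----> (\<integral>u. l' (Qt t u) \<partial>unif01) powr \<alpha>"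
      proof (rule AE_I2)
        fix t
        have "(%n. \<integral>u. k' n (Qt t u) \<partial>unif01) ----> (\<integral>u. l' (Qt t u) \<partial>unif01)"
        proof (rule integral_dominated_convergence[where w="%_. 1"])
          have "(%u. k (Qt t u)) \<in> borel_measurable unif01" if "uk k" for k
            using that measurable_compose[OF Qt_measurable2, of k] by (auto simp: uk_def)
          then show "(%u. l' (Qt t u)) \<in> borel_measurable unif01" "(%u. k' n (Qt t u)) \<in> borel_measurable unif01" for n
            using l' k'(1) by blast+
        qed (use kl k'(1) in \<open>auto simp: uk_def\<close>)
        then show "(%n. (\<integral>u. k' n (Qt t u) \<partial>unif01) powr \<alpha>) ----> (\<integral>u. l' (Qt t u) \<partial>unif01) powr \<alpha>"
          using a0 kint(1)[OF k'(1)] by (intro tendsto_powr' tendsto_const) auto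
      qed
      show "(%t. (\<integral>u. l' (Qt t u) \<partial>unif01) powr \<alpha>) \<in> borel_measurable \<rho>"
        "(%t. (\<integral>u. k' n (Qt t u) \<partial>unif01) powr \<alpha>) \<in> borel_measurable \<rho>" for n
        using Qpm[OF l'] Qpm[OF k'(1)] by blast+
      show "AE t in \<rho>. norm ((\<integral>u. k' n (Qt t u) \<partial>unif01) powr \<alpha>) <= 1" for n
        using kint[OF k'(1)] a0 powr_mono2[of \<alpha> _ 1] by auto
    qed simp
    moreover have "(%n. ps (k' n) / ps (%_. 1)) ----> ps l' / ps (%_. 1)"
      using ps_1 by (intro tendsto_divide tendsto_const ps_limit k'(1) l' kl) simp
    ultimately have "S l'" using k'(2) unfolding S_def by (simp add: LIMSEQ_unique)
    then show ?case using lm unfolding l'_def by blast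
  qed
  have "S k" if "uk k" for k
    using S_cl[OF stepcl_borel[of k]] that clamp_id[OF that] by (simp add: uk_def)
  then show ?thesis unfolding S_def using R.prob_space_axioms sR by blast
qed

end

section \<open>The Levy measure of a strictly stable random measure\<close>

lemma measurable_scale_nonzero:
  assumes "0 < t"
  shows "scale_measure (ennreal t) \<in> measurable nonzero_radon_space (nonzero_radon_space :: 'x::topological_space measure measure)"
proof -
  have "scale_measure (ennreal t) \<in> measurable radon_space (radon_space :: 'x measure measure)"
    by (rule measurable_scale_measure_radon) auto
  then have "scale_measure (ennreal t) \<in> measurable nonzero_radon_space (radon_space :: 'x measure measure)"
    unfolding nonzero_radon_space_def by (rule measurable_restrict_space1)
  moreover have "scale_measure (ennreal t) \<mu> \<noteq> null_measure borel" if m: "\<mu> \<in> radon_measures" "\<mu> \<noteq> null_measure borel" for \<mu> :: "'x measure"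
  proof
    assume z: "scale_measure (ennreal t) \<mu> = null_measure borel"
    have "emeasure \<mu> A = 0" for A
    proof -
      have "ennreal t * emeasure \<mu> A = 0" using arg_cong[OF z, of "%M. emeasure M A"] by simp
      then show ?thesis using assms by (simp add: ennreal_eq_0_iff)
    qed
    then have "\<mu> = null_measure borel" using sets_radon_measure[OF m(1)] by (intro measure_eqI) auto
    then show False using m(2) by blast
  qed
  ultimately show ?thesis unfolding nonzero_radon_space_def
    by (intro measurable_restrict_space2) (auto simp: space_restrict_space)
qed

context stable_normalized
begin

text \<open>\<Lambda> is the image of \<rho> times Lebesgue measure on the half-line under (t, s)
  \<mapsto> b s powr (- 1 / \<alpha>) times \<open>\<mu> t\<close>. Its exponent is computed from
  \<open>kap\<close> and \<open>angular_measure\<close>. Homogeneity is then read off from the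
  exponents by \<open>levy_measure_unique\<close>.\<close>

lemma stable_levy:
  assumes jm [measurable]: "j \<in> measurable borel borel" and jg: "!!x. j (g x) = x"
    and flow: "!!n. \<exists>c>0. \<forall>x\<in>exh n. c <= f x"
  shows "\<exists>\<Lambda>. stable_intensity \<alpha> \<Lambda> \<and> (\<forall>h\<in>BM. laplace_functional P \<zeta> h = lap (laplace_exp \<Lambda> (en h)))"
proof -
  obtain \<rho> :: "real measure" where \<rho>: "prob_space \<rho>" "sets \<rho> = sets borel"
    and am: "\<forall>k. uk k --> (\<integral>t. (\<integral>u. k (Qt t u) \<partial>unif01) powr \<alpha> \<partial>\<rho>) = ps k / ps (%_. 1)"
    using angular_measure by blast
  interpret R: prob_space \<rho> by (rule \<rho>(1))
  interpret V: prob_space unif01 by (rule prob_space_unif01)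
  have fj [measurable]: "(%y. f (j y)) \<in> borel_measurable borel" by (rule measurable_compose[OF jm fm])
  \<comment> \<open>The limiting probability measure is carried back to the space by
    \<open>j\<close> and divided by f, which undoes the normalisation. The lower bounds of f on each
    \<open>exh n\<close> make the result locally finite.\<close>
  define \<mu> where "\<mu> t = density (distr unif01 borel (%u. j (Qt t u))) (%x. ennreal (1 / f x))" for t
  have jQ [measurable]: "(%u. j (Qt t u)) \<in> measurable borel borel" for t by (rule measurable_compose[OF Qt_measurable2 jm])
  have smu: "sets (\<mu> t) = sets borel" for t by (simp add: \<mu>_def)
  have mu_int: "(np h (\<mu> t)) = (\<integral>\<^sup>+u. ennreal (1 / f (j (Qt t u))) * h (j (Qt t u)) \<partial>unif01)"
    if h [measurable]: "h \<in> borel_measurable borel" for h t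
  proof -
    have jQ': "(%u. j (Qt t u)) \<in> measurable unif01 borel" by simp
    have "(np h (\<mu> t)) = (\<integral>\<^sup>+x. ennreal (1 / f x) * h x \<partial>distr unif01 borel (%u. j (Qt t u)))"
      unfolding \<mu>_def by (rule nn_integral_density) simp_all
    also have "\<dots> = (\<integral>\<^sup>+u. ennreal (1 / f (j (Qt t u))) * h (j (Qt t u)) \<partial>unif01)"
      by (rule nn_integral_distr[OF jQ']) simp
    finally show ?thesis .
  qed
  have jQ2: "(%p. j (Qt (fst p) (snd p))) \<in> measurable (borel \<Otimes>\<^sub>M borel) borel" by (rule measurable_compose[OF Qt_measurable jm])
  have mu_meas: "(%t. \<integral>\<^sup>+x. h x \<partial>\<mu> t) \<in> borel_measurable borel" if h: "h \<in> borel_measurable borel" for h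
  proof -
    have "(%p. ennreal (1 / f (j (Qt (fst p) (snd p)))) * h (j (Qt (fst p) (snd p)))) \<in> borel_measurable (borel \<Otimes>\<^sub>M borel)"
      using measurable_compose[OF jQ2 fm] measurable_compose[OF jQ2 h] by simp
    then have "(%(t, u). ennreal (1 / f (j (Qt t u))) * h (j (Qt t u))) \<in> borel_measurable (borel \<Otimes>\<^sub>M unif01)"
      using measurable_cong_sets[OF sets_pair_measure_cong[OF refl sets_unif01] refl, of borel borel] by (auto simp: case_prod_beta')
    then show ?thesis unfolding mu_int[OF h] by (rule V.borel_measurable_nn_integral)
  qed
  have em: "emeasure (\<mu> t) B = (np (indicator B) (\<mu> t))" if "B \<in> sets borel" for B t using that smu by simp
  have mu_radon: "\<mu> t \<in> radon_measures" for t
  proof (rule radon_measuresI[OF smu])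
    fix n
    obtain c where c: "0 < c" "\<forall>x\<in>exh n. c <= f x" using flow by blast
    have "emeasure (\<mu> t) (exh n) = (\<integral>\<^sup>+u. ennreal (1 / f (j (Qt t u))) * indicator (exh n) (j (Qt t u)) \<partial>unif01)"
      unfolding em[OF exh_borel] by (rule mu_int) simp
    also have "\<dots> <= (\<integral>\<^sup>+u. ennreal (1 / c) \<partial>unif01)"
      using c f_pos by (intro nn_integral_mono) (auto simp: indicator_def intro!: ennreal_leI divide_left_mono)
    also have "\<dots> = ennreal (1 / c)" using V.emeasure_space_1 by simp
    finally show "emeasure (\<mu> t) (exh n) < top" by (rule order_le_less_trans) simp
  qed
  have mu_ne: "\<mu> t \<noteq> null_measure borel" for t
  proof
    assume z: "\<mu> t = null_measure borel"
    have "(ip f (\<mu> t)) = (\<integral>\<^sup>+u. 1 \<partial>unif01)"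
      using f_pos by (subst mu_int) (auto intro!: nn_integral_cong simp: ennreal_mult'[symmetric] less_imp_le less_imp_neq[THEN not_sym])
    then show False unfolding z using V.emeasure_space_1 by simp
  qed
  \<comment> \<open>Chosen so that b powr \<alpha> times the constant of \<open>kap\<close> is the
    exponent of f.\<close>
  define b where "b = (ps (%_. 1) / kapc \<alpha>) powr (1 / \<alpha>)"
  have kc: "0 < kapc \<alpha>" by (rule kap_1(2)[OF a0 a1])
  have b: "0 < b" "b powr \<alpha> = ps (%_. 1) / kapc \<alpha>" using ps_1 kc a0 by (simp_all add: b_def powr_powr)
  \<comment> \<open>The radial measure gives no mass to s \<le> 0. The value 1 there keeps the
    factor positive, so that the scaled measures are non-zero everywhere.\<close>
  define r where "r s = b * (if 0 < s then s powr (- 1 / \<alpha>) else 1)" for s :: real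
  have r: "0 < r s" for s using b by (simp add: r_def)
  have rm [measurable]: "r \<in> borel_measurable borel" unfolding r_def by measurable
  let ?D = "density lborel (indicator {0<..}) :: real measure"
  interpret D: sigma_finite_measure ?D by (rule sigma_finite_density_pos)
  let ?T = "%p. scale_measure (ennreal (r (snd p))) (\<mu> (fst p))"
  have sP: "sets (\<rho> \<Otimes>\<^sub>M ?D) = sets (borel \<Otimes>\<^sub>M borel)" by (intro sets_pair_measure_cong \<rho>(2)) simp
  have Tm: "?T \<in> measurable (\<rho> \<Otimes>\<^sub>M ?D) nonzero_radon_space"
  proof -
    have "\<mu> \<in> measurable borel radon_space"
      by (rule measurable_radon_spaceI) (simp_all add: mu_radon em mu_meas)
    then have "?T \<in> measurable (borel \<Otimes>\<^sub>M borel) radon_space"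
      by (intro measurable_scale_measure_radon measurable_compose[OF measurable_fst]) auto
    moreover have "?T p \<noteq> null_measure borel" for p
      using measurable_space[OF measurable_scale_nonzero[OF r], of "\<mu> (fst p)" "snd p"] mu_radon mu_ne
      by (simp add: space_nonzero)
    ultimately have "?T \<in> measurable (borel \<Otimes>\<^sub>M borel) nonzero_radon_space"
      unfolding nonzero_radon_space_def by (intro measurable_restrict_space2) auto
    then show ?thesis using measurable_cong_sets[OF sP refl] by blast
  qed
  define \<Lambda> where "\<Lambda> = distr (\<rho> \<Otimes>\<^sub>M ?D) nonzero_radon_space ?T"
  have sL: "sets \<Lambda> = sets nonzero_radon_space" by (simp add: \<Lambda>_def)
  \<comment> \<open>The constant C brings h / f into the unit interval, where
    \<open>angular_measure\<close> applies; its effect on the exponent is the factor C powr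
    \<alpha>.\<close>
  have LE: "laplace_exp \<Lambda> (en h) = ennreal (C powr \<alpha> * ps (%y. h (j y) / (C * f (j y))))"
    if C: "0 < C" and h [measurable]: "h \<in> borel_measurable borel" and k: "uk (%y. h (j y) / (C * f (j y)))" for h C
  proof -
    define k where "k y = h (j y) / (C * f (j y))" for y
    have k': "uk k" using k unfolding k_def[abs_def] .
    define I where "I t = (\<integral>u. k (Qt t u) \<partial>unif01)" for t
    have I: "0 <= I t" for t unfolding I_def using k' by (intro Bochner_Integration.integral_nonneg) (auto simp: uk_def)
    have kQ: "(%u. k (Qt t u)) \<in> borel_measurable borel" for t
      using k' measurable_compose[OF Qt_measurable2, of k borel t] by (simp add: uk_def)
    have hm: "(en h) \<in> borel_measurable borel" by simp
    have hk: "ennreal (1 / f z) * ennreal (h z) = ennreal (C * (h z / (C * f z)))" for z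
      using C f_pos[of z] by (subst ennreal_mult'[symmetric]) auto
    have muh: "(ip h (\<mu> t)) = ennreal (C * I t)" for t
    proof -
      have "(ip h (\<mu> t)) = (\<integral>\<^sup>+u. ennreal (C * k (Qt t u)) \<partial>unif01)"
        unfolding mu_int[OF hm] hk k_def ..
      also have "\<dots> = ennreal (\<integral>u. C * k (Qt t u) \<partial>unif01)"
      proof (rule nn_integral_eq_integral)
        show "integrable unif01 (%u. C * k (Qt t u))"
          using kQ[of t] k' C by (intro V.integrable_const_bound[where B=C]) (auto simp: uk_def abs_mult mult_left_le)
        show "AE u in unif01. 0 <= C * k (Qt t u)" using k' C by (simp add: uk_def)
      qed
      finally show ?thesis by (simp add: I_def)
    qed
    have lm: "(%\<nu>. ennreal (1 - lap (ip h \<nu>))) \<in> borel_measurable (nonzero_radon_space :: 'x measure measure)"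
      using measurable_lap_nn_integral[OF hm, of nonzero_radon_space "- {null_measure borel}"] by (simp add: nonzero_radon_space_def)
    have "laplace_exp \<Lambda> (en h) = (\<integral>\<^sup>+p. ennreal (1 - lap (ip h (?T p))) \<partial>(\<rho> \<Otimes>\<^sub>M ?D))"
      unfolding laplace_exp_def \<Lambda>_def using lm by (intro nn_integral_distr[OF Tm]) simp
    also have "\<dots> = (\<integral>\<^sup>+p. ennreal (1 - lap (ennreal (r (snd p)) * ennreal (C * I (fst p)))) \<partial>(\<rho> \<Otimes>\<^sub>M ?D))"
      by (intro nn_integral_cong) (simp add: nn_integral_scale_measure'[OF smu hm] muh)
    also have "\<dots> = (\<integral>\<^sup>+t. \<integral>\<^sup>+s. ennreal (1 - lap (ennreal (r s) * ennreal (C * I t))) \<partial>?D \<partial>\<rho>)"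
    proof -
      have "I \<in> borel_measurable borel" unfolding I_def[abs_def] using k' by (intro Qk_measurable) (simp add: uk_def)
      then have "(%p. ennreal (1 - lap (ennreal (r (snd p)) * ennreal (C * I (fst p))))) \<in> borel_measurable (borel \<Otimes>\<^sub>M borel)"
        by measurable
      then have "(%p. ennreal (1 - lap (ennreal (r (snd p)) * ennreal (C * I (fst p))))) \<in> borel_measurable (\<rho> \<Otimes>\<^sub>M ?D)"
        using measurable_cong_sets[OF sP refl] by blast
      from D.nn_integral_fst[OF this] show ?thesis by simp
    qed
    also have "\<dots> = (\<integral>\<^sup>+t. ennreal (ps (%_. 1) * C powr \<alpha> * I t powr \<alpha>) \<partial>\<rho>)"
    proof (intro nn_integral_cong)
      fix t
      have z: "0 <= b * (C * I t)" using b C I by simp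
      have "(\<integral>\<^sup>+s. ennreal (1 - lap (ennreal (r s) * ennreal (C * I t))) \<partial>?D) =
        (\<integral>\<^sup>+s. indicator {0<..} s * ennreal (1 - lap (ennreal (r s) * ennreal (C * I t))) \<partial>lborel)"
        by (rule nn_integral_density) simp_all
      also have "\<dots> = kap \<alpha> (ennreal (b * (C * I t)))"
        unfolding kap_def using b C I
        by (intro nn_integral_cong) (auto simp: r_def indicator_def ennreal_mult'[symmetric] mult_ac)
      also have "\<dots> = ennreal (kapc \<alpha> * (b * (C * I t)) powr \<alpha>)" by (rule kap_eq[OF a0 a1 z])
      also have "kapc \<alpha> * (b * (C * I t)) powr \<alpha> = ps (%_. 1) * C powr \<alpha> * I t powr \<alpha>"
        using b C I kc by (simp add: powr_mult)
      finally show "(\<integral>\<^sup>+s. ennreal (1 - lap (ennreal (r s) * ennreal (C * I t))) \<partial>?D) = ennreal (ps (%_. 1) * C powr \<alpha> * I t powr \<alpha>)" .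
    qed
    also have "\<dots> = ennreal (\<integral>t. ps (%_. 1) * C powr \<alpha> * I t powr \<alpha> \<partial>\<rho>)"
    proof (rule nn_integral_eq_integral)
      have "(%t. I t powr \<alpha>) \<in> borel_measurable borel" unfolding I_def using k' Qk_measurable[of k] by (auto simp: uk_def)
      then have Im: "(%t. I t powr \<alpha>) \<in> borel_measurable \<rho>" using measurable_cong_sets[OF \<rho>(2) refl] by blast
      have I1: "I t <= 1" for t
      proof -
        have "I t <= (\<integral>u. 1 \<partial>unif01)" unfolding I_def
        proof (rule integral_mono)
          show "integrable unif01 (%u. k (Qt t u))"
            using kQ[of t] k' by (intro V.integrable_const_bound[where B=1]) (auto simp: uk_def)
        qed (use k' in \<open>auto simp: uk_def\<close>)
        then show ?thesis by (simp add: V.prob_space[simplified])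
      qed
      have "integrable \<rho> (%t. I t powr \<alpha>)"
        using Im I I1 a0 powr_mono2[of \<alpha> _ 1] by (intro R.integrable_const_bound[where B=1]) auto
      then show "integrable \<rho> (%t. ps (%_. 1) * C powr \<alpha> * I t powr \<alpha>)" by simp
      show "AE t in \<rho>. 0 <= ps (%_. 1) * C powr \<alpha> * I t powr \<alpha>" using ps_1 by simp
    qed
    also have "(\<integral>t. ps (%_. 1) * C powr \<alpha> * I t powr \<alpha> \<partial>\<rho>) = C powr \<alpha> * ps k"
      using am k' ps_1 unfolding I_def by simp
    finally show ?thesis unfolding k_def .
  qed
  have BMk: "\<exists>C>0. uk (%y. h (j y) / (C * f (j y)))" if h: "h \<in> BM" for h
  proof -
    obtain c K where c: "0 < c" "compact K" "closed K" "\<forall>x. h x <= c * indicator K x" using BM_bound[OF h] by (elim exE conjE)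
    obtain n where n: "K \<subseteq> exh n" using compact_subset_exh[OF c(2)] by blast
    obtain d where d: "0 < d" "\<forall>x\<in>exh n. d <= f x" using flow by blast
    have le: "h x / (c / d * f x) <= 1" for x
    proof (cases "x \<in> K")
      case True
      then have "h x <= c" "d <= f x" using c(4) n d(2) by (metis indicator_simps(1) mult.right_neutral, blast)
      then have "h x * d <= c * f x" using c(1) d(1) BM_nonneg[OF h, of x] by (intro mult_mono) auto
      then show ?thesis using c(1) d(1) f_pos[of x] by (simp add: field_simps)
    next
      case False
      then have "h x = 0" using c(4)[rule_format, of x] BM_nonneg[OF h, of x] by simp
      then show ?thesis by simp
    qed
    have [measurable]: "(%y. h (j y)) \<in> borel_measurable borel" by (rule measurable_compose[OF jm BM_measurable[OF h]])
    have "(%y. h (j y) / (c / d * f (j y))) \<in> borel_measurable borel" by measurable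
    then have "uk (%y. h (j y) / (c / d * f (j y)))"
      unfolding uk_def using le c(1) d(1) f_pos BM_nonneg[OF h] by (auto simp: less_imp_le)
    then show ?thesis using c(1) d(1) by (intro exI[of _ "c / d"]) simp
  qed
  have lapl: "laplace_functional P \<zeta> h = lap (laplace_exp \<Lambda> (en h))" if h: "h \<in> BM" for h
  proof -
    obtain C where C: "0 < C" and k: "uk (%y. h (j y) / (C * f (j y)))" using BMk[OF h] by blast
    let ?k = "%y. h (j y) / (C * f (j y))"
    \<comment> \<open>Only the values of the quotient on the range of g enter the exponent, and
      there \<open>j\<close> inverts g. Points \<open>Qt t u\<close> off this range do no harm,
      since \<open>angular_measure\<close> holds for every Borel function with values in the unit
      interval.\<close>
    have fk: "f x * ?k (g x) = h x / C" for x using f_pos[of x] by (simp add: jg)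
    have "ennreal (h x) = ennreal C * ennreal (f x * ?k (g x))" for x
      unfolding fk using C by (simp add: ennreal_mult'[symmetric])
    then have "laplace_functional P \<zeta> h = (\<integral>w. lap (pr \<zeta> (%x. ennreal C * ennreal (f x * ?k (g x))) w) \<partial>P)"
      unfolding random_measure_laplace[OF P h] by simp
    also have "\<dots> = (\<integral>w. lap (ennreal C * pr \<zeta> (%x. ennreal (f x * ?k (g x))) w) \<partial>P)"
      by (intro bint_cong refl) (simp only: pr_cmult[OF _ km[OF k]])
    also have "\<dots> = exp (- (C powr \<alpha> * ps ?k))"
      unfolding ps_def using C by (intro stable_laplace(2)[OF km[OF k] pr_fin[OF k]]) simp
    also have "\<dots> = lap (laplace_exp \<Lambda> (en h))"
    proof -
      have "0 <= ps ?k" unfolding ps_def by (rule stable_laplace(1)[OF km[OF k] pr_fin[OF k]])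
      then show ?thesis unfolding LE[OF C BM_measurable[OF h] k] by (subst lap_ennreal) auto
    qed
    finally show ?thesis .
  qed
  have fin': "laplace_exp \<Lambda> (en h) < top" if h: "h \<in> BM" for h
  proof -
    obtain C where C: "0 < C" and k: "uk (%y. h (j y) / (C * f (j y)))" using BMk[OF h] by blast
    show ?thesis unfolding LE[OF C BM_measurable[OF h] k] by simp
  qed
  have scale: "emeasure \<Lambda> (scale_measure (ennreal t) ` A) = ennreal (t powr (- \<alpha>)) * emeasure \<Lambda> A"
    if t: "0 < t" and A: "A \<in> sets \<Lambda>" for t A
  proof -
    let ?S = "%c. scale_measure (ennreal c) :: 'x measure => 'x measure"
    have Sm: "?S (1 / t) \<in> measurable \<Lambda> nonzero_radon_space"
      unfolding measurable_cong_sets[OF sL refl] by (rule measurable_scale_nonzero) (use t in simp)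
    have inv: "?S t (?S (1 / t) \<nu>) = \<nu>" "?S (1 / t) (?S t \<nu>) = \<nu>" for \<nu>
      using t by (simp_all add: ennreal_mult'[symmetric])
    have "distr \<Lambda> nonzero_radon_space (?S (1 / t)) = scale_measure (ennreal (t powr (- \<alpha>))) \<Lambda>"
    proof (rule levy_measure_unique)
      have "laplace_exp (distr \<Lambda> nonzero_radon_space (?S (1 / t))) (en h) = ennreal (t powr (- \<alpha>)) * laplace_exp \<Lambda> (en h)" if h: "h \<in> BM" for h
      proof -
        obtain C where C: "0 < C" and k: "uk (%y. h (j y) / (C * f (j y)))" using BMk[OF h] by blast
        have hm: "(en h) \<in> borel_measurable borel" using BM_measurable[OF h] by simp
        have lm: "(%\<nu>. ennreal (1 - lap (ip h \<nu>))) \<in> borel_measurable (nonzero_radon_space :: 'x measure measure)"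
          using measurable_lap_nn_integral[OF hm, of nonzero_radon_space "- {null_measure borel}"] by (simp add: nonzero_radon_space_def)
        have "laplace_exp (distr \<Lambda> nonzero_radon_space (?S (1 / t))) (en h) = (\<integral>\<^sup>+\<nu>. ennreal (1 - lap (ip h (?S (1 / t) \<nu>))) \<partial>\<Lambda>)"
          unfolding laplace_exp_def using lm by (intro nn_integral_distr[OF Sm]) simp
        also have "\<dots> = laplace_exp \<Lambda> (%x. ennreal (h x / t))"
          unfolding laplace_exp_def
        proof (intro nn_integral_cong)
          fix \<nu> assume "\<nu> \<in> space \<Lambda>"
          then have nu: "\<nu> \<in> radon_measures" using sets_eq_imp_space_eq[OF sL] by (simp add: space_nonzero)
          have "(ip h (?S (1 / t) \<nu>)) = ennreal (1 / t) * (ip h \<nu>)"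
            by (rule nn_integral_scale_measure'[OF sets_radon_measure[OF nu] hm])
          also have "\<dots> = (\<integral>\<^sup>+x. ennreal (h x / t) \<partial>\<nu>)"
            using t by (subst nn_integral_cmult[OF borel_measurable_radon[OF nu hm], symmetric]) (simp add: ennreal_mult'[symmetric])
          finally show "ennreal (1 - lap (ip h (?S (1 / t) \<nu>))) = ennreal (1 - lap (\<integral>\<^sup>+x. ennreal (h x / t) \<partial>\<nu>))" by simp
        qed
        \<comment> \<open>Dividing both h and C by t leaves the quotient unchanged, so that t enters
          through the power of C alone.\<close>
        also have "\<dots> = ennreal ((C / t) powr \<alpha> * ps (%y. h (j y) / t / (C / t * f (j y))))"
          using C t BM_measurable[OF h] k by (intro LE) auto
        also have "\<dots> = ennreal (t powr (- \<alpha>) * (C powr \<alpha> * ps (%y. h (j y) / (C * f (j y)))))"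
          using C t by (simp add: powr_divide powr_minus_divide)
        also have "\<dots> = ennreal (t powr (- \<alpha>)) * laplace_exp \<Lambda> (en h)"
          unfolding LE[OF C BM_measurable[OF h] k] by (simp add: ennreal_mult')
        finally show ?thesis .
      qed note eq = this
      then show "laplace_exp (distr \<Lambda> nonzero_radon_space (?S (1 / t))) (en h) < top" if "h \<in> BM" for h
        using fin'[OF that] that by (simp add: ennreal_mult_less_top)
      show "laplace_exp (distr \<Lambda> nonzero_radon_space (?S (1 / t))) (en h) =
        laplace_exp (scale_measure (ennreal (t powr (- \<alpha>))) \<Lambda>) (en h)" if h: "h \<in> BM" for h
      proof -
        have hm: "(en h) \<in> borel_measurable borel" using BM_measurable[OF h] by simp
        have "sets \<Lambda> = sets (restrict_space radon_space (- {null_measure borel}))" using sL by (simp add: nonzero_radon_space_def)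
        from measurable_lap_nn_integral[OF hm this] show ?thesis
          unfolding eq[OF h] unfolding laplace_exp_def by (intro nn_integral_scale_measure[symmetric]) simp
      qed
    qed (simp_all add: sL)
    then have e: "emeasure (distr \<Lambda> nonzero_radon_space (?S (1 / t))) A = ennreal (t powr (- \<alpha>)) * emeasure \<Lambda> A" by simp
    have "?S (1 / t) -` A \<inter> space \<Lambda> = ?S t ` A"
    proof (intro set_eqI iffI)
      fix \<nu> assume "\<nu> \<in> ?S (1 / t) -` A \<inter> space \<Lambda>"
      then have "?S (1 / t) \<nu> \<in> A" by simp
      from imageI[OF this, of "?S t"] show "\<nu> \<in> ?S t ` A" by (simp only: inv)
    next
      fix \<nu> assume "\<nu> \<in> ?S t ` A"
      then obtain \<nu>' where n: "\<nu>' \<in> A" "\<nu> = ?S t \<nu>'" by blast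
      have "\<nu>' \<in> space nonzero_radon_space" using n(1) sets.sets_into_space[OF A] sets_eq_imp_space_eq[OF sL] by blast
      then have "?S t \<nu>' \<in> space \<Lambda>" using measurable_space[OF measurable_scale_nonzero[OF t]] sets_eq_imp_space_eq[OF sL] by blast
      then show "\<nu> \<in> ?S (1 / t) -` A \<inter> space \<Lambda>" using n by (simp only: inv vimage_eq IntI)
    qed
    then show ?thesis using e A sL by (simp add: emeasure_distr[OF Sm])
  qed
  have "stable_intensity \<alpha> \<Lambda>"
    unfolding stable_intensity_def using sL fin' scale by (simp add: laplace_exponent_eq)
  then show ?thesis using lapl by blast
qed

end

section \<open>From strict stability to the theorem\<close>

context lcsc
begin

lemma strictly_stable_levy:
  fixes P :: "'w measure" and \<zeta> :: "'w => 'x measure"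
  assumes P: "random_measure P \<zeta>" and a: "0 < \<alpha>" "\<alpha> < 1" and st: "strictly_stable \<alpha> P \<zeta>"
  shows "\<exists>\<Lambda>. stable_intensity \<alpha> \<Lambda> \<and> (\<forall>h\<in>BM. laplace_functional P \<zeta> h = lap (laplace_exp \<Lambda> (en h)))"
proof -
  interpret S: stable_lcsc X P \<zeta> \<alpha> by unfold_locales (rule P a st)+
  obtain f :: "'x => real" where f: "f \<in> borel_measurable borel" "\<forall>x. 0 < f x" "\<forall>n. \<exists>c>0. \<forall>x\<in>exh n. c <= f x"
    "AE w in P. pr \<zeta> (en f) w < top" using S.normalizing_function by blast
  have fe: "(en f) \<in> borel_measurable borel" using f(1) by simp
  note lp = S.stable_laplace[OF fe f(4)]
  show ?thesis
  proof (cases "psi P \<zeta> (en f) = 0")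
    case False
    obtain g :: "'x => real" and j where g: "g \<in> borel_measurable borel" "j \<in> measurable borel borel"
      "\<forall>x. 0 <= g x \<and> g x <= 1" "\<forall>x. j (g x) = x" using borel_embedding by blast
    interpret N: stable_normalized X P \<zeta> \<alpha> f g
      by unfold_locales (use f g lp(1) False in auto)
    show ?thesis using g(2,4) f(3) by (intro N.stable_levy) auto
  next
    \<comment> \<open>A vanishing exponent means that the pairing with f is almost surely 0. Every h
      in \<open>BM\<close> is at most a multiple of f, so all Laplace functionals are 1 and the zero
      measure is the Levy measure.\<close>
    case True
    let ?L = "null_measure nonzero_radon_space :: 'x measure measure"
    have "laplace_functional P \<zeta> h = 1" if h: "h \<in> BM" for h
    proof -
      obtain c K where c: "0 < c" "compact K" "closed K" "\<forall>x. h x <= c * indicator K x" using BM_bound[OF h] by (elim exE conjE)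
      obtain n where n: "K \<subseteq> exh n" using compact_subset_exh[OF c(2)] by blast
      obtain d where d: "0 < d" "\<forall>x\<in>exh n. d <= f x" using f(3) by blast
      have le: "h x <= c / d * f x" for x
      proof (cases "x \<in> K")
        case True
        then have "c * d <= c * f x" "h x <= c" using c(1) c(4)[rule_format, of x] n d(2) by auto
        then show ?thesis using d(1) c(1) by (simp add: field_simps) (metis mult.commute mult_le_cancel_right_pos order_trans)
      next
        case False
        then have "h x <= 0" using c(4)[rule_format, of x] by simp
        moreover have "0 <= c / d * f x" using c(1) d(1) f(2) by (simp add: less_imp_le)
        ultimately show ?thesis by linarith
      qed
      have hm: "(en h) \<in> borel_measurable borel" using BM_measurable[OF h] by simp
      have "1 = (\<integral>w. lap (ennreal (c / d) * pr \<zeta> (en f) w) \<partial>P)"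
        using lp(2)[of "c / d"] c(1) d(1) True by simp
      also have "\<dots> <= (\<integral>w. lap (pr \<zeta> (en h) w) \<partial>P)"
      proof (intro integral_mono S.lap_integrable lap_antimono)
        show "pr \<zeta> (en h) w <= ennreal (c / d) * pr \<zeta> (en f) w" if "w \<in> space P" for w
          unfolding S.pr_cmult[OF that fe, symmetric] using c(1) d(1)
        proof (intro nn_integral_mono)
          fix x
          have "ennreal (c / d) * ennreal (f x) = ennreal (c / d * f x)" using c(1) d(1) by (subst ennreal_mult') auto
          then show "ennreal (h x) <= ennreal (c / d) * ennreal (f x)" using ennreal_leI[OF le[of x]] by (simp only:)
        qed
        show "pr \<zeta> (en h) \<in> borel_measurable P" by (rule S.pr_measurable[OF hm])
        show "(%w. ennreal (c / d) * pr \<zeta> (en f) w) \<in> borel_measurable P" using S.pr_measurable[OF fe] by simp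
      qed
      finally show ?thesis using S.laplace_le_1[OF S.pr_measurable[OF hm]] by (simp add: random_measure_laplace[OF P h])
    qed
    moreover have "laplace_exp ?L h = 0" for h by (simp add: laplace_exp_def)
    moreover have "stable_intensity \<alpha> ?L"
      unfolding stable_intensity_def by (simp add: laplace_exponent_def)
    ultimately show ?thesis by (intro exI[of _ ?L]) simp
  qed
qed

text \<open>The Radon property is supplied by \<open>stable_intensity_radon\<close>, and finiteness
  of the exponent makes \<open>lap\<close> agree with the real exponential.\<close>

lemma levy_measure_iff:
  "levy_measure \<alpha> P \<zeta> \<Lambda> \<longleftrightarrow> stable_intensity \<alpha> \<Lambda> \<and>
    (\<forall>h\<in>BM. laplace_functional P \<zeta> h = lap (laplace_exp \<Lambda> (%x. ennreal ((h :: 'x => real) x))))"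
proof -
  have "exp (- enn2real (laplace_exponent \<Lambda> h)) = lap (laplace_exp \<Lambda> (en h))"
    if "stable_intensity \<alpha> \<Lambda>" "h \<in> BM" for h
  proof -
    have "sets \<Lambda> = sets nonzero_radon_space" using that(1) by (simp add: stable_intensity_def)
    moreover have "laplace_exp \<Lambda> (en h) \<noteq> top" using stable_intensity_laplace_exp[OF that] by simp
    ultimately show ?thesis by (simp add: laplace_exponent_eq[OF that(2)] lap_def)
  qed
  then show ?thesis unfolding levy_measure_def using stable_intensity_radon by metis
qed

text \<open>The functions 1 - exp (- \<mu> (exh n)) are integrable, and at each non-zero measure one
  of them is positive. The construction of Poisson points requires \<sigma>-finiteness.\<close>

lemma stable_intensity_sigma_finite:
  assumes st: "stable_intensity \<alpha> (\<Lambda> :: 'x measure measure)"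
  shows "sigma_finite_measure \<Lambda>"
proof (rule sigma_finite_measureI_integrable)
  have s: "sets \<Lambda> = sets nonzero_radon_space" using st by (simp add: stable_intensity_def)
  have i: "(%x. ennreal (indicator (exh n) x)) = indicator (exh n)" for n by (auto simp: indicator_def)
  show "(%\<mu>. ennreal (1 - lap (\<integral>\<^sup>+x. indicator (exh n) x \<partial>\<mu>))) \<in> borel_measurable \<Lambda>" for n
  proof -
    have "sets \<Lambda> = sets (restrict_space radon_space (- {null_measure borel}))" using s by (simp add: nonzero_radon_space_def)
    from measurable_lap_nn_integral[OF _ this, of "indicator (exh n)"] show ?thesis by simp
  qed
  show "(\<integral>\<^sup>+\<mu>. ennreal (1 - lap (\<integral>\<^sup>+x. indicator (exh n) x \<partial>\<mu>)) \<partial>\<Lambda>) < top" for n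
    using stable_intensity_laplace_exp[OF st indicator_exh_BM[of n]] unfolding laplace_exp_def i .
  show "\<exists>n. 0 < ennreal (1 - lap (\<integral>\<^sup>+x. indicator (exh n) x \<partial>\<mu>))" if "\<mu> \<in> space \<Lambda>" for \<mu>
  proof -
    have m: "\<mu> \<in> radon_measures" "\<mu> \<noteq> null_measure borel"
      using that sets_eq_imp_space_eq[OF s] by (auto simp: space_nonzero)
    then obtain n where "0 < emeasure \<mu> (exh n)" using nonzero_iff_exh[OF m(1)] by blast
    then have "lap (\<integral>\<^sup>+x. indicator (exh n) x \<partial>\<mu>) < 1" using sets_radon_measure[OF m(1)] by (simp add: lap_less_1_iff)
    then show ?thesis by (intro exI[of _ n]) simp
  qed
qed

lemma nonzero_radon_space_nonempty: "space (nonzero_radon_space :: 'x measure measure) \<noteq> {}"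
proof -
  fix x :: 'x
  have "return borel x \<in> radon_measures" by (simp add: radon_measures_def indicator_def)
  moreover have "return borel x \<noteq> null_measure borel"
  proof
    assume "return borel x = null_measure borel"
    from arg_cong[OF this, of "%M. emeasure M UNIV"] show False by simp
  qed
  ultimately show ?thesis by (auto simp: space_nonzero)
qed

end

theorem theorem12:
  fixes P :: "'w measure"
    and \<zeta> :: "'w \<Rightarrow> 'x::{second_countable_topology, t2_space} measure"
    and \<alpha> :: real
  assumes "locally compact (UNIV :: 'x set)"
    and "random_measure P \<zeta>"
    and "0 < \<alpha>" and "\<alpha> < 1"
  shows
    "(strictly_stable \<alpha> P \<zeta> \<longleftrightarrow>
       (\<exists>\<Lambda>. stable_intensity \<alpha> \<Lambda> \<and>
          (\<exists>(Q :: 'x measure poisson_sample measure) I x.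
             poisson_points Q \<Lambda> I x \<and> equals_vague_series P \<zeta> Q 1 I x))) \<and>
     (\<forall>\<Lambda> (Q :: 'q measure) I x.
        stable_intensity \<alpha> \<Lambda> \<and> poisson_points Q \<Lambda> I x \<and> equals_vague_series P \<zeta> Q 1 I x \<longrightarrow>
        (\<forall>\<Lambda>'. levy_measure \<alpha> P \<zeta> \<Lambda>' \<longleftrightarrow> \<Lambda>' = \<Lambda>)) \<and>
     (\<forall>\<Lambda> (Q :: 'q measure) I x.
        levy_measure \<alpha> P \<zeta> \<Lambda> \<and> poisson_points Q \<Lambda> I x \<longrightarrow>
        equals_vague_series P \<zeta> Q 1 I x) \<and>
     (\<forall>\<Lambda> B \<sigma> c b (Q :: 'q measure) \<epsilon> \<xi>.
        levy_measure \<alpha> P \<zeta> \<Lambda> \<and> relatively_compact_base B \<and>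
        \<sigma> = spectral_measure \<alpha> B \<Lambda> \<and> emeasure \<sigma> (sphere_of B) < \<infinity> \<and>
        c = measure \<sigma> (sphere_of B) \<and> b = (c / Gamma (1 - \<alpha>)) powr (1 / \<alpha>) \<and>
        lepage_variables Q \<sigma> c \<epsilon> \<xi> \<longrightarrow>
        equals_vague_series P \<zeta> Q b (\<lambda>_. UNIV)
          (\<lambda>\<omega> k. scale_measure (ennreal ((\<Sum>j\<le>k. \<xi> j \<omega>) powr (- 1 / \<alpha>))) (\<epsilon> k \<omega>)))"
proof -
  note P = assms(2) and a = assms(3,4)
  interpret lcsc "TYPE('x)" by unfold_locales (rule assms(1))
  have s: "sets \<Lambda> = sets nonzero_radon_space" if "stable_intensity \<alpha> \<Lambda>" for \<Lambda> :: "'x measure measure"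
    using that by (simp add: stable_intensity_def)
  have c1: "\<exists>\<Lambda>. stable_intensity \<alpha> \<Lambda> \<and> (\<exists>(Q :: 'x measure poisson_sample measure) I x.
      poisson_points Q \<Lambda> I x \<and> equals_vague_series P \<zeta> Q 1 I x)" if st: "strictly_stable \<alpha> P \<zeta>"
  proof -
    obtain \<Lambda> where L: "stable_intensity \<alpha> \<Lambda>" "\<forall>h\<in>BM. laplace_functional P \<zeta> h = lap (laplace_exp \<Lambda> (en h))"
      using strictly_stable_levy[OF P a st] by blast
    have "space \<Lambda> \<noteq> {}" using sets_eq_imp_space_eq[OF s[OF L(1)]] nonzero_radon_space_nonempty by simp
    from poisson_points_exist[OF stable_intensity_sigma_finite[OF L(1)] this]
    obtain Q :: "'x measure poisson_sample measure" and I x where pp: "poisson_points Q \<Lambda> I x" by blast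
    have "equals_vague_series P \<zeta> Q 1 I x"
      by (rule poisson_points_equals_vague_series[OF P pp s[OF L(1)]]) (use L(2) in blast)
    then show ?thesis using L(1) pp by blast
  qed
  have c2: "strictly_stable \<alpha> P \<zeta>"
    if "stable_intensity \<alpha> \<Lambda>" "poisson_points Q \<Lambda> I x" "equals_vague_series P \<zeta> Q 1 I x" for \<Lambda> I x and Q :: "'x measure poisson_sample measure"
    by (rule strictly_stableI[OF P a(1) that(1)], rule equals_vague_series_laplace[OF P that(2) s[OF that(1)] that(3)])
  have c3: "levy_measure \<alpha> P \<zeta> \<Lambda>' \<longleftrightarrow> \<Lambda>' = \<Lambda>"
    if "stable_intensity \<alpha> \<Lambda>" "poisson_points Q \<Lambda> I x" "equals_vague_series P \<zeta> Q 1 I x" for \<Lambda> \<Lambda>' I x and Q :: "'q measure"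
  proof -
    have L: "laplace_functional P \<zeta> h = lap (laplace_exp \<Lambda> (en h))" if "h \<in> BM" for h
      by (rule equals_vague_series_laplace[OF P \<open>poisson_points Q \<Lambda> I x\<close> s[OF \<open>stable_intensity \<alpha> \<Lambda>\<close>] \<open>equals_vague_series P \<zeta> Q 1 I x\<close> that])
    show ?thesis
    proof
      assume "levy_measure \<alpha> P \<zeta> \<Lambda>'"
      then have L': "stable_intensity \<alpha> \<Lambda>'" "\<forall>h\<in>BM. laplace_functional P \<zeta> h = lap (laplace_exp \<Lambda>' (en h))"
        by (simp_all add: levy_measure_iff)
      show "\<Lambda>' = \<Lambda>"
      proof (rule levy_measure_unique[OF s[OF L'(1)] s[OF that(1)]])
        fix h :: "'x => real" assume h: "h \<in> BM"
        show "laplace_exp \<Lambda>' (en h) < top" by (rule stable_intensity_laplace_exp[OF L'(1) h])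
        have "lap (laplace_exp \<Lambda>' (en h)) = lap (laplace_exp \<Lambda> (en h))" using L[OF h] L'(2) h by simp
        \<comment> \<open>\<open>lap\<close> is injective on the extended half-line, so equal
          Laplace functionals give equal exponents.\<close>
        then show "laplace_exp \<Lambda>' (en h) = laplace_exp \<Lambda> (en h)" by (simp only: lap_inj)
      qed
    next
      assume "\<Lambda>' = \<Lambda>"
      then show "levy_measure \<alpha> P \<zeta> \<Lambda>'" using that(1) L by (simp add: levy_measure_iff)
    qed
  qed
  have c4: "equals_vague_series P \<zeta> Q 1 I x"
    if l: "levy_measure \<alpha> P \<zeta> \<Lambda>" and pp: "poisson_points Q \<Lambda> I x" for \<Lambda> I x and Q :: "'q measure"
    by (rule poisson_points_equals_vague_series[OF P pp s]) (use l in \<open>simp_all add: levy_measure_iff\<close>)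
  have c5: "equals_vague_series P \<zeta> Q b (%_. UNIV)
      (%w k. scale_measure (ennreal (lpw \<alpha> \<xi> w k)) (\<epsilon> k w))"
    if l: "levy_measure \<alpha> P \<zeta> \<Lambda>" and B: "relatively_compact_base B" and sg: "\<sigma> = spectral_measure \<alpha> B \<Lambda>"
      and f: "emeasure \<sigma> (sphere_of B) < \<infinity>" "c = measure \<sigma> (sphere_of B)" "b = (c / Gamma (1 - \<alpha>)) powr (1 / \<alpha>)"
      and lv: "lepage_variables Q \<sigma> c \<epsilon> \<xi>"
    for \<Lambda> B \<sigma> c b \<epsilon> \<xi> and Q :: "'q measure"
  proof -
    have st: "stable_intensity \<alpha> \<Lambda>" and lf: "!!h. h \<in> BM ==> laplace_functional P \<zeta> h = lap (laplace_exp \<Lambda> (en h))"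
      using l by (simp_all add: levy_measure_iff)
    show ?thesis
      by (rule lepage_equals_vague_series[OF P a st lf B f(1)[unfolded sg] f(2)[unfolded sg] f(3) lv[unfolded sg]])
  qed
  have iff: "strictly_stable \<alpha> P \<zeta> \<longleftrightarrow> (\<exists>\<Lambda>. stable_intensity \<alpha> \<Lambda> \<and>
      (\<exists>(Q :: 'x measure poisson_sample measure) I x. poisson_points Q \<Lambda> I x \<and> equals_vague_series P \<zeta> Q 1 I x))"
    using c1 c2 by blast
  show ?thesis
    by (intro conjI iff allI impI; elim conjE; (rule c3, assumption+ | rule c4, assumption+ | rule c5, assumption+))
qed

end
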